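(* Let $d\ge 2$ and let $2\le k<\ell$ be relatively prime integers. Let $X=X_{d,k,\ell}\subset\mathbb{A}^4=\mathrm{Spec}(\mathbb{C}[x,y,z,t])$ be the Koras-Russell threefold of the first kind defined by the equation $x^dy+z^k+t^\ell+x=0$. Identify $\mathrm{Aut}(X)$ with the group $\mathcal{A}$ of automorphisms of $\mathbb{C}[x,z,t]$ preserving the ideals $(x)$ and $(x^d,z^k+t^\ell+x)$, and let $\mathcal{A}_n\subset\mathcal{A}$ ($1\le n\le d$) be the subgroups defined in the context. Then the following hold: (1) Every automorphism of $X$ extends to an automorphism of $\mathbb{A}^4$. (2) The group $\mathrm{Aut}(X)$ acts on $X$ with exactly 4 orbits: - an open orbit $\{x\neq 0\}\simeq\mathbb{C}^*\times\mathbb{C}^2$; - a copy of $\mathbb{C}^*\times\mathbb{C}$ given by $x=0$ and $z\neq 0$; - the line $\{x=z=t=0\}$ minus the point $(0,0,0,0)$; - a fixed point $(0,0,0,0)$. (3) Every finite subgroup of $\mathrm{Aut}(X)$ is cyclic. (4) Every one-parameter unipotent subgroup of $\mathrm{Aut}(X)$ (that is, every subgroup which is the image of an algebraic action of the additive group $\mathbb{G}_a$ on $X$) is contained in $\mathcal{A}_d$. In particular, the subgroup of $\mathrm{Aut}(X)$ generated by all $\mathbb{G}_a$-actions on $X$ is strictly smaller than $\mathcal{A}_1$.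
   Context: All varieties are over $\mathbb{C}$. $\mathbb{G}_a$ is the additive group $(\mathbb{C},+)$. Points of $\mathbb{A}^4$ are written in the coordinates $(x,y,z,t)$. $\mathrm{Aut}(X)$ is the group of algebraic automorphisms of $X$, viewed through the corresponding $\mathbb{C}$-algebra automorphisms of the coordinate ring $\mathbb{C}[X]=\mathbb{C}[x,y,z,t]/(x^dy+z^k+t^\ell+x)$. The ring $\mathbb{C}[x,z,t]$ is regarded as a subring of $\mathbb{C}[X]$ via the projection $\mathrm{pr}_{x,z,t}|_X:X\to\mathbb{A}^3$. Let $\mathcal{A}$ be the group of $\mathbb{C}$-algebra automorphisms $\varphi$ of $\mathbb{C}[x,z,t]$ which preserve the ideals $(x)$ and $(x^d,z^k+t^\ell+x)$. Every automorphism of $\mathbb{C}[X]$ restricts to an element of $\mathcal{A}$, and restriction gives an isomorphism between the automorphism group of $X$ and $\mathcal{A}$ (each element of $\mathcal{A}$ lifts uniquely to an automorphism of $\mathbb{C}[X]$). For $1\le n\le d$, $\mathcal{A}_n$ denotes the normal subgroup of $\mathcal{A}$ consisting of the automorphisms $\varphi$ with $\varphi(x)=x$ which are congruent to the identity modulo $(x^n)$. Known from earlier work: $\mathrm{Aut}(X)\simeq\mathcal{A}_1\rtimes\mathbb{C}^*$, and $\mathcal{A}_n/\mathcal{A}_{n+1}\cong(\mathbb{C}[z,t],+)$ for all $1\le n\le d-1$. The proposition summarizes consequences of this description. *)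

theory Defs
  imports
    Complex_Main
    "HOL-Computational_Algebra.Polynomial"
    "HOL-Algebra.Group_Action"
    "HOL-Algebra.Elementary_Groups"
begin

section \<open>Affine and quasi-affine varieties over the complex numbers\<close>

text \<open>
  Affine space \<open>\<complex>\<^sup>n\<close> is the \<open>n\<close>-fold product type \<open>complex \<times> \<dots> \<times> complex\<close>, and
  \<open>coords\<close> is the set of its \<open>n\<close> coordinate functions. Varieties are given by their
  sets of complex points.
\<close>

class coordinate_space =
  fixes coords :: "('a \<Rightarrow> complex) set"

instantiation complex :: coordinate_space
begin
definition coords_complex :: "(complex \<Rightarrow> complex) set"
  where "coords_complex = {\<lambda>z. z}"
instance ..
end

instantiation prod :: (coordinate_space, coordinate_space) coordinate_space
begin
definition coords_prod :: "('a \<times> 'b \<Rightarrow> complex) set"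
  where "coords_prod = (\<lambda>c. c \<circ> fst) ` coords \<union> (\<lambda>c. c \<circ> snd) ` coords"
instance ..
end

inductive polynomial_fun :: "('a::coordinate_space \<Rightarrow> complex) \<Rightarrow> bool"
where
  const: "polynomial_fun (\<lambda>_. a)"
| coord: "c \<in> coords \<Longrightarrow> polynomial_fun c"
| add: "polynomial_fun f \<Longrightarrow> polynomial_fun g \<Longrightarrow> polynomial_fun (\<lambda>P. f P + g P)"
| mult: "polynomial_fun f \<Longrightarrow> polynomial_fun g \<Longrightarrow> polynomial_fun (\<lambda>P. f P * g P)"

definition polynomial_map :: "('a::coordinate_space \<Rightarrow> 'b::coordinate_space) \<Rightarrow> bool"
  where "polynomial_map F \<longleftrightarrow> (\<forall>c\<in>coords. polynomial_fun (c \<circ> F))"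

text \<open>
  For a Zariski closed set \<open>V\<close>, the morphisms from \<open>V\<close> to an affine space are the
  restrictions to \<open>V\<close> of polynomial maps of the ambient space.
\<close>

definition polynomial_map_on ::
    "'a set \<Rightarrow> ('a::coordinate_space \<Rightarrow> 'b::coordinate_space) \<Rightarrow> bool"
  where "polynomial_map_on V F \<longleftrightarrow> (\<exists>G. polynomial_map G \<and> (\<forall>P\<in>V. F P = G P))"

text \<open>
  The group of algebraic automorphisms of a Zariski closed set \<open>V\<close>. As in \<open>BijGroup\<close>, its
  elements are extensional functions (\<open>undefined\<close> outside \<open>V\<close>), so that two automorphisms
  are equal as soon as they agree on \<open>V\<close>.
\<close>

definition Aut_variety :: "'a::coordinate_space set \<Rightarrow> ('a \<Rightarrow> 'a) monoid"
  where "Aut_variety V = (BijGroup V)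
    \<lparr>carrier := {F \<in> Bij V. polynomial_map_on V F \<and> polynomial_map_on V (inv_into V F)}\<rparr>"

definition zariski_open :: "'a::coordinate_space set \<Rightarrow> bool"
  where "zariski_open U \<longleftrightarrow>
    (\<exists>\<F>. (\<forall>f\<in>\<F>. polynomial_fun f) \<and> - U = {P. \<forall>f\<in>\<F>. f P = 0})"

definition zariski_open_in :: "'a::coordinate_space set \<Rightarrow> 'a set \<Rightarrow> bool"
  where "zariski_open_in V W \<longleftrightarrow> (\<exists>U. zariski_open U \<and> W = V \<inter> U)"

text \<open>
  On a quasi-affine variety (a Zariski open subset of a closed set), a regular function is
  locally a quotient of polynomials, and need not be a restriction of a polynomial.
\<close>

definition regular_on :: "'a set \<Rightarrow> ('a::coordinate_space \<Rightarrow> complex) \<Rightarrow> bool"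
  where "regular_on S f \<longleftrightarrow>
    (\<forall>P\<in>S. \<exists>U g h. zariski_open U \<and> P \<in> U \<and> polynomial_fun g \<and> polynomial_fun h \<and>
       (\<forall>Q\<in>S \<inter> U. h Q \<noteq> 0 \<and> f Q = g Q / h Q))"

definition regular_map_on ::
    "'a set \<Rightarrow> ('a::coordinate_space \<Rightarrow> 'b::coordinate_space) \<Rightarrow> bool"
  where "regular_map_on S F \<longleftrightarrow> (\<forall>c\<in>coords. regular_on S (c \<circ> F))"

definition isomorphic_varieties ::
    "'a::coordinate_space set \<Rightarrow> 'b::coordinate_space set \<Rightarrow> bool"
  where "isomorphic_varieties S T \<longleftrightarrow>
    (\<exists>F. bij_betw F S T \<and> regular_map_on S F \<and> regular_map_on T (inv_into S F))"


section \<open>Actions of the additive group\<close>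

definition Ga :: "complex monoid"
  where "Ga = \<lparr>carrier = UNIV, mult = (+), one = 0\<rparr>"

definition Ga_action :: "'a::coordinate_space set \<Rightarrow> (complex \<Rightarrow> 'a \<Rightarrow> 'a) \<Rightarrow> bool"
  where "Ga_action V a \<longleftrightarrow>
    group_action Ga V a \<and> polynomial_map_on (UNIV \<times> V) (\<lambda>(s, P). a s P)"


section \<open>Koras-Russell threefolds of the first kind\<close>

type_synonym A3 = "complex \<times> complex \<times> complex"
type_synonym A4 = "complex \<times> complex \<times> complex \<times> complex"

text \<open>
  For \<open>d, k, l \<ge> 1\<close> the defining polynomial is irreducible, so the polynomial functions on
  this set of points form the ring \<open>\<complex>[x,y,z,t]/(x\<^sup>dy + z\<^sup>k + t\<^sup>l + x)\<close>.
\<close>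

definition koras_russell :: "nat \<Rightarrow> nat \<Rightarrow> nat \<Rightarrow> A4 set"
  where "koras_russell d k l = {(x, y, z, t). x ^ d * y + z ^ k + t ^ l + x = 0}"


subsection \<open>The polynomial ring in \<open>x\<close>, \<open>z\<close>, \<open>t\<close> and the groups \<open>\<A>\<close>, \<open>\<A>\<^sub>n\<close>\<close>

text \<open>
  The ring \<open>\<complex>[x,z,t]\<close> is represented as \<open>\<complex>[t][z][x]\<close>: the outermost variable is \<open>x\<close> and
  the innermost one is \<open>t\<close>.
\<close>

type_synonym Cxzt = "complex poly poly poly"

definition const_xzt :: "complex \<Rightarrow> Cxzt" where "const_xzt c = [:[:[:c:]:]:]"
definition var_x :: Cxzt where "var_x = [:0, 1:]"
definition var_z :: Cxzt where "var_z = [:[:0, 1:]:]"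
definition var_t :: Cxzt where "var_t = [:[:[:0, 1:]:]:]"

fun eval_xzt :: "Cxzt \<Rightarrow> A3 \<Rightarrow> complex"
  where "eval_xzt p (x, z, t) = poly (poly (poly p [:[:x:]:]) [:z:]) t"

definition algebra_automorphism :: "(Cxzt \<Rightarrow> Cxzt) \<Rightarrow> bool"
  where "algebra_automorphism \<phi> \<longleftrightarrow> bij \<phi> \<and>
    (\<forall>p q. \<phi> (p + q) = \<phi> p + \<phi> q) \<and> (\<forall>p q. \<phi> (p * q) = \<phi> p * \<phi> q) \<and>
    (\<forall>c. \<phi> (const_xzt c) = const_xzt c)"

definition ideal_x :: "Cxzt set"
  where "ideal_x = {u * var_x | u. True}"

definition ideal_xd_r :: "nat \<Rightarrow> nat \<Rightarrow> nat \<Rightarrow> Cxzt set"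
  where "ideal_xd_r d k l = {u * var_x ^ d + v * (var_z ^ k + var_t ^ l + var_x) | u v. True}"

definition KR_A :: "nat \<Rightarrow> nat \<Rightarrow> nat \<Rightarrow> (Cxzt \<Rightarrow> Cxzt) set"
  where "KR_A d k l = {\<phi>. algebra_automorphism \<phi> \<and>
    \<phi> ` ideal_x = ideal_x \<and> \<phi> ` ideal_xd_r d k l = ideal_xd_r d k l}"

definition KR_A_n :: "nat \<Rightarrow> nat \<Rightarrow> nat \<Rightarrow> nat \<Rightarrow> (Cxzt \<Rightarrow> Cxzt) set"
  where "KR_A_n d k l n = {\<phi> \<in> KR_A d k l. \<phi> var_x = var_x \<and> (\<forall>p. var_x ^ n dvd \<phi> p - p)}"


subsection \<open>The identification of \<open>Aut(X)\<close> with \<open>\<A>\<close>\<close>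

fun pr_xzt :: "A4 \<Rightarrow> A3"
  where "pr_xzt (x, y, z, t) = (x, z, t)"

text \<open>
  An element \<open>p\<close> of \<open>\<complex>[x,z,t]\<close> is regarded as the function \<open>eval_xzt p \<circ> pr_xzt\<close> on \<open>X\<close>.
  The automorphism \<open>F\<close> of \<open>X\<close> corresponds to \<open>\<phi>\<close> when \<open>\<phi>\<close> is the restriction to \<open>\<complex>[x,z,t]\<close>
  of the algebra automorphism \<open>f \<mapsto> f \<circ> F\<close> of the coordinate ring.
\<close>

definition restricts_to :: "nat \<Rightarrow> nat \<Rightarrow> nat \<Rightarrow> (A4 \<Rightarrow> A4) \<Rightarrow> (Cxzt \<Rightarrow> Cxzt) \<Rightarrow> bool"
  where "restricts_to d k l F \<phi> \<longleftrightarrow>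
    (\<forall>p. \<forall>P\<in>koras_russell d k l. eval_xzt (\<phi> p) (pr_xzt P) = eval_xzt p (pr_xzt (F P)))"

text \<open>The subgroup \<open>\<A>\<^sub>n\<close>, seen inside \<open>Aut(X)\<close>.\<close>

definition Aut_n :: "nat \<Rightarrow> nat \<Rightarrow> nat \<Rightarrow> nat \<Rightarrow> (A4 \<Rightarrow> A4) set"
  where "Aut_n d k l n = {F \<in> carrier (Aut_variety (koras_russell d k l)).
    \<exists>\<phi>\<in>KR_A_n d k l n. restricts_to d k l F \<phi>}"

end

theory Submission
  imports
    Defs
    "HOL-Computational_Algebra.Polynomial_Factorial"
    "HOL-Computational_Algebra.Fundamental_Theorem_Algebra"
    "HOL-Library.Product_Plus"
    "HOL-Library.Product_Lexorder"
begin

text \<open>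
  For the degree function on \<open>\<complex>[X]\<close> that records the pole along \<open>x = 0\<close> and then the weighted
  degree in \<open>z\<close>, \<open>t\<close>, a Mason-type inequality shows that the kernel of every nonzero locally nilpotent
  derivation lies in \<open>\<complex>[x,z,t]\<close>; hence automorphisms of \<open>X\<close> preserve \<open>\<complex>[x,z,t]\<close> and, because of the
  pole of \<open>y\<close>, the two ideals. Modulo \<open>x\<close> they preserve the cuspidal curve \<open>z\<^sup>k + t\<^sup>l = 0\<close>, so that up to
  a one-dimensional torus they are the identity modulo \<open>x\<close>.

  If such an automorphism is the identity modulo \<open>x\<^sup>n\<close> with \<open>n < d\<close>, its leading term is the
  Hamiltonian derivation of a multiple \<open>f (z\<^sup>k + t\<^sup>l)\<close> of the cusp. The Hamiltonian
  \<open>f (z\<^sup>k + t\<^sup>l + x - c)\<close> has the same leading term at \<open>c = 0\<close>, and a truncated exponential realizes it by an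
  automorphism over \<open>\<complex>[c]\<close> which respects all the hypersurfaces \<open>x\<^sup>dy + z\<^sup>k + t\<^sup>l + x = c\<close>; setting
  \<open>c\<close> to the value of this polynomial gives an automorphism of \<open>\<A>\<^sup>4\<close>. Induction on \<open>n\<close> yields (1).

  The orbits are read off from the torus and two shears. Automorphisms that are the identity modulo
  \<open>x\<close> form a torsion-free group, so a finite group embeds into the torus. For a \<open>\<G>\<^sub>a\<close>-action the torus
  part is trivial, and the leading Hamiltonian derivation is locally nilpotent with \<open>z\<^sup>k + t\<^sup>l\<close>
  dividing its own image, hence vanishes by Mason's inequality.
\<close>

section \<open>Ring homomorphisms and derivations of polynomial rings\<close>

text \<open>The obstacle to (1): an automorphism fixing x only satisfies \<phi>(r) = u r + x^d b for
  r = \<open>rr\<close>, and the lift of \<phi> that sends y to u y - b need not be invertible on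
  affine space, because u need not be a unit. With the parameter c the analogous lift preserves the
  function x^d y + z^k + t^l + x on all of affine space, so that y can be recovered from it off x =
  0; working modulo x^(d+1) instead of x^d makes the lift the identity on x = 0. An automorphism
  that is the identity modulo x^d allows u = 1 and needs no parameter. The degree function is forced
  by the equation: with weights l and k for z and t and a pole of order d for y, the terms x^d y,
  z^k and t^l have equal value, and the lone x has a smaller one. The leading relation is the
  trinomial x^d y + z^k + t^l = 0 with exponents at least 2 at x, z and t, the shape that Mason's
  inequality needs. It is applied to leading forms, but the associated graded ring is never built:
  \<open>nu\<close> reads off the nilpotency order of a leading form from the degrees of iterated
  derivatives.\<close>

definition ring_map :: "('a::comm_ring_1 \<Rightarrow> 'b::comm_ring_1) \<Rightarrow> bool"
  where "ring_map h \<longleftrightarrow> h 1 = 1 \<and> (\<forall>a b. h (a + b) = h a + h b) \<and> (\<forall>a b. h (a * b) = h a * h b)"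

lemma ring_mapI:
  assumes "h 1 = 1" "\<And>a b. h (a + b) = h a + h b" "\<And>a b. h (a * b) = h a * h b"
  shows "ring_map h"
  using assms by (simp add: ring_map_def)

context
  fixes h :: "'a::comm_ring_1 \<Rightarrow> 'b::comm_ring_1"
  assumes h: "ring_map h"
begin

lemma rm_1: "h 1 = 1" and rm_add: "h (a + b) = h a + h b" and rm_mult: "h (a * b) = h a * h b"
  using h by (auto simp: ring_map_def)

lemma rm_0: "h 0 = 0"
  using rm_add[of 0 0] by simp

lemma rm_minus: "h (- a) = - h a"
  using rm_add[of a "- a"] rm_0 by (simp add: eq_neg_iff_add_eq_0 add.commute)

lemma rm_diff: "h (a - b) = h a - h b"
  using rm_add[of a "- b"] rm_minus by simp

lemma rm_power: "h (a ^ n) = h a ^ n"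
  by (induction n) (auto simp: rm_1 rm_mult)

lemma rm_sum: "h (sum f S) = (\<Sum>i\<in>S. h (f i))"
  by (induction S rule: infinite_finite_induct) (auto simp: rm_0 rm_add)

lemma rm_of_nat: "h (of_nat n) = of_nat n"
  by (induction n) (auto simp: rm_0 rm_1 rm_add)

lemma rm_dvd: "a dvd b \<Longrightarrow> h a dvd h b"
  by (auto simp: dvd_def rm_mult)

lemmas rm_simps = rm_0 rm_1 rm_add rm_mult rm_minus rm_diff rm_power rm_sum rm_of_nat

end

lemma ring_map_id: "ring_map (\<lambda>x. x)"
  by (simp add: ring_map_def)

lemma ring_map_comp: "ring_map f \<Longrightarrow> ring_map g \<Longrightarrow> ring_map (\<lambda>x. f (g x))"
  by (simp add: ring_map_def)

lemma ring_map_const: "ring_map (\<lambda>c. [:c:])"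
  by (intro ring_mapI) (auto simp: one_pCons)

lemma ring_map_poly: "ring_map (\<lambda>p. poly p a)"
  by (intro ring_mapI) auto

text \<open>The universal property of a polynomial ring: coefficients go through \<open>h\<close>,
  the variable goes to \<open>a\<close>. A change of coefficients is part of it because the targets
  include the field of fractions, graded rings and families over a parameter ring.\<close>

definition ev :: "('a::comm_ring_1 \<Rightarrow> 'b::comm_ring_1) \<Rightarrow> 'b \<Rightarrow> 'a poly \<Rightarrow> 'b"
  where "ev h a p = poly (map_poly h p) a"

lemma ev_pCons: "ring_map h \<Longrightarrow> ev h a (pCons c p) = h c + a * ev h a p"
  by (simp add: ev_def map_poly_pCons rm_0)

lemma ev_0: "ev h a 0 = 0"
  by (simp add: ev_def)

lemma ev_const: "ring_map h \<Longrightarrow> ev h a [:c:] = h c"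
  by (simp add: ev_pCons ev_0)

lemma ev_X: "ring_map h \<Longrightarrow> ev h a [:0, 1:] = a"
  by (simp add: ev_pCons ev_0 rm_simps)

lemma pCons_gen: "pCons c p = [:c:] + [:0, 1:] * (p :: 'a::comm_ring_1 poly)"
  by simp

lemma poly_gen_induct [case_names const var add mult]:
  assumes "\<And>c. P [:c:]" "P [:0, 1:]" "\<And>p q. P p \<Longrightarrow> P q \<Longrightarrow> P (p + q)"
    "\<And>p q. P p \<Longrightarrow> P q \<Longrightarrow> P (p * q)"
  shows "P (p :: 'a::comm_ring_1 poly)"
proof (induction p)
  case 0
  then show ?case using assms(1)[of 0] by simp
next
  case (pCons a p)
  then show ?case using assms by (subst pCons_gen) blast
qed

lemma ring_map_ev:
  assumes h: "ring_map h"
  shows "ring_map (ev h a)"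
proof (rule ring_mapI)
  show "ev h a 1 = 1" by (simp add: one_pCons ev_const[OF h] rm_simps[OF h])
  show add: "ev h a (p + q) = ev h a p + ev h a q" for p q
  proof (induction p arbitrary: q)
    case 0
    then show ?case by (simp add: ev_0)
  next
    case (pCons c p)
    show ?case
      by (cases q) (simp add: ev_pCons[OF h] pCons.IH rm_simps[OF h] distrib_left)
  qed
  have smult: "ev h a (smult c q) = h c * ev h a q" for c q
    by (induction q) (auto simp: ev_0 ev_pCons[OF h] rm_simps[OF h] algebra_simps)
  show "ev h a (p * q) = ev h a p * ev h a q" for p q
    by (induction p) (auto simp: ev_0 ev_pCons[OF h] add smult rm_simps[OF h] algebra_simps)
qed

lemma ring_map_poly_eq:
  assumes f: "ring_map f" and g: "ring_map g"
    and "\<And>c. f [:c:] = g [:c:]" "f [:0, 1:] = g [:0, 1:]"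
  shows "f p = g (p :: 'a::comm_ring_1 poly)"
  by (induction p rule: poly_gen_induct) (auto simp: assms(3,4) rm_simps[OF f] rm_simps[OF g])

definition derivation :: "('a::comm_ring_1 \<Rightarrow> 'a) \<Rightarrow> bool"
  where "derivation D \<longleftrightarrow> (\<forall>a b. D (a + b) = D a + D b) \<and> (\<forall>a b. D (a * b) = a * D b + b * D a)"

context
  fixes D :: "'a::comm_ring_1 \<Rightarrow> 'a"
  assumes D: "derivation D"
begin

lemma dv_add: "D (a + b) = D a + D b" and dv_mult: "D (a * b) = a * D b + b * D a"
  using D by (auto simp: derivation_def)

lemma dv_0: "D 0 = 0"
  using dv_add[of 0 0] by simp

lemma dv_1: "D 1 = 0"
  using dv_mult[of 1 1] by simp

lemma dv_minus: "D (- a) = - D a"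
  using dv_add[of a "- a"] dv_0 by (simp add: eq_neg_iff_add_eq_0 add.commute)

lemma dv_diff: "D (a - b) = D a - D b"
  using dv_add[of a "- b"] dv_minus by simp

lemma dv_power: "D (a ^ n) = of_nat n * a ^ (n - 1) * D a"
proof (induction n)
  case (Suc n)
  then show ?case by (cases n) (auto simp: dv_mult algebra_simps)
qed (auto simp: dv_1)

lemma dv_sum: "D (sum f S) = (\<Sum>i\<in>S. D (f i))"
  by (induction S rule: infinite_finite_induct) (auto simp: dv_0 dv_add)

lemmas dv_simps = dv_0 dv_1 dv_add dv_minus dv_diff dv_mult dv_power dv_sum

lemma derivation_map_poly: "derivation (map_poly D)"
proof -
  have add: "map_poly D (p + q) = map_poly D p + map_poly D q" for p q
    by (rule poly_eqI) (simp add: coeff_map_poly dv_simps)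
  have smult: "map_poly D (smult c q) = smult c (map_poly D q) + smult (D c) q" for c q
    by (rule poly_eqI) (simp add: coeff_map_poly dv_simps)
  have "map_poly D (p * q) = p * map_poly D q + q * map_poly D p" for p q
  proof (induction p)
    case (pCons c p)
    then show ?case by (simp add: add smult map_poly_pCons dv_simps algebra_simps)
  qed auto
  with add show ?thesis by (simp add: derivation_def)
qed

end

lemma derivation_pderiv: "derivation (pderiv :: 'a::{comm_ring_1,semiring_no_zero_divisors} poly \<Rightarrow> _)"
  by (simp add: derivation_def pderiv_add pderiv_mult)

lemma derivation_scale: "derivation D \<Longrightarrow> derivation (\<lambda>p. c * D p)"
  by (simp add: derivation_def algebra_simps)

lemma derivation_minus: "derivation D \<Longrightarrow> derivation E \<Longrightarrow> derivation (\<lambda>p. D p - E p)"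
  by (simp add: derivation_def algebra_simps)

text \<open>The base ring stays arbitrary because the same three-variable ring is used over the
  complex numbers and over polynomials in a parameter. With x outermost, reduction modulo x is the
  constant coefficient.\<close>

definition vx :: "'a::comm_ring_1 poly poly poly" where "vx = [:0, 1:]"
definition vz :: "'a::comm_ring_1 poly poly poly" where "vz = [:[:0, 1:]:]"
definition vt :: "'a::comm_ring_1 poly poly poly" where "vt = [:[:[:0, 1:]:]:]"
definition kc :: "'a::comm_ring_1 \<Rightarrow> 'a poly poly poly" where "kc c = [:[:[:c:]:]:]"

lemma poly3_induct [case_names const x z t add mult]:
  assumes "\<And>c. P (kc c)" "P vx" "P vz" "P vt" "\<And>p q. P p \<Longrightarrow> P q \<Longrightarrow> P (p + q)"
    "\<And>p q. P p \<Longrightarrow> P q \<Longrightarrow> P (p * q)"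
  shows "P (p :: 'a::comm_ring_1 poly poly poly)"
proof -
  have "P [:[:q:]:]" for q
  proof (induction q rule: poly_gen_induct)
    case (add p q) then show ?case using assms(5)[of "[:[:p:]:]" "[:[:q:]:]"] by simp
  next
    case (mult p q) then show ?case using assms(6)[of "[:[:p:]:]" "[:[:q:]:]"] by simp
  qed (use assms in \<open>auto simp: kc_def vt_def\<close>)
  then have "P [:q:]" for q
  proof (induction q rule: poly_gen_induct)
    case (add p q) then show ?case using assms(5)[of "[:p:]" "[:q:]"] by simp
  next
    case (mult p q) then show ?case using assms(6)[of "[:p:]" "[:q:]"] by (simp add: mult.commute)
  qed (use assms in \<open>auto simp: vz_def\<close>)
  then show ?thesis
    by (induction p rule: poly_gen_induct) (use assms in \<open>auto simp: vx_def\<close>)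
qed

lemma ring_map_kc: "ring_map kc"
  unfolding kc_def by (intro ring_map_comp[OF ring_map_const] ring_map_const)

lemma kc_eq_iff: "kc a = kc b \<longleftrightarrow> a = b"
  by (simp add: kc_def)

definition subst3 :: "('a::comm_ring_1 \<Rightarrow> 'b::comm_ring_1) \<Rightarrow> 'b \<Rightarrow> 'b \<Rightarrow> 'b \<Rightarrow> 'a poly poly poly \<Rightarrow> 'b"
  where "subst3 h a b c = ev (ev (ev h c) b) a"

lemma ring_map_subst3: "ring_map h \<Longrightarrow> ring_map (subst3 h a b c)"
  unfolding subst3_def by (intro ring_map_ev)

lemma subst3_gens:
  assumes "ring_map h"
  shows "subst3 h a b c (kc s) = h s" "subst3 h a b c vx = a" "subst3 h a b c vz = b"
    "subst3 h a b c vt = c"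
  using assms by (auto simp: subst3_def kc_def vx_def vz_def vt_def ev_const ev_X ring_map_ev)

lemma ring_map_poly3_eq:
  assumes f: "ring_map f" and g: "ring_map g"
    and "\<And>c. f (kc c) = g (kc c)" "f vx = g vx" "f vz = g vz" "f vt = g vt"
  shows "f p = g p"
  by (induction p rule: poly3_induct) (auto simp: assms(3-) rm_simps[OF f] rm_simps[OF g])

definition dz :: "'a::{comm_ring_1,semiring_no_zero_divisors} poly poly poly \<Rightarrow> 'a poly poly poly"
  where "dz = map_poly pderiv"
definition dt :: "'a::{comm_ring_1,semiring_no_zero_divisors} poly poly poly \<Rightarrow> 'a poly poly poly"
  where "dt = map_poly (map_poly pderiv)"

lemma derivation_dz: "derivation dz" and derivation_dt: "derivation dt"
  unfolding dz_def dt_def by (intro derivation_map_poly derivation_pderiv)+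

lemma derivation_dx: "derivation (pderiv :: 'a::idom poly poly poly \<Rightarrow> _)"
  by (rule derivation_pderiv)

lemma d_gens [simp]:
  "dz (kc c) = 0" "dz vx = 0" "dz vz = 1" "dz vt = 0"
  "dt (kc c) = 0" "dt vx = 0" "dt vz = 0" "dt vt = 1"
  "pderiv (kc c) = 0" "pderiv vx = 1" "pderiv vz = 0" "pderiv vt = 0"
  by (auto simp: dz_def dt_def kc_def vx_def vz_def vt_def map_poly_pCons pderiv_pCons one_pCons)

lemma dz_dt: "dz (dt p) = dt (dz p)"
  by (induction p rule: poly3_induct)
     (auto simp: dv_simps[OF derivation_dz] dv_simps[OF derivation_dt] algebra_simps)

section \<open>Locally nilpotent derivations and degree functions\<close>

text \<open>The domain is a subset of a type, since the coordinate ring is later realized inside a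
  field of fractions. The value at 0 is left open; \<open>le\<close> and \<open>lt\<close> treat it
  as minus infinity.\<close>

locale degree_fun =
  fixes A :: "'r::{idom,ring_char_0} set" and v :: "'r \<Rightarrow> 'g::linordered_ab_group_add"
  assumes one_in: "1 \<in> A" and add_in: "\<And>f g. f \<in> A \<Longrightarrow> g \<in> A \<Longrightarrow> f + g \<in> A"
    and mult_in: "\<And>f g. f \<in> A \<Longrightarrow> g \<in> A \<Longrightarrow> f * g \<in> A" and minus_in: "\<And>f. f \<in> A \<Longrightarrow> - f \<in> A"
    and v_mult: "\<And>f g. f \<in> A \<Longrightarrow> g \<in> A \<Longrightarrow> f \<noteq> 0 \<Longrightarrow> g \<noteq> 0 \<Longrightarrow> v (f * g) = v f + v g"
    and v_add: "\<And>f g. f \<in> A \<Longrightarrow> g \<in> A \<Longrightarrow> f \<noteq> 0 \<Longrightarrow> g \<noteq> 0 \<Longrightarrow> f + g \<noteq> 0 \<Longrightarrow> v (f + g) \<le> max (v f) (v g)"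
    and v_nat: "\<And>n. n > 0 \<Longrightarrow> v (of_nat n) = 0"
begin

lemma zero_in: "0 \<in> A"
  using add_in[OF one_in minus_in[OF one_in]] by simp

lemma of_nat_in: "of_nat n \<in> A"
  by (induction n) (auto simp: zero_in one_in add_in)

lemma diff_in: "f \<in> A \<Longrightarrow> g \<in> A \<Longrightarrow> f - g \<in> A"
  using add_in[of f "- g"] minus_in by simp

lemma power_in: "f \<in> A \<Longrightarrow> f ^ n \<in> A"
  by (induction n) (auto simp: one_in mult_in)

lemma sum_in: "(\<And>i. i \<in> S \<Longrightarrow> f i \<in> A) \<Longrightarrow> sum f S \<in> A"
  by (induction S rule: infinite_finite_induct) (auto simp: zero_in add_in)

lemmas ring_in = zero_in one_in add_in mult_in minus_in diff_in power_in sum_in of_nat_in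

definition le :: "'r \<Rightarrow> 'g \<Rightarrow> bool" where "le f w \<longleftrightarrow> f = 0 \<or> v f \<le> w"
definition lt :: "'r \<Rightarrow> 'g \<Rightarrow> bool" where "lt f w \<longleftrightarrow> f = 0 \<or> v f < w"

lemma v_1: "v 1 = 0"
  using v_nat[of 1] by simp

lemma v_minus: assumes "f \<in> A" "f \<noteq> 0" shows "v (- f) = v f"
proof -
  have "v (- 1) + v (- 1) = 0" using v_mult[of "- 1" "- 1"] by (simp add: ring_in v_1)
  then have "v (- 1) = 0" by simp
  then show ?thesis using v_mult[of "- 1" f] assms by (simp add: ring_in)
qed

lemma le_0 [simp]: "le 0 w" and lt_0 [simp]: "lt 0 w"
  by (auto simp: le_def lt_def)

lemma le_refl: "le f (v f)" by (simp add: le_def)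

lemma le_add: "f \<in> A \<Longrightarrow> g \<in> A \<Longrightarrow> le f w \<Longrightarrow> le g w \<Longrightarrow> le (f + g) w"
  using v_add[of f g] by (cases "f = 0"; cases "g = 0"; cases "f + g = 0")
    (auto simp: le_def max_def split: if_splits)

lemma lt_add: "f \<in> A \<Longrightarrow> g \<in> A \<Longrightarrow> lt f w \<Longrightarrow> lt g w \<Longrightarrow> lt (f + g) w"
  using v_add[of f g] by (cases "f = 0"; cases "g = 0"; cases "f + g = 0")
    (auto simp: lt_def max_def split: if_splits)

lemma lt_minus: "f \<in> A \<Longrightarrow> lt f w \<Longrightarrow> lt (- f) w"
  using v_minus[of f] by (cases "f = 0") (auto simp: lt_def)

lemma lt_diff: "f \<in> A \<Longrightarrow> g \<in> A \<Longrightarrow> lt f w \<Longrightarrow> lt g w \<Longrightarrow> lt (f - g) w"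
  using lt_add[of f "- g" w] lt_minus[of g w] by (auto simp: ring_in)

lemma lt_sum: "(\<And>i. i \<in> S \<Longrightarrow> f i \<in> A \<and> lt (f i) w) \<Longrightarrow> lt (sum f S) w"
  by (induction S rule: infinite_finite_induct) (auto intro!: lt_add sum_in)

lemma le_mult: "f \<in> A \<Longrightarrow> g \<in> A \<Longrightarrow> le f a \<Longrightarrow> le g b \<Longrightarrow> le (f * g) (a + b)"
  by (cases "f = 0"; cases "g = 0") (auto simp: le_def v_mult intro: add_mono)

lemma le_lt_mult: "f \<in> A \<Longrightarrow> g \<in> A \<Longrightarrow> le f a \<Longrightarrow> lt g b \<Longrightarrow> lt (f * g) (a + b)"
  by (cases "f = 0"; cases "g = 0") (auto simp: le_def lt_def v_mult intro: add_le_less_mono)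

lemma lt_le_mult: "f \<in> A \<Longrightarrow> g \<in> A \<Longrightarrow> lt f a \<Longrightarrow> le g b \<Longrightarrow> lt (f * g) (a + b)"
  using le_lt_mult[of g f b a] by (simp add: algebra_simps)

lemma le_of_nat: "le (of_nat n) 0"
  using v_nat[of n] by (cases n) (auto simp: le_def)

lemma v_add_lt:
  assumes f: "f \<in> A" and g: "g \<in> A" and "f \<noteq> 0" "lt g (v f)"
  shows "f + g \<noteq> 0" "v (f + g) = v f"
proof -
  show nz: "f + g \<noteq> 0"
  proof
    assume "f + g = 0"
    then have "f = - g" by (simp add: eq_neg_iff_add_eq_0)
    then have "v f = v g" "g \<noteq> 0" using v_minus[of g] g \<open>f \<noteq> 0\<close> by auto
    with assms show False by (auto simp: lt_def)
  qed
  show "v (f + g) = v f"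
  proof (cases "g = 0")
    case False
    then have "v g < v f" using assms by (auto simp: lt_def)
    moreover have "v (f + g) \<le> max (v f) (v g)" using v_add f g assms False nz by blast
    moreover have "v f \<le> max (v (f + g)) (v g)"
      using v_add[of "f + g" "- g"] f g assms False nz by (auto simp: ring_in v_minus)
    ultimately show ?thesis by (auto simp: max_def split: if_splits)
  qed simp
qed

end

text \<open>A derivation that raises degrees by at most \<open>e\<close> induces a homogeneous
  derivation of degree \<open>e\<close> on the associated graded ring. Statements about it are
  phrased by comparing \<open>v ((D ^^ n) f)\<close> with \<open>v f + sm n\<close>.\<close>

locale lnd_degree = degree_fun A v
  for A :: "'r::{idom,ring_char_0} set" and v :: "'r \<Rightarrow> 'g::linordered_ab_group_add" +
  fixes D :: "'r \<Rightarrow> 'r" and e :: 'g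
  assumes D_in: "\<And>f. f \<in> A \<Longrightarrow> D f \<in> A"
    and D_add: "\<And>f g. f \<in> A \<Longrightarrow> g \<in> A \<Longrightarrow> D (f + g) = D f + D g"
    and D_mult: "\<And>f g. f \<in> A \<Longrightarrow> g \<in> A \<Longrightarrow> D (f * g) = f * D g + g * D f"
    and D_nil: "\<And>f. f \<in> A \<Longrightarrow> \<exists>n. (D ^^ n) f = 0"
    and v_D: "\<And>f. f \<in> A \<Longrightarrow> f \<noteq> 0 \<Longrightarrow> D f \<noteq> 0 \<Longrightarrow> v (D f) \<le> v f + e"
begin

lemmas in_A = ring_in D_in

lemma Dn_in: "f \<in> A \<Longrightarrow> (D ^^ n) f \<in> A"
  by (induction n) (auto simp: in_A)

lemma D_0: "D 0 = 0"
  using D_add[OF zero_in zero_in] by simp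

lemma Dn_0: "(D ^^ n) 0 = 0"
  by (induction n) (auto simp: D_0)

lemma Dn_add: "f \<in> A \<Longrightarrow> g \<in> A \<Longrightarrow> (D ^^ n) (f + g) = (D ^^ n) f + (D ^^ n) g"
  by (induction n) (auto simp: D_add Dn_in)

lemma D_sum: "(\<And>i. i \<in> S \<Longrightarrow> f i \<in> A) \<Longrightarrow> D (sum f S) = (\<Sum>i\<in>S. D (f i))"
  by (induction S rule: infinite_finite_induct) (auto simp: D_0 D_add sum_in)

lemma D_1: "D 1 = 0"
  using D_mult[OF one_in one_in] by simp

lemma D_of_nat: "D (of_nat n) = 0"
  by (induction n) (auto simp: D_0 D_1 D_add of_nat_in one_in)

lemma D_power: "f \<in> A \<Longrightarrow> D (f ^ n) = of_nat n * f ^ (n - 1) * D f"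
proof (induction n)
  case (Suc n)
  then show ?case by (cases n) (auto simp: D_mult power_in mult_in algebra_simps)
qed (auto simp: D_1)

lemma Leibniz:
  assumes f: "f \<in> A" and g: "g \<in> A"
  shows "(D ^^ n) (f * g) = (\<Sum>i\<le>n. of_nat (n choose i) * (D ^^ i) f * (D ^^ (n - i)) g)"
proof (induction n)
  case (Suc n)
  let ?F = "\<lambda>i. (D ^^ i) f" and ?G = "\<lambda>i. (D ^^ i) g"
  have mem: "?F i \<in> A" "?G i \<in> A" for i using f g Dn_in by auto
  have "(D ^^ Suc n) (f * g) = (\<Sum>i\<le>n. D (of_nat (n choose i) * ?F i * ?G (n - i)))"
    by (simp add: Suc D_sum in_A mem)
  also have "\<dots> = (\<Sum>i\<le>n. of_nat (n choose i) * ?F i * ?G (Suc n - i))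
      + (\<Sum>i\<le>n. of_nat (n choose i) * ?F (Suc i) * ?G (n - i))"
    by (subst sum.distrib[symmetric], rule sum.cong)
       (auto simp: D_mult D_of_nat in_A mem Suc_diff_le algebra_simps)
  also have "(\<Sum>i\<le>n. of_nat (n choose i) * ?F i * ?G (Suc n - i))
      = ?F 0 * ?G (Suc n) + (\<Sum>i\<le>n. of_nat (n choose Suc i) * ?F (Suc i) * ?G (n - i))"
  proof -
    have "(\<Sum>i\<le>n. of_nat (n choose i) * ?F i * ?G (Suc n - i))
       = (\<Sum>i\<le>Suc n. of_nat (n choose i) * ?F i * ?G (Suc n - i))" by simp
    also have "\<dots> = ?F 0 * ?G (Suc n) + (\<Sum>i\<le>n. of_nat (n choose Suc i) * ?F (Suc i) * ?G (n - i))"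
      by (subst sum.atMost_Suc_shift) simp
    finally show ?thesis .
  qed
  also have "?F 0 * ?G (Suc n) + (\<Sum>i\<le>n. of_nat (n choose Suc i) * ?F (Suc i) * ?G (n - i))
      + (\<Sum>i\<le>n. of_nat (n choose i) * ?F (Suc i) * ?G (n - i))
      = ?F 0 * ?G (Suc n) + (\<Sum>i\<le>n. of_nat (Suc n choose Suc i) * ?F (Suc i) * ?G (n - i))"
    by (simp add: sum.distrib algebra_simps)
  also have "\<dots> = (\<Sum>i\<le>Suc n. of_nat (Suc n choose i) * ?F i * ?G (Suc n - i))"
    by (subst sum.atMost_Suc_shift) (simp del: binomial_Suc_Suc funpow.simps)
  finally show ?case .
qed simp

primrec sm :: "nat \<Rightarrow> 'g" where
  "sm 0 = 0" | "sm (Suc n) = sm n + e"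

lemma sm_add: "sm (m + n) = sm m + sm n"
  by (induction n) (auto simp: algebra_simps)

lemma le_D: assumes "f \<in> A" "le f w" shows "le (D f) (w + e)"
proof (cases "f = 0 \<or> D f = 0")
  case False
  then have "v (D f) \<le> v f + e" "v f + e \<le> w + e" using v_D assms by (auto simp: le_def)
  then show ?thesis unfolding le_def by (metis order_trans)
qed (auto simp: D_0)

lemma lt_D: assumes "f \<in> A" "lt f w" shows "lt (D f) (w + e)"
proof (cases "f = 0 \<or> D f = 0")
  case False
  then have "v (D f) \<le> v f + e" "v f + e < w + e" using v_D assms by (auto simp: lt_def)
  then show ?thesis unfolding lt_def by (metis le_less_trans)
qed (auto simp: D_0)

lemma le_Dn: "f \<in> A \<Longrightarrow> le f w \<Longrightarrow> le ((D ^^ n) f) (w + sm n)"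
proof (induction n)
  case (Suc n)
  then show ?case using le_D[OF Dn_in, of f n "w + sm n"] by (simp add: add.assoc)
qed simp

lemma lt_Dn: "f \<in> A \<Longrightarrow> lt f w \<Longrightarrow> lt ((D ^^ n) f) (w + sm n)"
proof (induction n)
  case (Suc n)
  then show ?case using lt_D[OF Dn_in, of f n "w + sm n"] by (simp add: add.assoc)
qed simp

section \<open>Nilpotency order of leading forms\<close>

definition top_at :: "nat \<Rightarrow> 'r \<Rightarrow> bool"
  where "top_at n f \<longleftrightarrow> (D ^^ n) f \<noteq> 0 \<and> v ((D ^^ n) f) = v f + sm n"

text \<open>\<open>top_at n f\<close> says that the n-th iterate of the induced graded derivation
  does not kill the leading form of \<open>f\<close>. Hence \<open>nu f\<close> is the nilpotency
  order of the leading form, which can be smaller than that of \<open>f\<close> itself.\<close>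

definition nu :: "'r \<Rightarrow> nat" where "nu f = Max {n. top_at n f}"

lemma not_top_at: "f \<in> A \<Longrightarrow> \<not> top_at n f \<Longrightarrow> lt ((D ^^ n) f) (v f + sm n)"
  using le_Dn[OF _ le_refl, of f n] by (auto simp: top_at_def lt_def le_def)

text \<open>Once the graded derivation has killed a leading form, all further iterates are zero as
  well.\<close>

lemma lt_mono_iter:
  assumes f: "f \<in> A" and "lt ((D ^^ m) f) (v f + sm m)" "m \<le> n"
  shows "lt ((D ^^ n) f) (v f + sm n)"
  using lt_Dn[OF Dn_in[OF f] assms(2), of "n - m"] assms(3)
    funpow_add[of "n - m" m D] sm_add[of m "n - m"]
  by (simp add: add.assoc)

lemma top_at_finite: assumes "f \<in> A" shows "finite {n. top_at n f}"
proof -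
  obtain m where m: "(D ^^ m) f = 0" using D_nil assms by blast
  have "n < m" if "top_at n f" for n
  proof (rule ccontr)
    assume "\<not> n < m"
    then have "(D ^^ n) f = 0"
      using funpow_add[of "n - m" m D] m by (simp add: Dn_0)
    with that show False by (simp add: top_at_def)
  qed
  then show ?thesis by (meson finite_nat_set_iff_bounded mem_Collect_eq)
qed

context
  fixes f assumes f: "f \<in> A" "f \<noteq> 0"
begin

lemma nu_top: "top_at (nu f) f"
proof -
  have "0 \<in> {n. top_at n f}" using f by (simp add: top_at_def)
  then show ?thesis
    unfolding nu_def using Max_in[OF top_at_finite[OF f(1)]] by blast
qed

lemma nu_lt: "nu f < n \<Longrightarrow> lt ((D ^^ n) f) (v f + sm n)"
  using Max_ge[OF top_at_finite[OF f(1)], of n] not_top_at[OF f(1), of n]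
  unfolding nu_def by fastforce

lemma nu_eqI:
  assumes "top_at n f" "lt ((D ^^ Suc n) f) (v f + sm (Suc n))"
  shows "nu f = n"
proof (rule antisym)
  show "nu f \<le> n"
  proof (rule ccontr)
    assume "\<not> nu f \<le> n"
    then have "lt ((D ^^ nu f) f) (v f + sm (nu f))" using lt_mono_iter[OF f(1) assms(2)] by auto
    with nu_top show False by (auto simp: top_at_def lt_def)
  qed
  show "n \<le> nu f"
    using nu_lt[of n] assms(1) by (auto simp: top_at_def lt_def not_le[symmetric])
qed

lemma nu_0_iff: "nu f = 0 \<longleftrightarrow> lt (D f) (v f + e)"
proof
  assume "nu f = 0"
  then show "lt (D f) (v f + e)" using nu_lt[of 1] by simp
next
  assume "lt (D f) (v f + e)"
  then show "nu f = 0" using f by (intro nu_eqI) (auto simp: top_at_def)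
qed

lemma nu_D:
  assumes "nu f = Suc n"
  shows "D f \<noteq> 0" "v (D f) = v f + e" "nu (D f) = n"
proof -
  have "\<not> lt (D f) (v f + e)" using nu_0_iff assms by simp
  with le_D[OF f(1) le_refl] show nz: "D f \<noteq> 0" and v: "v (D f) = v f + e"
    by (auto simp: lt_def le_def)
  have shift: "(D ^^ m) (D f) = (D ^^ Suc m) f" for m by (simp add: funpow_swap1)
  have sms: "v f + e + sm m = v f + sm (Suc m)" for m by (simp add: algebra_simps)
  have "Max {m. top_at m (D f)} = n"
  proof (rule Max_eqI[OF top_at_finite[OF D_in[OF f(1)]]])
    show "n \<in> {m. top_at m (D f)}"
      using nu_top assms unfolding top_at_def shift v sms by simp
    fix m assume "m \<in> {m. top_at m (D f)}"
    then have "top_at (Suc m) f" unfolding top_at_def shift v sms by simp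
    then have "\<not> Suc n < Suc m" using nu_lt[of "Suc m"] assms by (auto simp: top_at_def lt_def)
    then show "m \<le> n" by simp
  qed
  then show "nu (D f) = n" by (simp add: nu_def)
qed

end

text \<open>A difference of smaller degree does not touch the leading form, and \<open>nu\<close>
  depends on nothing else. This is how lower-order terms of an equation are discarded.\<close>

lemma nu_cong:
  assumes f: "f \<in> A" "f \<noteq> 0" and g: "g \<in> A" and "lt (g - f) (v f)"
  shows "g \<noteq> 0" "v g = v f" "nu g = nu f"
proof -
  have eq: "g = f + (g - f)" by simp
  have d: "g - f \<in> A" using f g by (simp add: in_A)
  show g0: "g \<noteq> 0" and v: "v g = v f"
    using v_add_lt[OF f(1) d f(2) assms(4)] by (auto simp: eq[symmetric])
  have Dg: "(D ^^ n) g = (D ^^ n) f + (D ^^ n) (g - f)" for n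
    using Dn_add[OF f(1) d, of n] by simp
  have small: "lt ((D ^^ n) (g - f)) (v f + sm n)" for n
    using lt_Dn[OF d assms(4)] by simp
  show "nu g = nu f"
  proof (rule nu_eqI[OF g g0])
    have t: "top_at (nu f) f" by (rule nu_top[OF f])
    show "top_at (nu f) g"
      using v_add_lt[of "(D ^^ nu f) f" "(D ^^ nu f) (g - f)"] t small[of "nu f"]
      by (auto simp: top_at_def Dg v Dn_in f d)
    show "lt ((D ^^ Suc (nu f)) g) (v g + sm (Suc (nu f)))"
      unfolding Dg v by (intro lt_add Dn_in f d small nu_lt) auto
  qed
qed

text \<open>Of the Leibniz summands of order \<open>nu f + nu g\<close> only the one with
  \<open>nu f\<close> derivatives on \<open>f\<close> reaches the maximal degree, and its binomial
  coefficient has degree 0. One order higher every summand falls below the bound.\<close>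

lemma nu_mult:
  assumes f: "f \<in> A" "f \<noteq> 0" and g: "g \<in> A" "g \<noteq> 0"
  shows "nu (f * g) = nu f + nu g"
proof -
  let ?a = "nu f" and ?b = "nu g"
  define N where "N = ?a + ?b"
  define tm where "tm n i = of_nat (n choose i) * (D ^^ i) f * (D ^^ (n - i)) g" for n i
  have tm_in: "tm n i \<in> A" for n i unfolding tm_def by (intro in_A Dn_in f g)
  have v: "v (f * g) = v f + v g" using v_mult f g by blast
  have small: "lt (tm n i) (v (f * g) + sm n)" if "i \<le> n" "i > ?a \<or> n - i > ?b" for n i
  proof -
    have eq: "v (f * g) + sm n = 0 + (v f + sm i) + (v g + sm (n - i))"
      using sm_add[of i "n - i"] that(1) by (simp add: v algebra_simps)
    from that(2) show ?thesis
    proof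
      assume "i > ?a"
      then show ?thesis unfolding eq tm_def
        by (intro lt_le_mult le_lt_mult in_A Dn_in f g le_of_nat le_Dn le_refl nu_lt)
    next
      assume "n - i > ?b"
      then show ?thesis unfolding eq tm_def
        by (intro le_lt_mult le_mult in_A Dn_in f g le_of_nat le_Dn le_refl nu_lt)
    qed
  qed
  have ta: "(D ^^ ?a) f \<noteq> 0" "v ((D ^^ ?a) f) = v f + sm ?a"
    and tb: "(D ^^ ?b) g \<noteq> 0" "v ((D ^^ ?b) g) = v g + sm ?b"
    using nu_top[OF f] nu_top[OF g] by (auto simp: top_at_def)
  have ch: "N choose ?a > 0" by (simp add: N_def)
  have main: "tm N ?a \<noteq> 0" "v (tm N ?a) = v (f * g) + sm N"
    using ta tb ch v_nat[OF ch] unfolding tm_def N_def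
    by (auto simp: v v_mult in_A Dn_in f g sm_add algebra_simps)
  have split: "(D ^^ N) (f * g) = tm N ?a + (\<Sum>i\<in>{..N} - {?a}. tm N i)"
    unfolding Leibniz[OF f(1) g(1)] tm_def[symmetric]
    by (subst sum.remove[of _ ?a]) (auto simp: N_def)
  have rest: "lt (\<Sum>i\<in>{..N} - {?a}. tm N i) (v (f * g) + sm N)"
    by (rule lt_sum) (auto intro!: tm_in small simp: N_def)
  show ?thesis
  proof (rule nu_eqI)
    show "f * g \<in> A" "f * g \<noteq> 0" using f g by (auto simp: in_A)
    show "top_at (?a + ?b) (f * g)"
      using v_add_lt[of "tm N ?a" "\<Sum>i\<in>{..N} - {?a}. tm N i"] main rest
      unfolding top_at_def N_def[symmetric] split by (auto intro!: tm_in sum_in)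
    show "lt ((D ^^ Suc (?a + ?b)) (f * g)) (v (f * g) + sm (Suc (?a + ?b)))"
      unfolding Leibniz[OF f(1) g(1)] tm_def[symmetric]
      by (rule lt_sum) (auto intro!: tm_in small simp del: sm.simps)
  qed
qed

lemma nu_1: "nu 1 = 0"
  using nu_mult[of 1 1] by (simp add: in_A)

lemma nu_power: "f \<in> A \<Longrightarrow> f \<noteq> 0 \<Longrightarrow> nu (f ^ n) = n * nu f"
  by (induction n) (auto simp: nu_1 nu_mult in_A)

lemma nu_minus: "f \<in> A \<Longrightarrow> f \<noteq> 0 \<Longrightarrow> nu (- f) = nu f"
  using nu_mult[of "- 1" "- 1"] nu_mult[of "- 1" f] nu_1 by (simp add: in_A)

lemma nu_of_nat: "n > 0 \<Longrightarrow> nu (of_nat n) = 0"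
  by (subst nu_0_iff) (auto simp: in_A D_of_nat)

section \<open>Mason's inequality for leading forms\<close>

context
  fixes a b p q h :: 'r and m n :: nat
  assumes mem: "a \<in> A" "b \<in> A" "p \<in> A" "q \<in> A" "h \<in> A"
    and nz: "a \<noteq> 0" "b \<noteq> 0" "p \<noteq> 0" "q \<noteq> 0" "h \<noteq> 0"
    and h: "h = a * p ^ m + b * q ^ n"
    and va: "v (a * p ^ m) = v h" and vb: "v (b * q ^ n) = v h"
    and nu0: "nu a = 0" "nu b = 0" "nu h = 0"
    and mn: "2 \<le> m" "2 \<le> n"
begin

lemma Dh: "D h = D a * p ^ m + of_nat m * a * p ^ (m - 1) * D p
    + (D b * q ^ n + of_nat n * b * q ^ (n - 1) * D q)"
  unfolding h by (simp add: D_add D_mult D_power in_A mem algebra_simps)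

lemma small_terms: "lt (D h) (v h + e)" "lt (D a * p ^ m) (v h + e)" "lt (D b * q ^ n) (v h + e)"
proof -
  show "lt (D h) (v h + e)" using nu_0_iff nu0 mem nz by blast
  have "lt (D a) (v a + e)" "lt (D b) (v b + e)" using nu_0_iff nu0 mem nz by blast+
  then have "lt (D a * p ^ m) (v a + e + v (p ^ m))" "lt (D b * q ^ n) (v b + e + v (q ^ n))"
    by (auto intro!: lt_le_mult in_A mem le_refl)
  moreover have "v h = v a + v (p ^ m)" "v h = v b + v (q ^ n)"
    using va vb v_mult[of a "p ^ m"] v_mult[of b "q ^ n"] mem nz by (auto simp: in_A)
  ultimately show "lt (D a * p ^ m) (v h + e)" "lt (D b * q ^ n) (v h + e)"
    by (simp_all add: algebra_simps)
qed

text \<open>When \<open>p\<close> is killed in leading order, differentiating the relation leaves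
  \<open>of_nat n * b * q ^ (n - 1) * D q\<close> as a combination of terms of smaller degree; it
  would have full degree if \<open>nu q\<close> were positive.\<close>

lemma mason_nonzero:
  assumes "nu p = 0"
  shows "nu q = 0"
proof (rule ccontr)
  assume "nu q \<noteq> 0"
  then obtain c where c: "nu q = Suc c" by (cases "nu q") auto
  have Dq: "D q \<noteq> 0" "v (D q) = v q + e" using nu_D mem nz c by blast+
  have "lt (D p) (v p + e)" using nu_0_iff assms mem nz by blast
  then have "lt (of_nat m * (a * p ^ (m - 1)) * D p) (0 + v (a * p ^ (m - 1)) + (v p + e))"
    by (intro le_lt_mult le_mult in_A mem le_refl le_of_nat)
  moreover have "v (a * p ^ (m - 1)) + v p = v h"
    using v_mult[of "a * p ^ (m - 1)" p] mem nz mn va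
    by (simp add: in_A mult.assoc power_eq_if[of p m] mult.commute[of p])
  ultimately have 1: "lt (of_nat m * (a * p ^ (m - 1)) * D p) (v h + e)"
    by (simp add: add.assoc[symmetric])
  have "of_nat n * b * q ^ (n - 1) * D q
      = D h - D a * p ^ m - D b * q ^ n - of_nat m * (a * p ^ (m - 1)) * D p"
    using Dh by (simp add: algebra_simps)
  also have "lt \<dots> (v h + e)"
    by (intro lt_diff small_terms 1 in_A mem)
  finally have "v (of_nat n * b * q ^ (n - 1) * D q) < v h + e"
    using Dq nz mn by (auto simp: lt_def)
  moreover have "v (of_nat n * b * q ^ (n - 1) * D q) = v (b * q ^ (n - 1)) + v (D q)"
    using v_mult[of "of_nat n" "b * q ^ (n - 1) * D q"] v_mult[of "b * q ^ (n - 1)" "D q"] mem nz mn Dq v_nat[of n]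
    by (simp add: in_A mult.assoc)
  moreover have "v (b * q ^ (n - 1)) + v q = v h"
    using v_mult[of "b * q ^ (n - 1)" q] mem nz mn vb
    by (simp add: in_A mult.assoc power_eq_if[of q n] mult.commute[of q])
  ultimately show False using Dq by (simp add: add.assoc[symmetric])
qed

text \<open>Cramer's rule for the linear system formed by \<open>h\<close> and \<open>D h\<close>: up to terms of lower
  degree, \<open>a * p ^ (m - 1)\<close> times the Wronskian of \<open>p\<close> and \<open>q\<close> is \<open>- n * h * D q\<close>.\<close>

lemma mason_less:
  assumes "nu q = Suc c"
  shows "(m - 1) * nu p < nu q"
proof -
  have Dq: "D q \<noteq> 0" "v (D q) = v q + e" "nu (D q) = c" using nu_D mem nz assms by blast+
  define W where "W = of_nat m * q * D p - of_nat n * p * D q"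
  define P where "P = - (of_nat n * h * D q)"
  define Q where "Q = a * p ^ (m - 1) * W"
  have W_in: "W \<in> A" unfolding W_def by (intro in_A mem)
  have n0: "n > 0" using mn by simp
  have P: "P \<in> A" "P \<noteq> 0" using mem nz mn Dq by (auto simp: P_def in_A)
  have pm: "p ^ m = p ^ (m - 1) * p" using mn by (cases m) auto
  have qn: "q ^ n = q ^ (n - 1) * q" using mn by (cases n) auto
  have diff: "Q - P = q * (D h - D a * p ^ m - D b * q ^ n)"
    unfolding Q_def P_def W_def Dh unfolding h pm qn by (simp add: algebra_simps)
  have vP: "v P = v q + (v h + e)"
  proof -
    have "v P = v (of_nat n * (h * D q))"
      unfolding P_def using v_minus[of "of_nat n * h * D q"] mem nz mn Dq by (simp add: in_A mult.assoc)
    also have "\<dots> = v q + (v h + e)"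
      using v_mult[of "of_nat n" "h * D q"] v_mult[of h "D q"] mem nz mn Dq v_nat[OF n0]
      by (simp add: in_A algebra_simps)
    finally show ?thesis .
  qed
  have "lt (Q - P) (v P)"
    unfolding diff vP by (intro le_lt_mult lt_diff small_terms in_A mem le_refl)
  then have Q: "Q \<noteq> 0" "nu Q = nu P"
    using nu_cong[OF P, of Q] by (auto simp: Q_def in_A mem W_in)
  have "nu P = nu (of_nat n * (h * D q))"
    unfolding P_def using nu_minus[of "of_nat n * h * D q"] mem nz mn Dq by (simp add: in_A mult.assoc)
  also have "\<dots> = c"
    using nu_mult[of "of_nat n" "h * D q"] nu_mult[of h "D q"] mem nz mn Dq nu_of_nat[OF n0] nu0
    by (simp add: in_A)
  finally have "nu P = c" .
  moreover have "W \<noteq> 0" using Q by (auto simp: Q_def)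
  then have "nu Q = (m - 1) * nu p + nu W"
    unfolding Q_def using nu_mult[of "a * p ^ (m - 1)" W] nu_mult[of a "p ^ (m - 1)"] nu_power[of p] mem nz W_in nu0
    by (simp add: in_A)
  ultimately show ?thesis using Q assms by simp
qed

end

text \<open>If both orders were positive, \<open>(m - 1) * nu p < nu q\<close> and
  \<open>(n - 1) * nu q < nu p\<close> would contradict each other, since both exponents are at
  least 2. The model case is that a p^m + b q^n = h with nonzero constants a, b, h has no
  nonconstant polynomial solutions.\<close>

theorem mason:
  assumes "a \<in> A" "b \<in> A" "p \<in> A" "q \<in> A" "h \<in> A"
    and "a \<noteq> 0" "b \<noteq> 0" "p \<noteq> 0" "q \<noteq> 0" "h \<noteq> 0"
    and h: "h = a * p ^ m + b * q ^ n"
    and "v (a * p ^ m) = v h" "v (b * q ^ n) = v h"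
    and "nu a = 0" "nu b = 0" "nu h = 0" "2 \<le> m" "2 \<le> n"
  shows "nu p = 0 \<and> nu q = 0"
proof -
  have h': "h = b * q ^ n + a * p ^ m" using h by simp
  note 1 = mason_nonzero[OF assms(1-10) h assms(12-18)]
    and 2 = mason_nonzero[OF assms(2,1,4,3,5,7,6,9,8,10) h' assms(13,12,15,14,16,18,17)]
    and 3 = mason_less[OF assms(1-10) h assms(12-18)]
    and 4 = mason_less[OF assms(2,1,4,3,5,7,6,9,8,10) h' assms(13,12,15,14,16,18,17)]
  show ?thesis
  proof (cases "nu p = 0 \<or> nu q = 0")
    case True
    with 1 2 show ?thesis by auto
  next
    case False
    then obtain i j where ij: "nu p = Suc i" "nu q = Suc j" by (metis not0_implies_Suc)
    have "nu p \<le> (m - 1) * nu p" "nu q \<le> (n - 1) * nu q" using assms by auto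
    with 3[OF ij(2)] 4[OF ij(1)] show ?thesis by linarith
  qed
qed

end

section \<open>Weighted degrees\<close>

locale koras =
  fixes d k l :: nat
  assumes d2: "2 \<le> d" and k2: "2 \<le> k" and kl: "k < l" and cop: "coprime k l"
begin

lemma pos: "0 < d" "0 < k" "0 < l"
  using d2 k2 kl by auto

text \<open>\<open>grade\<close> substitutes \<open>z * u ^ l\<close> and \<open>t * u ^ k\<close>, where the new variable \<open>u\<close> is the outermost
  one of the target ring, so that weighted degrees become degrees in \<open>u\<close>.\<close>

definition grade :: "'a::idom poly poly \<Rightarrow> 'a poly poly poly"
  where "grade = ev (ev kc (vt * vx ^ k)) (vz * vx ^ l)"

definition wdeg :: "'a::idom poly poly \<Rightarrow> nat" where "wdeg p = degree (grade p)"

definition whom :: "nat \<Rightarrow> 'a::idom poly poly \<Rightarrow> bool"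
  where "whom n p \<longleftrightarrow> (\<forall>a b. coeff (coeff p a) b \<noteq> 0 \<longrightarrow> l * a + k * b = n)"

lemma ring_map_grade: "ring_map grade"
  unfolding grade_def by (intro ring_map_ev ring_map_kc)

lemma grade_mult: "grade (p * q) = grade p * grade q"
  by (rule rm_mult[OF ring_map_grade])

lemma vx_power: "vx ^ n = monom 1 n"
  by (simp add: vx_def monom_altdef)

lemma coeff_vx_mult: "coeff (vx ^ n * p) i = (if i < n then 0 else coeff p (i - n))"
  by (simp add: vx_power coeff_monom_mult)

lemma coeff_const_mult: "coeff ([:c:] * p) i = c * coeff p i"
  by simp

lemma grade_inner_coeff:
  "coeff (coeff (coeff (ev kc (vt * vx ^ k) c) n) a) b = (if a = 0 \<and> k * b = n then coeff c b else 0)"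
  (is "_ = ?R c n a b")
proof (induction c arbitrary: n a b)
  case 0
  then show ?case by (simp add: ev_0)
next
  case (pCons c p)
  have eq: "ev kc (vt * vx ^ k) (pCons c p) = kc c + [:[:[:0, 1:]:]:] * (vx ^ k * ev kc (vt * vx ^ k) p)"
    by (simp add: ev_pCons[OF ring_map_kc] vt_def algebra_simps)
  show ?case
    unfolding eq coeff_add coeff_const_mult coeff_vx_mult
    using pos by (cases b; cases n; cases a)
       (auto simp: pCons.IH kc_def coeff_pCons algebra_simps split: nat.splits)
qed

lemma grade_coeff:
  "coeff (coeff (coeff (grade p) n) a) b = (if l * a + k * b = n then coeff (coeff p a) b else 0)"
proof (induction p arbitrary: n a b)
  case 0
  then show ?case by (simp add: grade_def ev_0)
next
  case (pCons c p)
  have eq: "grade (pCons c p) = ev kc (vt * vx ^ k) c + [:[:0, 1:]:] * (vx ^ l * grade p)"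
    by (simp add: grade_def ev_pCons[OF ring_map_ev[OF ring_map_kc]] vz_def algebra_simps)
  show ?case
    unfolding eq coeff_add coeff_const_mult coeff_vx_mult grade_inner_coeff
    using pos by (cases a) (auto simp: pCons.IH coeff_pCons algebra_simps split: nat.splits)
qed

lemma grade_eq_0_iff: "grade p = 0 \<longleftrightarrow> p = 0"
proof
  assume "grade p = 0"
  then have "coeff (coeff p a) b = 0" for a b
    using grade_coeff[of p "l * a + k * b" a b] by simp
  then show "p = 0" by (intro poly_eqI) (simp add: poly_eq_iff)
qed (simp add: grade_def ev_0)

lemma wdeg_mult: "p \<noteq> 0 \<Longrightarrow> q \<noteq> 0 \<Longrightarrow> wdeg (p * q) = wdeg p + wdeg q"
  by (simp add: wdeg_def grade_mult degree_mult_eq grade_eq_0_iff)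

lemma wdeg_ge: "coeff (coeff p a) b \<noteq> 0 \<Longrightarrow> l * a + k * b \<le> wdeg p"
  unfolding wdeg_def using grade_coeff[of p "l * a + k * b" a b] by (intro le_degree) auto

lemma wdeg_le:
  assumes "\<And>a b. coeff (coeff p a) b \<noteq> 0 \<Longrightarrow> l * a + k * b \<le> n"
  shows "wdeg p \<le> n"
  unfolding wdeg_def
proof (rule degree_le, safe)
  fix i assume "n < i"
  have "coeff (coeff (coeff (grade p) i) a) b = 0" for a b
    using assms[of a b] \<open>n < i\<close> by (cases "coeff (coeff p a) b = 0") (auto simp: grade_coeff)
  then show "coeff (grade p) i = 0" by (simp add: poly_eq_iff)
qed

lemma wdeg_add: "wdeg (p + q) \<le> max (wdeg p) (wdeg q)"
proof (rule wdeg_le)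
  fix a b assume "coeff (coeff (p + q) a) b \<noteq> 0"
  then have "coeff (coeff p a) b \<noteq> 0 \<or> coeff (coeff q a) b \<noteq> 0" by auto
  then show "l * a + k * b \<le> max (wdeg p) (wdeg q)"
    using wdeg_ge[of p a b] wdeg_ge[of q a b] by auto
qed

lemma wdeg_whom: "whom n p \<Longrightarrow> p \<noteq> 0 \<Longrightarrow> wdeg p = n"
proof -
  assume w: "whom n p" and "p \<noteq> 0"
  then obtain a b where "coeff (coeff p a) b \<noteq> 0" by (metis poly_eqI coeff_0)
  then show ?thesis using wdeg_ge[of p a b] wdeg_le[of p n] w by (auto simp: whom_def intro!: antisym)
qed

text \<open>The grading variable is outermost, so this leading coefficient is the weighted
  homogeneous component of top degree.\<close>

definition wtop :: "'a::idom poly poly \<Rightarrow> 'a poly poly" where "wtop p = lead_coeff (grade p)"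

lemma wtop: "p \<noteq> 0 \<Longrightarrow> wtop p \<noteq> 0" "whom (wdeg p) (wtop p)" "p \<noteq> 0 \<Longrightarrow> wdeg (wtop p) = wdeg p"
proof -
  show nz: "p \<noteq> 0 \<Longrightarrow> wtop p \<noteq> 0" by (simp add: wtop_def grade_eq_0_iff)
  show w: "whom (wdeg p) (wtop p)" by (auto simp: whom_def wtop_def grade_coeff wdeg_def)
  show "p \<noteq> 0 \<Longrightarrow> wdeg (wtop p) = wdeg p" using wdeg_whom[OF w] nz by simp
qed

lemma wdeg_minus_wtop: "p - wtop p \<noteq> 0 \<Longrightarrow> wdeg (p - wtop p) < wdeg p"
proof -
  assume nz: "p - wtop p \<noteq> 0"
  have c: "coeff (coeff (p - wtop p) a) b = (if l * a + k * b = wdeg p then 0 else coeff (coeff p a) b)" for a b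
    by (simp add: wtop_def grade_coeff wdeg_def)
  have "wdeg (p - wtop p) \<le> wdeg p"
    by (rule wdeg_le, rule wdeg_ge) (metis c)
  moreover have "wdeg (p - wtop p) \<noteq> wdeg p"
  proof
    assume eq: "wdeg (p - wtop p) = wdeg p"
    obtain a b where "coeff (coeff (wtop (p - wtop p)) a) b \<noteq> 0"
      using wtop(1)[OF nz] by (metis poly_eqI coeff_0)
    then show False using eq c[of a b] by (auto simp: wtop_def[of "p - wtop p"] grade_coeff wdeg_def split: if_splits)
  qed
  ultimately show ?thesis by simp
qed

definition pz :: "'a::idom poly poly" where "pz = [:0, 1:]"
definition pt :: "'a::idom poly poly" where "pt = [:[:0, 1:]:]"
definition r0 :: "'a::idom poly poly" where "r0 = pz ^ k + pt ^ l"

lemma pz_power: "pz ^ n = monom 1 n" and pt_power: "pt ^ n = [:monom 1 n:]"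
  by (induction n) (auto simp: pz_def pt_def monom_altdef one_pCons mult.commute)

lemma coeff_zt [simp]:
  "coeff (coeff (pz ^ i * pt ^ j) a) b = (if a = i \<and> b = j then 1 else 0)"
  by (auto simp: pz_power pt_power coeff_monom_mult smult_monom)

lemma smult_const_1 [simp]: "smult [:1:] p = (p :: 'a::idom poly poly)"
  by (simp flip: one_pCons)

lemma whom_zt: "whom (l * i + k * j) (smult [:c:] (pz ^ i * pt ^ j))"
  unfolding whom_def by simp

lemma whom_add: "whom n p \<Longrightarrow> whom n q \<Longrightarrow> whom n (p + q)"
  unfolding whom_def coeff_add by (metis add.right_neutral)

lemma whom_pz: "whom l pz" and whom_pt: "whom k pt" and whom_const: "whom 0 [:[:c:]:]"
  using whom_zt[of 1 0 1] whom_zt[of 0 1 1] whom_zt[of 0 0 c] by simp_all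

lemma whom_cusp: "whom (k * l) (pz ^ k + smult [:c:] (pt ^ l))"
  using whom_add[of "k * l", OF whom_zt[of k 0 1, simplified mult.commute[of l k], simplified]
    whom_zt[of 0 l c, simplified]]
  by simp

lemma cusp_nz: "pz ^ k + smult [:c:] (pt ^ l) \<noteq> 0"
proof
  assume "pz ^ k + smult [:c:] (pt ^ l) = 0"
  then have "coeff (coeff (pz ^ k + smult [:c:] (pt ^ l)) k) 0 = 0" by simp
  then show False using pos by (simp add: pz_power pt_power coeff_pCons split: nat.splits)
qed

lemma r0_cusp: "r0 = pz ^ k + smult [:1:] (pt ^ l)"
  by (simp add: r0_def)

lemma zt_nz: "pz \<noteq> 0" "pt \<noteq> 0" "r0 \<noteq> 0"
  using cusp_nz[of 1] by (auto simp: pz_def pt_def r0_cusp)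

lemma wdeg_gens: "wdeg pz = l" "wdeg pt = k" "wdeg r0 = k * l" "c \<noteq> 0 \<Longrightarrow> wdeg [:[:c:]:] = 0"
proof -
  show "wdeg pz = l" by (rule wdeg_whom[OF whom_pz zt_nz(1)])
  show "wdeg pt = k" by (rule wdeg_whom[OF whom_pt zt_nz(2)])
  show "wdeg r0 = k * l" unfolding r0_cusp by (rule wdeg_whom[OF whom_cusp cusp_nz])
  show "c \<noteq> 0 \<Longrightarrow> wdeg [:[:c:]:] = 0" by (rule wdeg_whom[OF whom_const]) simp
qed

lemma whom_0: assumes "whom 0 p" shows "p = [:[:coeff (coeff p 0) 0:]:]"
proof -
  have "coeff (coeff p a) b = 0" if "a \<noteq> 0 \<or> b \<noteq> 0" for a b
    using assms that pos unfolding whom_def by (metis add_is_0 mult_is_0 not_less0)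
  then show ?thesis
    by (intro poly_eqI) (auto simp: coeff_pCons split: nat.splits)
qed

text \<open>On homogeneous polynomials \<open>grade\<close> is multiplication by a power of the
  grading variable. Cancelling \<open>f\<close> and this power in the graded product shows that
  \<open>grade g\<close> has the same shape.\<close>

lemma whom_factor:
  assumes "whom n (f * g)" "whom m f" "f \<noteq> 0" "g \<noteq> 0"
  shows "whom (n - m) g" "m \<le> n"
proof -
  have n: "n = m + wdeg g"
    using assms wdeg_mult[of f g] wdeg_whom[OF assms(1)] wdeg_whom[OF assms(2)] by simp
  then show "m \<le> n" by simp
  have gr: "grade p = [:p:] * vx ^ i" if "whom i p" for p :: "'a poly poly" and i
  proof (intro poly_eqI)
    fix j a b
    have "coeff (coeff (coeff (grade p) j) a) b = coeff (coeff (coeff ([:p:] * vx ^ i) j) a) b"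
      using that by (auto simp: grade_coeff vx_power whom_def)
    then show "coeff (coeff (coeff (grade p) j) a) b = coeff (coeff (coeff ([:p:] * vx ^ i) j) a) b" .
  qed
  have "[:f:] * vx ^ m * grade g = [:f * g:] * vx ^ n"
    using gr[OF assms(1)] gr[OF assms(2)] by (simp add: grade_mult)
  also have "\<dots> = [:f:] * vx ^ m * ([:g:] * vx ^ wdeg g)"
    by (simp add: n power_add mult.commute)
  finally have "grade g = [:g:] * vx ^ wdeg g"
    using \<open>f \<noteq> 0\<close> mult_left_cancel[of "[:f:] * vx ^ m"] by (simp add: vx_def del: mult_pCons_left)
  then have "coeff (coeff (coeff (grade g) (wdeg g)) a) b = coeff (coeff g a) b" for a b
    by (simp add: vx_power)
  then show "whom (n - m) g" unfolding whom_def n grade_coeff by (metis add_diff_cancel_left')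
qed

subsection \<open>Factors of weighted homogeneous polynomials\<close>

text \<open>The degree m homogenization of the univariate \<open>p\<close>, with z^k and t^l
  substituted. A root c of \<open>p\<close> becomes a factor z^k - c t^l.\<close>

definition homog :: "nat \<Rightarrow> 'a::idom poly \<Rightarrow> 'a poly poly"
  where "homog m p = (\<Sum>i\<le>m. smult [:coeff p i:] (pz ^ (k * i) * pt ^ (l * (m - i))))"

lemma homog_coeff:
  "coeff (coeff (homog m p) a) b = (\<Sum>i\<le>m. if a = k * i \<and> b = l * (m - i) then coeff p i else 0)"
  by (simp add: homog_def coeff_sum if_distrib cong: if_cong)

lemma homog_linear_mult:
  assumes "degree q \<le> m"
  shows "homog (Suc m) ([:- c, 1:] * q) = (pz ^ k + smult [:- c:] (pt ^ l)) * homog m q"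
proof -
  let ?t = "\<lambda>c i j. smult [:c:] (pz ^ (k * i) * pt ^ (l * j)) :: 'a poly poly"
  have "homog (Suc m) ([:- c, 1:] * q) = homog (Suc m) (pCons 0 q) + homog (Suc m) (smult (- c) q)"
    by (simp add: homog_def sum.distrib[symmetric] smult_add_left[symmetric] algebra_simps)
  also have "homog (Suc m) (pCons 0 q) = (\<Sum>i\<le>m. ?t (coeff q i) (Suc i) (m - i))"
    unfolding homog_def by (subst sum.atMost_Suc_shift) simp
  also have "\<dots> = pz ^ k * homog m q"
    by (simp add: homog_def sum_distrib_left power_add algebra_simps)
  also have "homog (Suc m) (smult (- c) q) = (\<Sum>i\<le>m. ?t (- c * coeff q i) i (Suc m - i))"
    unfolding homog_def using assms by (simp add: coeff_eq_0)
  also have "\<dots> = smult [:- c:] (pt ^ l) * homog m q"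
    unfolding homog_def sum_distrib_left
  proof (rule sum.cong)
    fix i assume "i \<in> {..m}"
    then have "l * (Suc m - i) = l + l * (m - i)" by (simp add: Suc_diff_le)
    then show "?t (- c * coeff q i) i (Suc m - i)
      = smult [:- c:] (pt ^ l) * smult [:coeff q i:] (pz ^ (k * i) * pt ^ (l * (m - i)))"
      by (simp add: power_add algebra_simps)
  qed simp
  finally show ?thesis by (simp add: algebra_simps)
qed

text \<open>If neither z nor t divides \<open>g\<close>, then \<open>g\<close> contains a pure power
  of z and a pure power of t. By coprimality only powers of z^k and t^l occur, so \<open>g\<close>
  is a homogenized univariate polynomial, and a complex root of that polynomial supplies the third
  kind of factor.\<close>

lemma whom_has_factor:
  fixes g :: "complex poly poly"
  assumes w: "whom n g" and n: "n > 0" and g: "g \<noteq> 0"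
  obtains (z) g' where "g = pz * g'" | (t) g' where "g = pt * g'"
    | (cusp) g' c where "c \<noteq> 0" "g = (pz ^ k + smult [:c:] (pt ^ l)) * g'"
proof (cases "coeff g 0 = 0")
  case True
  then obtain g' where "g = pz * g'" by (cases g) (auto simp: pz_def)
  then show ?thesis by (rule z)
next
  case z0: False
  show ?thesis
  proof (cases "\<forall>a. coeff (coeff g a) 0 = 0")
    case True
    have "[:0, 1:] dvd coeff g a" for a
      using True by (simp add: poly_eq_0_iff_dvd[symmetric] poly_0_coeff_0 dvd_iff_poly_eq_0)
    then have "[:[:0, 1:]:] dvd g" by (simp add: const_poly_dvd_iff)
    then show ?thesis by (auto simp: pt_def[symmetric] dvd_def intro: t)
  next
    case False
    then obtain a0 where a0: "coeff (coeff g a0) 0 \<noteq> 0" by blast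
    obtain b0 where b0: "coeff (coeff g 0) b0 \<noteq> 0" using z0 by (metis poly_eqI coeff_0)
    have na: "l * a0 = n" and nb: "k * b0 = n" using w[unfolded whom_def, rule_format, OF a0] w[unfolded whom_def, rule_format, OF b0] by auto
    then have "k dvd a0" using cop by (metis coprime_dvd_mult_right_iff dvd_triv_left)
    then obtain m' where m': "a0 = k * m'" by auto
    then have "m' > 0" using na n by (cases m') auto
    then obtain m where m: "a0 = k * Suc m" using m' by (cases m') auto
    have b0': "b0 = l * Suc m" using na nb m pos by (metis mult.left_commute mult_cancel1 less_irrefl)
    define p where "p = (\<Sum>i\<le>Suc m. monom (coeff (coeff g (k * i)) (l * (Suc m - i))) i)"
    have cp: "coeff p i = (if i \<le> Suc m then coeff (coeff g (k * i)) (l * (Suc m - i)) else 0)" for i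
      by (auto simp: p_def coeff_sum)
    have gp: "g = homog (Suc m) p"
    proof (intro poly_eqI)
      fix a b
      show "coeff (coeff g a) b = coeff (coeff (homog (Suc m) p) a) b"
      proof (cases "\<exists>i\<le>Suc m. a = k * i \<and> b = l * (Suc m - i)")
        case True
        then obtain i where i: "i \<le> Suc m" "a = k * i" "b = l * (Suc m - i)" by blast
        have "coeff (coeff (homog (Suc m) p) a) b = (\<Sum>j\<le>Suc m. if j = i then coeff p i else 0)"
          unfolding homog_coeff i by (rule sum.cong) (use pos in auto)
        also have "\<dots> = coeff (coeff g a) b" using i by (simp add: cp)
        finally show ?thesis by simp
      next
        case False
        then have "coeff (coeff (homog (Suc m) p) a) b = 0"
          unfolding homog_coeff by (intro sum.neutral) auto
        moreover have "coeff (coeff g a) b = 0"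
        proof (rule ccontr)
          assume "coeff (coeff g a) b \<noteq> 0"
          then have eq: "l * a + k * b = k * l * Suc m" using w na m by (simp add: whom_def algebra_simps)
          then have "l * a = k * (l * Suc m - b)" by (simp add: diff_mult_distrib2 algebra_simps)
          then have "k dvd a" using cop by (metis coprime_dvd_mult_right_iff dvd_triv_left)
          then obtain i where i: "a = k * i" by auto
          then have "k * (l * i + b) = k * (l * Suc m)" using eq by (simp add: algebra_simps)
          then have "l * i + b = l * Suc m" using pos by (metis mult_cancel1 less_irrefl)
          then have "l * i \<le> l * Suc m" and b: "b = l * Suc m - l * i" by linarith+
          then have "i \<le> Suc m" using pos by (simp only: mult_le_cancel1)
          moreover have "b = l * (Suc m - i)" using b by (simp only: diff_mult_distrib2)
          ultimately show False using False i by blast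
        qed
        ultimately show ?thesis by simp
      qed
    qed
    have lc: "coeff p (Suc m) \<noteq> 0" and c0: "coeff p 0 \<noteq> 0"
      using a0 b0 b0' m by (auto simp: cp)
    have dp: "degree p = Suc m"
      using lc by (intro antisym degree_le le_degree) (auto simp: cp)
    then obtain c where c: "poly p c = 0"
      using fundamental_theorem_of_algebra[of p] by (auto simp: constant_degree)
    then obtain q where q: "p = [:- c, 1:] * q" by (metis dvd_def poly_eq_0_iff_dvd)
    have "c \<noteq> 0" using c c0 by (auto simp: poly_0_coeff_0)
    have "q \<noteq> 0" using q lc by auto
    then have "degree q \<le> m" using dp degree_mult_eq[of "[:- c, 1:]" q] q by simp
    then have "g = (pz ^ k + smult [:- c:] (pt ^ l)) * homog m q"
      using gp q homog_linear_mult by metis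
    then show ?thesis using \<open>c \<noteq> 0\<close> by (intro cusp[of "- c" "homog m q"]) auto
  qed
qed

end

text \<open>Pairs of integers in lexicographic order are the value group of the degree function on
  the coordinate ring.\<close>

instance prod :: (linordered_ab_group_add, linordered_ab_group_add) linordered_ab_group_add
  by standard (auto simp: less_eq_prod_def)

instance fract :: ("{idom,ring_char_0}") ring_char_0
proof
  have "of_nat n = (to_fract (of_nat n) :: 'a fract)" for n
    by (induction n) auto
  then show "inj (of_nat :: nat \<Rightarrow> 'a fract)" by (intro injI) simp
qed

section \<open>The coordinate ring\<close>

definition ord :: "'a::zero poly \<Rightarrow> nat" where "ord p = (LEAST i. coeff p i \<noteq> 0)"
definition low :: "'a::zero poly \<Rightarrow> 'a" where "low p = coeff p (ord p)"

lemma ord_low: assumes "p \<noteq> 0" shows "low p \<noteq> 0" "\<And>i. i < ord p \<Longrightarrow> coeff p i = 0"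
proof -
  have "\<exists>i. coeff p i \<noteq> 0" using assms by (metis poly_eqI coeff_0)
  then show "low p \<noteq> 0" unfolding low_def ord_def by (metis (mono_tags, lifting) LeastI)
  show "i < ord p \<Longrightarrow> coeff p i = 0" for i unfolding ord_def using not_less_Least by blast
qed

lemma ord_eqI: "coeff p i \<noteq> 0 \<Longrightarrow> (\<And>j. j < i \<Longrightarrow> coeff p j = 0) \<Longrightarrow> ord p = i"
  unfolding ord_def by (rule Least_equality) (auto simp: not_less[symmetric])

lemma ord_ge: "p \<noteq> 0 \<Longrightarrow> (\<And>j. j < i \<Longrightarrow> coeff p j = 0) \<Longrightarrow> i \<le> ord p"
  using ord_low(1)[of p] unfolding low_def by (meson not_less)

lemma ord_le: "coeff p i \<noteq> 0 \<Longrightarrow> ord p \<le> i"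
  unfolding ord_def by (rule Least_le)

lemma ord_low_mult:
  fixes p q :: "'a::idom poly"
  assumes "p \<noteq> 0" "q \<noteq> 0"
  shows "ord (p * q) = ord p + ord q" "low (p * q) = low p * low q"
proof -
  have c: "coeff (p * q) (ord p + ord q) = low p * low q"
  proof -
    have "coeff (p * q) (ord p + ord q) = (\<Sum>i\<le>ord p + ord q. if i = ord p then low p * low q else 0)"
      unfolding coeff_mult
    proof (rule sum.cong)
      fix i assume "i \<in> {..ord p + ord q}"
      then consider "i < ord p" | "i = ord p" | "ord p + ord q - i < ord q" by force
      then show "coeff p i * coeff q (ord p + ord q - i) = (if i = ord p then low p * low q else 0)"
        using ord_low[OF assms(1)] ord_low[OF assms(2)] by cases (auto simp: low_def)
    qed simp
    then show ?thesis by simp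
  qed
  have z: "coeff (p * q) j = 0" if "j < ord p + ord q" for j
    unfolding coeff_mult
  proof (rule sum.neutral, safe)
    fix i assume "i \<le> j"
    then have "i < ord p \<or> j - i < ord q" using that by linarith
    then show "coeff p i * coeff q (j - i) = 0"
      using ord_low[OF assms(1)] ord_low[OF assms(2)] by auto
  qed
  show o: "ord (p * q) = ord p + ord q"
    using c z ord_low(1)[OF assms(1)] ord_low(1)[OF assms(2)] by (intro ord_eqI) auto
  show "low (p * q) = low p * low q" using c by (simp add: low_def o)
qed

context koras
begin

text \<open>Values are compared lexicographically: first the order of the pole along \<open>x = 0\<close>, then the
  weighted degree.\<close>

definition vp :: "'a::idom poly poly poly \<Rightarrow> int \<times> int"
  where "vp p = (- int (ord p), int (wdeg (low p)))"

lemma vp_mult: "p \<noteq> 0 \<Longrightarrow> q \<noteq> 0 \<Longrightarrow> vp (p * q) = vp p + vp q"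
  by (simp add: vp_def ord_low_mult wdeg_mult ord_low)

lemma vp_leI:
  assumes "p \<noteq> 0" "\<And>j. j < i \<Longrightarrow> coeff p j = 0" "coeff p i \<noteq> 0 \<Longrightarrow> wdeg (coeff p i) \<le> w"
  shows "vp p \<le> (- int i, int w)"
  using ord_ge[OF assms(1,2), of i] assms(3) ord_low(1)[OF assms(1)]
  by (cases "ord p = i") (auto simp: vp_def low_def)

lemma vp_lessI:
  assumes "p \<noteq> 0" "\<And>j. j < i \<Longrightarrow> coeff p j = 0" "coeff p i \<noteq> 0 \<Longrightarrow> wdeg (coeff p i) < w"
  shows "vp p < (- int i, int w)"
  using ord_ge[OF assms(1,2), of i] assms(3) ord_low(1)[OF assms(1)]
  by (cases "ord p = i") (auto simp: vp_def low_def)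

lemma vp_add:
  assumes "p \<noteq> 0" "q \<noteq> 0" "p + q \<noteq> 0"
  shows "vp (p + q) \<le> max (vp p) (vp q)"
proof -
  have *: "vp (p + q) \<le> max (vp p) (vp q)" if "ord p \<le> ord q" "p \<noteq> 0" "q \<noteq> 0" "p + q \<noteq> 0"
    for p q :: "'a poly poly poly"
  proof (cases "ord p = ord q")
    case True
    have "vp (p + q) \<le> (- int (ord p), int (max (wdeg (low p)) (wdeg (low q))))"
      using wdeg_add[of "low p" "low q"] ord_low(2)[of p] ord_low(2)[of q] that True
      by (intro vp_leI) (auto simp: low_def)
    also have "\<dots> = max (vp p) (vp q)" by (auto simp: vp_def True max_def)
    finally show ?thesis .
  next
    case False
    then have "vp (p + q) \<le> vp p"
      unfolding vp_def[of p] using that ord_low(2)[of p] ord_low(2)[of q] False by (intro vp_leI) (auto simp: low_def)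
    then show ?thesis by (simp add: le_max_iff_disj)
  qed
  show ?thesis
    using *[of p q] *[of q p] assms by (cases "ord p \<le> ord q") (auto simp: add.commute max.commute)
qed

lemma vp_const: "g \<noteq> 0 \<Longrightarrow> vp [:g:] = (0, int (wdeg g))"
proof -
  assume "g \<noteq> 0"
  then have "ord [:g:] = 0" by (intro ord_eqI) auto
  then show ?thesis by (simp add: vp_def low_def)
qed

lemma vz_eq: "vz = [:pz:]" and vt_eq: "vt = [:pt:]"
  by (auto simp: vz_def vt_def pz_def pt_def)

lemma v_nz [simp]: "vx \<noteq> 0" "vz \<noteq> 0" "vt \<noteq> 0"
  by (auto simp: vx_def vz_def vt_def)

lemma vp_gens: "vp vx = (-1, 0)" "vp vz = (0, int l)" "vp vt = (0, int k)" "c \<noteq> 0 \<Longrightarrow> vp (kc c) = (0, 0)"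
proof -
  have "ord (vx :: 'a poly poly poly) = 1"
    by (intro ord_eqI) (auto simp: vx_def coeff_pCons split: nat.splits)
  then show "vp (vx :: 'a poly poly poly) = (-1, 0)"
    using wdeg_gens(4)[of "1 :: 'a"] by (simp add: vp_def low_def vx_def one_pCons)
  show "vp vz = (0, int l)" "vp vt = (0, int k)"
    by (simp_all add: vz_eq vt_eq vp_const zt_nz wdeg_gens)
  show "c \<noteq> 0 \<Longrightarrow> vp (kc c) = (0, 0)" by (simp add: kc_def vp_const wdeg_gens)
qed

lemma vp_vx_power: "vp (vx ^ n) = (- int n, 0)"
proof (induction n)
  case 0
  show ?case using vp_gens(4)[of 1] by (simp add: rm_1[OF ring_map_kc])
next
  case (Suc n)
  then show ?case by (simp add: vp_mult vp_gens)
qed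

definition rr :: "'a::idom poly poly poly" where "rr = vz ^ k + vt ^ l + vx"

lemma rr_eq: "rr = [:r0, 1:]"
  by (simp add: rr_def r0_def vz_eq vt_eq vx_def flip: rm_power[OF ring_map_const])

section \<open>The coordinate ring inside a field of fractions\<close>

abbreviation emb :: "Cxzt \<Rightarrow> Cxzt fract" where "emb \<equiv> to_fract"
text \<open>On X the coordinate y equals -(z^k + t^l + x) / x^d, so that C[X] becomes the subring
  \<open>KA\<close> generated by C[x,z,t] and this fraction.\<close>

definition Y :: "Cxzt fract" where "Y = - emb rr / emb vx ^ d"
definition pr :: "Cxzt poly \<Rightarrow> Cxzt fract" where "pr = ev to_fract Y"
definition KA :: "Cxzt fract set" where "KA = range pr"

lemma ring_map_emb: "ring_map to_fract"
  by (intro ring_mapI) auto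

lemma ring_map_pr: "ring_map pr"
  unfolding pr_def by (intro ring_map_ev ring_map_emb)

lemma pr_const: "pr [:p:] = emb p" and pr_Y: "pr [:0, 1:] = Y" and pr_pCons: "pr (pCons a q) = emb a + Y * pr q"
  unfolding pr_def by (auto simp: ev_const ev_X ring_map_emb ev_pCons ev_0)

lemma Y_eq: "emb vx ^ d * Y = - emb rr"
  by (simp add: Y_def)

definition rel :: "Cxzt poly" where "rel = [:rr, vx ^ d:]"

lemma pr_rel: "pr rel = 0"
proof -
  have "pr rel = emb rr + emb vx ^ d * Y"
    by (simp add: rel_def pr_pCons rm_power[OF ring_map_emb] rm_0[OF ring_map_pr] algebra_simps)
  then show ?thesis by (simp add: Y_eq)
qed

fun ev4 :: "Cxzt poly \<Rightarrow> A4 \<Rightarrow> complex"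
  where "ev4 q (x, y, z, t) = ev (\<lambda>p. eval_xzt p (x, z, t)) y q"

lemma ring_map_eval: "ring_map (\<lambda>p. eval_xzt p P)"
  by (cases P) (auto intro!: ring_mapI)

lemma eval_subst3: "eval_xzt p (x, z, t) = subst3 (\<lambda>c. c) x z t p"
  by (rule ring_map_poly3_eq[OF ring_map_eval ring_map_subst3[OF ring_map_id]])
     (simp_all add: subst3_gens[OF ring_map_id], simp_all add: kc_def vx_def vz_def vt_def)

lemma eval_gens: "eval_xzt (kc c) (x, z, t) = c" "eval_xzt vx (x, z, t) = x" "eval_xzt vz (x, z, t) = z"
   "eval_xzt vt (x, z, t) = t"
  by (auto simp: kc_def vx_def vz_def vt_def)

declare eval_xzt.simps [simp del]

lemmas eval_simps = rm_simps[OF ring_map_eval] eval_gens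

lemma eval_rr: "eval_xzt rr (x, z, t) = z ^ k + t ^ l + x"
  by (simp add: rr_def eval_simps)

lemma ring_map_ev4: "ring_map (\<lambda>q. ev4 q P)"
  by (cases P) (auto intro!: ring_map_ev ring_map_eval)

lemma ev4_pCons: "ev4 (pCons a q) (x, y, z, t) = eval_xzt a (x, z, t) + y * ev4 q (x, y, z, t)"
  by (simp add: ev_pCons[OF ring_map_eval])

lemma ev4_0: "ev4 0 P = 0" by (rule rm_0[OF ring_map_ev4])

declare ev4.simps [simp del]

lemma ev4_const: "ev4 [:a:] (x, y, z, t) = eval_xzt a (x, z, t)" and ev4_Y: "ev4 [:0, 1:] (x, y, z, t) = y"
  by (auto simp: ev4_pCons ev4_0 eval_simps)

text \<open>Points with x nonzero suffice, because x p vanishes at all the others too. These are the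
  points over which X projects bijectively to the (x,z,t)-space.\<close>

lemma eval_eq_0:
  assumes "\<And>x z t. x \<noteq> 0 \<Longrightarrow> eval_xzt p (x, z, t) = 0"
  shows "p = 0"
proof -
  have inf: "q = 0" if "\<And>z. poly q [:z:] = 0" for q :: "'a::{idom,ring_char_0} poly poly"
  proof (rule ccontr)
    assume "q \<noteq> 0"
    then have "finite {x. poly q x = 0}" by (rule poly_roots_finite)
    moreover have "range (\<lambda>z. [:z:]) \<subseteq> {x. poly q x = 0}" using that by auto
    moreover have "infinite (range (\<lambda>z::'a. [:z:]))"
      by (subst finite_image_iff) (auto simp: inj_on_def infinite_UNIV_char_0)
    ultimately show False using finite_subset by blast
  qed
  have inf2: "q = 0" if "\<And>z. poly q [:[:z:]:] = 0" for q :: "'a::{idom,ring_char_0} poly poly poly"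
  proof (rule ccontr)
    assume "q \<noteq> 0"
    then have "finite {x. poly q x = 0}" by (rule poly_roots_finite)
    moreover have "range (\<lambda>z. [:[:z:]:]) \<subseteq> {x. poly q x = 0}" using that by auto
    moreover have "infinite (range (\<lambda>z::'a. [:[:z:]:]))"
      by (subst finite_image_iff) (auto simp: inj_on_def infinite_UNIV_char_0)
    ultimately show False using finite_subset by blast
  qed
  have "eval_xzt (vx * p) (x, z, t) = 0" for x z t
    using assms[of x z t] by (cases "x = 0") (auto simp: eval_simps)
  then have "poly (poly (poly (vx * p) [:[:x:]:]) [:z:]) t = 0" for x z t
    by (simp add: eval_xzt.simps)
  then have "poly (poly (vx * p) [:[:x:]:]) [:z:] = 0" for x z
    using poly_all_0_iff_0 by blast
  then have "poly (vx * p) [:[:x:]:] = 0" for x by (rule inf)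
  then have "vx * p = 0" by (rule inf2)
  then show ?thesis by simp
qed

text \<open>One polynomial clears the denominator both in the field of fractions and pointwise on X;
  this links \<open>pr\<close> with the evaluation of functions.\<close>

lemma clear_denominator:
  "degree q \<le> m \<Longrightarrow> \<exists>p. pr q * emb vx ^ (d * m) = emb p \<and>
     (\<forall>x y z t. (x, y, z, t) \<in> koras_russell d k l \<longrightarrow> ev4 q (x, y, z, t) * x ^ (d * m) = eval_xzt p (x, z, t))"
proof (induction q arbitrary: m)
  case 0
  show ?case
    by (rule exI[of _ 0]) (auto simp: rm_0[OF ring_map_pr] ev4_0 eval_simps)
next
  case (pCons a q)
  show ?case
  proof (cases "q = 0")
    case True
    show ?thesis
      by (rule exI[of _ "a * vx ^ (d * m)"])
         (auto simp: True pr_const ev4_const eval_simps rm_power[OF ring_map_emb])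
  next
    case False
    then obtain m' where m': "m = Suc m'" "degree q \<le> m'" using pCons.prems by (cases m) auto
    obtain p where p: "pr q * emb vx ^ (d * m') = emb p"
      "\<And>x y z t. (x, y, z, t) \<in> koras_russell d k l \<Longrightarrow> ev4 q (x, y, z, t) * x ^ (d * m') = eval_xzt p (x, z, t)"
      using pCons.IH[OF m'(2)] by blast
    have "pr (pCons a q) * emb vx ^ (d * m)
       = emb a * emb vx ^ (d * m) + (emb vx ^ d * Y) * (pr q * emb vx ^ (d * m'))"
      by (simp add: pr_pCons m' power_add algebra_simps)
    also have "\<dots> = emb (a * vx ^ (d * m) - rr * p)"
      by (simp add: p Y_eq rm_power[OF ring_map_emb])
    finally have 1: "pr (pCons a q) * emb vx ^ (d * m) = emb (a * vx ^ (d * m) - rr * p)" .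
    have 2: "ev4 (pCons a q) (x, y, z, t) * x ^ (d * m) = eval_xzt (a * vx ^ (d * m) - rr * p) (x, z, t)"
      if "(x, y, z, t) \<in> koras_russell d k l" for x y z t
    proof -
      have xy: "x ^ d * y = - (z ^ k + t ^ l + x)"
        unfolding eq_neg_iff_add_eq_0 using that by (simp add: koras_russell_def add.assoc)
      have "ev4 (pCons a q) (x, y, z, t) * x ^ (d * m)
         = eval_xzt a (x, z, t) * x ^ (d * m) + (x ^ d * y) * (ev4 q (x, y, z, t) * x ^ (d * m'))"
        by (simp add: ev4_pCons m' power_add algebra_simps)
      then show ?thesis unfolding xy p(2)[OF that] by (simp add: eval_simps eval_rr algebra_simps)
    qed
    show ?thesis using 1 2 by blast
  qed
qed

text \<open>The extension of \<open>vp\<close> to fractions whose denominator is a power of x: x^m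
  has value (-m, 0), hence the shift by (m, 0). Independence of the representation is
  \<open>val_eq\<close>.\<close>

definition val :: "Cxzt fract \<Rightarrow> int \<times> int"
  where "val s = (SOME w. \<exists>m p. p \<noteq> 0 \<and> s * emb vx ^ m = emb p \<and> w = vp p + (int m, 0))"

lemma val_eq:
  assumes "p \<noteq> 0" "s * emb vx ^ m = emb p"
  shows "val s = vp p + (int m, 0)"
proof -
  have "\<exists>w. \<exists>m p. p \<noteq> 0 \<and> s * emb vx ^ m = emb p \<and> w = vp p + (int m, 0)" using assms by blast
  then have "\<exists>m p. p \<noteq> 0 \<and> s * emb vx ^ m = emb p \<and> val s = vp p + (int m, 0)"
    unfolding val_def by (rule someI_ex)
  then obtain n q where q: "q \<noteq> 0" "s * emb vx ^ n = emb q" "val s = vp q + (int n, 0)" by blast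
  have "emb (p * vx ^ n) = emb (q * vx ^ m)"
    by (simp add: rm_power[OF ring_map_emb] assms(2)[symmetric] q(2)[symmetric] ac_simps)
  then have "vp (p * vx ^ n) = vp (q * vx ^ m)" by (metis to_fract_eq_iff)
  then have "vp p + (- int n, 0) = vp q + (- int m, 0)"
    using assms q by (simp add: vp_mult vp_vx_power)
  then show ?thesis using q by (auto simp: prod_eq_iff)
qed

lemma KA_clear: assumes "f \<in> KA" "f \<noteq> 0" obtains p m where "p \<noteq> 0" "f * emb vx ^ m = emb p"
proof -
  obtain q where q: "f = pr q" using assms by (auto simp: KA_def)
  obtain p where p: "f * emb vx ^ (d * degree q) = emb p"
    using clear_denominator[of q "degree q"] q by blast
  then have "p \<noteq> 0" using assms(2) by force
  then show ?thesis using p by (rule that)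
qed

lemma emb_KA: "emb p \<in> KA" and Y_KA: "Y \<in> KA"
  unfolding KA_def using pr_const pr_Y by (metis rangeI)+

lemma val_emb: "p \<noteq> 0 \<Longrightarrow> val (emb p) = vp p"
  using val_eq[of p "emb p" 0] by (simp add: prod_eq_iff)

lemma of_nat_kc: "of_nat n = (kc (of_nat n) :: Cxzt)"
  by (simp add: rm_of_nat[OF ring_map_kc])

sublocale dg: degree_fun KA val
proof
  show "1 \<in> KA" using emb_KA[of 1] by simp
  show "f + g \<in> KA" "f * g \<in> KA" if "f \<in> KA" "g \<in> KA" for f g
    using that unfolding KA_def by (auto simp flip: rm_add[OF ring_map_pr] rm_mult[OF ring_map_pr])
  show "- f \<in> KA" if "f \<in> KA" for f
    using that unfolding KA_def by (auto simp flip: rm_minus[OF ring_map_pr])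
  show "val (of_nat n) = 0" if "n > 0" for n
  proof -
    have "of_nat n = emb (kc (of_nat n))"
      by (simp flip: of_nat_kc rm_of_nat[OF ring_map_emb])
    then show ?thesis using that val_emb[of "kc (of_nat n)"] vp_gens(4)[of "of_nat n :: complex"]
      by (auto simp: kc_def zero_prod_def)
  qed
  fix f g assume f: "f \<in> KA" "f \<noteq> 0" and g: "g \<in> KA" "g \<noteq> 0"
  obtain p m where p: "p \<noteq> 0" "f * emb vx ^ m = emb p" using KA_clear f by blast
  obtain q n where q: "q \<noteq> 0" "g * emb vx ^ n = emb q" using KA_clear g by blast
  have "f * g * emb vx ^ (m + n) = emb (p * q)"
    by (simp add: p(2)[symmetric] q(2)[symmetric] power_add algebra_simps)
  then show "val (f * g) = val f + val g"
    using val_eq[OF p] val_eq[OF q] val_eq[of "p * q" "f * g" "m + n"] p q by (simp add: vp_mult prod_eq_iff)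
  assume nz: "f + g \<noteq> 0"
  have "(f + g) * emb vx ^ (m + n) = f * emb vx ^ m * emb vx ^ n + g * emb vx ^ n * emb vx ^ m"
    by (simp add: power_add algebra_simps)
  then have s: "(f + g) * emb vx ^ (m + n) = emb (p * vx ^ n + q * vx ^ m)"
    unfolding p q by (simp add: rm_power[OF ring_map_emb])
  then have nz': "p * vx ^ n + q * vx ^ m \<noteq> 0" using nz by force
  have "vp (p * vx ^ n + q * vx ^ m) \<le> max (vp (p * vx ^ n)) (vp (q * vx ^ m))"
    using p q nz' by (intro vp_add) auto
  then show "val (f + g) \<le> max (val f) (val g)"
    unfolding val_eq[OF p] val_eq[OF q] val_eq[OF nz' s] using p q
    by (cases "vp p"; cases "vp q"; cases "vp (p * vx ^ n + q * vx ^ m)")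
       (auto simp: vp_mult vp_vx_power max_def split: if_splits)
qed

section \<open>Normal forms and leading monomials in the coordinate ring\<close>

lemma normal_form:
  obtains n s where "q = n + rel * s" "\<And>j. j > 0 \<Longrightarrow> coeff n j = 0 \<or> degree (coeff n j) < d"
proof -
  have divx: "\<exists>w c. p = vx ^ d * w + c \<and> (c = 0 \<or> degree c < d)" for p :: Cxzt
  proof -
    define w c where "w = (\<Sum>i\<le>degree p. monom (coeff p (i + d)) i)" and "c = (\<Sum>i<d. monom (coeff p i) i)"
    have cw: "coeff w i = coeff p (i + d)" for i
      unfolding w_def by (auto simp: coeff_sum coeff_eq_0)
    have cc: "coeff c i = (if i < d then coeff p i else 0)" for i
      unfolding c_def by (simp add: coeff_sum)
    have "p = vx ^ d * w + c"
      by (intro poly_eqI) (simp add: coeff_vx_mult cw cc)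
    moreover have "c = 0 \<or> degree c < d"
    proof -
      have "degree c \<le> d - 1" using pos by (intro degree_le) (auto simp: cc)
      then show ?thesis using pos by auto
    qed
    ultimately show ?thesis by blast
  qed
  have "\<exists>n s. q = n + rel * s \<and> (\<forall>j>0. coeff n j = 0 \<or> degree (coeff n j) < d)" for q
  proof (induction q)
    case 0
    show ?case by (intro exI[of _ 0]) simp
  next
    case (pCons a q)
    obtain n s where ns: "q = n + rel * s" "\<forall>j>0. coeff n j = 0 \<or> degree (coeff n j) < d"
      using pCons.IH by blast
    obtain n0 n' where n: "n = pCons n0 n'" by (cases n)
    obtain w c where wc: "n0 = vx ^ d * w + c" "c = 0 \<or> degree c < d" using divx by blast
    have "pCons a q = pCons (a - rr * w) (pCons c n') + rel * (pCons 0 s + [:w:])"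
      by (simp add: ns(1) n wc(1) rel_def algebra_simps)
    moreover have "coeff (pCons (a - rr * w) (pCons c n')) j = 0 \<or>
        degree (coeff (pCons (a - rr * w) (pCons c n')) j) < d" if "j > 0" for j
      using that ns(2)[rule_format, of "j - 1"] wc(2) by (auto simp: n coeff_pCons split: nat.splits)
    ultimately show ?case by blast
  qed
  then show ?thesis using that by metis
qed

definition mon :: "nat \<Rightarrow> nat \<Rightarrow> complex poly poly \<Rightarrow> Cxzt fract"
  where "mon i j g = emb vx ^ i * Y ^ j * emb [:g:]"

lemma mon_KA: "mon i j g \<in> KA"
  unfolding mon_def by (intro dg.ring_in emb_KA Y_KA)

lemma rr_nz: "rr \<noteq> 0" by (simp add: rr_eq)

lemma vp_rr: "vp rr = (0, int (k * l))"
proof -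
  have "ord (rr :: 'a::idom poly poly poly) = 0" using zt_nz by (intro ord_eqI) (auto simp: rr_eq)
  then show ?thesis by (simp add: vp_def low_def rr_eq wdeg_gens)
qed

lemma Y_nz: "Y \<noteq> 0" by (simp add: Y_def rr_nz)

lemma val_Y: "val Y = (int d, int (k * l))"
proof -
  have "Y * emb vx ^ d = emb (- rr)" using Y_eq by (simp add: mult.commute)
  moreover have "vp (- rr :: Cxzt) = (0, int (k * l))"
    using vp_mult[of "kc (- 1) :: Cxzt" rr] vp_gens(4)[of "- 1 :: complex"] rr_nz
    by (simp add: vp_rr rm_minus[OF ring_map_kc] rm_1[OF ring_map_kc] kc_eq_iff)
  ultimately show ?thesis using val_eq[of "- rr" Y d] rr_nz by simp
qed

lemma val_power: "f \<in> KA \<Longrightarrow> f \<noteq> 0 \<Longrightarrow> val (f ^ n) = (int n * fst (val f), int n * snd (val f))"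
  by (induction n) (auto simp: dg.v_1 dg.v_mult dg.ring_in zero_prod_def prod_eq_iff algebra_simps)

lemma mon_nz: "g \<noteq> 0 \<Longrightarrow> mon i j g \<noteq> 0"
  by (simp add: mon_def Y_nz)

lemma val_mon: assumes "g \<noteq> 0"
  shows "val (mon i j g) = (int (d * j) - int i, int (k * l * j + wdeg g))"
proof -
  have "val (mon i j g) = val (emb vx ^ i) + val (Y ^ j) + val (emb [:g:])"
    unfolding mon_def using assms Y_nz dg.v_mult[of "emb vx ^ i * Y ^ j" "emb [:g:]"] dg.v_mult[of "emb vx ^ i" "Y ^ j"]
    by (simp add: dg.ring_in emb_KA Y_KA)
  then show ?thesis using assms
    by (simp add: val_power emb_KA Y_KA Y_nz val_Y val_emb vp_gens vp_const prod_eq_iff algebra_simps)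
qed

text \<open>The bound on the x-degree makes the y^J term have pole order d J - i > d (J - 1), more
  than any lower power of y can have. Hence no cancellation between powers of y occurs, and the top
  power carries the leading term.\<close>

lemma normal_top:
  assumes nz: "n \<noteq> 0" and nf: "\<And>j. j > 0 \<Longrightarrow> coeff n j = 0 \<or> degree (coeff n j) < d"
  obtains i g where "g \<noteq> 0" "whom (wdeg g) g"
    "dg.lt (pr n - mon i (degree n) g) (val (mon i (degree n) g))" "degree n > 0 \<Longrightarrow> i < d"
proof -
  define J where "J = degree n"
  define q where "q = coeff n J"
  have q0: "q \<noteq> 0" using nz by (simp add: q_def J_def)
  define i where "i = ord q"
  define g where "g = wtop (low q)"
  have lq: "low q \<noteq> 0" using ord_low(1)[OF q0] .
  have g: "g \<noteq> 0" "whom (wdeg g) g" "wdeg g = wdeg (low q)"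
    using wtop(1)[OF lq] wtop(3)[OF lq] wtop(2)[of "low q"] by (auto simp: g_def)
  have i: "i < d" if "J > 0"
  proof -
    have "degree q < d" using nf[OF that] q0 by (simp add: q_def)
    moreover have "i \<le> degree q" unfolding i_def using q0 by (intro ord_le) simp
    ultimately show ?thesis by simp
  qed
  define n' where "n' = n - monom q J"
  have n': "n = n' + monom q J" by (simp add: n'_def)
  have dn': "n' = 0 \<or> degree n' < J"
  proof -
    have "coeff n' a = 0" if "a \<ge> J" for a
      using that by (cases "a = J") (auto simp: n'_def q_def J_def coeff_eq_0)
    then show ?thesis by (meson degree_lessI)
  qed
  have prm: "pr (monom q J) = emb q * Y ^ J"
    by (simp add: monom_altdef rm_mult[OF ring_map_pr] rm_power[OF ring_map_pr] pr_Y
        flip: pr_const) (simp add: rm_mult[OF ring_map_pr, symmetric] rm_power[OF ring_map_pr, symmetric] flip: pr_Y)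
  have v: "val (mon i J g) = (int (d * J) - int i, int (k * l * J + wdeg g))" by (rule val_mon[OF g(1)])
  have t1: "dg.lt (pr n') (val (mon i J g))"
  proof (cases "pr n' = 0")
    case False
    then have "n' \<noteq> 0" by (auto simp: rm_0[OF ring_map_pr])
    with dn' have J: "J > 0" "degree n' \<le> J - 1" by auto
    obtain p where p: "pr n' * emb vx ^ (d * (J - 1)) = emb p" using clear_denominator[OF J(2)] by blast
    then have "p \<noteq> 0" using False by force
    from val_eq[OF this p] have "fst (val (pr n')) \<le> int (d * (J - 1))" by (simp add: vp_def)
    moreover have "int (d * (J - 1)) < int (d * J) - int i"
      using i J by (cases J) (auto simp: algebra_simps)
    ultimately show ?thesis unfolding dg.lt_def v by (simp add: less_prod_def)
  qed simp
  have t2: "dg.lt (emb (q - vx ^ i * [:g:]) * Y ^ J) (val (mon i J g))"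
  proof (cases "q - vx ^ i * [:g:] = 0")
    case False
    have vl: "vp (q - vx ^ i * [:g:]) < (- int i, int (wdeg g))"
    proof (rule vp_lessI[OF False])
      show "coeff (q - vx ^ i * [:g:]) j = 0" if "j < i" for j
        using that ord_low(2)[OF q0] by (simp add: coeff_vx_mult i_def del: mult_pCons_right)
      show "wdeg (coeff (q - vx ^ i * [:g:]) i) < wdeg g" if "coeff (q - vx ^ i * [:g:]) i \<noteq> 0"
        using that wdeg_minus_wtop[of "low q"] unfolding g(3) by (simp add: coeff_vx_mult i_def low_def g_def del: mult_pCons_right)
    qed
    have "val (emb (q - vx ^ i * [:g:]) * Y ^ J) = vp (q - vx ^ i * [:g:]) + val (Y ^ J)"
      by (subst dg.v_mult[OF emb_KA dg.power_in[OF Y_KA]])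
         (use False Y_nz val_emb[OF False] in \<open>simp_all del: to_fract_diff mult_pCons_right\<close>)
    then show ?thesis using vl unfolding dg.lt_def v
      by (cases "vp (q - vx ^ i * [:g:])") (auto simp: val_power Y_KA Y_nz val_Y algebra_simps)
  qed simp
  have "emb (q - vx ^ i * [:g:]) = emb q - emb vx ^ i * emb [:g:]"
    by (simp only: to_fract_diff to_fract_mult rm_power[OF ring_map_emb])
  then have eq: "pr n - mon i J g = pr n' + emb (q - vx ^ i * [:g:]) * Y ^ J"
    by (simp add: n' rm_add[OF ring_map_pr] prm mon_def algebra_simps)
  have "pr n' \<in> KA" unfolding KA_def by (rule rangeI)
  then have "dg.lt (pr n - mon i J g) (val (mon i J g))"
    unfolding eq by (rule dg.lt_add[OF _ dg.mult_in[OF emb_KA dg.power_in[OF Y_KA]] t1 t2])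
  from that[OF g(1,2) this[unfolded J_def]] i show ?thesis by (simp add: J_def)
qed

lemma normal_nz:
  assumes "n \<noteq> 0" "\<And>j. j > 0 \<Longrightarrow> coeff n j = 0 \<or> degree (coeff n j) < d"
  shows "pr n \<noteq> 0"
proof
  assume "pr n = 0"
  moreover obtain i g where "g \<noteq> 0" "dg.lt (pr n - mon i (degree n) g) (val (mon i (degree n) g))"
    using normal_top[OF assms] by metis
  ultimately show False
    using dg.v_minus[OF mon_KA mon_nz] mon_nz[of g i "degree n"] by (simp add: dg.lt_def)
qed

lemma pr_eq_0_iff: "pr q = 0 \<longleftrightarrow> rel dvd q"
proof
  assume "pr q = 0"
  obtain n s where ns: "q = n + rel * s" "\<And>j. j > 0 \<Longrightarrow> coeff n j = 0 \<or> degree (coeff n j) < d"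
    using normal_form by blast
  have "pr n = 0" using \<open>pr q = 0\<close> ns(1) by (simp add: rm_simps[OF ring_map_pr] pr_rel)
  then have "n = 0" using normal_nz ns(2) by blast
  then show "rel dvd q" using ns by simp
qed (auto simp: dvd_def rm_mult[OF ring_map_pr] pr_rel)

lemma KA_top:
  assumes "f \<in> KA" "f \<noteq> 0"
  obtains i j g where "g \<noteq> 0" "whom (wdeg g) g" "dg.lt (f - mon i j g) (val (mon i j g))"
    "j > 0 \<Longrightarrow> i < d" "j = 0 \<Longrightarrow> f \<in> range emb"
proof -
  obtain q where q: "f = pr q" using assms by (auto simp: KA_def)
  obtain n s where ns: "q = n + rel * s" "\<And>j. j > 0 \<Longrightarrow> coeff n j = 0 \<or> degree (coeff n j) < d"
    using normal_form by blast
  have fn: "f = pr n" using q ns(1) by (simp add: rm_simps[OF ring_map_pr] pr_rel)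
  then have "n \<noteq> 0" using assms by (auto simp: rm_0[OF ring_map_pr])
  then obtain i g where ig: "g \<noteq> 0" "whom (wdeg g) g"
    "dg.lt (pr n - mon i (degree n) g) (val (mon i (degree n) g))" "degree n > 0 \<Longrightarrow> i < d"
    using normal_top[OF \<open>n \<noteq> 0\<close> ns(2)] by metis
  have "f \<in> range emb" if "degree n = 0"
    using that fn pr_const by (metis degree_eq_zeroE rangeI)
  then show ?thesis using that ig fn by metis
qed

lemma ev4_rel: "(x, y, z, t) \<in> koras_russell d k l \<Longrightarrow> ev4 rel (x, y, z, t) = 0"
  by (simp add: rel_def ev4_pCons ev4_0 eval_simps eval_rr koras_russell_def algebra_simps)

text \<open>This allows elements of \<open>KA\<close> to be compared by their values at the points
  of X; the points with x nonzero already determine them.\<close>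

lemma pr_eq_0_iff_ev4: "pr q = 0 \<longleftrightarrow> (\<forall>P\<in>koras_russell d k l. ev4 q P = 0)"
proof
  assume "pr q = 0"
  then show "\<forall>P\<in>koras_russell d k l. ev4 q P = 0"
    using ev4_rel by (auto simp: pr_eq_0_iff dvd_def rm_mult[OF ring_map_ev4])
next
  assume z: "\<forall>P\<in>koras_russell d k l. ev4 q P = 0"
  obtain p where p: "pr q * emb vx ^ (d * degree q) = emb p"
    "\<And>x y z t. (x, y, z, t) \<in> koras_russell d k l \<Longrightarrow> ev4 q (x, y, z, t) * x ^ (d * degree q) = eval_xzt p (x, z, t)"
    using clear_denominator[of q "degree q"] by blast
  have "eval_xzt p (x, z, t) = 0" if "x \<noteq> 0" for x z t
  proof -
    have "(x, - (z ^ k + t ^ l + x) / x ^ d, z, t) \<in> koras_russell d k l"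
      using that by (simp add: koras_russell_def)
    then show ?thesis using p(2) z by fastforce
  qed
  then have "p = 0" by (rule eval_eq_0)
  then show "pr q = 0" using p(1) by simp
qed

end

section \<open>Kernels of locally nilpotent derivations of the coordinate ring\<close>

text \<open>The last assumption expresses that \<open>D\<close> is nonzero on \<open>KA\<close>: as
  y is a quotient of polynomials in x, z, t, a derivation killing these three kills y too.\<close>

locale koras_lnd = koras +
  fixes D :: "Cxzt fract \<Rightarrow> Cxzt fract"
  assumes DK_in: "\<And>f. f \<in> KA \<Longrightarrow> D f \<in> KA"
    and DK_add: "\<And>f g. f \<in> KA \<Longrightarrow> g \<in> KA \<Longrightarrow> D (f + g) = D f + D g"
    and DK_mult: "\<And>f g. f \<in> KA \<Longrightarrow> g \<in> KA \<Longrightarrow> D (f * g) = f * D g + g * D f"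
    and DK_nil: "\<And>f. f \<in> KA \<Longrightarrow> \<exists>n. (D ^^ n) f = 0"
    and DK_const: "\<And>c. D (emb (kc c)) = 0"
    and DK_nz: "D (emb vx) \<noteq> 0 \<or> D (emb vz) \<noteq> 0 \<or> D (emb vt) \<noteq> 0"

context koras
begin

lemma vp_pderiv:
  assumes "pderiv p \<noteq> 0"
  shows "vp (pderiv p) \<le> vp (p :: 'a::{idom,ring_char_0} poly poly poly) - (-1, 0)"
proof (cases "ord p")
  case 0
  then show ?thesis by (simp add: vp_def)
next
  case (Suc i)
  have p: "p \<noteq> 0" using assms by auto
  have "vp (pderiv p) \<le> (- int i, int (wdeg (low p)))"
  proof (rule vp_leI[OF assms])
    show "coeff (pderiv p) j = 0" if "j < i" for j
      using that ord_low(2)[OF p, of "Suc j"] Suc by (simp add: coeff_pderiv)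
    have "coeff (pderiv p) i = of_nat (Suc i) * low p"
      by (simp add: coeff_pderiv low_def Suc)
    also have "\<dots> = [:[:of_nat (Suc i):]:] * low p" by (simp add: of_nat_poly)
    finally have "coeff (pderiv p) i = [:[:of_nat (Suc i):]:] * low p" .
    then show "wdeg (coeff (pderiv p) i) \<le> wdeg (low p)"
      using wdeg_mult[of "[:[:of_nat (Suc i):]:]" "low p"] wdeg_gens(4)[of "of_nat (Suc i) :: 'a"] ord_low(1)[OF p]
      by (simp del: of_nat_Suc mult_pCons_left add: of_nat_neq_0)
  qed
  then show ?thesis using Suc by (simp add: vp_def)
qed

lemma vp_map_poly:
  assumes "f 0 = 0" "map_poly f p \<noteq> 0" "f (low p) \<noteq> 0 \<Longrightarrow> wdeg (f (low p)) + w \<le> wdeg (low p)"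
  shows "vp (map_poly f p) \<le> vp p - (0, int w)"
proof -
  have p: "p \<noteq> 0" using assms by auto
  have z: "coeff (map_poly f p) j = 0" if "j < ord p" for j
    using that ord_low(2)[OF p] assms(1) by (simp add: coeff_map_poly)
  have c: "coeff (map_poly f p) (ord p) = f (low p)" by (simp add: coeff_map_poly assms(1) low_def)
  have ge: "ord p \<le> ord (map_poly f p)" using z by (intro ord_ge assms) auto
  show ?thesis
  proof (cases "ord (map_poly f p) = ord p")
    case True
    then have "low (map_poly f p) = f (low p)" "f (low p) \<noteq> 0"
      using c ord_low(1)[OF assms(2)] by (auto simp: low_def)
    then show ?thesis using assms(3) True by (auto simp: vp_def)
  next
    case False
    then show ?thesis using ge by (simp add: vp_def)
  qed
qed

lemma wdeg_pderiv:
  fixes g :: "'a::{idom,ring_char_0} poly poly"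
  shows "pderiv g \<noteq> 0 \<Longrightarrow> wdeg (pderiv g) + l \<le> wdeg g"
    and "map_poly pderiv g \<noteq> 0 \<Longrightarrow> wdeg (map_poly pderiv g) + k \<le> wdeg g"
proof -
  assume nz: "pderiv g \<noteq> 0"
  have *: "l * a + k * b + l \<le> wdeg g" if "coeff (coeff (pderiv g) a) b \<noteq> 0" for a b
    using that wdeg_ge[of g "Suc a" b] by (auto simp: coeff_pderiv of_nat_poly simp del: of_nat_Suc)
  obtain a b where "coeff (coeff (pderiv g) a) b \<noteq> 0" using nz by (metis poly_eqI coeff_0)
  then have "l \<le> wdeg g" using *[of a b] by simp
  moreover have "wdeg (pderiv g) \<le> wdeg g - l" by (rule wdeg_le) (use * in fastforce)
  ultimately show "wdeg (pderiv g) + l \<le> wdeg g" by simp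
next
  assume nz: "map_poly pderiv g \<noteq> 0"
  have *: "l * a + k * b + k \<le> wdeg g" if "coeff (coeff (map_poly pderiv g) a) b \<noteq> 0" for a b
    using that wdeg_ge[of g a "Suc b"] by (auto simp: coeff_pderiv coeff_map_poly simp del: of_nat_Suc)
  obtain a b where "coeff (coeff (map_poly pderiv g) a) b \<noteq> 0" using nz by (metis poly_eqI coeff_0)
  then have "k \<le> wdeg g" using *[of a b] by simp
  moreover have "wdeg (map_poly pderiv g) \<le> wdeg g - k" by (rule wdeg_le) (use * in fastforce)
  ultimately show "wdeg (map_poly pderiv g) + k \<le> wdeg g" by simp
qed

lemma vp_dz: "dz p \<noteq> 0 \<Longrightarrow> vp (dz p) \<le> vp (p :: 'a::{idom,ring_char_0} poly poly poly) - (0, int l)"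
  and vp_dt: "dt p \<noteq> 0 \<Longrightarrow> vp (dt p) \<le> vp p - (0, int k)"
  unfolding dz_def dt_def by (rule vp_map_poly; simp add: wdeg_pderiv)+

lemma kc_eq_0_iff [simp]: "kc c = 0 \<longleftrightarrow> c = 0"
  by (simp add: kc_def)

lemma val_gens: "val (emb vx) = (-1, 0)" "val (emb vz) = (0, int l)" "val (emb vt) = (0, int k)"
  "c \<noteq> 0 \<Longrightarrow> val (emb (kc c)) = 0"
  by (simp_all add: val_emb vp_gens zero_prod_def)

end

context koras_lnd
begin

lemma D_emb: "D (emb p) = emb (pderiv p) * D (emb vx) + emb (dz p) * D (emb vz) + emb (dt p) * D (emb vt)"
  by (induction p rule: poly3_induct)
     (simp_all add: DK_const DK_add DK_mult emb_KA dv_simps[OF derivation_dz] dv_simps[OF derivation_dt]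
        dv_simps[OF derivation_dx] algebra_simps)

text \<open>The degree of \<open>D\<close> for \<open>val\<close>. It is enough to look at x, z and
  t, since y is a fraction in them. The maximum is attained at one of these generators, so the
  induced graded derivation does not vanish there.\<close>

definition e :: "int \<times> int"
  where "e = Max ((\<lambda>g. val (D g) - val g) ` {g \<in> {emb vx, emb vz, emb vt}. D g \<noteq> 0})"

lemma e_gens:
  shows "g \<in> {emb vx, emb vz, emb vt} \<Longrightarrow> dg.le (D g) (val g + e)"
    and "\<exists>g\<in>{emb vx, emb vz, emb vt}. D g \<noteq> 0 \<and> val (D g) = val g + e"
proof -
  let ?G = "{g \<in> {emb vx, emb vz, emb vt}. D g \<noteq> 0}"
  have fin: "finite ?G" by simp
  have ne: "?G \<noteq> {}" using DK_nz by auto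
  show "g \<in> {emb vx, emb vz, emb vt} \<Longrightarrow> dg.le (D g) (val g + e)"
  proof (cases "D g = 0")
    case False
    assume "g \<in> {emb vx, emb vz, emb vt}"
    then have "val (D g) - val g \<le> e"
      unfolding e_def using fin False by (intro Max_ge) auto
    then show ?thesis by (simp add: dg.le_def algebra_simps)
  qed simp
  have "e \<in> (\<lambda>g. val (D g) - val g) ` ?G"
    unfolding e_def by (rule Max_in) (use fin ne in auto)
  then show "\<exists>g\<in>{emb vx, emb vz, emb vt}. D g \<noteq> 0 \<and> val (D g) = val g + e"
    by (auto simp: algebra_simps)
qed

lemma le_emb: "(p \<noteq> 0 \<Longrightarrow> vp p \<le> w) \<Longrightarrow> dg.le (emb p) w"
  by (cases "p = 0") (auto simp: dg.le_def val_emb)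

lemma D_emb_le: assumes "p \<noteq> 0" shows "dg.le (D (emb p)) (vp p + e)"
proof -
  have 1: "dg.le (emb (pderiv p) * D (emb vx)) (vp p - (-1, 0) + (val (emb vx) + e))"
    by (intro dg.le_mult le_emb vp_pderiv e_gens emb_KA DK_in) auto
  have 2: "dg.le (emb (dz p) * D (emb vz)) (vp p - (0, int l) + (val (emb vz) + e))"
    by (intro dg.le_mult le_emb vp_dz e_gens emb_KA DK_in) auto
  have 3: "dg.le (emb (dt p) * D (emb vt)) (vp p - (0, int k) + (val (emb vt) + e))"
    by (intro dg.le_mult le_emb vp_dt e_gens emb_KA DK_in) auto
  have eq: "w - a + (a + e) = w + e" for w a :: "int \<times> int" by simp
  show ?thesis
    by (subst D_emb, intro dg.le_add dg.ring_in emb_KA DK_in) (use 1 2 3 in \<open>simp_all add: val_gens eq\<close>)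
qed

text \<open>If x^m f = p, the product rule expresses x^m D f by D p and f D(x^m), and both have
  degree at most that of p plus \<open>e\<close>.\<close>

lemma D_bound: assumes f: "f \<in> KA" "f \<noteq> 0" "D f \<noteq> 0" shows "val (D f) \<le> val f + e"
proof -
  obtain p m where p: "p \<noteq> 0" "f * emb vx ^ m = emb p" using KA_clear f by blast
  have xm: "emb vx ^ m = emb (vx ^ m)" by (simp add: rm_power[OF ring_map_emb])
  have "D (emb p) = f * D (emb (vx ^ m)) + emb (vx ^ m) * D f"
    using p(2) DK_mult[OF f(1) emb_KA[of "vx ^ m"]] by (simp add: xm)
  then have eq: "emb (vx ^ m) * D f = D (emb p) + - (f * D (emb (vx ^ m)))" by simp
  have vpp: "vp p = val f + vp (vx ^ m :: Cxzt)" using val_eq[OF p] by (simp add: vp_vx_power prod_eq_iff)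
  have "dg.le (f * D (emb (vx ^ m))) (val f + (vp (vx ^ m :: Cxzt) + e))"
  proof (rule dg.le_mult[OF f(1) DK_in[OF emb_KA] dg.le_refl])
    show "dg.le (D (emb (vx ^ m))) (vp (vx ^ m :: Cxzt) + e)" by (rule D_emb_le) simp
  qed
  then have "dg.le (- (f * D (emb (vx ^ m)))) (vp p + e)"
    using dg.v_minus[of "f * D (emb (vx ^ m))"] f DK_in[OF emb_KA]
    by (cases "D (emb (vx ^ m)) = 0") (auto simp: dg.le_def vpp dg.ring_in algebra_simps)
  moreover have "dg.le (D (emb p)) (vp p + e)" by (rule D_emb_le[OF p(1)])
  ultimately have "dg.le (D (emb p) + - (f * D (emb (vx ^ m)))) (vp p + e)"
    using dg.le_add[OF DK_in[OF emb_KA] dg.minus_in[OF dg.mult_in[OF f(1) DK_in[OF emb_KA]]]] by blast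
  then have "dg.le (emb (vx ^ m) * D f) (vp p + e)" by (simp only: eq)
  then have "val (emb (vx ^ m) * D f) \<le> vp p + e" using f by (auto simp: dg.le_def)
  then have "vp (vx ^ m :: Cxzt) + val (D f) \<le> vp p + e"
    using dg.v_mult[OF emb_KA DK_in[OF f(1)], of "vx ^ m"] f by (simp add: val_emb)
  then show ?thesis unfolding vpp by (simp add: algebra_simps)
qed

sublocale L: lnd_degree KA val D e
  by standard (auto intro: DK_in DK_add DK_mult DK_nil D_bound)

lemma nu_const: "c \<noteq> 0 \<Longrightarrow> L.nu (emb (kc c)) = 0"
  by (subst L.nu_0_iff) (auto simp: emb_KA DK_const)

lemma nu_gens_nz: "L.nu (emb vx) \<noteq> 0 \<or> L.nu (emb vz) \<noteq> 0 \<or> L.nu (emb vt) \<noteq> 0"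
proof -
  obtain g where g: "g \<in> {emb vx, emb vz, emb vt}" "D g \<noteq> 0" "val (D g) = val g + e"
    using e_gens(2) by blast
  have "g \<in> KA" "g \<noteq> 0" using g(1) emb_KA by auto
  then have "L.nu g \<noteq> 0" using L.nu_0_iff[of g] g by (auto simp: dg.lt_def)
  then show ?thesis using g(1) by auto
qed

lemma nu_mon: "g \<noteq> 0 \<Longrightarrow> L.nu (mon i j g) = i * L.nu (emb vx) + j * L.nu Y + L.nu (emb [:g:])"
  unfolding mon_def using Y_nz
  by (simp add: L.nu_mult L.nu_power dg.ring_in emb_KA Y_KA)

lemma nu_Dn:
  assumes f: "f \<in> KA" "f \<noteq> 0" "n \<le> L.nu f"
  shows "(D ^^ n) f \<noteq> 0 \<and> L.nu ((D ^^ n) f) = L.nu f - n \<and> val ((D ^^ n) f) = val f + L.sm n"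
  using f(3)
proof (induction n)
  case (Suc n)
  then have IH: "(D ^^ n) f \<noteq> 0" "L.nu ((D ^^ n) f) = L.nu f - n" "val ((D ^^ n) f) = val f + L.sm n"
    by auto
  have mem: "(D ^^ n) f \<in> KA" by (rule L.Dn_in[OF f(1)])
  have "L.nu ((D ^^ n) f) = Suc (L.nu f - Suc n)" using IH Suc.prems by simp
  from L.nu_D[OF mem IH(1) this] show ?case using IH by (simp add: algebra_simps)
qed (use f in simp)

lemma sm_snd: "snd (L.sm n) = int n * snd e"
  by (induction n) (auto simp: algebra_simps)

section \<open>Refuting a kernel element outside C[x,z,t]\<close>

context
  fixes f0
  assumes f0: "f0 \<in> KA" "D f0 = 0" "f0 \<notin> range emb"
begin

text \<open>The leading monomial x^i y^j g of \<open>f0\<close> has j > 0 because \<open>f0\<close>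
  is not in C[x,z,t]. Its order is 0 and is a sum of nonnegative contributions, one of them j times
  the order of y.\<close>

lemma nu_Y: "L.nu Y = 0"
proof -
  have nz: "f0 \<noteq> 0" using f0(3) by (metis rangeI to_fract_0)
  have "L.nu f0 = 0" using L.nu_0_iff[OF f0(1) nz] f0(2) by simp
  moreover obtain i j g where "g \<noteq> 0" "dg.lt (f0 - mon i j g) (val (mon i j g))" "j = 0 \<Longrightarrow> f0 \<in> range emb"
    using KA_top[OF f0(1) nz] by metis
  moreover from this have "L.nu (mon i j g) = L.nu f0"
    using L.nu_cong[OF mon_KA mon_nz f0(1)] by metis
  ultimately show ?thesis using f0(3) by (auto simp: nu_mon)
qed

abbreviation "XX \<equiv> emb vx"
abbreviation "ZZ \<equiv> emb vz"
abbreviation "TT \<equiv> emb vt"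

lemma relation: "Y * XX ^ d + (ZZ ^ k + TT ^ l + XX) = 0"
  using Y_eq by (simp add: rr_def rm_power[OF ring_map_emb] algebra_simps)

lemma val_powers: "val (Y * XX ^ d) = (0, int (k * l))" "val (1 * ZZ ^ k) = (0, int (k * l))"
  "c \<noteq> 0 \<Longrightarrow> val (emb (kc c) * TT ^ l) = (0, int (k * l))" "val (1 * TT ^ l) = (0, int (k * l))"
  using dg.v_mult[of Y "XX ^ d"] dg.v_mult[of "emb (kc c)" "TT ^ l"] Y_nz
  by (simp_all add: dg.ring_in emb_KA Y_KA val_power val_gens val_Y)

text \<open>If z had order 0, the relation x^d y + t^l = -z^k - x, in which the lone x is of smaller
  degree, would be of Mason's type. Then x and t would have order 0 too, and no generator would
  attain \<open>e\<close>.\<close>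

lemma nu_Z: "L.nu ZZ \<noteq> 0"
proof
  assume z: "L.nu ZZ = 0"
  define h where "h = - (ZZ ^ k) - XX"
  have "Y * XX ^ d + 1 * TT ^ l - h = Y * XX ^ d + (ZZ ^ k + TT ^ l + XX)" by (simp add: h_def)
  then have h: "h = Y * XX ^ d + 1 * TT ^ l" using relation by simp
  have zk: "- (ZZ ^ k) \<in> KA" "- (ZZ ^ k) \<noteq> 0" "val (- (ZZ ^ k)) = (0, int (k * l))" "L.nu (- (ZZ ^ k)) = 0"
    using dg.v_minus[of "ZZ ^ k"] val_powers(2) z
    by (simp_all add: dg.ring_in emb_KA L.nu_minus L.nu_power)
  have "h \<in> KA" unfolding h_def by (intro dg.ring_in emb_KA)
  moreover have "dg.lt (h - - (ZZ ^ k)) (val (- (ZZ ^ k)))"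
    using dg.v_minus[of XX] by (simp add: h_def dg.lt_def zk val_gens emb_KA)
  ultimately have hh: "h \<in> KA" "h \<noteq> 0" "val h = (0, int (k * l))" "L.nu h = 0"
    using L.nu_cong[OF zk(1,2), of h] zk by auto
  have "L.nu XX = 0 \<and> L.nu TT = 0"
    by (rule L.mason[of Y 1 XX TT h d l])
       (use hh h d2 k2 kl Y_nz val_powers nu_Y L.nu_1 in \<open>auto simp: dg.ring_in emb_KA Y_KA\<close>)
  with z nu_gens_nz show False by auto
qed

lemma nu_T: "L.nu TT \<noteq> 0"
proof
  assume z: "L.nu TT = 0"
  define h where "h = - (TT ^ l) - XX"
  have "Y * XX ^ d + 1 * ZZ ^ k - h = Y * XX ^ d + (ZZ ^ k + TT ^ l + XX)" by (simp add: h_def)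
  then have h: "h = Y * XX ^ d + 1 * ZZ ^ k" using relation by simp
  have zk: "- (TT ^ l) \<in> KA" "- (TT ^ l) \<noteq> 0" "val (- (TT ^ l)) = (0, int (k * l))" "L.nu (- (TT ^ l)) = 0"
    using dg.v_minus[of "TT ^ l"] val_powers(4) z
    by (simp_all add: dg.ring_in emb_KA L.nu_minus L.nu_power)
  have "h \<in> KA" unfolding h_def by (intro dg.ring_in emb_KA)
  moreover have "dg.lt (h - - (TT ^ l)) (val (- (TT ^ l)))"
    using dg.v_minus[of XX] by (simp add: h_def dg.lt_def zk val_gens emb_KA)
  ultimately have hh: "h \<in> KA" "h \<noteq> 0" "val h = (0, int (k * l))" "L.nu h = 0"
    using L.nu_cong[OF zk(1,2), of h] zk by auto
  have "L.nu XX = 0 \<and> L.nu ZZ = 0"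
    by (rule L.mason[of Y 1 XX ZZ h d k])
       (use hh h d2 k2 kl Y_nz val_powers nu_Y L.nu_1 in \<open>auto simp: dg.ring_in emb_KA Y_KA\<close>)
  with z nu_gens_nz show False by auto
qed

lemma emb_cusp: "emb [:pz ^ k + smult [:c:] (pt ^ l):] = 1 * ZZ ^ k + emb (kc c) * TT ^ l"
proof -
  have "[:pz ^ k + smult [:c:] (pt ^ l):] = vz ^ k + kc c * vt ^ l"
    by (simp add: vz_eq vt_eq kc_def flip: rm_power[OF ring_map_const])
  then show ?thesis by (simp add: rm_power[OF ring_map_emb])
qed

text \<open>A binomial of order 0 would satisfy Mason's hypotheses with z^k and c t^l as summands
  and force the order of z to vanish.\<close>

lemma nu_cusp: assumes "c \<noteq> 0" shows "L.nu (emb [:pz ^ k + smult [:c:] (pt ^ l):]) \<noteq> 0"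
proof
  let ?h = "emb [:pz ^ k + smult [:c:] (pt ^ l):]"
  assume z: "L.nu ?h = 0"
  have v: "val ?h = (0, int (k * l))"
    using cusp_nz[of c] wdeg_whom[OF whom_cusp cusp_nz, of c] by (simp add: val_emb vp_const)
  have "L.nu ZZ = 0 \<and> L.nu TT = 0"
    by (rule L.mason[of 1 "emb (kc c)" ZZ TT ?h k l])
       (use z v emb_cusp[of c] assms d2 k2 kl val_powers L.nu_1 nu_const cusp_nz[of c]
        in \<open>auto simp: dg.ring_in emb_KA\<close>)
  then show False using nu_Z by blast
qed

text \<open>Up to the smaller term x, the product -x^d y is the binomial z^k + t^l, whose order is
  positive.\<close>

lemma nu_X: "L.nu XX \<noteq> 0"
proof
  assume z: "L.nu XX = 0"
  have er: "emb rr = - (Y * XX ^ d)" using Y_eq by (simp add: mult.commute)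
  have nr: "L.nu (emb rr) = 0"
    unfolding er using z nu_Y Y_nz by (simp add: L.nu_minus L.nu_mult L.nu_power dg.ring_in emb_KA Y_KA)
  have "dg.lt (emb [:r0:] - emb rr) (val (emb rr))"
  proof -
    have "emb [:r0:] - emb rr = - emb vx" by (simp add: rr_eq vx_def flip: to_fract_diff to_fract_uminus)
    then show ?thesis using dg.v_minus[of XX] by (simp add: dg.lt_def val_gens emb_KA val_emb rr_nz vp_rr)
  qed
  then have "L.nu (emb [:r0:]) = L.nu (emb rr)"
    by (rule L.nu_cong(3)[rotated 3]) (simp_all add: emb_KA rr_nz)
  then show False using nr nu_cusp[of 1] by (simp add: r0_cusp)
qed

text \<open>In positive weighted degree there is a factor z, t or z^k + c t^l, and each of these has
  positive order.\<close>

lemma nu_whom_0: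
  assumes "whom n g" "g \<noteq> 0" "L.nu (emb [:g:]) = 0"
  shows "n = 0"
proof (rule ccontr)
  assume "n \<noteq> 0"
  then have n: "n > 0" by simp
  have m: "L.nu (emb [:a * b:]) = L.nu (emb [:a:]) + L.nu (emb [:b:])" if "a * b \<noteq> 0" for a b
    using that L.nu_mult[of "emb [:a:]" "emb [:b:]"] by (simp add: emb_KA mult.commute flip: to_fract_mult)
  from assms(1) n assms(2) show False
  proof (cases rule: whom_has_factor)
    case (z g')
    then show False using m[of pz g'] assms nu_Z by (simp add: vz_eq)
  next
    case (t g')
    then show False using m[of pt g'] assms nu_T by (simp add: vt_eq)
  next
    case (cusp g' c)
    then show False using m[of "pz ^ k + smult [:c:] (pt ^ l)" g'] assms nu_cusp[of c] by simp
  qed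
qed

lemma nu_0_val: assumes "f \<in> KA" "f \<noteq> 0" "L.nu f = 0" shows "\<exists>j. val f = (int (d * j), int (k * l * j))"
proof -
  obtain i j g where g: "g \<noteq> 0" "whom (wdeg g) g" "dg.lt (f - mon i j g) (val (mon i j g))"
    using KA_top[OF assms(1,2)] by metis
  have eq: "L.nu f = L.nu (mon i j g)" "val f = val (mon i j g)"
    using L.nu_cong[OF mon_KA mon_nz[OF g(1)] assms(1) g(3)] by auto
  then have "i = 0" "L.nu (emb [:g:]) = 0" using assms(3) nu_X by (auto simp: nu_mon[OF g(1)])
  then show ?thesis using eq(2) nu_whom_0[OF g(2,1)] by (auto simp: val_mon[OF g(1)])
qed

text \<open>The derivative of order \<open>nu f\<close> still has full degree but order 0, so its
  leading form is a constant times a power of y, whose second degree component is a multiple of k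
  l.\<close>

lemma last_derivative: assumes "f \<in> KA" "f \<noteq> 0"
  shows "\<exists>j. snd (val f) + int (L.nu f) * snd e = int (k * l) * j"
proof -
  have "(D ^^ L.nu f) f \<noteq> 0 \<and> L.nu ((D ^^ L.nu f) f) = 0 \<and> val ((D ^^ L.nu f) f) = val f + L.sm (L.nu f)"
    using nu_Dn[OF assms, of "L.nu f"] by simp
  then obtain j where "val f + L.sm (L.nu f) = (int (d * j), int (k * l * j))"
    using nu_0_val[OF L.Dn_in[OF assms(1)]] by metis
  then have "snd (val f + L.sm (L.nu f)) = int (k * l) * int j" by simp
  then show ?thesis unfolding snd_add sm_snd by blast
qed

text \<open>Some iterated derivative of t has order 1. Apart from powers of y and constants its
  leading monomial is a single x, z, t or binomial z^k + c t^l, so \<open>snd e\<close> is congruent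
  to 0, -l, -k or 0 modulo k l. By \<open>last_derivative\<close> for t and z, divisibility of
  \<open>snd e\<close> by l would make l divide k, and divisibility by k would make k divide
  l.\<close>

lemma kernel_contradiction: False
proof -
  obtain m where m: "L.nu TT = Suc m" using nu_T by (cases "L.nu TT") auto
  define u where "u = (D ^^ m) TT"
  have T: "TT \<in> KA" "TT \<noteq> 0" by (auto simp: emb_KA)
  have u: "u \<in> KA" "u \<noteq> 0" "L.nu u = 1"
    using nu_Dn[OF T, of m] m L.Dn_in[OF T(1)] by (auto simp: u_def)
  obtain i j g where g: "g \<noteq> 0" "whom (wdeg g) g" "dg.lt (u - mon i j g) (val (mon i j g))"
    using KA_top[OF u(1,2)] by metis
  have eq: "L.nu u = L.nu (mon i j g)" "val u = val (mon i j g)"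
    using L.nu_cong[OF mon_KA mon_nz[OF g(1)] u(1) g(3)] by auto
  have one: "i * L.nu XX + L.nu (emb [:g:]) = 1" using eq u by (simp add: nu_mon[OF g(1)] nu_Y)
  obtain j' where j': "snd (val u) + int (L.nu u) * snd e = int (k * l) * j'"
    using last_derivative[OF u(1,2)] by blast
  obtain jT where jT: "int k + int (L.nu TT) * snd e = int (k * l) * jT"
    using last_derivative[OF T] by (auto simp: val_gens)
  obtain jZ where jZ: "int l + int (L.nu ZZ) * snd e = int (k * l) * jZ"
    using last_derivative[of ZZ] by (auto simp: val_gens emb_KA)
  have e: "snd e = int (k * l) * (j' - int j) - int (wdeg g)"
    using j' u eq by (simp add: val_mon[OF g(1)] algebra_simps)
  have kl_k: "\<not> int l dvd int k" using kl pos by (auto dest: zdvd_imp_le)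
  have k_l: "\<not> int k dvd int l"
    using cop k2 coprime_absorb_left[of k l] by auto
  have notl: False if "int l dvd snd e"
  proof -
    have "int k = int (k * l) * jT - int (L.nu TT) * snd e" using jT by simp
    moreover have "int l dvd int (k * l) * jT - int (L.nu TT) * snd e" using that by simp
    ultimately show False using kl_k by simp
  qed
  have notk: False if "int k dvd snd e"
  proof -
    have "int l = int (k * l) * jZ - int (L.nu ZZ) * snd e" using jZ by simp
    moreover have "int k dvd int (k * l) * jZ - int (L.nu ZZ) * snd e" using that by simp
    ultimately show False using k_l by simp
  qed
  have m: "L.nu (emb [:a * b:]) = L.nu (emb [:a:]) + L.nu (emb [:b:])" if "a * b \<noteq> 0" for a b
    using that L.nu_mult[of "emb [:a:]" "emb [:b:]"] by (simp add: emb_KA mult.commute flip: to_fract_mult)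
  show False
  proof (cases "i = 0")
    case False
    then have "i * L.nu XX \<noteq> 0" using nu_X by simp
    then have "L.nu (emb [:g:]) = 0" using one by linarith
    then have "wdeg g = 0" using nu_whom_0[OF g(2,1)] by simp
    then show False using e notl by simp
  next
    case True
    then have ng: "L.nu (emb [:g:]) = 1" using one by simp
    have "wdeg g > 0"
    proof (rule ccontr)
      assume "\<not> wdeg g > 0"
      then have "whom 0 g" using g(2) by simp
      from whom_0[OF this] have "g = [:[:coeff (coeff g 0) 0:]:]" .
      then have "emb [:g:] = emb (kc (coeff (coeff g 0) 0))" by (simp add: kc_def)
      moreover have "coeff (coeff g 0) 0 \<noteq> 0"
        using g(1) \<open>g = [:[:coeff (coeff g 0) 0:]:]\<close> by (metis pCons_0_0)
      ultimately show False using ng nu_const by simp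
    qed
    from g(2) this g(1) show False
    proof (cases rule: whom_has_factor)
      case (z g')
      have g': "g' \<noteq> 0" using z g by auto
      have "L.nu (emb [:g':]) = 0" using m[of pz g'] z g' ng nu_Z by (simp add: vz_eq zt_nz)
      moreover have "whom (wdeg g - l) g'" "l \<le> wdeg g"
        using whom_factor[OF _ whom_pz, of "wdeg g" g'] g(2) z g' by (auto simp: zt_nz)
      ultimately have "wdeg g = l" using nu_whom_0 g' by fastforce
      then show False using e notl by simp
    next
      case (t g')
      have g': "g' \<noteq> 0" using t g by auto
      have "L.nu (emb [:g':]) = 0" using m[of pt g'] t g' ng nu_T by (simp add: vt_eq zt_nz)
      moreover have "whom (wdeg g - k) g'" "k \<le> wdeg g"
        using whom_factor[OF _ whom_pt, of "wdeg g" g'] g(2) t g' by (auto simp: zt_nz)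
      ultimately have "wdeg g = k" using nu_whom_0 g' by fastforce
      then show False using e notk by simp
    next
      case (cusp g' c)
      have g': "g' \<noteq> 0" using cusp g by auto
      have "L.nu (emb [:g':]) = 0"
        using m[of "pz ^ k + smult [:c:] (pt ^ l)" g'] cusp g' ng nu_cusp[of c] cusp_nz[of c] by simp
      moreover have "whom (wdeg g - k * l) g'" "k * l \<le> wdeg g"
        using whom_factor[OF _ whom_cusp cusp_nz, of "wdeg g" c g'] g(2) cusp g' by auto
      ultimately have "wdeg g = k * l" using nu_whom_0 g' by fastforce
      then show False using e notl by simp
    qed
  qed
qed

end

theorem kernel_subset: "f \<in> KA \<Longrightarrow> D f = 0 \<Longrightarrow> f \<in> range emb"
  using kernel_contradiction by blast

end

section \<open>Automorphisms preserve the subring of functions of \<open>x\<close>, \<open>z\<close>, \<open>t\<close>\<close>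

lemma coords_A4: "(coords :: (A4 \<Rightarrow> complex) set) =
    {\<lambda>P. fst P, \<lambda>P. fst (snd P), \<lambda>P. fst (snd (snd P)), \<lambda>P. snd (snd (snd P))}"
  by (auto simp: coords_prod_def coords_complex_def comp_def image_iff)

lemma polynomial_map_A4: "polynomial_map (G :: 'a::coordinate_space \<Rightarrow> A4) \<longleftrightarrow>
    polynomial_fun (\<lambda>P. fst (G P)) \<and> polynomial_fun (\<lambda>P. fst (snd (G P))) \<and>
    polynomial_fun (\<lambda>P. fst (snd (snd (G P)))) \<and> polynomial_fun (\<lambda>P. snd (snd (snd (G P))))"
  by (simp add: polynomial_map_def coords_A4 comp_def)

lemma derivation_nilpotent_mult:
  assumes D: "derivation D"
  shows "(D ^^ m) a = 0 \<Longrightarrow> (D ^^ n) b = 0 \<Longrightarrow> (D ^^ (m + n)) (a * b) = 0"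
proof -
  have add: "(D ^^ n) (a + b) = (D ^^ n) a + (D ^^ n) b" for n a b
    by (induction n) (auto simp: dv_add[OF D])
  have zero: "(D ^^ n) 0 = 0" for n by (induction n) (auto simp: dv_0[OF D])
  have "m + n = s \<Longrightarrow> (D ^^ m) a = 0 \<Longrightarrow> (D ^^ n) b = 0 \<Longrightarrow> (D ^^ s) (a * b) = 0" for s
  proof (induction s arbitrary: m n a b)
    case (Suc s)
    have "(D ^^ s) (a * D b) = 0"
    proof (cases n)
      case 0
      then show ?thesis using Suc.prems by (simp add: dv_0[OF D] zero)
    next
      case (Suc n')
      then show ?thesis using Suc.prems by (intro Suc.IH[of m n']) (auto simp: funpow_swap1)
    qed
    moreover have "(D ^^ s) (b * D a) = 0"
    proof (cases m)
      case 0
      then show ?thesis using Suc.prems by (simp add: dv_0[OF D] zero)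
    next
      case (Suc m')
      then show ?thesis using Suc.prems by (intro Suc.IH[of n m']) (auto simp: funpow_swap1)
    qed
    ultimately show ?case by (simp add: funpow_swap1 dv_mult[OF D] add)
  qed simp
  then show "(D ^^ m) a = 0 \<Longrightarrow> (D ^^ n) b = 0 \<Longrightarrow> (D ^^ (m + n)) (a * b) = 0" by blast
qed

lemma derivation_nilpotent_add:
  assumes D: "derivation D"
  shows "(D ^^ m) a = 0 \<Longrightarrow> (D ^^ n) b = 0 \<Longrightarrow> (D ^^ (m + n)) (a + b) = 0"
proof -
  assume a: "(D ^^ m) a = 0" and b: "(D ^^ n) b = 0"
  have add: "(D ^^ n) (a + b) = (D ^^ n) a + (D ^^ n) b" for n a b
    by (induction n) (auto simp: dv_add[OF D])
  have zero: "(D ^^ n) 0 = 0" for n by (induction n) (auto simp: dv_0[OF D])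
  have "(D ^^ (m + n)) a = 0" using a zero by (simp add: add.commute[of m] funpow_add)
  moreover have "(D ^^ (m + n)) b = 0" using b zero by (simp add: funpow_add)
  ultimately show "(D ^^ (m + n)) (a + b) = 0" by (simp add: add)
qed

lemma poly4_induct [case_names const x y z t add mult]:
  assumes "\<And>c. P [:kc c:]" "P [:vx:]" "P [:0, 1:]" "P [:vz:]" "P [:vt:]"
    "\<And>p q. P p \<Longrightarrow> P q \<Longrightarrow> P (p + q)" "\<And>p q. P p \<Longrightarrow> P q \<Longrightarrow> P (p * q)"
  shows "P (q :: Cxzt poly)"
proof (induction q rule: poly_gen_induct)
  case (const p)
  show ?case
  proof (induction p rule: poly3_induct)
    case (add p q) then show ?case using assms(6)[of "[:p:]" "[:q:]"] by simp
  next
    case (mult p q) then show ?case using assms(7)[of "[:p:]" "[:q:]"] by (simp add: mult.commute)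
  qed (use assms in auto)
qed (use assms in auto)

lemma unit_poly3:
  fixes p :: "'a::field poly poly poly"
  assumes "p * q = 1"
  obtains c where "p = kc c" "c \<noteq> 0"
proof -
  have step: "\<exists>a b. p = [:a:] \<and> a * b = 1" if "p * q = 1" for p q :: "'b::idom poly"
  proof -
    have nz: "p \<noteq> 0" "q \<noteq> 0" using that by auto
    then have "degree p + degree q = 0" using that degree_mult_eq[of p q] by simp
    then obtain a b where "p = [:a:]" "q = [:b:]" by (metis add_is_0 degree_eq_zeroE)
    then show ?thesis using that by (intro exI[of _ a] exI[of _ b]) (auto simp: one_pCons mult.commute)
  qed
  obtain a b where a: "p = [:a:]" "a * b = 1" using step[OF assms] by blast
  obtain a' b' where a': "a = [:a':]" "a' * b' = 1" using step[OF a(2)] by blast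
  obtain c b'' where c: "a' = [:c:]" "c * b'' = 1" using step[OF a'(2)] by blast
  then have "c \<noteq> 0" by auto
  then show ?thesis using that[of c] a(1) a'(1) c(1) by (simp add: kc_def)
qed

lemma vx_dvd_iff: "vx dvd p \<longleftrightarrow> coeff p 0 = (0 :: 'a::idom poly poly)"
proof
  assume "coeff p 0 = 0"
  then show "vx dvd p" by (cases p) (auto simp: vx_def dvd_def)
qed (auto simp: vx_def dvd_def)

lemma vx_prime: "vx dvd p * q \<Longrightarrow> vx dvd p \<or> vx dvd (q :: 'a::idom poly poly poly)"
  by (simp add: vx_dvd_iff coeff_mult_0)

lemma vx_dvd_power: "vx dvd p ^ n \<Longrightarrow> vx dvd (p :: 'a::idom poly poly poly)"
proof (induction n)
  case 0
  then show ?case by (auto simp: vx_dvd_iff)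
next
  case (Suc n)
  then show ?case using vx_prime by auto
qed

lemma var_eq: "var_x = vx" "var_z = vz" "var_t = vt" "const_xzt = kc"
  by (auto simp: var_x_def var_z_def var_t_def const_xzt_def vx_def vz_def vt_def kc_def fun_eq_iff)

context koras
begin

abbreviation "KR \<equiv> koras_russell d k l"

lemma polynomial_fun_ev4: assumes "polynomial_fun (f :: A4 \<Rightarrow> complex)" shows "\<exists>q. \<forall>P. f P = ev4 q P"
  using assms
proof (induction f rule: polynomial_fun.induct)
  case (const a)
  have "ev4 [:kc a:] P = a" for P by (cases P) (auto simp: ev4_const eval_gens)
  then show ?case by metis
next
  case (coord c)
  have x: "ev4 [:vx:] P = fst P" and y: "ev4 [:0, 1:] P = fst (snd P)"
    and z: "ev4 [:vz:] P = fst (snd (snd P))" and t: "ev4 [:vt:] P = snd (snd (snd P))" for P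
    by (cases P; auto simp: ev4_const ev4_Y eval_gens)+
  from coord consider "c = (\<lambda>P. fst P)" | "c = (\<lambda>P. fst (snd P))" | "c = (\<lambda>P. fst (snd (snd P)))"
    | "c = (\<lambda>P. snd (snd (snd P)))" unfolding coords_A4 by blast
  then show ?case by cases (metis x y z t)+
next
  case (add f g)
  then show ?case by (metis rm_add[OF ring_map_ev4])
next
  case (mult f g)
  then show ?case by (metis rm_mult[OF ring_map_ev4])
qed

definition sub4 :: "Cxzt poly \<Rightarrow> Cxzt poly \<Rightarrow> Cxzt poly \<Rightarrow> Cxzt poly \<Rightarrow> Cxzt poly \<Rightarrow> Cxzt poly"
  where "sub4 gx gy gz gt = ev (subst3 (\<lambda>c. [:kc c:]) gx gz gt) gy"

lemma ring_map_kc4: "ring_map (\<lambda>c. [:kc c:])"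
  by (rule ring_map_comp[OF ring_map_const ring_map_kc])

lemma ev4_sub4: "ev4 (sub4 gx gy gz gt q) P = ev4 q (ev4 gx P, ev4 gy P, ev4 gz P, ev4 gt P)"
proof -
  have s3: "ring_map (subst3 (\<lambda>c. [:kc c:]) gx gz gt)" by (rule ring_map_subst3[OF ring_map_kc4])
  have r: "ring_map (sub4 gx gy gz gt)" unfolding sub4_def by (rule ring_map_ev[OF s3])
  have c: "sub4 gx gy gz gt [:p:] = subst3 (\<lambda>c. [:kc c:]) gx gz gt p" for p
    unfolding sub4_def by (rule ev_const[OF s3])
  have y: "sub4 gx gy gz gt [:0, 1:] = gy" unfolding sub4_def by (rule ev_X[OF s3])
  have k: "ev4 [:kc c:] P = c" for c by (cases P) (simp add: ev4_const eval_gens)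
  show ?thesis
    by (induction q rule: poly4_induct)
       (simp_all add: c y k subst3_gens[OF ring_map_kc4] ev4_const ev4_Y eval_gens rm_simps[OF ring_map_ev4] rm_simps[OF r])
qed

section \<open>Functions on X and their pullback along morphisms\<close>

definition fn :: "Cxzt fract \<Rightarrow> A4 \<Rightarrow> complex"
  where "fn a P = ev4 (SOME q. pr q = a) P"

lemma fn_pr: "P \<in> KR \<Longrightarrow> fn (pr q) P = ev4 q P"
proof -
  assume P: "P \<in> KR"
  have "pr (SOME q'. pr q' = pr q) = pr q" by (rule someI[of "\<lambda>q'. pr q' = pr q"]) simp
  then have "pr ((SOME q'. pr q' = pr q) - q) = 0" by (simp add: rm_diff[OF ring_map_pr])
  then show ?thesis using P unfolding pr_eq_0_iff_ev4 fn_def by (simp add: rm_diff[OF ring_map_ev4])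
qed

lemma fn_inj: "a \<in> KA \<Longrightarrow> b \<in> KA \<Longrightarrow> (\<And>P. P \<in> KR \<Longrightarrow> fn a P = fn b P) \<Longrightarrow> a = b"
proof -
  assume ab: "a \<in> KA" "b \<in> KA" and eq: "\<And>P. P \<in> KR \<Longrightarrow> fn a P = fn b P"
  obtain p q where pq: "a = pr p" "b = pr q" using ab by (auto simp: KA_def)
  have "pr (p - q) = 0"
    unfolding pr_eq_0_iff_ev4 using eq by (auto simp: pq fn_pr rm_diff[OF ring_map_ev4])
  then show ?thesis by (simp add: pq rm_diff[OF ring_map_pr])
qed

lemma fn_add: "a \<in> KA \<Longrightarrow> b \<in> KA \<Longrightarrow> P \<in> KR \<Longrightarrow> fn (a + b) P = fn a P + fn b P"
  and fn_mult: "a \<in> KA \<Longrightarrow> b \<in> KA \<Longrightarrow> P \<in> KR \<Longrightarrow> fn (a * b) P = fn a P * fn b P"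
  by (auto simp: KA_def fn_pr rm_simps[OF ring_map_ev4]
      simp flip: rm_add[OF ring_map_pr] rm_mult[OF ring_map_pr])

lemma fn_emb: "P \<in> KR \<Longrightarrow> fn (emb p) P = eval_xzt p (pr_xzt P)"
  by (cases P) (simp add: fn_pr ev4_const flip: pr_const)

definition regular :: "(A4 \<Rightarrow> A4) \<Rightarrow> bool"
  where "regular F \<longleftrightarrow> F ` KR \<subseteq> KR \<and> polynomial_map_on KR F"

definition pull :: "(A4 \<Rightarrow> A4) \<Rightarrow> Cxzt fract \<Rightarrow> Cxzt fract"
  where "pull F a = (SOME b. b \<in> KA \<and> (\<forall>P\<in>KR. fn b P = fn a (F P)))"

lemma regular_polys:
  assumes "regular F"
  obtains gx gy gz gt where "\<And>P. P \<in> KR \<Longrightarrow> F P = (ev4 gx P, ev4 gy P, ev4 gz P, ev4 gt P)"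
proof -
  obtain G where G: "polynomial_map G" "\<And>P. P \<in> KR \<Longrightarrow> F P = G P"
    using assms by (auto simp: regular_def polynomial_map_on_def)
  obtain gx gy gz gt where "\<And>P. fst (G P) = ev4 gx P" "\<And>P. fst (snd (G P)) = ev4 gy P"
    "\<And>P. fst (snd (snd (G P))) = ev4 gz P" "\<And>P. snd (snd (snd (G P))) = ev4 gt P"
    using G(1) polynomial_fun_ev4 unfolding polynomial_map_A4 by metis
  then show ?thesis using that G(2) by (metis prod.collapse)
qed

lemma pull:
  assumes F: "regular F" and a: "a \<in> KA"
  shows "pull F a \<in> KA" "\<And>P. P \<in> KR \<Longrightarrow> fn (pull F a) P = fn a (F P)"
proof -
  obtain gx gy gz gt where g: "\<And>P. P \<in> KR \<Longrightarrow> F P = (ev4 gx P, ev4 gy P, ev4 gz P, ev4 gt P)"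
    using regular_polys[OF F] by metis
  obtain q where q: "a = pr q" using a by (auto simp: KA_def)
  have "fn (pr (sub4 gx gy gz gt q)) P = fn a (F P)" if "P \<in> KR" for P
  proof -
    have "F P \<in> KR" using F that by (auto simp: regular_def)
    then show ?thesis using that by (simp add: q fn_pr ev4_sub4 g)
  qed
  then have "\<exists>b. b \<in> KA \<and> (\<forall>P\<in>KR. fn b P = fn a (F P))"
    by (intro exI[of _ "pr (sub4 gx gy gz gt q)"]) (simp add: KA_def)
  then have "pull F a \<in> KA \<and> (\<forall>P\<in>KR. fn (pull F a) P = fn a (F P))"
    unfolding pull_def by (rule someI_ex)
  then show "pull F a \<in> KA" "\<And>P. P \<in> KR \<Longrightarrow> fn (pull F a) P = fn a (F P)" by auto
qed

lemma pull_hom: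
  assumes F: "regular F" and ab: "a \<in> KA" "b \<in> KA"
  shows "pull F (a + b) = pull F a + pull F b" "pull F (a * b) = pull F a * pull F b"
proof -
  have FP: "P \<in> KR \<Longrightarrow> F P \<in> KR" for P using F by (auto simp: regular_def)
  show "pull F (a + b) = pull F a + pull F b"
    by (rule fn_inj) (simp_all add: pull[OF F] ab dg.ring_in fn_add FP)
  show "pull F (a * b) = pull F a * pull F b"
    by (rule fn_inj) (simp_all add: pull[OF F] ab dg.ring_in fn_mult FP)
qed

lemma pull_const: "regular F \<Longrightarrow> pull F (emb (kc c)) = emb (kc c)"
proof (rule fn_inj)
  assume F: "regular F"
  show "pull F (emb (kc c)) \<in> KA" "emb (kc c) \<in> KA" by (simp_all add: pull[OF F] emb_KA)
  fix P assume P: "P \<in> KR"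
  have "F P \<in> KR" using F P by (auto simp: regular_def)
  then show "fn (pull F (emb (kc c))) P = fn (emb (kc c)) P"
    using P by (cases P; cases "F P") (simp add: pull[OF F] emb_KA fn_emb eval_gens)
qed

lemma pull_inv:
  assumes F: "regular F" and G: "regular G" and "\<And>P. P \<in> KR \<Longrightarrow> G (F P) = P" and a: "a \<in> KA"
  shows "pull F (pull G a) = a"
proof (rule fn_inj)
  show "pull F (pull G a) \<in> KA" "a \<in> KA" using a by (simp_all add: pull[OF F] pull[OF G])
  fix P assume P: "P \<in> KR"
  then have "F P \<in> KR" using F by (auto simp: regular_def)
  then show "fn (pull F (pull G a)) P = fn a P" using assms P by (simp add: pull)
qed

text \<open>The derivation induced on the coordinate ring by a derivation of the ambient polynomial
  ring; killing the defining polynomial makes it independent of the representative.\<close>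

definition bar :: "(Cxzt poly \<Rightarrow> Cxzt poly) \<Rightarrow> Cxzt fract \<Rightarrow> Cxzt fract"
  where "bar E a = pr (E (SOME q. pr q = a))"

lemma bar_pr:
  assumes E: "derivation E" "E rel = 0"
  shows "bar E (pr q) = pr (E q)"
proof -
  have "pr (SOME q'. pr q' = pr q) = pr q" by (rule someI[of "\<lambda>q'. pr q' = pr q"]) simp
  then have "pr ((SOME q'. pr q' = pr q) - q) = 0" by (simp add: rm_diff[OF ring_map_pr])
  then obtain s where s: "(SOME q'. pr q' = pr q) - q = rel * s" unfolding pr_eq_0_iff by (auto simp: dvd_def)
  have "pr (E (SOME q'. pr q' = pr q)) - pr (E q) = pr (E ((SOME q'. pr q' = pr q) - q))"
    by (simp add: dv_diff[OF E(1)] rm_diff[OF ring_map_pr])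
  also have "\<dots> = 0" unfolding s by (simp add: dv_mult[OF E(1)] E(2) rm_mult[OF ring_map_pr] pr_rel)
  finally show ?thesis by (simp add: bar_def)
qed

text \<open>Conjugating \<open>E\<close> with \<open>F\<close> gives another locally nilpotent
  derivation of C[X]. The pullback of the kernel of \<open>E\<close> lies in its kernel, hence in
  C[x,z,t] by \<open>kernel_subset\<close>. The element \<open>q0\<close> witnesses that the
  conjugate is nonzero.\<close>

lemma lnd_conjugate_kernel:
  assumes E: "derivation E" "E rel = 0" "\<And>c. E [:kc c:] = 0"
    and nil: "\<And>q. \<exists>n. (E ^^ n) q = 0" and q0: "pr (E q0) \<noteq> 0"
    and F: "regular F" and G: "regular G"
    and FG: "\<And>P. P \<in> KR \<Longrightarrow> G (F P) = P" "\<And>P. P \<in> KR \<Longrightarrow> F (G P) = P"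
    and q: "E q = 0"
  shows "pull F (pr q) \<in> range emb"
proof -
  define D where "D a = pull F (bar E (pull G a))" for a
  note bp = bar_pr[OF E(1,2)]
  have bKA: "bar E a \<in> KA" if "a \<in> KA" for a using that bp by (auto simp: KA_def)
  have badd: "bar E (a + b) = bar E a + bar E b" if "a \<in> KA" "b \<in> KA" for a b
    using that by (auto simp: KA_def bp dv_simps[OF E(1)] rm_simps[OF ring_map_pr] simp flip: rm_add[OF ring_map_pr])
  have bmult: "bar E (a * b) = a * bar E b + b * bar E a" if "a \<in> KA" "b \<in> KA" for a b
    using that by (auto simp: KA_def bp dv_simps[OF E(1)] rm_simps[OF ring_map_pr] simp flip: rm_mult[OF ring_map_pr])
  have GF: "pull G (pull F a) = a" "pull F (pull G a) = a" if "a \<in> KA" for a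
    using pull_inv[OF G F FG(2) that] pull_inv[OF F G FG(1) that] by auto
  have in_KA: "D a \<in> KA" if "a \<in> KA" for a unfolding D_def by (intro pull bKA F G that)
  have add: "D (a + b) = D a + D b" if "a \<in> KA" "b \<in> KA" for a b
    using that by (simp add: D_def pull_hom pull bKA badd F G)
  have mult: "D (a * b) = a * D b + b * D a" if "a \<in> KA" "b \<in> KA" for a b
    using that by (simp add: D_def pull_hom pull bKA bmult F G dg.ring_in GF)
  have const: "D (emb (kc c)) = 0" for c
  proof -
    have "D (emb (kc c)) = pull F (bar E (emb (kc c)))" by (simp add: D_def pull_const G)
    also have "bar E (emb (kc c)) = 0" using bp[of "[:kc c:]"] E(3) by (simp add: pr_const rm_0[OF ring_map_pr])
    also have "pull F 0 = 0" using pull_const[OF F, of 0] by (simp add: kc_def)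
    finally show ?thesis .
  qed
  have pF0: "pull F 0 = 0" "pull G 0 = 0"
    using pull_const[OF F, of 0] pull_const[OF G, of 0] by (simp_all add: kc_def)
  have nilp: "\<exists>n. (D ^^ n) a = 0" if a: "a \<in> KA" for a
  proof -
    obtain p where p: "pull G a = pr p" using pull(1)[OF G a] by (auto simp: KA_def)
    have it: "(D ^^ n) a = pull F (pr ((E ^^ n) p))" for n
    proof (induction n)
      case 0
      show ?case using GF(2)[OF a] p by simp
    next
      case (Suc n)
      have "pr ((E ^^ n) p) \<in> KA" by (simp add: KA_def)
      then have "D (pull F (pr ((E ^^ n) p))) = pull F (pr ((E ^^ Suc n) p))"
        by (simp add: D_def GF bp)
      then show ?case using Suc by simp
    qed
    obtain n where "(E ^^ n) p = 0" using nil by blast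
    then have "(D ^^ n) a = 0" using it[of n] by (simp add: rm_0[OF ring_map_pr] pF0)
    then show ?thesis by blast
  qed
  have nz: "D (emb vx) \<noteq> 0 \<or> D (emb vz) \<noteq> 0 \<or> D (emb vt) \<noteq> 0"
  proof (rule ccontr)
    assume "\<not> ?thesis"
    then have z: "D (emb vx) = 0" "D (emb vz) = 0" "D (emb vt) = 0" by auto
    have D_emb: "D (emb p) = 0" for p
      by (induction p rule: poly3_induct) (auto simp: const z add mult emb_KA)
    \<comment> \<open>A derivation vanishing on x, z, t kills x^d y, and therefore y.\<close>
    have "emb (vx ^ d) * D Y = D (emb (vx ^ d) * Y) - Y * D (emb (vx ^ d))"
      by (simp add: mult emb_KA Y_KA)
    also have "emb (vx ^ d) * Y = emb (- rr)" using Y_eq by (simp add: rm_power[OF ring_map_emb])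
    finally have "D Y = 0" by (simp add: D_emb del: to_fract_uminus)
    then have D0: "D (pr p) = 0" for p
    proof (induction p)
      case 0
      show ?case using D_emb[of 0] by (simp add: rm_0[OF ring_map_pr])
    next
      case (pCons a p)
      have "pr p \<in> KA" by (simp add: KA_def)
      then show ?case using pCons by (simp add: pr_pCons add mult D_emb emb_KA Y_KA dg.ring_in)
    qed
    have "pr q0 \<in> KA" by (simp add: KA_def)
    then have m: "pull F (pr q0) \<in> KA" "pr q0 \<in> KA" using pull(1)[OF F] by auto
    then obtain q1 where "pull F (pr q0) = pr q1" by (auto simp: KA_def)
    then have "pull F (pr (E q0)) = 0" using D0[of q1] GF(1)[OF m(2)] by (simp add: D_def bp)
    then have "pull G (pull F (pr (E q0))) = 0" by (simp add: pF0)
    moreover have "pr (E q0) \<in> KA" by (simp add: KA_def)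
    ultimately show False using GF(1) q0 by simp
  qed
  interpret L: koras_lnd d k l D
    by unfold_locales (use in_KA add mult nilp const nz in auto)
  have m: "pr q \<in> KA" by (simp add: KA_def)
  show ?thesis
  proof (rule L.kernel_subset)
    show "pull F (pr q) \<in> KA" using m by (rule pull[OF F])
    show "D (pull F (pr q)) = 0" using m q by (simp add: D_def GF bp rm_0[OF ring_map_pr] pF0)
  qed
qed

text \<open>The triangular derivations x^d d/dz - k z^(k-1) d/dy and x^d d/dt - l t^(l-1) d/dy
  annihilate the defining polynomial. One kernel contains x and t, the other x and z, so the two
  together control all three coordinates.\<close>

definition E1 :: "Cxzt poly \<Rightarrow> Cxzt poly"
  where "E1 q = [:vx ^ d:] * map_poly dz q - [:of_nat k * vz ^ (k - 1):] * pderiv q"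
definition E2 :: "Cxzt poly \<Rightarrow> Cxzt poly"
  where "E2 q = [:vx ^ d:] * map_poly dt q - [:of_nat l * vt ^ (l - 1):] * pderiv q"

lemma derivation_E: "derivation E1" "derivation E2"
  unfolding E1_def E2_def
  by (intro derivation_minus derivation_scale derivation_map_poly derivation_dz derivation_dt derivation_pderiv)+

lemma E1_gens: "E1 [:kc c:] = 0" "E1 [:vx:] = 0" "E1 [:vt:] = 0" "E1 [:vz:] = [:vx ^ d:]"
    "E1 [:0, 1:] = - [:of_nat k * vz ^ (k - 1):]" "E1 rel = 0"
  and E2_gens: "E2 [:kc c:] = 0" "E2 [:vx:] = 0" "E2 [:vz:] = 0" "E2 [:vt:] = [:vx ^ d:]"
    "E2 [:0, 1:] = - [:of_nat l * vt ^ (l - 1):]" "E2 rel = 0"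
  by (simp_all add: E1_def E2_def map_poly_pCons dv_simps[OF derivation_dz] dv_simps[OF derivation_dt]
      pderiv_pCons rel_def rr_def mult.commute)

lemma E_nilpotent: "\<exists>n. (E1 ^^ n) q = 0" "\<exists>n. (E2 ^^ n) q = 0"
proof -
  have c: "\<exists>n. (E ^^ n) (E q) = 0 \<Longrightarrow> \<exists>n. (E ^^ n) q = 0" for E :: "Cxzt poly \<Rightarrow> Cxzt poly" and q
  proof -
    assume "\<exists>n. (E ^^ n) (E q) = 0"
    then obtain n where "(E ^^ Suc n) q = 0" by (auto simp: funpow_swap1)
    then show ?thesis by blast
  qed
  have const1: "\<exists>n. (E1 ^^ n) [:p:] = 0" and const2: "\<exists>n. (E2 ^^ n) [:p:] = 0" for p
  proof -
    have x: "\<exists>n. (E1 ^^ n) [:vx ^ d:] = 0" "\<exists>n. (E2 ^^ n) [:vx ^ d:] = 0"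
      by (rule exI[of _ 1], simp add: E1_def E2_def map_poly_pCons dv_simps[OF derivation_dz] dv_simps[OF derivation_dt])+
    show "\<exists>n. (E1 ^^ n) [:p:] = 0"
    proof (induction p rule: poly3_induct)
      case (add p q) then show ?case
        using derivation_nilpotent_add[OF derivation_E(1), of _ "[:p:]" _ "[:q:]"] by auto
    next
      case (mult p q) then show ?case
        using derivation_nilpotent_mult[OF derivation_E(1), of _ "[:p:]" _ "[:q:]"] by (auto simp: mult.commute)
    next
      case z show ?case by (rule c) (use x(1) in \<open>simp add: E1_gens\<close>)
    qed (rule exI[of _ 1], simp add: E1_gens)+
    show "\<exists>n. (E2 ^^ n) [:p:] = 0"
    proof (induction p rule: poly3_induct)
      case (add p q) then show ?case
        using derivation_nilpotent_add[OF derivation_E(2), of _ "[:p:]" _ "[:q:]"] by auto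
    next
      case (mult p q) then show ?case
        using derivation_nilpotent_mult[OF derivation_E(2), of _ "[:p:]" _ "[:q:]"] by (auto simp: mult.commute)
    next
      case t show ?case by (rule c) (use x(2) in \<open>simp add: E2_gens\<close>)
    qed (rule exI[of _ 1], simp add: E2_gens)+
  qed
  show "\<exists>n. (E1 ^^ n) q = 0"
  proof (induction q rule: poly_gen_induct)
    case (const p) then show ?case by (rule const1)
  next
    case var show ?case
      by (rule c) (use const1[of "- (of_nat k * vz ^ (k - 1))"] in \<open>simp add: E1_gens\<close>)
  next
    case (add p q) then show ?case using derivation_nilpotent_add[OF derivation_E(1)] by blast
  next
    case (mult p q) then show ?case using derivation_nilpotent_mult[OF derivation_E(1)] by blast
  qed
  show "\<exists>n. (E2 ^^ n) q = 0"
  proof (induction q rule: poly_gen_induct)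
    case (const p) then show ?case by (rule const2)
  next
    case var show ?case
      by (rule c) (use const2[of "- (of_nat l * vt ^ (l - 1))"] in \<open>simp add: E2_gens\<close>)
  next
    case (add p q) then show ?case using derivation_nilpotent_add[OF derivation_E(2)] by blast
  next
    case (mult p q) then show ?case using derivation_nilpotent_mult[OF derivation_E(2)] by blast
  qed
qed

abbreviation "AX \<equiv> carrier (Aut_variety KR)"

lemma Aut_iff: "F \<in> carrier (Aut_variety V) \<longleftrightarrow> F \<in> extensional V \<and> bij_betw F V V \<and>
    polynomial_map_on V F \<and> polynomial_map_on V (inv_into V F)"
  by (auto simp: Aut_variety_def Bij_def)

lemma Aut_regular:
  assumes "F \<in> AX"
  shows "regular F" "regular (inv_into KR F)"
    "\<And>P. P \<in> KR \<Longrightarrow> inv_into KR F (F P) = P" "\<And>P. P \<in> KR \<Longrightarrow> F (inv_into KR F P) = P"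
proof -
  have F: "bij_betw F KR KR" "polynomial_map_on KR F" "polynomial_map_on KR (inv_into KR F)"
    using assms by (simp_all add: Aut_iff)
  show "regular F" using F bij_betw_imp_surj_on[OF F(1)] by (simp add: regular_def)
  show "regular (inv_into KR F)"
    using F bij_betw_imp_surj_on[OF bij_betw_inv_into[OF F(1)]] by (simp add: regular_def)
  show "\<And>P. P \<in> KR \<Longrightarrow> inv_into KR F (F P) = P" "\<And>P. P \<in> KR \<Longrightarrow> F (inv_into KR F P) = P"
    using bij_betw_inv_into_left[OF F(1)] bij_betw_inv_into_right[OF F(1)] by auto
qed

lemma Aut_in: "F \<in> AX \<Longrightarrow> P \<in> KR \<Longrightarrow> F P \<in> KR"
  using Aut_regular(1) by (auto simp: regular_def)

lemma KR_point: "x \<noteq> 0 \<Longrightarrow> (x, - (z ^ k + t ^ l + x) / x ^ d, z, t) \<in> KR"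
  by (simp add: koras_russell_def)

lemma eval_KR_inj:
  assumes "\<And>P. P \<in> KR \<Longrightarrow> eval_xzt p (pr_xzt P) = eval_xzt q (pr_xzt P)"
  shows "p = q"
proof -
  have "eval_xzt (p - q) (x, z, t) = 0" if "x \<noteq> 0" for x z t
    using assms[OF KR_point[OF that]] by (simp add: eval_simps)
  then have "p - q = 0" by (rule eval_eq_0)
  then show ?thesis by simp
qed

lemma pull_gens:
  assumes F: "regular F" and G: "regular G"
    and FG: "\<And>P. P \<in> KR \<Longrightarrow> G (F P) = P" "\<And>P. P \<in> KR \<Longrightarrow> F (G P) = P"
  shows "pull F (emb vx) \<in> range emb" "pull F (emb vz) \<in> range emb" "pull F (emb vt) \<in> range emb"
proof -
  have nz: "pr (E1 [:vz:]) \<noteq> 0" "pr (E2 [:vt:]) \<noteq> 0"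
    by (simp_all add: E1_gens E2_gens pr_const)
  note * = lnd_conjugate_kernel[OF derivation_E(1) E1_gens(6,1) E_nilpotent(1) nz(1) F G FG]
    and ** = lnd_conjugate_kernel[OF derivation_E(2) E2_gens(6,1) E_nilpotent(2) nz(2) F G FG]
  show "pull F (emb vx) \<in> range emb" "pull F (emb vt) \<in> range emb" "pull F (emb vz) \<in> range emb"
    using *[of "[:vx:]"] *[of "[:vt:]"] **[of "[:vz:]"] E1_gens E2_gens by (simp_all add: pr_const)
qed

lemma restricts_hom:
  assumes F: "regular F" and G: "regular G"
    and FG: "\<And>P. P \<in> KR \<Longrightarrow> G (F P) = P" "\<And>P. P \<in> KR \<Longrightarrow> F (G P) = P"
  obtains \<phi> where "ring_map \<phi>" "\<And>c. \<phi> (kc c) = kc c" "restricts_to d k l F \<phi>"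
proof -
  obtain px pz' pt' where p: "pull F (emb vx) = emb px" "pull F (emb vz) = emb pz'" "pull F (emb vt) = emb pt'"
    using pull_gens[OF F G FG] by blast
  define \<phi> where "\<phi> = subst3 kc px pz' pt'"
  have r: "ring_map \<phi>" unfolding \<phi>_def by (rule ring_map_subst3[OF ring_map_kc])
  note g = subst3_gens[OF ring_map_kc, of px pz' pt', folded \<phi>_def]
  have "eval_xzt (\<phi> q) (pr_xzt P) = eval_xzt q (pr_xzt (F P))" if P: "P \<in> KR" for q P
  proof -
    have FP: "F P \<in> KR" using F P by (auto simp: regular_def)
    have e: "eval_xzt a (pr_xzt P) = eval_xzt b (pr_xzt (F P))" if "pull F (emb b) = emb a" for a b
      using pull(2)[OF F emb_KA P, of b] by (simp add: that fn_emb P FP)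
    show ?thesis
      by (induction q rule: poly3_induct)
         (simp_all add: g eval_simps rm_simps[OF r] e[OF p(1)] e[OF p(2)] e[OF p(3)],
          cases P, cases "F P", simp add: eval_gens)
  qed
  then show ?thesis using that r g(1) by (auto simp: restricts_to_def)
qed

lemma restricts_comp:
  assumes "restricts_to d k l F \<phi>" "restricts_to d k l G \<psi>" "\<And>P. P \<in> KR \<Longrightarrow> G P \<in> KR"
    and "\<And>P. P \<in> KR \<Longrightarrow> H P = F (G P)"
  shows "restricts_to d k l H (\<lambda>p. \<psi> (\<phi> p))"
  using assms by (simp add: restricts_to_def)

lemma restricts_unique:
  assumes "restricts_to d k l F \<phi>" "restricts_to d k l F \<psi>"
  shows "\<phi> = \<psi>"
  by (rule ext, rule eval_KR_inj) (use assms in \<open>simp add: restricts_to_def\<close>)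

lemma restricts_id: assumes "\<And>P. P \<in> KR \<Longrightarrow> F P = P" shows "restricts_to d k l F (\<lambda>p. p)"
  using assms by (simp add: restricts_to_def)

text \<open>A normal form of degree J > 0 in y has a pole of order greater than d (J - 1) along x =
  0. A pole of order at most d therefore leaves only J \<le> 1.\<close>

lemma KA_small_val:
  assumes w: "W \<in> KA" and e: "emb vx ^ d * W \<in> range emb"
  obtains a b where "W = emb a + emb b * Y"
proof (cases "W = 0")
  case True
  then show ?thesis using that[of 0 0] by simp
next
  case False
  obtain q where q: "W = pr q" using w by (auto simp: KA_def)
  obtain n s where ns: "q = n + rel * s" "\<And>j. j > 0 \<Longrightarrow> coeff n j = 0 \<or> degree (coeff n j) < d"
    using normal_form by blast
  have Wn: "W = pr n" using q ns(1) by (simp add: rm_simps[OF ring_map_pr] pr_rel)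
  then have n0: "n \<noteq> 0" using False by (auto simp: rm_0[OF ring_map_pr])
  have "degree n \<le> 1"
  proof (rule ccontr)
    assume "\<not> degree n \<le> 1"
    then have J: "degree n \<ge> 2" by simp
    obtain i g where g: "g \<noteq> 0" "dg.lt (pr n - mon i (degree n) g) (val (mon i (degree n) g))" "i < d"
      using normal_top[OF n0 ns(2)] J by (metis less_le_trans zero_less_numeral)
    have "val W = val (mon i (degree n) g)"
      using dg.v_add_lt(2)[OF mon_KA dg.diff_in[OF w mon_KA] mon_nz[OF g(1)] g(2)[folded Wn]] by simp
    then have f: "fst (val W) = int (d * degree n) - int i" by (simp add: val_mon[OF g(1)])
    obtain p where p: "emb vx ^ d * W = emb p" using e by blast
    then have "p \<noteq> 0" using False by force
    then have "fst (val (emb p)) \<le> 0" by (simp add: val_emb vp_def)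
    moreover have "val (emb p) = val (emb vx ^ d) + val W"
      using dg.v_mult[OF dg.power_in[OF emb_KA] w] False by (simp flip: p)
    ultimately have "int (d * degree n) - int i - int d \<le> 0" by (simp add: f val_power emb_KA val_gens)
    moreover have "d * 2 \<le> d * degree n" using J by simp
    then have "2 * int d \<le> int (d * degree n)" by linarith
    ultimately show False using g(3) by linarith
  qed
  then have "n = [:coeff n 0, coeff n 1:]"
    by (intro poly_eqI) (auto simp: coeff_pCons coeff_eq_0 split: nat.splits)
  then have "W = emb (coeff n 0) + Y * emb (coeff n 1)"
    using Wn pr_pCons[of "coeff n 0" "[:coeff n 1:]"] by (simp add: pr_const)
  then show ?thesis by (intro that[of "coeff n 0" "coeff n 1"]) (simp add: mult.commute)
qed

lemma not_vx_dvd_rr: "\<not> vx dvd (rr :: 'a::idom poly poly poly)"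
  using zt_nz by (simp add: vx_dvd_iff rr_eq)

text \<open>The pole of \<open>Y\<close> forces an automorphism to send \<open>x\<close> to a multiple of \<open>x\<close>.\<close>

theorem Aut_restricts:
  assumes FA: "F \<in> AX"
  obtains \<phi> \<psi> c u b where "restricts_to d k l F \<phi>" "restricts_to d k l (inv_into KR F) \<psi>"
    "ring_map \<phi>" "ring_map \<psi>" "\<And>c. \<phi> (kc c) = kc c" "\<And>c. \<psi> (kc c) = kc c"
    "\<And>p. \<phi> (\<psi> p) = p" "\<And>p. \<psi> (\<phi> p) = p"
    "c \<noteq> 0" "\<phi> vx = kc c * vx" "\<phi> rr = u * rr + vx ^ d * b"
proof -
  define G where "G = inv_into KR F"
  note R = Aut_regular[OF FA, folded G_def]
  obtain \<phi> where \<phi>: "ring_map \<phi>" "\<And>c. \<phi> (kc c) = kc c" "restricts_to d k l F \<phi>"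
    using restricts_hom[OF R(1,2,3,4)] by blast
  obtain \<psi> where \<psi>: "ring_map \<psi>" "\<And>c. \<psi> (kc c) = kc c" "restricts_to d k l G \<psi>"
    using restricts_hom[OF R(2,1,4,3)] by blast
  have inG: "P \<in> KR \<Longrightarrow> G P \<in> KR" "P \<in> KR \<Longrightarrow> F P \<in> KR" for P using R by (auto simp: regular_def)
  have pp: "\<psi> (\<phi> p) = p" for p
    using restricts_unique[OF restricts_comp[OF \<phi>(3) \<psi>(3) inG(1) refl] restricts_id] R(4) by metis
  have pp': "\<phi> (\<psi> p) = p" for p
    using restricts_unique[OF restricts_comp[OF \<psi>(3) \<phi>(3) inG(2) refl] restricts_id] R(3) by metis
  have pole: "emb (\<theta> vx) ^ d * pull H Y = - emb (\<theta> rr)"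
    if H: "regular H" and \<theta>: "restricts_to d k l H \<theta>" for H \<theta>
  proof -
    have emb: "pull H (emb p) = emb (\<theta> p)" for p
    proof (rule fn_inj)
      fix P assume P: "P \<in> KR"
      then have "H P \<in> KR" using H by (auto simp: regular_def)
      then show "fn (pull H (emb p)) P = fn (emb (\<theta> p)) P"
        using P \<theta> by (simp add: pull[OF H] emb_KA fn_emb restricts_to_def)
    qed (simp_all add: pull[OF H] emb_KA)
    have "emb (\<theta> (vx ^ d)) * pull H Y = pull H (emb (vx ^ d) * Y)"
      by (simp add: pull_hom[OF H] emb_KA Y_KA emb)
    also have "emb (vx ^ d) * Y = emb (- rr)" using Y_eq by (simp add: rm_power[OF ring_map_emb])
    finally have 1: "emb (\<theta> (vx ^ d)) * pull H Y = emb (\<theta> (- rr))" by (simp add: emb del: to_fract_uminus)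
    have "emb (\<theta> p) * emb (\<theta> q) = emb (\<theta> (p * q))" for p q
      using pull_hom(2)[OF H emb_KA emb_KA, of p q] by (simp add: emb flip: to_fract_mult)
    then have m: "\<theta> (p * q) = \<theta> p * \<theta> q" for p q by (metis to_fract_eq_iff to_fract_mult)
    have c: "\<theta> (kc c) = kc c" for c using pull_const[OF H, of c] by (simp add: emb)
    have pw: "\<theta> (vx ^ n) = \<theta> vx ^ n" for n
      by (induction n) (use m c[of 1] in \<open>simp_all add: rm_1[OF ring_map_kc]\<close>)
    have "\<theta> (- rr) = - \<theta> rr"
      using m[of "kc (- 1)" rr] c[of "- 1"] by (simp add: rm_minus[OF ring_map_kc] rm_1[OF ring_map_kc])
    with 1 show ?thesis by (simp add: pw rm_power[OF ring_map_emb])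
  qed
  \<comment> \<open>Clear the denominator of the pullback of y and apply the inverse \<tau>: then x
    divides \<open>rr * \<tau> vx ^ m\<close>, and x is a prime not dividing
    \<open>rr\<close>.\<close>
  have dv: "vx dvd \<tau> vx"
    if H: "regular H" and \<theta>: "restricts_to d k l H \<theta>" and r: "ring_map \<theta>" "ring_map \<tau>"
      and inv: "\<And>p. \<tau> (\<theta> p) = p" for H \<theta> \<tau>
  proof -
    have WK: "pull H Y \<in> KA" by (rule pull[OF H Y_KA])
    have "\<theta> rr \<noteq> 0" using inv[of rr] rr_nz by (metis rm_0[OF r(2)])
    then have "pull H Y \<noteq> 0" using pole[OF H \<theta>] by force
    then obtain w m where w: "pull H Y * emb vx ^ m = emb w" using KA_clear[OF WK] by metis
    have "emb (\<theta> vx ^ d * w) = emb (- (\<theta> rr * vx ^ m))"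
      using pole[OF H \<theta>] by (simp add: rm_power[OF ring_map_emb] flip: w)
        (simp add: mult.assoc[symmetric])
    then have "\<theta> vx ^ d * w = - (\<theta> rr * vx ^ m)" by (simp only: to_fract_eq_iff)
    then have "\<tau> (\<theta> vx ^ d * w) = \<tau> (- (\<theta> rr * vx ^ m))" by simp
    then have "vx ^ d * \<tau> w = - (rr * \<tau> vx ^ m)" by (simp add: rm_simps[OF r(2)] inv)
    moreover have "vx dvd vx ^ d * \<tau> w" using pos by (simp add: dvd_mult2 dvd_power)
    ultimately have "vx dvd rr * \<tau> vx ^ m" by simp
    then show ?thesis using vx_prime not_vx_dvd_rr vx_dvd_power by blast
  qed
  obtain a where a: "\<psi> vx = vx * a" using dv[OF R(1) \<phi>(3,1) \<psi>(1) pp] by (auto simp: dvd_def)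
  obtain b where b: "\<phi> vx = vx * b" using dv[OF R(2) \<psi>(3,1) \<phi>(1) pp'] by (auto simp: dvd_def)
  have "vx * (b * \<phi> a) = vx * 1" using pp'[of vx] a b by (simp add: rm_mult[OF \<phi>(1)])
  then have "b * \<phi> a = 1" by (simp only: mult_cancel_left v_nz simp_thms)
  then obtain c where c: "b = kc c" "c \<noteq> 0" by (rule unit_poly3)
  have \<phi>x: "\<phi> vx = kc c * vx" using b c by (simp add: mult.commute)
  have WK: "pull F Y \<in> KA" by (rule pull[OF R(1) Y_KA])
  have cc: "emb (kc c) ^ d * emb (kc (inverse c)) ^ d = 1"
    using c by (simp add: power_mult_distrib[symmetric] rm_1[OF ring_map_kc] flip: to_fract_mult rm_mult[OF ring_map_kc])
  have 1: "emb (kc c) ^ d * (emb vx ^ d * pull F Y) = - emb (\<phi> rr)"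
    using pole[OF R(1) \<phi>(3)] by (simp add: \<phi>x power_mult_distrib mult.assoc)
  have "emb vx ^ d * pull F Y = (emb (kc c) ^ d * emb (kc (inverse c)) ^ d) * (emb vx ^ d * pull F Y)"
    by (simp only: cc mult_1_left)
  also have "\<dots> = emb (kc (inverse c)) ^ d * - emb (\<phi> rr)"
    unfolding 1[symmetric] by (simp only: ac_simps)
  finally have xW: "emb vx ^ d * pull F Y = emb (kc (inverse c) ^ d * - \<phi> rr)"
    by (simp add: rm_power[OF ring_map_emb])
  \<comment> \<open>The pullback of y has a pole of order at most d, so it is of degree at most 1 in
    y; multiplying by x^d turns its coefficients into those of the ideal condition for
    \<open>rr\<close>.\<close>
  obtain A B where AB: "pull F Y = emb A + emb B * Y"
    using KA_small_val[OF WK] xW by blast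
  have "emb (\<phi> rr) = - (emb (kc c * vx) ^ d * (emb A + emb B * Y))"
    using pole[OF R(1) \<phi>(3)] by (simp add: \<phi>x AB)
  also have "\<dots> = - (emb (kc c) ^ d * (emb vx ^ d * emb A + emb B * (emb vx ^ d * Y)))"
    by (simp add: power_mult_distrib algebra_simps)
  also have "\<dots> = emb (kc c ^ d * B * rr + vx ^ d * (- (kc c ^ d * A)))"
    unfolding Y_eq by (simp add: rm_power[OF ring_map_emb] algebra_simps)
  finally have "\<phi> rr = kc c ^ d * B * rr + vx ^ d * (- (kc c ^ d * A))" by (simp only: to_fract_eq_iff)
  then show ?thesis using that[OF \<phi>(3) \<psi>(3)[unfolded G_def] \<phi>(1) \<psi>(1) \<phi>(2) \<psi>(2) pp' pp c(2) \<phi>x] by blast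
qed

text \<open>The restriction determines the x-, z- and t-coordinates of the image, and the equation
  then determines x^d times the y-coordinate. As x is not a zero divisor in C[X], this also settles
  y on x = 0.\<close>

lemma Aut_eqI:
  assumes F: "F \<in> AX" and G: "G \<in> AX" and "restricts_to d k l F \<phi>" "restricts_to d k l G \<phi>"
  shows "F = G"
proof -
  obtain \<psi> c where \<psi>: "restricts_to d k l F \<psi>" "c \<noteq> 0" "\<psi> vx = kc c * vx" using Aut_restricts[OF F] by metis
  then have x: "\<phi> vx = kc c * vx" using restricts_unique[OF assms(3)] by simp
  have eqs: "eval_xzt p (pr_xzt (F P)) = eval_xzt p (pr_xzt (G P))" if "P \<in> KR" for p P
    using assms(3,4) that by (simp add: restricts_to_def flip: pr_xzt.simps)
  obtain fx fy fz ft where f: "\<And>P. P \<in> KR \<Longrightarrow> F P = (ev4 fx P, ev4 fy P, ev4 fz P, ev4 ft P)"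
    using regular_polys[OF Aut_regular(1)[OF F]] by metis
  obtain gx gy gz gt where g: "\<And>P. P \<in> KR \<Longrightarrow> G P = (ev4 gx P, ev4 gy P, ev4 gz P, ev4 gt P)"
    using regular_polys[OF Aut_regular(1)[OF G]] by metis
  have coords: "ev4 fx P = ev4 gx P" "ev4 fz P = ev4 gz P" "ev4 ft P = ev4 gt P" if "P \<in> KR" for P
    using eqs[OF that, of vx] eqs[OF that, of vz] eqs[OF that, of vt] by (auto simp: f g that eval_gens)
  have fxP: "ev4 fx (x, y, z, t) = c * x" if "(x, y, z, t) \<in> KR" for x y z t
    using assms(3) that x unfolding restricts_to_def
    by (metis (no_types, lifting) eval_gens(1,2) f pr_xzt.simps rm_mult[OF ring_map_eval])
  have "ev4 ([:vx ^ d:] * (fy - gy)) P = 0" if P: "P \<in> KR" for P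
  proof -
    obtain x y z t where Pe: "P = (x, y, z, t)" by (cases P)
    have inK: "F P \<in> KR" "G P \<in> KR" using P F G Aut_in by auto
    have solve: "a ^ d * y = - (z ^ k + t ^ l + a)" if "(a, y, z, t) \<in> KR" for a y z t
      unfolding eq_neg_iff_add_eq_0 using that by (simp add: koras_russell_def add.assoc)
    have "ev4 fx P ^ d * ev4 fy P = ev4 fx P ^ d * ev4 gy P"
      using solve[OF inK(1)[unfolded f[OF P]]] solve[OF inK(2)[unfolded g[OF P]]] coords[OF P] by simp
    then have "c ^ d * (x ^ d * (ev4 fy P - ev4 gy P)) = 0"
      using fxP P by (auto simp: Pe power_mult_distrib algebra_simps)
    then show ?thesis using \<psi>(2) by (simp add: Pe rm_simps[OF ring_map_ev4] ev4_const eval_simps del: mult_pCons_left)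
  qed
  then have "pr ([:vx ^ d:] * (fy - gy)) = 0" using pr_eq_0_iff_ev4 by blast
  then have "pr (fy - gy) = 0" by (simp add: rm_mult[OF ring_map_pr] pr_const del: mult_pCons_left)
  then have "ev4 fy P = ev4 gy P" if "P \<in> KR" for P
    using that unfolding pr_eq_0_iff_ev4 by (simp add: rm_diff[OF ring_map_ev4])
  then have "F P = G P" if "P \<in> KR" for P using coords that by (simp add: f g)
  then show ?thesis using F G by (intro extensionalityI[of F KR G]) (auto simp: Aut_iff)
qed

end

section \<open>The Jacobian bracket\<close>

lemma ring_map_map_poly: assumes h: "ring_map h" shows "ring_map (map_poly h)"
proof (rule ring_mapI)
  show "map_poly h 1 = 1" by (simp add: rm_1[OF h])
  show "map_poly h (p + q) = map_poly h p + map_poly h q" for p q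
    by (rule poly_eqI) (simp add: coeff_map_poly rm_simps[OF h])
  show "map_poly h (p * q) = map_poly h p * map_poly h q" for p q
    by (rule poly_eqI) (simp add: coeff_map_poly rm_simps[OF h] coeff_mult)
qed

text \<open>The Poisson bracket of the (z,t)-plane over x. The derivation \<open>br H\<close> is the
  Hamiltonian vector field of \<open>H\<close>, and \<open>br (\<psi> vz) (\<psi> vt)\<close> is the
  Jacobian determinant of an endomorphism over x.\<close>

definition br :: "'a::idom poly poly poly \<Rightarrow> 'a poly poly poly \<Rightarrow> 'a poly poly poly"
  where "br p q = dz p * dt q - dt p * dz q"

lemma br_gens [simp]: "br vz vt = 1" "br p vx = 0" "br p vz = - dt p" "br p vt = dz p" "br p (kc c) = 0"
  by (simp_all add: br_def)

lemma br_self: "br p p = 0"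
  by (simp add: br_def)

lemma derivation_br: "derivation (br p)"
  by (simp add: derivation_def br_def dv_simps[OF derivation_dz] dv_simps[OF derivation_dt] algebra_simps)

lemma br_left: "br (p + q) f = br p f + br q f" "br (p * q) f = p * br q f + q * br p f" "br (kc c) f = 0"
    "br vx f = 0" "br 0 f = 0" "br (p - q) f = br p f - br q f" "br (- p) f = - br p f"
  by (simp_all add: br_def dv_simps[OF derivation_dz] dv_simps[OF derivation_dt] algebra_simps)

lemma jacobi: "br h (br p q) = br (br h p) q + br p (br h q)"
  by (simp add: br_def dv_simps[OF derivation_dz] dv_simps[OF derivation_dt] dz_dt algebra_simps)

lemma chain_rule:
  assumes \<psi>: "ring_map \<psi>" and c: "\<And>c. \<psi> (kc c) = kc c" and x: "\<psi> vx = kc a * vx"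
  shows "dz (\<psi> p) = \<psi> (dz p) * dz (\<psi> vz) + \<psi> (dt p) * dz (\<psi> vt)"
    "dt (\<psi> p) = \<psi> (dz p) * dt (\<psi> vz) + \<psi> (dt p) * dt (\<psi> vt)"
  by (induction p rule: poly3_induct)
     (simp_all add: c x rm_simps[OF \<psi>] dv_simps[OF derivation_dz] dv_simps[OF derivation_dt] algebra_simps)

lemma br_hom:
  assumes "ring_map \<psi>" "\<And>c. \<psi> (kc c) = kc c" "\<psi> vx = kc a * vx"
  shows "br (\<psi> p) (\<psi> q) = \<psi> (br p q) * br (\<psi> vz) (\<psi> vt)"
  unfolding br_def chain_rule[OF assms, of p] chain_rule[OF assms, of q]
  by (simp add: rm_simps[OF assms(1)] algebra_simps)

definition br2 :: "'a::idom poly poly \<Rightarrow> 'a poly poly \<Rightarrow> 'a poly poly"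
  where "br2 p q = pderiv p * map_poly pderiv q - map_poly pderiv p * pderiv q"

lemma coeff_br: "coeff (br p q) 0 = br2 (coeff p 0) (coeff q 0)"
  by (simp add: br_def br2_def coeff_mult_0 dz_def dt_def coeff_map_poly)

lemma derivation_inner_pderiv: "derivation (map_poly pderiv :: 'a::idom poly poly \<Rightarrow> _)"
  by (intro derivation_map_poly derivation_pderiv)

lemmas d2_simps = dv_simps[OF derivation_pderiv] dv_simps[OF derivation_inner_pderiv]

lemma br2_cusp: "br2 (p ^ m + q ^ n) q = of_nat m * p ^ (m - 1) * br2 p q"
  "br2 (p ^ m + q ^ n) p = - (of_nat n * q ^ (n - 1) * br2 p q)"
  by (simp_all add: br2_def d2_simps algebra_simps)

lemma br2_const: "br2 ([:[:c:]:] * p) q = [:[:c:]:] * br2 p q"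
proof -
  have "pderiv ([:[:c:]:] * p) = [:[:c:]:] * pderiv p" for p :: "'a poly poly"
    by (simp only: dv_mult[OF derivation_pderiv] pderiv_singleton mult_zero_right add_0_right)
  moreover have "map_poly pderiv ([:[:c:]:] * p) = [:[:c:]:] * map_poly pderiv p"
    by (simp only: dv_mult[OF derivation_inner_pderiv])
       (simp add: map_poly_pCons del: mult_pCons_left)
  ultimately show ?thesis by (simp add: br2_def algebra_simps del: mult_pCons_left)
qed

lemma unit_const_const:
  fixes p :: "'a::field poly poly"
  assumes "p * q = 1"
  obtains c where "p = [:[:c:]:]" "c \<noteq> 0"
proof -
  have "[:p:] * [:q:] = 1" using assms by (simp add: mult.commute one_pCons)
  then obtain c where "[:p:] = kc c" "c \<noteq> 0" by (rule unit_poly3)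
  then show ?thesis using that by (simp add: kc_def)
qed

text \<open>Take m = a^i b^j for integers with i l + j k = 1: a parametrization of the torus a^k =
  b^l.\<close>

lemma bezout_roots:
  fixes a b :: complex
  assumes "a \<noteq> 0" "b \<noteq> 0" "a ^ k = b ^ l" "coprime k l"
  obtains m where "m \<noteq> 0" "a = m ^ l" "b = m ^ k"
proof -
  obtain i j :: int where ij: "i * int l + j * int k = 1"
    using bezout_int[of "int l" "int k"] assms(4)
    by (metis coprime_commute coprime_imp_gcd_eq_1 coprime_int_iff)
  define m where "m = a powi i * b powi j"
  have pw: "(x powi i) ^ n = x powi (i * int n)" for x :: complex and i n
    by (simp only: power_int_power')
  have nz: "a \<noteq> 0 \<or> u + v \<noteq> 0" "b \<noteq> 0 \<or> u + v \<noteq> 0" for u v :: int using assms by auto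
  have "m ^ l = a powi (i * int l) * b powi (int l * j)"
    by (simp only: m_def power_mult_distrib pw mult.commute[of j])
  also have "b powi (int l * j) = a powi (int k * j)"
    by (simp only: power_int_power[symmetric] assms(3))
  also have "a powi (i * int l) * a powi (int k * j) = a powi (i * int l + j * int k)"
    by (simp only: power_int_add[OF nz(1)] mult.commute[of "int k"])
  finally have 1: "m ^ l = a" using ij by simp
  have "m ^ k = a powi (int k * i) * b powi (j * int k)"
    by (simp only: m_def power_mult_distrib pw mult.commute[of i])
  also have "a powi (int k * i) = b powi (int l * i)"
    by (simp only: power_int_power[symmetric] assms(3))
  also have "b powi (int l * i) * b powi (j * int k) = b powi (i * int l + j * int k)"
    by (simp only: power_int_add[OF nz(2)] mult.commute[of "int l"])
  finally have 2: "m ^ k = b" using ij by simp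
  have "m \<noteq> 0" using assms(1,2) by (simp add: m_def)
  then show ?thesis using 1 2 by (intro that[of m]) simp_all
qed

section \<open>Automorphisms of the cuspidal curve and reduction modulo x\<close>

context koras
begin

lemma wdeg_br2:
  assumes "br2 p q \<noteq> (0 :: 'a::{idom,ring_char_0} poly poly)"
  shows "wdeg (br2 p q) + k + l \<le> wdeg p + wdeg q"
proof -
  have 1: "pderiv p * map_poly pderiv q = 0 \<or> wdeg (pderiv p * map_poly pderiv q) + k + l \<le> wdeg p + wdeg q"
    using wdeg_pderiv(1)[of p] wdeg_pderiv(2)[of q] wdeg_mult[of "pderiv p" "map_poly pderiv q"]
    by (cases "pderiv p = 0"; cases "map_poly pderiv q = 0") auto
  have 2: "map_poly pderiv p * pderiv q = 0 \<or> wdeg (map_poly pderiv p * pderiv q) + k + l \<le> wdeg p + wdeg q"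
    using wdeg_pderiv(1)[of q] wdeg_pderiv(2)[of p] wdeg_mult[of "map_poly pderiv p" "pderiv q"]
    by (cases "pderiv q = 0"; cases "map_poly pderiv p = 0") auto
  have m: "wdeg (- f) = wdeg f" for f :: "'a poly poly"
    by (simp add: wdeg_def rm_minus[OF ring_map_grade])
  show ?thesis
    using 1 2 assms wdeg_add[of "pderiv p * map_poly pderiv q" "- (map_poly pderiv p * pderiv q)"]
      m[of "map_poly pderiv p * pderiv q"]
    unfolding br2_def by (auto simp: max_def split: if_splits)
qed

text \<open>Bracketing the invariant cusp with \<open>tb\<close> and with \<open>zb\<close> yields
  two linear inequalities for their weighted degrees, which give at most l for \<open>zb\<close> and
  at most k for \<open>tb\<close>. Only \<alpha> z + g(t) and \<beta> t + c0 remain, and comparing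
  coefficients in the cusp equation removes g and c0.\<close>

lemma cusp_automorphism:
  fixes zb tb :: "complex poly poly"
  assumes jac: "br2 zb tb = [:[:j:]:]" "j \<noteq> 0" and cusp: "zb ^ k + tb ^ l = [:[:c:]:] * r0" and c: "c \<noteq> 0"
  obtains \<alpha> \<beta> where "zb = [:0, [:\<alpha>:]:]" "tb = [:[:0, \<beta>:]:]" "\<alpha> ^ k = c" "\<beta> ^ l = c"
proof -
  have nz: "zb \<noteq> 0" "tb \<noteq> 0" using jac by (auto simp: br2_def)
  have cc: "wdeg ([:[:a:]:] * p) = wdeg p" "[:[:a:]:] * p \<noteq> 0" if "a \<noteq> 0" "p \<noteq> 0" for a and p :: "complex poly poly"
    using that wdeg_mult[of "[:[:a:]:]" p] by (simp_all add: wdeg_gens del: mult_pCons_left)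
  have wp: "wdeg (p ^ n) = n * wdeg p" if "p \<noteq> 0" for n and p :: "complex poly poly"
    using that wdeg_gens(4)[of "1::complex"] by (induction n) (auto simp: wdeg_mult one_pCons)
  have oc: "of_nat n = [:[:of_nat n:]:]" for n by (simp add: of_nat_poly)
  have e1: "[:[:c:]:] * br2 r0 tb = [:[:of_nat k * j:]:] * zb ^ (k - 1)"
    using br2_cusp(1)[of zb k tb l] unfolding cusp br2_const jac oc by (simp add: algebra_simps)
  have e2: "[:[:c:]:] * br2 r0 zb = [:[:- (of_nat l * j):]:] * tb ^ (l - 1)"
  proof -
    have neg: "[:[:- (of_nat l * j):]:] = - (of_nat l * [:[:j:]:])" by (simp add: oc)
    show ?thesis
      using br2_cusp(2)[of zb k tb l] unfolding cusp br2_const jac neg by (simp only: ac_simps mult_minus_left mult_minus_right)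
  qed
  have n1: "[:[:of_nat k * j:]:] * zb ^ (k - 1) \<noteq> 0" and n2: "[:[:- (of_nat l * j):]:] * tb ^ (l - 1) \<noteq> 0"
    using nz jac pos by (auto simp del: mult_pCons_left)
  define P Q where "P = wdeg zb" and "Q = wdeg tb"
  have "br2 r0 tb \<noteq> 0" "br2 r0 zb \<noteq> 0" using n1 n2 unfolding e1[symmetric] e2[symmetric] by auto
  from wdeg_br2[OF this(1)] wdeg_br2[OF this(2)]
  have i1: "wdeg (br2 r0 tb) + k + l \<le> k * l + Q" and i2: "wdeg (br2 r0 zb) + k + l \<le> k * l + P"
    by (simp_all add: wdeg_gens P_def Q_def)
  have "wdeg (br2 r0 tb) = (k - 1) * P" "wdeg (br2 r0 zb) = (l - 1) * Q"
    using cc(1)[OF c \<open>br2 r0 tb \<noteq> 0\<close>] cc(1)[OF c \<open>br2 r0 zb \<noteq> 0\<close>] cc(1)[of "of_nat k * j" "zb ^ (k - 1)"]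
      cc(1)[of "- (of_nat l * j)" "tb ^ (l - 1)"] nz jac pos
    unfolding e1 e2 by (simp_all add: wp P_def Q_def del: mult_pCons_left)
  with i1 i2 have 1: "(k - 1) * P + k + l \<le> k * l + Q" and 2: "(l - 1) * Q + k + l \<le> k * l + P" by auto
  \<comment> \<open>m = (k - 1)(l - 1) - 1 is the determinant of the two inequalities and also their
    common right-hand side; being positive, it can be cancelled after elimination.\<close>
  define m where "m = int k * int l - int k - int l"
  have m: "m > 0"
  proof -
    have "int k * int l \<ge> 2 * int l" using k2 by (intro mult_right_mono) auto
    then show ?thesis using kl unfolding m_def by linarith
  qed
  have km: "int (k - 1) = int k - 1" "int (l - 1) = int l - 1" using pos by auto
  have "int ((k - 1) * P + k + l) \<le> int (k * l + Q)" "int ((l - 1) * Q + k + l) \<le> int (k * l + P)"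
    using 1 2 by (simp_all only: of_nat_le_iff)
  then have 1: "(int k - 1) * int P - int Q \<le> m" and 2: "(int l - 1) * int Q - int P \<le> m"
    unfolding m_def of_nat_add of_nat_mult km by linarith+
  have "(int l - 1) * ((int k - 1) * int P - int Q) \<le> (int l - 1) * m"
    using 1 pos by (intro mult_left_mono) auto
  with 2 have "m * int P \<le> m * int l" by (simp add: m_def algebra_simps)
  then have P: "P \<le> l" using m by simp
  have "(int k - 1) * ((int l - 1) * int Q - int P) \<le> (int k - 1) * m"
    using 2 pos by (intro mult_left_mono) auto
  with 1 have "m * int Q \<le> m * int k" by (simp add: m_def algebra_simps)
  then have Q: "Q \<le> k" using m by simp
  have zc: "coeff (coeff zb a) b = 0" if "l * a + k * b > l" for a b
    using wdeg_ge[of zb a b] P that by (auto simp: P_def)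
  have tc: "coeff (coeff tb a) b = 0" if "l * a + k * b > k" for a b
    using wdeg_ge[of tb a b] Q that by (auto simp: Q_def)
  define \<alpha> where "\<alpha> = coeff (coeff zb 1) 0"
  define \<beta> where "\<beta> = coeff (coeff tb 0) 1"
  define g where "g = coeff zb 0"
  define c0 where "c0 = coeff (coeff tb 0) 0"
  have zb: "zb = [:g, [:\<alpha>:]:]"
  proof (intro poly_eqI)
    fix a b
    show "coeff (coeff zb a) b = coeff (coeff [:g, [:\<alpha>:]:] a) b"
      using zc[of a b] pos
      by (cases a; cases b; cases "a - 1") (auto simp: g_def \<alpha>_def coeff_pCons split: nat.splits)
  qed
  have tb: "tb = [:[:c0, \<beta>:]:]"
  proof (intro poly_eqI)
    fix a b
    show "coeff (coeff tb a) b = coeff (coeff [:[:c0, \<beta>:]:] a) b"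
      using tc[of a b] pos kl
      by (cases a; cases b; cases "b - 1") (auto simp: c0_def \<beta>_def coeff_pCons split: nat.splits)
  qed
  have tl: "tb ^ l = [:[:c0, \<beta>:] ^ l:]" unfolding tb by (rule rm_power[OF ring_map_const, symmetric])
  have r0': "[:[:c:]:] * r0 = monom [:c:] k + [:monom c l:]"
    by (simp add: r0_def pz_power pt_power smult_monom smult_add_right)
  have eq: "coeff ([:g, [:\<alpha>:]:] ^ k) i + coeff [:[:c0, \<beta>:] ^ l:] i = coeff (monom [:c:] k + [:monom c l:]) i" for i
    using cusp unfolding tl r0' zb by (metis coeff_add)
  have ck: "[:\<alpha>:] ^ k = [:c:]"
    using eq[of k] pos by (simp add: coeff_linear_poly_power coeff_pCons split: nat.splits)
  then have ak: "\<alpha> ^ k = c" by (simp flip: rm_power[OF ring_map_const])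
  then have a0: "\<alpha> \<noteq> 0" using c pos by auto
  have ch: "k choose (k - 1) = k" "k - (k - 1) = 1" "k - 1 \<le> k"
    using binomial_symmetric[of 1 k] pos by simp_all
  \<comment> \<open>As k \<ge> 2, the exponent k - 1 of z is different from both 0 and k, the only
    ones occurring on the right.\<close>
  have "coeff ([:g, [:\<alpha>:]:] ^ k) (k - 1) = 0"
    using eq[of "k - 1"] k2 by (cases "k - 1") auto
  then have "of_nat k * [:\<alpha>:] ^ (k - 1) * g = 0"
    by (simp only: coeff_linear_poly_power[OF ch(3)] ch(1,2) power_one_right) 
  then have g: "g = 0" using a0 pos by auto
  have "[:c0, \<beta>:] ^ l = monom c l" using eq[of 0] g pos by (simp add: coeff_linear_poly_power zero_power)
  then have e: "coeff ([:c0, \<beta>:] ^ l) i = coeff (monom c l) i" for i by simp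
  have "c0 = 0" using e[of 0] pos by (simp add: coeff_linear_poly_power)
  moreover have "\<beta> ^ l = c" using e[of l] by (simp add: coeff_linear_poly_power)
  ultimately show ?thesis using that zb tb g ak by simp
qed

lemma ring_map_red: "ring_map (\<lambda>p. coeff p 0)"
  by (intro ring_mapI) (auto simp: coeff_mult_0)

lemma red_gens: "coeff vx 0 = 0" "coeff vz 0 = pz" "coeff vt 0 = pt" "coeff (kc c) 0 = [:[:c:]:]" "coeff rr 0 = r0"
  by (simp_all add: vx_def vz_eq vt_eq kc_def rr_eq)

text \<open>Modulo x the condition on \<open>rr\<close> says that the cusp is multiplied by a unit,
  and invertibility makes the Jacobian a nonzero constant, so \<open>cusp_automorphism\<close>
  applies. The cusp and x are multiplied by the same scalar; this is invisible modulo x and is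
  checked on the line z = t = 0.\<close>

lemma reduction_form:
  assumes \<phi>: "ring_map \<phi>" "\<And>c. \<phi> (kc c) = kc c" "\<phi> vx = kc c * vx" "\<phi> rr = u * rr + vx ^ d * b"
    and \<psi>: "ring_map \<psi>" "\<And>c. \<psi> (kc c) = kc c" "\<psi> rr = u' * rr + vx ^ d * b'"
    and inv: "\<And>p. \<phi> (\<psi> p) = (p :: Cxzt)"
  obtains \<alpha> \<beta> j where "coeff (\<phi> vz) 0 = [:0, [:\<alpha>:]:]" "coeff (\<phi> vt) 0 = [:[:0, \<beta>:]:]"
    "\<alpha> ^ k = c" "\<beta> ^ l = c" "br (\<phi> vz) (\<phi> vt) = kc j"
proof -
  have "\<phi> (br (\<psi> vz) (\<psi> vt)) * br (\<phi> vz) (\<phi> vt) = 1"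
    unfolding br_hom[OF \<phi>(1-3), symmetric] inv by simp
  then obtain j where j: "br (\<phi> vz) (\<phi> vt) = kc j" "j \<noteq> 0"
    by (metis mult.commute unit_poly3)
  define zb tb u0 where "zb = coeff (\<phi> vz) 0" and "tb = coeff (\<phi> vt) 0" and "u0 = coeff u 0"
  have jac: "br2 zb tb = [:[:j:]:]" using coeff_br[of "\<phi> vz" "\<phi> vt"] j by (simp add: zb_def tb_def kc_def)
  have prr: "\<phi> rr = \<phi> vz ^ k + \<phi> vt ^ l + kc c * vx"
    by (simp add: rr_def rm_simps[OF \<phi>(1)] \<phi>(3))
  have "coeff (\<phi> vz ^ k + \<phi> vt ^ l + kc c * vx) 0 = coeff (u * rr + vx ^ d * b) 0"
    using prr \<phi>(4) by simp
  then have cusp: "zb ^ k + tb ^ l = u0 * r0"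
    using pos by (simp add: rm_simps[OF ring_map_red] red_gens zb_def tb_def u0_def)
  have "rr = \<phi> u' * (u * rr + vx ^ d * b) + (kc c * vx) ^ d * \<phi> b'"
    using inv[of rr] by (simp add: \<psi>(3) rm_simps[OF \<phi>(1)] \<phi>(3,4))
  then have "coeff rr 0 = coeff (\<phi> u' * (u * rr + vx ^ d * b) + (kc c * vx) ^ d * \<phi> b') 0" by simp
  then have "r0 = coeff (\<phi> u') 0 * (u0 * r0)"
    using pos by (simp add: rm_simps[OF ring_map_red] red_gens u0_def zero_power)
  then have "r0 * (u0 * coeff (\<phi> u') 0) = r0 * 1" by (simp add: ac_simps)
  then have "u0 * coeff (\<phi> u') 0 = 1" by (metis mult_cancel_left zt_nz(3))
  then obtain c' where c': "u0 = [:[:c':]:]" "c' \<noteq> 0" by (rule unit_const_const)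
  obtain \<alpha> \<beta> where ab: "zb = [:0, [:\<alpha>:]:]" "tb = [:[:0, \<beta>:]:]" "\<alpha> ^ k = c'" "\<beta> ^ l = c'"
    using cusp_automorphism[OF jac j(2) _ c'(2)] cusp c'(1) by metis
  \<comment> \<open>Restriction to z = t = 0. There the images of z and t vanish at x = 0, so their
    k-th and l-th powers have no linear term; nor has the multiple of x^d. Comparing the terms
    linear in x identifies the two scalars, which uses k, l, d \<ge> 2.\<close>
  define \<epsilon> :: "Cxzt \<Rightarrow> complex poly" where "\<epsilon> = map_poly (\<lambda>q. poly (poly q 0) 0)"
  have re: "ring_map \<epsilon>" unfolding \<epsilon>_def
    by (intro ring_map_map_poly ring_map_comp[OF ring_map_poly ring_map_poly])
  have ce: "coeff (\<epsilon> p) i = poly (poly (coeff p i) 0) 0" for p i by (simp add: \<epsilon>_def coeff_map_poly)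
  have x: "\<epsilon> vx = [:0, 1:]" by (simp add: \<epsilon>_def vx_def map_poly_pCons)
  have rre: "\<epsilon> rr = [:0, 1:]" using pos
    by (simp add: \<epsilon>_def rr_eq map_poly_pCons r0_def pz_def pt_def power_0_left)
  have sq: "coeff (f ^ n) (Suc 0) = 0" if "coeff f 0 = 0" "n \<ge> 2" for f :: "complex poly" and n
  proof -
    obtain a g where "f = pCons a g" by (cases f)
    then have g: "f = [:0, 1:] * g" using that(1) by simp
    show ?thesis using that(2) unfolding g power_mult_distrib
      by (simp add: coeff_monom_mult flip: monom_altdef[of 1, simplified])
  qed
  have "\<epsilon> (\<phi> vz) ^ k + \<epsilon> (\<phi> vt) ^ l + \<epsilon> (kc c) * [:0, 1:] = \<epsilon> u * [:0, 1:] + [:0, 1:] ^ d * \<epsilon> b"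
    using arg_cong[OF trans[OF prr[symmetric] \<phi>(4)], of \<epsilon>] by (simp add: rm_simps[OF re] x rre del: mult_pCons_right)
  then have "coeff (\<epsilon> (\<phi> vz) ^ k + \<epsilon> (\<phi> vt) ^ l + \<epsilon> (kc c) * [:0, 1:]) 1 = coeff (\<epsilon> u * [:0, 1:] + [:0, 1:] ^ d * \<epsilon> b) 1"
    by simp
  moreover have "coeff (\<epsilon> (\<phi> vz)) 0 = 0" "coeff (\<epsilon> (\<phi> vt)) 0 = 0"
    using ab by (simp_all add: ce zb_def tb_def)
  moreover have "coeff ([:0, 1:] ^ d * \<epsilon> b) 1 = 0"
    using d2 by (simp add: coeff_monom_mult flip: monom_altdef[of 1, simplified])
  ultimately have "coeff (\<epsilon> (kc c)) 0 = coeff (\<epsilon> u) 0" using k2 kl by (simp add: sq)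
  then have "c = c'" using c' by (simp add: ce kc_def u0_def)
  then show ?thesis using that ab j by (simp add: zb_def tb_def)
qed

end

section \<open>Lifting automorphisms of Jacobian one modulo powers of \<open>x\<close>\<close>

text \<open>Domains in which positive integers are invertible: this is what integration of
  polynomials and exponentials require, over the complex numbers as well as over a ring of
  parameters.\<close>

class rational_algebra = idom + ring_char_0 +
  assumes of_nat_unit: "n > 0 \<Longrightarrow> \<exists>q. of_nat n * q = 1"

instance complex :: rational_algebra
proof
  fix n :: nat
  assume "n > 0"
  then show "\<exists>q. of_nat n * q = (1 :: complex)" by (intro exI[of _ "1 / of_nat n"]) simp
qed

instance poly :: (rational_algebra) rational_algebra
proof
  fix n :: nat
  assume "n > 0"
  then obtain q :: 'a where "of_nat n * q = 1" using of_nat_unit by blast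
  then show "\<exists>q. of_nat n * q = (1 :: 'a poly)"
    by (intro exI[of _ "[:q:]"]) (simp add: of_nat_poly one_pCons mult.commute)
qed

lemma pderiv_surj: "\<exists>q. pderiv q = (p :: 'a::rational_algebra poly)"
proof -
  have m: "\<exists>q. pderiv q = monom a n" for a :: 'a and n
  proof -
    obtain c :: 'a where c: "of_nat (Suc n) * c = 1" using of_nat_unit[of "Suc n"] by blast
    have "pderiv (monom (a * c) (Suc n)) = monom a n"
      using c by (simp add: pderiv_monom mult.left_commute del: of_nat_Suc)
    then show ?thesis by blast
  qed
  have "\<exists>q. pderiv q = (\<Sum>i\<in>S. monom (coeff p i) i)" if "finite S" for S
    using that
  proof induction
    case empty
    show ?case by (rule exI[of _ 0]) simp
  next
    case (insert i S)
    obtain q1 q2 where "pderiv q1 = monom (coeff p i) i" "pderiv q2 = (\<Sum>i\<in>S. monom (coeff p i) i)"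
      using m insert.IH by blast
    then have "pderiv (q1 + q2) = (\<Sum>i\<in>insert i S. monom (coeff p i) i)"
      using insert.hyps by (simp add: pderiv_add)
    then show ?case by blast
  qed
  from this[OF finite_atMost, of "degree p"] show ?thesis by (simp add: poly_as_sum_of_monoms)
qed

lemma pderiv_commute: "pderiv (map_poly pderiv p) = map_poly pderiv (pderiv (p :: 'a::idom poly poly))"
  by (rule poly_eqI) (simp add: coeff_pderiv coeff_map_poly dv_simps[OF derivation_pderiv] del: of_nat_Suc)

text \<open>The polynomial Poincare lemma in the plane: a divergence-free vector field is
  Hamiltonian. Integrate in z; what is left depends on t alone and is integrated in t.\<close>

lemma potential_exists:
  fixes a b :: "'a::rational_algebra poly poly"
  assumes "pderiv a + map_poly pderiv b = 0"
  obtains H where "pderiv H = b" "map_poly pderiv H = - a"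
proof -
  obtain H1 where H1: "pderiv H1 = b" using pderiv_surj by blast
  have "pderiv (- a - map_poly pderiv H1) = 0"
    using assms by (simp add: d2_simps pderiv_commute H1) (metis neg_eq_iff_add_eq_0)
  then obtain c where c: "- a - map_poly pderiv H1 = [:c:]"
    by (metis degree_eq_zeroE pderiv_eq_0_iff)
  obtain h where h: "pderiv h = c" using pderiv_surj by blast
  have "map_poly pderiv (H1 + [:h:]) = - a"
    using c h by (simp add: d2_simps map_poly_pCons flip: c)
  moreover have "pderiv (H1 + [:h:]) = b" by (simp add: pderiv_add H1)
  ultimately show ?thesis using that by blast
qed

section \<open>Automorphisms over x of Jacobian one and their leading Hamiltonians\<close>

definition xaut :: "('a::idom poly poly poly \<Rightarrow> 'a poly poly poly) \<Rightarrow> bool"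
  where "xaut \<psi> \<longleftrightarrow> ring_map \<psi> \<and> (\<forall>c. \<psi> (kc c) = kc c) \<and> \<psi> vx = vx \<and> br (\<psi> vz) (\<psi> vt) = 1 \<and>
    (\<exists>\<psi>'. ring_map \<psi>' \<and> (\<forall>p. \<psi> (\<psi>' p) = p) \<and> (\<forall>p. \<psi>' (\<psi> p) = p))"

lemma xautD: assumes "xaut \<psi>"
  shows "ring_map \<psi>" "\<psi> (kc c) = kc c" "\<psi> vx = vx" "br (\<psi> p) (\<psi> q) = \<psi> (br p q)"
proof -
  show r: "ring_map \<psi>" "\<psi> (kc c) = kc c" "\<psi> vx = vx" for c using assms by (auto simp: xaut_def)
  have "\<psi> vx = kc 1 * vx" using r by (simp add: rm_1[OF ring_map_kc])
  from br_hom[OF r(1,2) this] have "br (\<psi> p) (\<psi> q) = \<psi> (br p q) * br (\<psi> vz) (\<psi> vt)" .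
  moreover have "br (\<psi> vz) (\<psi> vt) = 1" using assms unfolding xaut_def by blast
  ultimately show "br (\<psi> p) (\<psi> q) = \<psi> (br p q)" by simp
qed

lemma xaut_inverse: assumes "xaut \<psi>"
  obtains \<psi>' where "xaut \<psi>'" "\<And>p. \<psi> (\<psi>' p) = p" "\<And>p. \<psi>' (\<psi> p) = p"
proof -
  obtain \<psi>' where \<psi>': "ring_map \<psi>'" "\<And>p. \<psi> (\<psi>' p) = p" "\<And>p. \<psi>' (\<psi> p) = p"
    using assms by (auto simp: xaut_def)
  have "\<psi> (br (\<psi>' vz) (\<psi>' vt)) = 1" unfolding xautD(4)[OF assms, symmetric] \<psi>' by simp
  then have "br (\<psi>' vz) (\<psi>' vt) = 1" using \<psi>'(3) rm_1[OF \<psi>'(1)] by metis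
  moreover have "\<psi>' (kc c) = kc c" "\<psi>' vx = vx" for c
    using \<psi>'(3)[of "kc c"] \<psi>'(3)[of vx] by (simp_all add: xautD[OF assms])
  moreover have "ring_map \<psi>" by (rule xautD[OF assms])
  ultimately have "xaut \<psi>'" unfolding xaut_def using \<psi>' by blast
  then show ?thesis using that \<psi>' by blast
qed

lemma xaut_id: "xaut (\<lambda>p. p)"
  unfolding xaut_def by (auto intro!: exI[of _ "\<lambda>p. p"] ring_map_id)

lemma xaut_comp: assumes "xaut \<psi>" "xaut \<chi>" shows "xaut (\<lambda>p. \<psi> (\<chi> p))"
proof -
  obtain \<psi>' where \<psi>': "xaut \<psi>'" "\<And>p. \<psi> (\<psi>' p) = p" "\<And>p. \<psi>' (\<psi> p) = p" using xaut_inverse[OF assms(1)] by blast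
  obtain \<chi>' where \<chi>': "xaut \<chi>'" "\<And>p. \<chi> (\<chi>' p) = p" "\<And>p. \<chi>' (\<chi> p) = p" using xaut_inverse[OF assms(2)] by blast
  have "ring_map (\<lambda>p. \<chi>' (\<psi>' p))" by (rule ring_map_comp[OF xautD(1)[OF \<chi>'(1)] xautD(1)[OF \<psi>'(1)]])
  moreover have "ring_map (\<lambda>p. \<psi> (\<chi> p))" by (rule ring_map_comp[OF xautD(1)[OF assms(1)] xautD(1)[OF assms(2)]])
  moreover have "br (\<chi> vz) (\<chi> vt) = 1" using xautD(4)[OF assms(2), of vz vt] by (simp add: rm_1[OF xautD(1)[OF assms(2)]])
  ultimately show ?thesis unfolding xaut_def
    using \<psi>' \<chi>' by (auto simp: xautD[OF assms(1)] xautD[OF assms(2)] rm_1[OF xautD(1)[OF assms(1)]]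
        intro!: exI[of _ "\<lambda>p. \<chi>' (\<psi>' p)"])
qed

text \<open>The automorphism is x^n times a Hamiltonian vector field away from the identity, modulo
  x^(n+1). Only \<open>H\<close> modulo x matters, so \<open>H\<close> may be exchanged for another
  representative of the same leading term.\<close>

definition infl :: "nat \<Rightarrow> 'a::idom poly poly poly \<Rightarrow> ('a poly poly poly \<Rightarrow> 'a poly poly poly) \<Rightarrow> bool"
  where "infl n H \<psi> \<longleftrightarrow> (\<forall>p. vx ^ Suc n dvd \<psi> p - p - vx ^ n * br H p)"

lemma dvd_diff_swap: "a dvd b - c \<Longrightarrow> a dvd c - (b :: 'a::comm_ring_1)"
  using dvd_minus_iff[of a "b - c"] by simp

lemma vx_nz [simp]: "vx \<noteq> 0"
  by (simp add: vx_def)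

lemma inflE: assumes "infl n H \<psi>" obtains w where "\<psi> p = p + vx ^ n * br H p + vx ^ Suc n * w"
proof -
  obtain w where "\<psi> p - p - vx ^ n * br H p = vx ^ Suc n * w" using assms by (auto simp: infl_def dvd_def)
  then have "\<psi> p = p + vx ^ n * br H p + vx ^ Suc n * w" by (simp only: diff_eq_eq ac_simps)
  then show ?thesis by (rule that)
qed

lemma inflI: "\<psi> p = p + vx ^ n * br H p + vx ^ Suc n * w \<Longrightarrow> vx ^ Suc n dvd \<psi> p - p - vx ^ n * br H p"
  by (simp add: algebra_simps)

text \<open>The condition passes to products because the product of two correction terms is
  divisible by x^(2 n), and 2 n \<ge> n + 1 for positive n.\<close>

lemma infl_gensI:
  assumes \<psi>: "ring_map \<psi>" "\<And>c. \<psi> (kc c) = kc c" "\<psi> vx = vx" and n: "n > 0"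
    and z: "vx ^ Suc n dvd \<psi> vz - vz - vx ^ n * br H vz" and t: "vx ^ Suc n dvd \<psi> vt - vt - vx ^ n * br H vt"
  shows "infl n H \<psi>"
  unfolding infl_def
proof
  fix p
  obtain m where m: "n = Suc m" using n by (cases n) auto
  show "vx ^ Suc n dvd \<psi> p - p - vx ^ n * br H p"
  proof (induction p rule: poly3_induct)
    case (add p q)
    have "\<psi> (p + q) - (p + q) - vx ^ n * br H (p + q) = (\<psi> p - p - vx ^ n * br H p) + (\<psi> q - q - vx ^ n * br H q)"
      by (simp add: rm_add[OF \<psi>(1)] dv_add[OF derivation_br] algebra_simps)
    then show ?case by (simp only: dvd_add[OF add.IH])
  next
    case (mult p q)
    have "\<psi> (p * q) - p * q - vx ^ n * br H (p * q)
       = (\<psi> p - p - vx ^ n * br H p) * \<psi> q + (p + vx ^ n * br H p) * (\<psi> q - q - vx ^ n * br H q)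
         + vx ^ Suc n * (vx ^ m * br H p * br H q)"
      by (simp add: rm_mult[OF \<psi>(1)] dv_mult[OF derivation_br] m algebra_simps)
    then show ?case
      by (simp only: dvd_add[OF dvd_add[OF dvd_mult2[OF mult.IH(1)] dvd_mult[OF mult.IH(2)]] dvd_triv_left])
  qed (use \<psi> z t in auto)
qed

lemma infl_comp:
  assumes \<psi>: "xaut \<psi>" and n: "n > 0" and H: "infl n H \<psi>" and K: "infl n K \<chi>"
  shows "infl n (H + K) (\<lambda>p. \<psi> (\<chi> p))"
  unfolding infl_def
proof
  fix p
  obtain m where m: "n = Suc m" using n by (cases n) auto
  note r = xautD(1,3)[OF \<psi>]
  obtain w where w: "\<chi> p = p + vx ^ n * br K p + vx ^ Suc n * w" using inflE[OF K] by blast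
  obtain w1 where w1: "\<psi> p = p + vx ^ n * br H p + vx ^ Suc n * w1" using inflE[OF H] by blast
  obtain w2 where w2: "\<psi> (br K p) = br K p + vx ^ n * br H (br K p) + vx ^ Suc n * w2" using inflE[OF H] by blast
  have "\<psi> (\<chi> p) = \<psi> p + vx ^ n * \<psi> (br K p) + vx ^ Suc n * \<psi> w"
    unfolding w by (simp add: rm_simps[OF r(1)] r(2))
  also have "\<dots> = p + vx ^ n * br (H + K) p + vx ^ Suc n * (w1 + \<psi> w + vx ^ m * (br H (br K p) + vx * w2))"
    unfolding w1 w2 by (simp add: m br_left algebra_simps)
  finally show "vx ^ Suc n dvd \<psi> (\<chi> p) - p - vx ^ n * br (H + K) p" by (rule inflI)
qed

lemma infl_inverse:
  assumes \<psi>': "xaut \<psi>'" and inv: "\<And>p. \<psi>' (\<psi> p) = p" and H: "infl n H \<psi>" and n: "n > 0"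
  shows "infl n (- H) \<psi>'"
proof -
  obtain m where m: "n = Suc m" using n by (cases n) auto
  note r = xautD(1,3)[OF \<psi>']
  have small: "vx ^ n dvd \<psi>' p - p" for p
  proof -
    obtain w where w: "\<psi> p = p + vx ^ n * br H p + vx ^ Suc n * w" using inflE[OF H] by blast
    have "p = \<psi>' p + vx ^ n * (\<psi>' (br H p) + vx * \<psi>' w)"
      using inv[of p] unfolding w by (simp add: rm_simps[OF r(1)] r(2) algebra_simps)
    then have "\<psi>' p - p = vx ^ n * - (\<psi>' (br H p) + vx * \<psi>' w)" by (simp add: algebra_simps)
    then show ?thesis by (metis dvd_triv_left)
  qed
  show ?thesis unfolding infl_def
  proof
    fix p
    obtain w where w: "\<psi> p = p + vx ^ n * br H p + vx ^ Suc n * w" using inflE[OF H] by blast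
    obtain w2 where w2: "\<psi>' (br H p) - br H p = vx ^ n * w2" using small by (auto simp: dvd_def)
    have "p = \<psi>' p + vx ^ n * \<psi>' (br H p) + vx ^ Suc n * \<psi>' w"
      using inv[of p] unfolding w by (simp add: rm_simps[OF r(1)] r(2))
    also have "\<psi>' (br H p) = br H p + vx ^ n * w2" using w2 by (simp add: algebra_simps)
    finally have "\<psi>' p = p + vx ^ n * br (- H) p + vx ^ Suc n * (- \<psi>' w - vx ^ m * w2)"
      by (simp add: m br_left algebra_simps)
    then show "vx ^ Suc n dvd \<psi>' p - p - vx ^ n * br (- H) p" by (rule inflI)
  qed
qed

text \<open>Preserving the bracket, \<tau> carries the Hamiltonian vector field of \<open>H\<close>
  to that of \<open>\<tau> H\<close>.\<close>

lemma infl_conj: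
  assumes \<tau>: "xaut \<tau>" and inv: "\<And>p. \<tau> (\<tau>' p) = p" and H: "infl n H s"
  shows "infl n (\<tau> H) (\<lambda>p. \<tau> (s (\<tau>' p)))"
  unfolding infl_def
proof
  fix p
  obtain w where w: "s (\<tau>' p) = \<tau>' p + vx ^ n * br H (\<tau>' p) + vx ^ Suc n * w" using inflE[OF H] by blast
  have "\<tau> (s (\<tau>' p)) = p + vx ^ n * br (\<tau> H) p + vx ^ Suc n * \<tau> w"
    unfolding w using xautD(4)[OF \<tau>, of H "\<tau>' p"] by (simp add: rm_simps[OF xautD(1)[OF \<tau>]] xautD(3)[OF \<tau>] inv)
  then show "vx ^ Suc n dvd \<tau> (s (\<tau>' p)) - p - vx ^ n * br (\<tau> H) p" by (rule inflI)
qed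

section \<open>Realizing every Hamiltonian in z and t by products of shears\<close>

definition realizable :: "nat \<Rightarrow> 'a::idom poly poly \<Rightarrow> bool"
  where "realizable n H \<longleftrightarrow> (\<exists>\<psi>. xaut \<psi> \<and> infl n [:H:] \<psi>)"

lemma realizable_add: "n > 0 \<Longrightarrow> realizable n H \<Longrightarrow> realizable n K \<Longrightarrow> realizable n (H + K)"
proof -
  assume n: "n > 0" and "realizable n H" "realizable n K"
  then obtain \<psi> \<chi> where *: "xaut \<psi>" "infl n [:H:] \<psi>" "xaut \<chi>" "infl n [:K:] \<chi>"
    by (auto simp: realizable_def)
  have "infl n [:H + K:] (\<lambda>p. \<psi> (\<chi> p))" using infl_comp[OF *(1) n *(2,4)] by simp
  then show ?thesis using xaut_comp[OF *(1,3)] unfolding realizable_def by blast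
qed

lemma realizable_minus: "n > 0 \<Longrightarrow> realizable n H \<Longrightarrow> realizable n (- H)"
proof -
  assume n: "n > 0" and "realizable n H"
  then obtain \<psi> where *: "xaut \<psi>" "infl n [:H:] \<psi>" by (auto simp: realizable_def)
  obtain \<psi>' where **: "xaut \<psi>'" "\<And>p. \<psi>' (\<psi> p) = p" using xaut_inverse[OF *(1)] by metis
  have "infl n [:- H:] \<psi>'" using infl_inverse[OF ** *(2) n] by simp
  then show ?thesis using **(1) unfolding realizable_def by blast
qed

lemma realizable_0: "realizable n 0"
  unfolding realizable_def using xaut_id by (force simp: infl_def br_left)

lemma realizable_sum: "n > 0 \<Longrightarrow> (\<And>i. i \<in> S \<Longrightarrow> realizable n (f i)) \<Longrightarrow> realizable n (sum f S)"
  by (induction S rule: infinite_finite_induct) (auto intro: realizable_add realizable_0)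

definition shear_z :: "'a::idom poly poly poly \<Rightarrow> 'a poly poly poly \<Rightarrow> 'a poly poly poly"
  where "shear_z w = subst3 kc vx (vz + w) vt"
definition shear_t :: "'a::idom poly poly poly \<Rightarrow> 'a poly poly poly \<Rightarrow> 'a poly poly poly"
  where "shear_t w = subst3 kc vx vz (vt + w)"

lemma shear_gens:
  "ring_map (shear_z w)" "shear_z w (kc c) = kc c" "shear_z w vx = vx" "shear_z w vz = vz + w" "shear_z w vt = vt"
  "ring_map (shear_t w)" "shear_t w (kc c) = kc c" "shear_t w vx = vx" "shear_t w vz = vz" "shear_t w vt = vt + w"
  by (simp_all add: shear_z_def shear_t_def subst3_gens[OF ring_map_kc] ring_map_subst3[OF ring_map_kc])

lemma xaut_shear_z:
  assumes "\<And>v. shear_z v w = w" "dz w = 0"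
  shows "xaut (shear_z w)"
proof -
  have i: "shear_z v (shear_z (- v) p) = p" if "v = w \<or> v = - w" for v p
  proof (rule ring_map_poly3_eq[where p = p])
    show "ring_map (\<lambda>p. shear_z v (shear_z (- v) p))"
      by (rule ring_map_comp[OF shear_gens(1) shear_gens(1)])
    have "shear_z v v = v" using that assms(1) by (auto simp: rm_minus[OF shear_gens(1)])
    then show "shear_z v (shear_z (- v) vz) = vz" by (simp add: shear_gens rm_diff[OF shear_gens(1)])
  qed (auto simp: shear_gens ring_map_id)
  show ?thesis unfolding xaut_def
    using i[of w] i[of "- w"] assms(2)
    by (auto simp: shear_gens br_def dv_simps[OF derivation_dz] dv_simps[OF derivation_dt] intro!: exI[of _ "shear_z (- w)"])
qed

lemma xaut_shear_t:
  assumes "\<And>v. shear_t v w = w" "dt w = 0"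
  shows "xaut (shear_t w)" "\<And>p. shear_t w (shear_t (- w) p) = p" "xaut (shear_t (- w))"
proof -
  have i: "shear_t v (shear_t (- v) p) = p" if "v = w \<or> v = - w" for v p
  proof (rule ring_map_poly3_eq[where p = p])
    show "ring_map (\<lambda>p. shear_t v (shear_t (- v) p))"
      by (rule ring_map_comp[OF shear_gens(6) shear_gens(6)])
    have "shear_t v v = v" using that assms(1) by (auto simp: rm_minus[OF shear_gens(6)])
    then show "shear_t v (shear_t (- v) vt) = vt" by (simp add: shear_gens rm_diff[OF shear_gens(6)])
  qed (auto simp: shear_gens ring_map_id)
  then show "\<And>p. shear_t w (shear_t (- w) p) = p" by blast
  show "xaut (shear_t w)" unfolding xaut_def
    using i[of w] i[of "- w"] assms(2)
    by (auto simp: shear_gens br_def dv_simps[OF derivation_dz] dv_simps[OF derivation_dt]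
        intro!: exI[of _ "shear_t (- w)"])
  show "xaut (shear_t (- w))" unfolding xaut_def
    using i[of w] i[of "- w"] assms(2)
    by (auto simp: shear_gens br_def dv_simps[OF derivation_dz] dv_simps[OF derivation_dt]
        intro!: exI[of _ "shear_t w"])
qed

lemma ring_map_tpoly: "ring_map (\<lambda>p. [:[:p:]:])"
  by (intro ring_map_comp[OF ring_map_const] ring_map_const)

lemma dt_tpoly: "dt [:[:p:]:] = [:[:pderiv p:]:]" and dz_tpoly: "dz [:[:p:]:] = 0"
  by (simp_all add: dt_def dz_def map_poly_pCons)

lemma shear_z_tpoly: "shear_z w [:[:p:]:] = [:[:p:]:]"
  by (rule ring_map_poly_eq[OF ring_map_comp[OF shear_gens(1) ring_map_tpoly] ring_map_tpoly])
     (simp_all add: shear_gens flip: kc_def vt_def)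

lemma shear_t_zpoly: "shear_t w (ev kc vz q) = ev kc vz q"
  by (rule ring_map_poly_eq[OF ring_map_comp[OF shear_gens(6) ring_map_ev[OF ring_map_kc]] ring_map_ev[OF ring_map_kc]])
     (simp_all add: ev_const ev_X ring_map_kc shear_gens)

lemma dt_zpoly: "dt (ev kc vz q) = 0"
  by (induction q) (simp_all add: ev_0 ev_pCons[OF ring_map_kc] dv_simps[OF derivation_dt])

text \<open>The flow of the Hamiltonian x^n p(t) is polynomial: at time 1 it is the shear of z by
  -x^n p'(t).\<close>

lemma realizable_tpoly: assumes n: "n > 0" shows "realizable n [:p:]"
proof -
  define w where "w = vx ^ n * [:[:- pderiv p:]:]"
  have "shear_z v w = w" for v
    unfolding w_def by (simp add: rm_simps[OF shear_gens(1)] shear_gens shear_z_tpoly del: mult_pCons_right)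
  moreover have "dz w = 0" by (simp add: w_def dv_simps[OF derivation_dz] dz_tpoly del: mult_pCons_right)
  ultimately have "xaut (shear_z w)" by (rule xaut_shear_z)
  moreover have "infl n [:[:p:]:] (shear_z w)"
    by (rule infl_gensI) (simp_all add: shear_gens n dt_tpoly dz_tpoly w_def del: mult_pCons_right)
  ultimately show ?thesis unfolding realizable_def by blast
qed

lemma realizable_conj:
  assumes "realizable n H" and K: "shear_t (ev kc vz q) [:H:] = [:K:]"
  shows "realizable n K"
proof -
  let ?w = "ev kc vz q"
  note s = xaut_shear_t[OF shear_t_zpoly dt_zpoly, of q]
  obtain \<psi> where \<psi>: "xaut \<psi>" "infl n [:H:] \<psi>" using assms(1) by (auto simp: realizable_def)
  have "infl n [:K:] (\<lambda>p. shear_t ?w (\<psi> (shear_t (- ?w) p)))"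
    using infl_conj[OF s(1,2) \<psi>(2)] K by simp
  moreover have "xaut (\<lambda>p. shear_t ?w (\<psi> (shear_t (- ?w) p)))"
    by (rule xaut_comp[OF s(1) xaut_comp[OF \<psi>(1) s(3)]])
  ultimately show ?thesis unfolding realizable_def by blast
qed

text \<open>Conjugating the Hamiltonian t^(j+1) by the shear of t by z^i realizes (t + z^i)^(j+1).
  Its expansion contains (j + 1) z^i t^j, the pure power t^(j+1), and otherwise only lower powers of
  t, which the induction covers. The constant \<open>c\<close> is the inverse of j + 1.\<close>

lemma realizable_monom: assumes n: "n > 0"
  shows "realizable n (monom (monom (a :: 'a::rational_algebra) j) i)"
proof (induction j arbitrary: a i rule: less_induct)
  case (less j)
  obtain c :: 'a where c: "of_nat (Suc j) * c = 1" using of_nat_unit[of "Suc j"] by blast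
  define T Z :: "'a poly poly" where "T = [:[:0, 1:]:]" and "Z = [:0, 1:]"
  have mon: "monom (monom b m) e = [:[:b:]:] * (T ^ m * Z ^ e)" for b m e
  proof -
    have "T ^ m = [:monom 1 m:]" unfolding T_def
      by (subst rm_power[OF ring_map_const, symmetric]) (simp add: monom_altdef)
    moreover have "Z ^ e = monom 1 e" by (simp add: Z_def monom_altdef)
    ultimately show ?thesis by (simp add: smult_monom)
  qed
  define K where "K = [:[:a * c:]:] * (T + Z ^ i) ^ Suc j"
  have "shear_t (ev kc vz (monom 1 i)) [:[:monom (a * c) (Suc j):]:] = [:K:]"
  proof -
    have e: "ev kc vz (monom 1 i) = vz ^ i"
      by (simp add: monom_altdef rm_power[OF ring_map_ev[OF ring_map_kc]] ev_X ring_map_kc)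
    have "[:[:monom (a * c) (Suc j):]:] = kc (a * c) * vt ^ Suc j"
    proof -
      have "(vt :: 'a poly poly poly) ^ m = [:[:monom 1 m:]:]" for m unfolding vt_def
        by (subst rm_power[OF ring_map_tpoly, symmetric]) (simp add: monom_altdef)
      then show ?thesis by (simp add: kc_def smult_monom del: power_Suc)
    qed
    also have "shear_t (vz ^ i) \<dots> = kc (a * c) * (vt + vz ^ i) ^ Suc j"
      by (simp only: rm_simps[OF shear_gens(6)] shear_gens)
    also have "\<dots> = [:K:]"
    proof -
      have "vt = [:T:]" "vz = [:Z:]" "kc (a * c) = [:[:[:a * c:]:]:]" by (simp_all add: T_def Z_def vt_def vz_def kc_def)
      then show ?thesis unfolding K_def
        by (simp only: rm_mult[OF ring_map_const] rm_add[OF ring_map_const] rm_power[OF ring_map_const])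
    qed
    finally show ?thesis by (simp add: e)
  qed
  then have rK: "realizable n K" by (rule realizable_conj[OF realizable_tpoly[OF n]])
  have "K = (\<Sum>m\<le>Suc j. [:[:of_nat (Suc j choose m) * (a * c):]:] * (T ^ m * Z ^ (i * (Suc j - m))))"
    unfolding K_def binomial_ring sum_distrib_left
    by (rule sum.cong) (simp_all add: of_nat_poly power_mult mult.left_commute flip: power_mult, simp add: algebra_simps)
  also have "\<dots> = (\<Sum>m\<le>Suc j. monom (monom (of_nat (Suc j choose m) * (a * c)) m) (i * (Suc j - m)))"
    by (simp only: mon)
  also have "\<dots> = monom (monom (a * c) (Suc j)) 0 + (monom (monom a j) i
      + (\<Sum>m<j. monom (monom (of_nat (Suc j choose m) * (a * c)) m) (i * (Suc j - m))))"
  proof -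
    have "of_nat (Suc j choose j) * (a * c) = a" using c by (simp add: mult.left_commute del: of_nat_Suc)
    then show ?thesis by (simp add: lessThan_Suc_atMost[symmetric] add_ac del: binomial_Suc_Suc)
  qed
  finally have eq: "monom (monom a j) i = K + - monom (monom (a * c) (Suc j)) 0
      + - (\<Sum>m<j. monom (monom (of_nat (Suc j choose m) * (a * c)) m) (i * (Suc j - m)))"
    by simp
  have R: "realizable n (monom (monom (a * c) (Suc j)) 0)"
    using realizable_tpoly[OF n] by (simp add: monom_0)
  have "realizable n (\<Sum>m<j. monom (monom (of_nat (Suc j choose m) * (a * c)) m) (i * (Suc j - m)))"
    by (rule realizable_sum[OF n less.IH]) simp
  then show ?case unfolding eq
    by (intro realizable_add[OF n realizable_add[OF n rK realizable_minus[OF n R]] realizable_minus[OF n]])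
qed

lemma realizable: assumes n: "n > 0" shows "realizable n (H :: 'a::rational_algebra poly poly)"
proof -
  have "realizable n (monom q i)" for q :: "'a poly" and i
  proof -
    have "monom q i = (\<Sum>j\<le>degree q. monom (monom (coeff q j) j) i)"
      by (subst poly_as_sum_of_monoms[of q, symmetric]) (simp add: monom_sum)
    then show ?thesis by (simp only: realizable_sum[OF n realizable_monom[OF n]])
  qed
  then show ?thesis
    using realizable_sum[OF n, of "{..degree H}" "\<lambda>i. monom (coeff H i) i"] by (simp add: poly_as_sum_of_monoms)
qed

text \<open>Modulo x^(m+1) the Jacobian is 1 plus x^m times the divergence of the leading vector
  field. The divergence thus vanishes modulo x, and \<open>potential_exists\<close> supplies the
  Hamiltonian.\<close>

lemma xaut_congruent_to_id_level:
  fixes \<eta> :: "'a::rational_algebra poly poly poly \<Rightarrow> 'a poly poly poly"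
  assumes \<eta>: "ring_map \<eta>" "\<And>c. \<eta> (kc c) = kc c" "\<eta> vx = vx" and m: "m > 0"
    and c: "\<And>p. vx ^ m dvd \<eta> p - p" and jac: "vx ^ Suc m dvd br (\<eta> vz) (\<eta> vt) - 1"
  obtains H where "infl m [:H:] \<eta>"
proof -
  obtain a where a: "\<eta> vz - vz = vx ^ m * a" using c by (auto simp: dvd_def)
  obtain b where b: "\<eta> vt - vt = vx ^ m * b" using c by (auto simp: dvd_def)
  obtain n where n: "m = Suc n" using m by (cases m) auto
  have ez: "\<eta> vz = vz + vx ^ m * a" and et: "\<eta> vt = vt + vx ^ m * b" using a b by (auto simp: algebra_simps)
  have "br (\<eta> vz) (\<eta> vt) - 1 = vx ^ m * (dz a + dt b) + vx ^ Suc m * (vx ^ n * br a b)"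
    unfolding ez et by (simp add: br_def dv_simps[OF derivation_dz] dv_simps[OF derivation_dt] n algebra_simps)
  then have "vx ^ Suc m dvd vx ^ m * (dz a + dt b)"
    using jac by (metis dvd_add_left_iff dvd_triv_left)
  then have "vx dvd dz a + dt b" by (simp add: mult.commute[of vx])
  then have "pderiv (coeff a 0) + map_poly pderiv (coeff b 0) = 0"
    by (simp add: vx_dvd_iff dz_def dt_def coeff_map_poly)
  then obtain H where H: "pderiv H = coeff b 0" "map_poly pderiv H = - coeff a 0"
    by (rule potential_exists)
  have d: "dz [:H:] = [:coeff b 0:]" "dt [:H:] = - [:coeff a 0:]"
    by (simp_all add: dz_def dt_def map_poly_pCons H)
  have dv: "vx ^ Suc m dvd vx ^ m * (p - [:coeff p 0:])" for p :: "'a poly poly poly"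
  proof -
    have "vx dvd p - [:coeff p 0:]" by (simp add: vx_dvd_iff)
    then show ?thesis by (simp add: mult.commute[of vx] mult_dvd_mono)
  qed
  have "infl m [:H:] \<eta>"
  proof (rule infl_gensI[OF \<eta> m])
    have "\<eta> vz - vz - vx ^ m * br [:H:] vz = vx ^ m * (a - [:coeff a 0:])"
      by (simp add: ez d algebra_simps del: mult_pCons_right)
    then show "vx ^ Suc m dvd \<eta> vz - vz - vx ^ m * br [:H:] vz" using dv by simp
    have "\<eta> vt - vt - vx ^ m * br [:H:] vt = vx ^ m * (b - [:coeff b 0:])"
      by (simp add: et d algebra_simps del: mult_pCons_right)
    then show "vx ^ Suc m dvd \<eta> vt - vt - vx ^ m * br [:H:] vt" using dv by simp
  qed
  then show ?thesis by (rule that)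
qed

text \<open>An endomorphism of Jacobian one modulo x^D, not assumed invertible, is approximated by a
  true automorphism. If \<open>\<psi>\<close> is correct modulo x^m, the inverse of
  \<open>\<psi>\<close> composed with \<open>\<theta>\<close> has a leading Hamiltonian at level m,
  and composing \<open>\<psi>\<close> with an automorphism realizing it gains one power of
  x.\<close>

theorem xaut_lifting:
  fixes \<theta> :: "'a::rational_algebra poly poly poly \<Rightarrow> 'a poly poly poly"
  assumes \<theta>: "ring_map \<theta>" "\<And>c. \<theta> (kc c) = kc c" "\<theta> vx = vx"
    and c: "\<And>p. vx dvd \<theta> p - p" and jac: "vx ^ D dvd br (\<theta> vz) (\<theta> vt) - 1"
  obtains \<psi> where "xaut \<psi>" "\<And>p. vx ^ D dvd \<psi> p - \<theta> p"
proof -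
  have ex: "\<exists>\<psi>. xaut \<psi> \<and> (\<forall>p. vx ^ Suc n dvd \<psi> p - \<theta> p)" if "Suc n \<le> D" for n
    using that
  proof (induction n)
    case 0
    have "vx dvd p - \<theta> p" for p using c[of p] by (rule dvd_diff_swap)
    then show ?case using xaut_id by (intro exI[of _ "\<lambda>p. p"]) simp
  next
    case (Suc n)
    let ?m = "Suc n"
    obtain \<psi> where \<psi>: "xaut \<psi>" "\<And>p. vx ^ ?m dvd \<psi> p - \<theta> p" using Suc by auto
    obtain \<psi>' where \<psi>': "xaut \<psi>'" "\<And>p. \<psi> (\<psi>' p) = p" "\<And>p. \<psi>' (\<psi> p) = p" using xaut_inverse[OF \<psi>(1)] by blast
    note r' = xautD(1,2,3)[OF \<psi>'(1)] and r = xautD(1,2,3)[OF \<psi>(1)]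
    define \<eta> where "\<eta> p = \<psi>' (\<theta> p)" for p
    have \<eta>: "ring_map \<eta>" "\<And>c. \<eta> (kc c) = kc c" "\<eta> vx = vx"
      unfolding \<eta>_def using ring_map_comp[OF r'(1) \<theta>(1)] by (simp_all add: r' \<theta>)
    have x': "vx ^ m dvd \<psi>' p" if "vx ^ m dvd p" for m p
      using rm_dvd[OF r'(1) that] by (simp add: rm_power[OF r'(1)] r')
    have x: "vx ^ m dvd \<psi> p" if "vx ^ m dvd p" for m p
      using rm_dvd[OF r(1) that] by (simp add: rm_power[OF r(1)] r)
    have "vx ^ ?m dvd \<eta> p - p" for p
      using dvd_diff_swap[OF x'[OF \<psi>(2)[of p], unfolded rm_diff[OF r'(1)] \<psi>'(3)]] by (simp add: \<eta>_def)
    moreover have "vx ^ Suc ?m dvd br (\<eta> vz) (\<eta> vt) - 1"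
    proof -
      have "vx ^ Suc ?m dvd br (\<theta> vz) (\<theta> vt) - 1" using jac Suc.prems by (meson dvd_trans le_imp_power_dvd)
      from x'[OF this] show ?thesis unfolding \<eta>_def xautD(4)[OF \<psi>'(1)] by (simp add: rm_simps[OF r'(1)])
    qed
    ultimately obtain H where H: "infl ?m [:H:] \<eta>" using xaut_congruent_to_id_level[OF \<eta>] by blast
    obtain \<rho> where \<rho>: "xaut \<rho>" "infl ?m [:H:] \<rho>" using realizable[of ?m H] by (auto simp: realizable_def)
    have "vx ^ Suc ?m dvd \<psi> (\<rho> p) - \<theta> p" for p
    proof -
      have "vx ^ Suc ?m dvd (\<rho> p - p - vx ^ ?m * br [:H:] p) - (\<eta> p - p - vx ^ ?m * br [:H:] p)"
        using H \<rho>(2) unfolding infl_def by (blast intro: dvd_diff)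
      then have "vx ^ Suc ?m dvd \<rho> p - \<eta> p" by simp
      from x[OF this] show ?thesis by (simp add: rm_diff[OF r(1)] \<eta>_def \<psi>')
    qed
    then show ?case using xaut_comp[OF \<psi>(1) \<rho>(1)] by blast
  qed
  show ?thesis
  proof (cases D)
    case 0
    then show ?thesis by (intro that[OF xaut_id]) simp
  next
    case (Suc n)
    then obtain \<psi> where "xaut \<psi>" "\<forall>p. vx ^ D dvd \<psi> p - \<theta> p" using ex[of n] by blast
    then show ?thesis by (intro that) auto
  qed
qed

section \<open>Truncated exponentials\<close>

context
  fixes D :: "'a::rational_algebra poly poly poly \<Rightarrow> 'a poly poly poly" and L and n :: nat
  assumes L: "derivation L" "\<And>c. L (kc c) = 0" "L vx = 0"
    and n: "n > 0" and D: "\<And>p. D p = vx ^ n * L p"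
begin

text \<open>Reciprocals of factorials exist in the base ring although it need not be a field, so
  they are chosen as elements of it.\<close>

definition inv_fact :: "nat \<Rightarrow> 'a" where "inv_fact j = (SOME q. of_nat (fact j) * q = 1)"

lemma inv_fact: "of_nat (fact j) * inv_fact j = 1"
  unfolding inv_fact_def using someI_ex[OF of_nat_unit[of "fact j"]] by simp

lemma inv_fact_0: "inv_fact 0 = 1"
  using inv_fact[of 0] by simp

lemma inv_fact_Suc: "of_nat (Suc j) * inv_fact (Suc j) = inv_fact j"
proof -
  have "of_nat (fact j) * (of_nat (Suc j) * inv_fact (Suc j)) = of_nat (fact j) * inv_fact j"
    using inv_fact[of j] inv_fact[of "Suc j"] by (simp add: algebra_simps)
  then show ?thesis by (simp del: of_nat_Suc)
qed

definition dp :: "nat \<Rightarrow> 'a poly poly poly \<Rightarrow> 'a poly poly poly"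
  where "dp j p = kc (inv_fact j) * (D ^^ j) p"
text \<open>As D is divisible by x^n, the j-th divided power is divisible by x^(n j). Truncation at
  N therefore discards only multiples of x^N, without any nilpotency of D.\<close>

definition texp :: "nat \<Rightarrow> 'a poly poly poly \<Rightarrow> 'a poly poly poly"
  where "texp N p = (\<Sum>j<N. dp j p)"

lemma derivation_D: "derivation D"
  unfolding D by (rule derivation_scale[OF L(1)])

lemma D_kc: "D (kc c * p) = kc c * D p" and D_vx: "D (vx ^ i * p) = vx ^ i * D p"
  by (simp_all add: D L(2,3) dv_mult[OF L(1)] dv_power[OF L(1)] algebra_simps)

lemma of_nat_kc': "of_nat m = kc (of_nat m :: 'b::comm_ring_1)"
  by (simp add: rm_of_nat[OF ring_map_kc])

lemma dp_Suc: "of_nat (Suc j) * dp (Suc j) p = D (dp j p)"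
proof -
  have "of_nat (Suc j) * dp (Suc j) p = kc (of_nat (Suc j) * inv_fact (Suc j)) * (D ^^ Suc j) p"
    by (simp only: dp_def of_nat_kc' rm_mult[OF ring_map_kc] mult.assoc)
  then show ?thesis by (simp add: inv_fact_Suc dp_def D_kc del: of_nat_Suc)
qed

lemma dp_0: "dp 0 p = p"
  by (simp add: dp_def inv_fact_0 rm_1[OF ring_map_kc])

lemma Dn_add: "(D ^^ j) (p + q) = (D ^^ j) p + (D ^^ j) q"
  by (induction j) (auto simp: dv_add[OF derivation_D])

lemma dp_add: "dp j (p + q) = dp j p + dp j q"
  by (simp add: dp_def Dn_add distrib_left)

lemma Dn_dvd: "vx ^ (n * j) dvd (D ^^ j) p"
proof (induction j)
  case (Suc j)
  then obtain w where "(D ^^ j) p = vx ^ (n * j) * w" by (auto simp: dvd_def)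
  then have "(D ^^ Suc j) p = vx ^ (n * Suc j) * L w"
    by (simp add: D_vx) (simp add: D power_add algebra_simps)
  then show ?case by simp
qed simp

lemma dp_dvd: "vx ^ (n * j) dvd dp j p"
  unfolding dp_def using Dn_dvd by (rule dvd_mult)

lemma dp_const: "j > 0 \<Longrightarrow> dp j (kc c) = 0" "j > 0 \<Longrightarrow> dp j vx = 0"
proof -
  have z: "(D ^^ j) 0 = 0" for j by (induction j) (auto simp: dv_0[OF derivation_D])
  show "j > 0 \<Longrightarrow> dp j (kc c) = 0" "j > 0 \<Longrightarrow> dp j vx = 0"
    by (cases j; simp add: dp_def funpow_swap1 D L z)+
qed

text \<open>Stated for an arbitrary biadditive operation because it is needed for both the product
  and the bracket.\<close>

lemma dp_bilinear:
  assumes add: "\<And>p q r. B (p + q) r = B p r + B q r" "\<And>p q r. B p (q + r) = B p q + B p r"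
    and leib: "\<And>p q. D (B p q) = B (D p) q + B p (D q)"
  shows "dp j (B p q) = (\<Sum>i\<le>j. B (dp i p) (dp (j - i) q))"
proof (induction j)
  case 0
  show ?case by (simp add: dp_0)
next
  case (Suc j)
  have zero: "B 0 r = 0" "B r 0 = 0" for r using add(1)[of 0 0 r] add(2)[of r 0 0] by auto
  have nat: "of_nat m * B p q = B (of_nat m * p) q" "of_nat m * B p q = B p (of_nat m * q)" for m p q
    by (induction m) (auto simp: zero add distrib_right)
  have DB: "D (\<Sum>i\<le>j. B (dp i p) (dp (j - i) q)) = (\<Sum>i\<le>j. B (D (dp i p)) (dp (j - i) q))
      + (\<Sum>i\<le>j. B (dp i p) (D (dp (j - i) q)))"
    by (simp add: dv_sum[OF derivation_D] leib sum.distrib)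
  have 1: "(\<Sum>i\<le>j. B (D (dp i p)) (dp (j - i) q)) = (\<Sum>i\<le>Suc j. of_nat i * B (dp i p) (dp (Suc j - i) q))"
    by (subst sum.atMost_Suc_shift) (simp add: dp_Suc[symmetric] nat(1) del: of_nat_Suc)
  have 2: "(\<Sum>i\<le>j. B (dp i p) (D (dp (j - i) q))) = (\<Sum>i\<le>Suc j. of_nat (Suc j - i) * B (dp i p) (dp (Suc j - i) q))"
  proof -
    have "(\<Sum>i\<le>j. B (dp i p) (D (dp (j - i) q))) = (\<Sum>i\<le>j. of_nat (Suc j - i) * B (dp i p) (dp (Suc j - i) q))"
    proof (rule sum.cong)
      fix i assume "i \<in> {..j}"
      then have "Suc j - i = Suc (j - i)" by (simp add: Suc_diff_le)
      then show "B (dp i p) (D (dp (j - i) q)) = of_nat (Suc j - i) * B (dp i p) (dp (Suc j - i) q)"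
        by (simp only: nat(2) dp_Suc)
    qed simp
    then show ?thesis by (simp del: of_nat_diff)
  qed
  have "of_nat (Suc j) * dp (Suc j) (B p q) = D (dp j (B p q))" by (rule dp_Suc)
  also have "\<dots> = (\<Sum>i\<le>Suc j. of_nat i * B (dp i p) (dp (Suc j - i) q) + of_nat (Suc j - i) * B (dp i p) (dp (Suc j - i) q))"
    unfolding Suc DB 1 2 by (rule sum.distrib[symmetric])
  also have "\<dots> = of_nat (Suc j) * (\<Sum>i\<le>Suc j. B (dp i p) (dp (Suc j - i) q))"
    unfolding sum_distrib_left by (rule sum.cong) (auto simp: distrib_right[symmetric] simp flip: of_nat_add simp del: of_nat_Suc)
  finally show ?case by (simp only: mult_cancel_left of_nat_eq_0_iff) simp
qed

text \<open>The product of two truncated sums contains the triangle i + j < N, which is the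
  truncated exponential of \<open>B p q\<close>, and a remainder with i + j \<ge> N, which carries
  the factor x^(n (i + j)).\<close>

lemma texp_bilinear:
  assumes add: "\<And>p q r. B (p + q) r = B p r + B q r" "\<And>p q r. B p (q + r) = B p q + B p r"
    and leib: "\<And>p q. D (B p q) = B (D p) q + B p (D q)"
    and vx: "\<And>i j p q. B (vx ^ i * p) (vx ^ j * q) = vx ^ (i + j) * B p q"
  shows "vx ^ N dvd B (texp N p) (texp N q) - texp N (B p q)"
proof -
  let ?T = "{(i, j). i + j < N}" and ?S = "{..<N} \<times> {..<N}"
  let ?g = "\<lambda>(i, j). B (dp i p) (dp j q)"
  have zero: "B 0 r = 0" "B r 0 = 0" for r using add(1)[of 0 0 r] add(2)[of r 0 0] by auto
  have s1: "B (\<Sum>i\<in>I. f i) r = (\<Sum>i\<in>I. B (f i) r)" "B r (\<Sum>i\<in>I. f i) = (\<Sum>i\<in>I. B r (f i))" for I :: "nat set" and f r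
    by (induction I rule: infinite_finite_induct; simp add: zero add)+
  have "B (texp N p) (texp N q) = sum ?g ?S"
    by (simp only: texp_def s1(1)) (simp add: s1(2) sum.cartesian_product)
  moreover have "texp N (B p q) = sum ?g ?T"
    unfolding texp_def dp_bilinear[of B, OF add leib] by (simp add: sum.triangle_reindex)
  moreover have "sum ?g ?S = sum ?g ?T + sum ?g (?S - ?T)"
    by (subst sum.subset_diff[of ?T ?S]) (auto simp: add.commute)
  moreover have "vx ^ N dvd sum ?g (?S - ?T)"
  proof (rule dvd_sum, clarsimp)
    fix i j assume "\<not> i + j < N"
    have "i + j \<le> n * (i + j)" using n by (cases n) auto
    then have ge: "N \<le> n * i + n * j" using \<open>\<not> i + j < N\<close> by (simp add: distrib_left)
    obtain u w where "dp i p = vx ^ (n * i) * u" "dp j q = vx ^ (n * j) * w"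
      using dp_dvd by (metis dvd_def)
    then have "B (dp i p) (dp j q) = vx ^ (n * i + n * j) * B u w" by (simp add: vx)
    then show "vx ^ N dvd B (dp i p) (dp j q)" using ge by (simp add: le_imp_power_dvd)
  qed
  ultimately show ?thesis by simp
qed

lemma texp_vx: assumes "N > 0" shows "texp N (kc c) = kc c" "texp N vx = vx"
proof -
  have "{..<N} = insert 0 {0<..<N}" using assms by auto
  then show "texp N (kc c) = kc c" "texp N vx = vx"
    by (simp_all add: texp_def dp_0 dp_const)
qed

lemma texp_low: assumes "N > n"
  shows "vx ^ Suc n dvd texp N p - p - vx ^ n * L p"
proof -
  have split: "{..<N} = insert 0 (insert 1 {2..<N})" using assms n by auto
  have "texp N p - p - vx ^ n * L p = (\<Sum>j\<in>{2..<N}. dp j p)"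
    using inv_fact_Suc[of 0]
    by (simp add: texp_def split dp_0 dp_def[of "Suc 0"] D inv_fact_0 rm_1[OF ring_map_kc])
  also have "vx ^ Suc n dvd \<dots>"
  proof (rule dvd_sum)
    fix j assume "j \<in> {2..<N}"
    then have "n * 2 \<le> n * j" by simp
    then have "Suc n \<le> n * j" using n by linarith
    then show "vx ^ Suc n dvd dp j p" using dp_dvd[of j p] by (meson dvd_trans le_imp_power_dvd)
  qed
  finally show ?thesis .
qed

lemma texp_ideal:
  assumes "\<And>w. s dvd w \<Longrightarrow> s dvd D w" shows "s dvd texp N s"
proof -
  have "s dvd (D ^^ j) s" for j by (induction j) (auto intro: assms)
  then show ?thesis unfolding texp_def dp_def by (intro dvd_sum dvd_mult)
qed

end

text \<open>The truncated exponential of x^n \<open>br (f * s)\<close> respects products and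
  brackets modulo x^N only. The homomorphism with the same values at z and t agrees with it modulo
  x^N, and \<open>xaut_lifting\<close> corrects it to an automorphism. The ideal generated by
  \<open>s\<close> and x^N survives because {f s, s} = s {f, s}.\<close>

theorem hamiltonian_automorphism:
  fixes f s :: "'a::rational_algebra poly poly poly"
  assumes n: "n > 0" and N: "N > n"
  obtains \<psi> U w where "xaut \<psi>" "infl n (f * s) \<psi>" "\<psi> s = s * U + vx ^ N * w"
proof -
  let ?L = "br (f * s)" and ?D = "\<lambda>p. vx ^ n * br (f * s) p"
  have a: "derivation ?L" "\<And>c. ?L (kc c) = 0" "?L vx = 0" "n > 0" "\<And>p. ?D p = vx ^ n * ?L p"
    by (simp_all add: derivation_br n)
  note texp_bilinear = texp_bilinear[OF a] and texp_vx = texp_vx[OF a] and texp_low = texp_low[OF a N]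
  let ?E = "texp ?D N"
  have N0: "N > 0" using N by simp
  have mul: "vx ^ N dvd ?E p * ?E q - ?E (p * q)" for p q
    by (rule texp_bilinear) (simp_all add: dv_mult[OF derivation_br] power_add algebra_simps)
  have brk: "vx ^ N dvd br (?E p) (?E q) - ?E (br p q)" for p q
  proof (rule texp_bilinear)
    show "br (vx ^ i * p) (vx ^ j * q) = vx ^ (i + j) * br p q" for i j p q
      by (simp add: br_left dv_mult[OF derivation_br] dv_power[OF derivation_br] br_def[of "vx ^ _"]
          dv_simps[OF derivation_dz] dv_simps[OF derivation_dt])
         (simp add: br_def dv_simps[OF derivation_dz] dv_simps[OF derivation_dt] power_add algebra_simps)
    show "?D (br p q) = br (?D p) q + br p (?D q)" for p q
      by (subst jacobi) (simp add: br_def dv_simps[OF derivation_dz] dv_simps[OF derivation_dt] algebra_simps)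
  qed (simp_all add: br_left dv_add[OF derivation_br])
  define \<theta> where "\<theta> = subst3 kc vx (?E vz) (?E vt)"
  note \<theta>r = ring_map_subst3[OF ring_map_kc, of vx "?E vz" "?E vt", folded \<theta>_def]
    and \<theta>g = subst3_gens[OF ring_map_kc, of vx "?E vz" "?E vt", folded \<theta>_def]
  have \<theta>E: "vx ^ N dvd \<theta> p - ?E p" for p
  proof (induction p rule: poly3_induct)
    case (add p q)
    have "?E (p + q) = ?E p + ?E q" by (simp add: texp_def[OF a] dp_add[OF a] sum.distrib)
    then have "\<theta> (p + q) - ?E (p + q) = (\<theta> p - ?E p) + (\<theta> q - ?E q)" by (simp add: rm_add[OF \<theta>r])
    then show ?case by (simp only: dvd_add[OF add.IH])
  next
    case (mult p q)
    have "\<theta> (p * q) - ?E (p * q) = (\<theta> p - ?E p) * \<theta> q + ?E p * (\<theta> q - ?E q) + (?E p * ?E q - ?E (p * q))"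
      by (simp add: rm_mult[OF \<theta>r] algebra_simps)
    then show ?case
      by (simp only: dvd_add[OF dvd_add[OF dvd_mult2[OF mult.IH(1)] dvd_mult[OF mult.IH(2)]] mul])
  qed (simp_all add: \<theta>g texp_vx[OF N0])
  have low: "vx ^ Suc n dvd \<theta> p - p - vx ^ n * br (f * s) p" for p
  proof -
    have "vx ^ Suc n dvd \<theta> p - ?E p" using \<theta>E[of p] N by (meson Suc_leI dvd_trans le_imp_power_dvd)
    moreover have "\<theta> p - p - vx ^ n * br (f * s) p = (\<theta> p - ?E p) + (?E p - p - vx ^ n * br (f * s) p)" by simp
    ultimately show ?thesis using texp_low[of p] by (simp only: dvd_add)
  qed
  have "vx dvd \<theta> p - p" for p
  proof -
    have "vx dvd \<theta> p - p - vx ^ n * br (f * s) p" using low[of p] by (meson dvd_trans dvd_power zero_less_Suc dvd_triv_left power_Suc)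
    moreover have "vx dvd vx ^ n * br (f * s) p" using n by (simp add: dvd_mult2 dvd_power)
    ultimately show ?thesis by (metis diff_add_cancel dvd_add)
  qed
  moreover have "vx ^ N dvd br (\<theta> vz) (\<theta> vt) - 1"
    using brk[of vz vt] texp_vx(1)[OF N0, of 1] by (simp add: \<theta>g rm_1[OF ring_map_kc])
  ultimately obtain \<psi> where \<psi>: "xaut \<psi>" "\<And>p. vx ^ N dvd \<psi> p - \<theta> p"
    using xaut_lifting[OF \<theta>r, of N] \<theta>g by metis
  have "infl n (f * s) \<psi>" unfolding infl_def
  proof
    fix p
    have "vx ^ Suc n dvd \<psi> p - \<theta> p" using \<psi>(2)[of p] N by (meson Suc_leI dvd_trans le_imp_power_dvd)
    moreover have "\<psi> p - p - vx ^ n * br (f * s) p = (\<psi> p - \<theta> p) + (\<theta> p - p - vx ^ n * br (f * s) p)" by simp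
    ultimately show "vx ^ Suc n dvd \<psi> p - p - vx ^ n * br (f * s) p" using low[of p] by (simp only: dvd_add)
  qed
  moreover obtain U where U: "?E s = s * U"
  proof -
    have "s dvd ?E s"
    proof (rule texp_ideal[OF a])
      fix w assume "s dvd w"
      then obtain v where "w = s * v" by (auto simp: dvd_def)
      then have "?D w = s * (vx ^ n * (v * br f s + br (f * s) v))"
        by (simp add: dv_mult[OF derivation_br] br_left br_self algebra_simps)
      then show "s dvd ?D w" by simp
    qed
    then show ?thesis using that by (auto simp: dvd_def)
  qed
  moreover obtain w where "\<psi> s - ?E s = vx ^ N * w"
    using dvd_add[OF \<psi>(2)[of s] \<theta>E[of s]] by (auto simp: dvd_def)
  ultimately show ?thesis using that[OF \<psi>(1)] by (metis diff_add_cancel add.commute)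
qed

section \<open>Polynomials vanishing on the cuspidal curve\<close>

context koras
begin

lemma pcompose_monom_coeff:
  "coeff (ev (\<lambda>c. [:c:]) (monom 1 k) q) n = (if k dvd n then coeff q (n div k) else 0)"
proof (induction q arbitrary: n)
  case 0
  show ?case by (simp add: ev_0)
next
  case (pCons c q)
  show ?case
  proof (cases "n < k")
    case True
    then show ?thesis
      by (cases n) (auto simp: ev_pCons[OF ring_map_const] coeff_monom_mult coeff_pCons dest: dvd_imp_le)
  next
    case False
    then have "n = k + (n - k)" by simp
    then obtain m where m: "n = k + m" by blast
    have "coeff [:c:] (k + m) = 0" using pos by (cases "k + m") auto
    then show ?thesis using pos
      by (simp add: m ev_pCons[OF ring_map_const] coeff_monom_mult pCons.IH)
  qed
qed

text \<open>\<open>P\<close> restricts to the curve z = \<alpha> s^l, t = s^k. Division by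
  \<open>r0\<close>, monic of degree k in z, leaves monomials z^i t^j with i < k; by coprimality
  their exponents l i + k j in s are pairwise distinct, so a remainder that vanishes on the curve is
  zero.\<close>

lemma cusp_ideal:
  fixes H :: "complex poly poly"
  assumes \<alpha>: "\<alpha> \<noteq> 0" and P: "P = ev (ev (\<lambda>c. [:c:]) (monom 1 k)) (monom \<alpha> l)"
    and r0: "P r0 = 0" and z: "P H = 0"
  shows "r0 dvd H"
proof -
  have rP: "ring_map P" unfolding P by (intro ring_map_ev ring_map_const)
  have cr: "coeff r0 i = (if i = 0 then monom 1 l else if i = k then 1 else (0 :: complex poly))" for i
    using pos by (auto simp: r0_def pz_power pt_power coeff_pCons split: nat.splits)
  have "\<exists>f \<rho>. H = r0 * f + \<rho> \<and> (\<forall>i\<ge>k. coeff \<rho> i = 0)"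
  proof (induction H)
    case 0
    show ?case by (intro exI[of _ 0]) simp
  next
    case (pCons a H)
    obtain f \<rho> where f: "H = r0 * f + \<rho>" "\<forall>i\<ge>k. coeff \<rho> i = 0" using pCons.IH by blast
    define c where "c = coeff \<rho> (k - 1)"
    have "pCons a H = r0 * (pCons 0 f + [:c:]) + (pCons a \<rho> - [:c:] * r0)"
      by (simp add: f(1) algebra_simps)
    moreover have "coeff (pCons a \<rho> - [:c:] * r0) i = 0" if "i \<ge> k" for i
      using that pos f(2)[rule_format, of "i - 1"] by (cases i) (auto simp: cr c_def)
    ultimately show ?case by blast
  qed
  then obtain f \<rho> where f: "H = r0 * f + \<rho>" "\<And>i. i \<ge> k \<Longrightarrow> coeff \<rho> i = 0" by blast
  have P\<rho>: "P \<rho> = 0" using z by (simp add: f(1) rm_add[OF rP] rm_mult[OF rP] r0)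
  have c: "coeff (P \<rho>) m = (\<Sum>i\<le>degree \<rho>. if l * i \<le> m \<and> k dvd m - l * i then \<alpha> ^ i * coeff (coeff \<rho> i) ((m - l * i) div k) else 0)" for m
  proof -
    have "P \<rho> = (\<Sum>i\<le>degree (map_poly (ev (\<lambda>c. [:c:]) (monom 1 k)) \<rho>). ev (\<lambda>c. [:c:]) (monom 1 k) (coeff \<rho> i) * monom \<alpha> l ^ i)"
      by (simp add: P ev_def[of "ev _ _"] poly_altdef coeff_map_poly ev_0)
    also have "\<dots> = (\<Sum>i\<le>degree \<rho>. ev (\<lambda>c. [:c:]) (monom 1 k) (coeff \<rho> i) * monom \<alpha> l ^ i)"
    proof (rule sum.mono_neutral_left)
      let ?g = "ev (\<lambda>c. [:c:]) (monom 1 k) :: complex poly \<Rightarrow> complex poly"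
      show "{..degree (map_poly ?g \<rho>)} \<subseteq> {..degree \<rho>}" using map_poly_degree_leq[of ?g \<rho>] by simp
      show "\<forall>i\<in>{..degree \<rho>} - {..degree (map_poly ?g \<rho>)}. ?g (coeff \<rho> i) * monom \<alpha> l ^ i = 0"
      proof
        fix i assume "i \<in> {..degree \<rho>} - {..degree (map_poly ?g \<rho>)}"
        then have "coeff (map_poly ?g \<rho>) i = 0" by (intro coeff_eq_0) simp
        then show "?g (coeff \<rho> i) * monom \<alpha> l ^ i = 0" by (simp add: coeff_map_poly ev_0)
      qed
    qed simp
    finally show ?thesis
      by (simp add: coeff_sum monom_power mult.commute[of _ "monom _ _"] coeff_monom_mult pcompose_monom_coeff if_distrib cong: if_cong)
        (rule sum.cong, auto simp: mult.commute)
  qed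
  have "coeff (coeff \<rho> i) j = 0" for i j
  proof (cases "i < k \<and> i \<le> degree \<rho>")
    case True
    have "coeff (P \<rho>) (l * i + k * j) = (\<Sum>a\<le>degree \<rho>. if a = i then \<alpha> ^ i * coeff (coeff \<rho> i) j else 0)"
      unfolding c
    proof (rule sum.cong)
      fix a assume "a \<in> {..degree \<rho>}"
      show "(if l * a \<le> l * i + k * j \<and> k dvd l * i + k * j - l * a
              then \<alpha> ^ a * coeff (coeff \<rho> a) ((l * i + k * j - l * a) div k) else 0) =
            (if a = i then \<alpha> ^ i * coeff (coeff \<rho> i) j else 0)"
      proof (cases "a = i")
        case True
        then show ?thesis using pos by simp
      next
        case False
        show ?thesis
        proof (cases "a < k \<and> l * a \<le> l * i + k * j \<and> k dvd l * i + k * j - l * a")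
          case True
          then have "int k dvd int (l * i + k * j - l * a)" by (simp only: int_dvd_int_iff)
          moreover have "int (l * i + k * j - l * a) = int l * (int i - int a) + int k * int j"
            using True by (subst of_nat_diff) (auto simp: algebra_simps)
          ultimately have "int k dvd int l * (int i - int a) + int k * int j" by simp
          then have "int k dvd int l * (int i - int a)" by (simp add: dvd_add_left_iff)
          then have "int k dvd int i - int a" using cop by (simp add: coprime_dvd_mult_right_iff)
          moreover have "\<bar>int i - int a\<bar> < \<bar>int k\<bar>" using True \<open>i < k \<and> i \<le> degree \<rho>\<close> by linarith
          ultimately have "int i - int a = 0" using dvd_imp_le_int by (metis not_le)
          with False show ?thesis by simp
        next
          case F: False
          then show ?thesis using f(2)[of a] False by (cases "a < k") auto
        qed
      qed
    qed simp
    then show ?thesis using P\<rho> \<alpha> True by simp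
  next
    case False
    then show ?thesis using f(2)[of i] by (cases "i < k") (auto simp: coeff_eq_0)
  qed
  then have "\<rho> = 0" by (simp add: poly_eq_iff)
  then show ?thesis using f by simp
qed

text \<open>Along the parametrized cusp the Hamiltonian field of \<open>r0\<close> is tangent, so
  the hypothesis says that the derivative of \<open>H\<close> with respect to the parameter
  vanishes. Thus \<open>H\<close> is constant on the curve and \<open>cusp_ideal\<close>
  applies.\<close>

lemma cusp_hamiltonian:
  fixes H :: "complex poly poly"
  assumes "br2 H r0 = v * r0"
  obtains c f where "H = [:[:c:]:] + f * r0"
proof -
  \<comment> \<open>A k-th root of -1, so that z = \<alpha> s^l, t = s^k satisfies z^k + t^l =
    0.\<close>
  define \<alpha> :: complex where "\<alpha> = cis (pi / real k)"
  have ak: "\<alpha> ^ k = - 1" using pos by (simp add: \<alpha>_def DeMoivre)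
  then have a0: "\<alpha> \<noteq> 0" using pos by (auto simp: zero_power)
  define P where "P = ev (ev (\<lambda>c. [:c:]) (monom 1 k)) (monom \<alpha> l)"
  have r1: "ring_map (ev (\<lambda>c. [:c:]) (monom (1 :: complex) k))" by (intro ring_map_ev ring_map_const)
  have rP: "ring_map P" unfolding P_def by (intro ring_map_ev r1)
  have Pz: "P pz = monom \<alpha> l" and Pt: "P pt = monom 1 k" and Pc: "P [:[:c:]:] = [:c:]" for c
    by (simp_all add: P_def pz_def pt_def ev_X ev_const r1 ring_map_const)
  have Pr0: "P r0 = 0"
    by (simp add: r0_def rm_simps[OF rP] Pz Pt monom_power ak mult.commute[of k] add_monom)
  define X where "X = (monom 1 1 :: complex poly)"
  have mX: "monom c m = [:c:] * X ^ m" for c m by (simp add: X_def monom_power smult_monom)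
  have chain: "pderiv (P q) = P (pderiv q) * pderiv (monom \<alpha> l) + P (map_poly pderiv q) * pderiv (monom 1 k)" for q
  proof -
    have in0: "pderiv (P [:q:]) = P [:pderiv q:] * pderiv (monom 1 k)" for q
    proof (induction q rule: poly_gen_induct)
      case (add p q)
      have "P [:p + q:] = P [:p:] + P [:q:]" by (simp flip: rm_add[OF rP])
      moreover have "P [:pderiv (p + q):] = P [:pderiv p:] + P [:pderiv q:]" by (simp add: pderiv_add flip: rm_add[OF rP])
      ultimately show ?case by (simp add: add pderiv_add algebra_simps)
    next
      case (mult p q)
      have m: "P [:a * b:] = P [:a:] * P [:b:]" for a b by (simp add: mult.commute flip: rm_mult[OF rP])
      have "P [:pderiv (p * q):] = P [:p:] * P [:pderiv q:] + P [:q:] * P [:pderiv p:]"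
        by (simp add: pderiv_mult flip: m rm_add[OF rP])
      then show ?case by (simp add: m mult pderiv_mult algebra_simps)
    qed (simp_all add: Pc Pt[unfolded pt_def] rm_0[OF rP] pderiv_pCons)
    show ?thesis
    proof (induction q rule: poly_gen_induct)
      case (const c)
      show ?case using in0[of c] by (simp add: map_poly_pCons rm_0[OF rP])
    next
      case var
      show ?case using Pz rm_1[OF rP] by (simp add: pz_def map_poly_pCons pderiv_pCons rm_0[OF rP] one_pCons)
    next
      case (add p q)
      then show ?case by (simp add: d2_simps rm_simps[OF rP] algebra_simps)
    next
      case (mult p q)
      then show ?case by (simp add: d2_simps rm_simps[OF rP] algebra_simps)
    qed
  qed
  have dr: "pderiv (r0 :: complex poly poly) = of_nat k * pz ^ (k - 1)" "map_poly pderiv (r0 :: complex poly poly) = of_nat l * pt ^ (l - 1)"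
    by (simp_all add: r0_def d2_simps) (simp_all add: pz_def pt_def pderiv_pCons map_poly_pCons)
  define a where "a = [:\<alpha>:]"
  obtain k' l' where kl': "k = Suc k'" "l = Suc l'" using pos by (metis gr0_implies_Suc)
  have kl_ge: "k + l \<le> k * l"
  proof -
    have "2 * l \<le> k * l" using k2 by simp
    then show ?thesis using kl by linarith
  qed
  have "0 = P (br2 H r0)" by (simp add: assms rm_mult[OF rP] Pr0)
  also have "\<dots> = P (pderiv H) * (of_nat l * X ^ (k * l')) - P (map_poly pderiv H) * (of_nat k * (a ^ k' * X ^ (l * k')))"
  proof -
    have k1: "k - 1 = k'" "l - 1 = l'" using kl' by auto
    have "P (pderiv r0) = of_nat k * (a ^ k' * X ^ (l * k'))"
      unfolding dr k1 rm_mult[OF rP] rm_power[OF rP] rm_of_nat[OF rP] Pz mX power_mult_distrib power_mult a_def ..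
    moreover have "P (map_poly pderiv r0) = of_nat l * X ^ (k * l')"
      unfolding dr k1 rm_mult[OF rP] rm_power[OF rP] rm_of_nat[OF rP] Pt mX
      by (simp add: power_mult flip: one_pCons)
    ultimately show ?thesis by (simp only: br2_def rm_diff[OF rP] rm_mult[OF rP])
  qed
  finally have "0 = a * (P (pderiv H) * (of_nat l * X ^ (k * l')) - P (map_poly pderiv H) * (of_nat k * (a ^ k' * X ^ (l * k'))))"
    by (simp del: mult_pCons_left)
  also have "\<dots> = a * of_nat l * P (pderiv H) * X ^ (k * l') - of_nat k * P (map_poly pderiv H) * (a ^ k) * X ^ (l * k')"
  proof -
    have "a * a ^ k' = a ^ k" by (simp add: kl')
    then show ?thesis by (simp add: algebra_simps flip: \<open>a * a ^ k' = a ^ k\<close>)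
  qed
  also have "a ^ k = - 1" by (simp add: a_def ak one_pCons flip: rm_power[OF ring_map_const])
  finally have e: "0 = a * of_nat l * P (pderiv H) * X ^ (k * l') + of_nat k * P (map_poly pderiv H) * X ^ (l * k')" by simp
  have d: "pderiv (monom \<alpha> l) = a * of_nat l * X ^ l'" "pderiv (monom 1 k) = of_nat k * X ^ k'"
    by (simp_all only: pderiv_monom) (simp_all add: mX kl' of_nat_poly a_def mult.commute del: of_nat_Suc)
  \<comment> \<open>The Hamiltonian field and the velocity of the parametrization differ, up to a
    nonzero scalar, by the factor s^(m+1) with m = k l - k - l.\<close>
  obtain m where m: "k * l = k + l + m" using kl_ge le_Suc_ex by blast
  have ex: "k * l' = Suc m + l'" "l * k' = Suc m + k'" using m by (simp_all add: kl' algebra_simps)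
  have "X ^ Suc m * pderiv (P H) = 0"
    unfolding chain d using e unfolding ex power_add by (simp add: algebra_simps del: power_Suc)
  then have "pderiv (P H) = 0" by (simp add: X_def)
  then obtain c where c: "P H = [:c:]" by (metis degree_eq_zeroE pderiv_eq_0_iff)
  then have "P (H - [:[:c:]:]) = 0" by (simp add: rm_diff[OF rP] Pc)
  then have "r0 dvd H - [:[:c:]:]" by (rule cusp_ideal[OF a0 P_def Pr0])
  then obtain f where "H - [:[:c:]:] = f * r0" by (auto simp: dvd_def mult.commute)
  then have "H = [:[:c:]:] + f * r0" by (simp only: diff_eq_eq ac_simps)
  then show ?thesis by (rule that)
qed

end

section \<open>Decomposition of automorphisms and extension to affine space\<close>

lemma dvd_diffE:
  assumes "a dvd p - (q :: 'a::comm_ring_1)" obtains w where "p = q + a * w"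
proof -
  obtain w where "p - q = a * w" using assms by (auto simp: dvd_def)
  then have "p = q + a * w" by (simp add: algebra_simps)
  then show ?thesis by (rule that)
qed

text \<open>Being the identity modulo x forces the multiplier \<open>U\<close> to be 1 modulo x. The
  resulting factor 1 - a is inverted modulo x^N by the finite geometric series \<open>W\<close>, and
  so the ideal condition passes to the inverse automorphism.\<close>

lemma xaut_inverse_ideal:
  fixes s :: "'a::idom poly poly poly"
  assumes \<psi>: "ring_map \<psi>" "\<And>p. vx dvd \<psi> p - p" and \<psi>': "xaut \<psi>'" "\<And>p. \<psi>' (\<psi> p) = p"
    and s: "\<not> vx dvd s" and N: "N > 0" and U: "\<psi> s = s * U + vx ^ N * w"
  shows "vx dvd U - 1" "\<exists>U' w'. \<psi>' s = s * U' + vx ^ N * w'"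
proof -
  have "vx dvd (\<psi> s - s) - vx ^ N * w" by (rule dvd_diff[OF \<psi>(2)]) (simp add: dvd_mult2 dvd_power N)
  also have "(\<psi> s - s) - vx ^ N * w = s * (U - 1)" by (simp add: U algebra_simps)
  finally show "vx dvd U - 1" using vx_prime s by blast
  then obtain V where V: "U = 1 + vx * V" by (rule dvd_diffE)
  note r = xautD(1,3)[OF \<psi>'(1)]
  define a where "a = - (vx * \<psi>' V)"
  define W where "W = (\<Sum>i<N. a ^ i)"
  have W: "(1 - a) * W = 1 - a ^ N" unfolding W_def by (rule one_diff_power_eq[symmetric])
  have e: "s = \<psi>' s * (1 - a) + vx ^ N * \<psi>' w"
    using \<psi>'(2)[of s] unfolding U V by (simp add: rm_simps[OF r(1)] r(2) a_def)
  have "\<psi>' s = \<psi>' s * ((1 - a) * W) + \<psi>' s * a ^ N" unfolding W by (simp add: algebra_simps)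
  also have "\<dots> = (s - vx ^ N * \<psi>' w) * W + \<psi>' s * a ^ N" by (subst (3) e) (simp add: algebra_simps)
  also have "a ^ N = vx ^ N * (- \<psi>' V) ^ N" by (simp add: a_def flip: power_mult_distrib)
  finally have "\<psi>' s = s * W + vx ^ N * (\<psi>' s * (- \<psi>' V) ^ N - \<psi>' w * W)" by (simp add: algebra_simps)
  then show "\<exists>U' w'. \<psi>' s = s * U' + vx ^ N * w'" by blast
qed

lemma vx_pow_prime: "\<not> vx dvd s \<Longrightarrow> vx ^ n dvd p * s \<Longrightarrow> vx ^ n dvd (p :: 'a::idom poly poly poly)"
proof (induction n arbitrary: p)
  case (Suc n)
  have "vx dvd p * s" using dvd_trans[OF _ Suc.prems(2), of vx] by simp
  then have "vx dvd p" using vx_prime Suc.prems(1) by blast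
  then obtain q where q: "p = vx * q" by (auto simp: dvd_def)
  have "vx ^ n dvd q * s" using Suc.prems(2) by (simp add: q mult.assoc)
  from Suc.IH[OF Suc.prems(1) this] show ?case by (simp add: q)
qed simp

lemma polynomial_fun_comp:
  assumes "polynomial_fun f" "polynomial_map G" shows "polynomial_fun (\<lambda>P. f (G P))"
  using assms(1)
proof (induction f rule: polynomial_fun.induct)
  case (coord c)
  then show ?case using assms(2) by (simp add: polynomial_map_def comp_def)
qed (auto intro: polynomial_fun.intros)

lemma polynomial_map_comp: "polynomial_map F \<Longrightarrow> polynomial_map G \<Longrightarrow> polynomial_map (\<lambda>P. F (G P))"
  using polynomial_fun_comp unfolding polynomial_map_def comp_def by blast

lemma polynomial_fun_power: "polynomial_fun f \<Longrightarrow> polynomial_fun (\<lambda>P. f P ^ n)"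
  by (induction n) (auto intro: polynomial_fun.intros)

lemma polynomial_fun_minus: "polynomial_fun f \<Longrightarrow> polynomial_fun g \<Longrightarrow> polynomial_fun (\<lambda>P. f P - g P)"
  using polynomial_fun.add[of f "\<lambda>P. (- 1) * g P"] polynomial_fun.mult[OF polynomial_fun.const[of "- 1"], of g]
  by simp

lemma polynomial_fun_ev:
  assumes "\<And>a. polynomial_fun (\<lambda>P. h P a)" "polynomial_fun A" "\<And>P. ring_map (h P)"
  shows "polynomial_fun (\<lambda>P. ev (h P) (A P) q)"
proof (induction q)
  case 0
  show ?case by (simp add: ev_0 polynomial_fun.const)
next
  case (pCons a q)
  then show ?case using assms by (simp add: ev_pCons polynomial_fun.intros)
qed

lemma polynomial_fun_subst3:
  assumes "\<And>a. polynomial_fun (\<lambda>P. h P a)" "\<And>P. ring_map (h P)"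
    and "polynomial_fun A" "polynomial_fun B" "polynomial_fun C"
  shows "polynomial_fun (\<lambda>P. subst3 (h P) (A P) (B P) (C P) q)"
  unfolding subst3_def by (intro polynomial_fun_ev ring_map_ev assms)

lemma coords_fun: "polynomial_fun (\<lambda>P::A4. fst P)" "polynomial_fun (\<lambda>P::A4. fst (snd P))"
    "polynomial_fun (\<lambda>P::A4. fst (snd (snd P)))" "polynomial_fun (\<lambda>P::A4. snd (snd (snd P)))"
  by (intro polynomial_fun.coord; simp add: coords_A4)+

context koras
begin

text \<open>Fixing the origin is recorded along with the extension: it passes to compositions and
  later yields the fixed point of the whole group.\<close>

definition extends :: "(A4 \<Rightarrow> A4) \<Rightarrow> bool"
  where "extends \<Phi> \<longleftrightarrow> polynomial_map \<Phi> \<and> \<Phi> ` KR \<subseteq> KR \<and> \<Phi> (0, 0, 0, 0) = (0, 0, 0, 0) \<and>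
    (\<exists>\<Phi>'. polynomial_map \<Phi>' \<and> \<Phi>' ` KR \<subseteq> KR \<and> (\<forall>P. \<Phi> (\<Phi>' P) = P) \<and> (\<forall>P. \<Phi>' (\<Phi> P) = P))"

lemma extends_comp:
  assumes "extends F" "extends G" shows "extends (\<lambda>P. F (G P))"
proof -
  obtain F' where F': "polynomial_map F'" "F' ` KR \<subseteq> KR" "\<And>P. F (F' P) = P" "\<And>P. F' (F P) = P"
    using assms(1) by (auto simp: extends_def)
  obtain G' where G': "polynomial_map G'" "G' ` KR \<subseteq> KR" "\<And>P. G (G' P) = P" "\<And>P. G' (G P) = P"
    using assms(2) by (auto simp: extends_def)
  have "polynomial_map (\<lambda>P. G' (F' P))" "(\<lambda>P. G' (F' P)) ` KR \<subseteq> KR"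
    using polynomial_map_comp[OF G'(1) F'(1)] F'(2) G'(2) by auto
  moreover have "polynomial_map (\<lambda>P. F (G P))" "(\<lambda>P. F (G P)) ` KR \<subseteq> KR" "F (G (0, 0, 0, 0)) = (0, 0, 0, 0)"
  proof -
    have a: "polynomial_map F" "F ` KR \<subseteq> KR" "F (0, 0, 0, 0) = (0, 0, 0, 0)"
      using assms(1) by (simp_all add: extends_def)
    have b: "polynomial_map G" "G ` KR \<subseteq> KR" "G (0, 0, 0, 0) = (0, 0, 0, 0)"
      using assms(2) by (simp_all add: extends_def)
    show "polynomial_map (\<lambda>P. F (G P))" by (rule polynomial_map_comp[OF a(1) b(1)])
    show "(\<lambda>P. F (G P)) ` KR \<subseteq> KR" using a(2) b(2) by blast
    show "F (G (0, 0, 0, 0)) = (0, 0, 0, 0)" by (simp add: a b)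
  qed
  ultimately show ?thesis
    unfolding extends_def by (intro conjI exI[of _ "\<lambda>P. G' (F' P)"] allI) (simp_all add: F' G')
qed

lemma extends_Aut:
  assumes "extends \<Phi>"
  shows "\<Phi> \<in> carrier (Aut_variety UNIV)" "restrict \<Phi> KR \<in> AX"
proof -
  obtain F where F: "polynomial_map F" "F ` KR \<subseteq> KR" "\<And>P. \<Phi> (F P) = P" "\<And>P. F (\<Phi> P) = P"
    using assms by (auto simp: extends_def)
  have \<Phi>: "polynomial_map \<Phi>" "\<Phi> ` KR \<subseteq> KR" using assms by (auto simp: extends_def)
  have b: "bij \<Phi>" using F by (metis bijI')
  have "inv_into UNIV \<Phi> P = F P" for P using b F by (metis bij_is_inj inv_f_f)
  then show "\<Phi> \<in> carrier (Aut_variety UNIV)"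
    using b \<Phi> F by (auto simp: Aut_iff polynomial_map_on_def)
  have b2: "bij_betw (restrict \<Phi> KR) KR KR"
    by (rule bij_betw_byWitness[of _ F]) (use F \<Phi> in auto)
  have "inv_into KR (restrict \<Phi> KR) P = F P" if "P \<in> KR" for P
    by (rule inv_into_f_eq) (use b2 F that in \<open>auto simp: bij_betw_def\<close>)
  then have "polynomial_map_on KR (inv_into KR (restrict \<Phi> KR))"
    using F(1) unfolding polynomial_map_on_def by (intro exI[of _ F]) simp
  moreover have "polynomial_map_on KR (restrict \<Phi> KR)"
    using \<Phi>(1) unfolding polynomial_map_on_def by (intro exI[of _ \<Phi>]) simp
  ultimately show "restrict \<Phi> KR \<in> AX" using b2 by (simp add: Aut_iff)
qed

subsection \<open>The torus\<close>

text \<open>The weights k l, l, k of x, z, t scale z^k + t^l + x by m^(k l); y then has to have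
  weight k l - k l d.\<close>

definition torus :: "complex \<Rightarrow> A4 \<Rightarrow> A4"
  where "torus m P = (case P of (x, y, z, t) \<Rightarrow> (m ^ (k * l) * x, m ^ (k * l) * (inverse m ^ (k * l * d)) * y, m ^ l * z, m ^ k * t))"
definition torus_hom :: "complex \<Rightarrow> Cxzt \<Rightarrow> Cxzt"
  where "torus_hom m = subst3 kc (kc (m ^ (k * l)) * vx) (kc (m ^ l) * vz) (kc (m ^ k) * vt)"

lemma torus_KR: assumes "m \<noteq> 0" "P \<in> KR" shows "torus m P \<in> KR"
proof -
  obtain x y z t where P: "P = (x, y, z, t)" by (cases P)
  have "(m ^ (k * l)) ^ d * inverse m ^ (k * l * d) = 1"
    using assms by (simp add: power_inverse flip: power_mult)
  then have e1: "(m ^ (k * l) * x) ^ d * (m ^ (k * l) * inverse m ^ (k * l * d) * y) = m ^ (k * l) * (x ^ d * y)"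
    by (simp add: power_mult_distrib)
  have e2: "(m ^ l * z) ^ k + (m ^ k * t) ^ l + m ^ (k * l) * x = m ^ (k * l) * (z ^ k + t ^ l + x)"
    by (simp add: power_mult_distrib distrib_left mult.commute[of l k] flip: power_mult)
  have "m ^ (k * l) * (x ^ d * y) + m ^ (k * l) * (z ^ k + t ^ l + x) = 0"
    using assms(2) by (simp add: P koras_russell_def add.assoc flip: distrib_left)
  then show ?thesis
    unfolding e1[symmetric] e2[symmetric] by (simp only: P torus_def koras_russell_def prod.case mem_Collect_eq add.assoc)
qed

lemma torus_extends: assumes "m \<noteq> 0" shows "extends (torus m)"
proof -
  have p: "polynomial_map (torus m)" for m
    unfolding polynomial_map_A4 torus_def case_prod_unfold fst_conv snd_conv
    by (intro conjI polynomial_fun.mult polynomial_fun.const coords_fun)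
  have inv: "torus a (torus b P) = P" if "a * b = 1" for a b P
  proof -
    have "inverse a * inverse b = 1" using that by (metis inverse_1 inverse_mult_distrib)
    then have *: "a ^ n * (b ^ n * x) = x" "a ^ n * (inverse a ^ i * (b ^ n * (inverse b ^ i * x))) = x" for n i x
      using that by (simp_all add: mult.assoc[symmetric] power_mult_distrib[symmetric])
        (metis (no_types, lifting) mult.assoc mult.left_commute mult_1_left power_mult_distrib power_one)
    show ?thesis by (cases P) (simp add: torus_def * mult.assoc)
  qed
  have "(\<forall>P. torus m (torus (inverse m) P) = P) \<and> (\<forall>P. torus (inverse m) (torus m P) = P)"
    using assms inv by simp
  then show ?thesis unfolding extends_def using assms p torus_KR
    by (auto intro!: exI[of _ "torus (inverse m)"] simp: torus_def[of m "(0,0,0,0)"])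
qed

lemma torus_restricts: assumes "m \<noteq> 0" shows "restricts_to d k l (restrict (torus m) KR) (torus_hom m)"
  unfolding restricts_to_def
proof (intro allI ballI)
  fix p P assume P: "P \<in> KR"
  have r: "ring_map (torus_hom m)" unfolding torus_hom_def by (rule ring_map_subst3[OF ring_map_kc])
  note g = subst3_gens[OF ring_map_kc, of "kc (m ^ (k * l)) * vx" "kc (m ^ l) * vz" "kc (m ^ k) * vt", folded torus_hom_def]
  obtain x y z t where Pe: "P = (x, y, z, t)" by (cases P)
  show "eval_xzt (torus_hom m p) (pr_xzt P) = eval_xzt p (pr_xzt (restrict (torus m) KR P))"
    using P unfolding Pe by (induction p rule: poly3_induct) (simp_all add: g torus_def eval_simps rm_simps[OF r])
qed

subsection \<open>Automorphisms congruent to the identity modulo \<open>x ^ d\<close>\<close>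

lemma eval_hom:
  assumes \<eta>: "ring_map \<eta>" "\<And>c. \<eta> (kc c) = kc c" "\<eta> vx = vx"
  shows "eval_xzt (\<eta> p) (x, z, t) = eval_xzt p (x, eval_xzt (\<eta> vz) (x, z, t), eval_xzt (\<eta> vt) (x, z, t))"
  by (induction p rule: poly3_induct) (simp_all add: \<eta> eval_simps rm_simps[OF \<eta>(1)])

lemma polynomial_fun_eval: "polynomial_fun (\<lambda>P::A4. eval_xzt p (fst P, fst (snd (snd P)), snd (snd (snd P))))"
  unfolding eval_subst3 by (intro polynomial_fun_subst3 polynomial_fun.const coords_fun ring_map_id)

text \<open>Here \<open>rr\<close> changes only by x^d b, so subtracting b from y restores the
  equation. Doing the same with the inverse gives the inverse polynomial map on all of affine
  space.\<close>

lemma level_d_extends: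
  assumes \<eta>: "xaut \<eta>" "\<And>p. vx ^ d dvd \<eta> p - (p :: Cxzt)"
  obtains \<Phi> b where "extends \<Phi>" "restricts_to d k l (restrict \<Phi> KR) \<eta>" "\<eta> rr = rr + vx ^ d * b"
    "\<And>x y z t. \<Phi> (x, y, z, t) = (x, y - eval_xzt b (x, z, t), eval_xzt (\<eta> vz) (x, z, t), eval_xzt (\<eta> vt) (x, z, t))"
proof -
  obtain \<eta>' where \<eta>': "xaut \<eta>'" "\<And>p. \<eta> (\<eta>' p) = p" "\<And>p. \<eta>' (\<eta> p) = p" using xaut_inverse[OF \<eta>(1)] by blast
  have small': "vx ^ d dvd \<eta>' p - p" for p
  proof -
    have "vx ^ d dvd \<eta> (\<eta>' p) - \<eta>' p" by (rule \<eta>(2))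
    then show ?thesis unfolding \<eta>' by (rule dvd_diff_swap)
  qed
  define lift where "lift \<theta> b P = (case P of (x, y, z, t) \<Rightarrow>
      (x, y - eval_xzt b (x, z, t), eval_xzt (\<theta> vz) (x, z, t), eval_xzt (\<theta> vt) (x, z, t)))"
    for \<theta> :: "Cxzt \<Rightarrow> Cxzt" and b and P :: A4
  have poly: "polynomial_map (lift \<theta> b)" for \<theta> b
    unfolding polynomial_map_A4 lift_def case_prod_unfold fst_conv snd_conv
    by (intro conjI polynomial_fun_minus polynomial_fun_eval coords_fun)
  have inK: "lift \<theta> b P \<in> KR" if "P \<in> KR" "xaut \<theta>" "\<theta> rr = rr + vx ^ d * b" for \<theta> b P
  proof -
    obtain x y z t where P: "P = (x, y, z, t)" by (cases P)
    note r = xautD(1,2,3)[OF that(2)]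
    let ?Z = "eval_xzt (\<theta> vz) (x, z, t)" and ?T = "eval_xzt (\<theta> vt) (x, z, t)" and ?b = "eval_xzt b (x, z, t)"
    have "eval_xzt (\<theta> rr) (x, z, t) = ?Z ^ k + ?T ^ l + x"
      unfolding rr_def by (simp add: rm_simps[OF r(1)] r eval_simps)
    moreover have "eval_xzt (\<theta> rr) (x, z, t) = z ^ k + t ^ l + x + x ^ d * ?b"
      unfolding that(3) by (simp add: eval_simps eval_rr)
    ultimately have e: "?Z ^ k + ?T ^ l + x = z ^ k + t ^ l + x + x ^ d * ?b" by simp
    have "x ^ d * (y - ?b) + ?Z ^ k + ?T ^ l + x = x ^ d * y - x ^ d * ?b + (?Z ^ k + ?T ^ l + x)"
      by (simp add: algebra_simps)
    also have "\<dots> = 0" unfolding e using that(1) by (simp add: P koras_russell_def algebra_simps)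
    finally show ?thesis by (simp add: P lift_def koras_russell_def)
  qed
  have inv: "lift \<theta>' b' (lift \<theta> b P) = P"
    if t: "xaut \<theta>" "xaut \<theta>'" "\<And>p. \<theta> (\<theta>' p) = p" "\<theta> rr = rr + vx ^ d * b" "\<theta>' rr = rr + vx ^ d * b'" for \<theta> \<theta>' b b' P
  proof -
    obtain x y z t where P: "P = (x, y, z, t)" by (cases P)
    note r = xautD(1,2,3)[OF t(1)]
    have "rr = rr + vx ^ d * (b + \<theta> b')"
      using t(3)[of rr] unfolding t(5) by (simp add: rm_simps[OF r(1)] r t(4) algebra_simps)
    then have "vx ^ d * (b + \<theta> b') = 0" by (simp only: add_cancel_right_right)
    then have "b + \<theta> b' = 0" by (simp only: mult_eq_0_iff power_eq_0_iff vx_nz) simp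
    then have "eval_xzt (b + \<theta> b') (x, z, t) = 0" by (simp only: eval_simps)
    then have 0: "eval_xzt b (x, z, t) + eval_xzt (\<theta> b') (x, z, t) = 0" by (simp only: eval_simps)
    have e: "eval_xzt p (x, eval_xzt (\<theta> vz) (x, z, t), eval_xzt (\<theta> vt) (x, z, t)) = eval_xzt (\<theta> p) (x, z, t)" for p
      by (rule eval_hom[OF r, symmetric])
    have "lift \<theta>' b' (lift \<theta> b P) = (x, y - eval_xzt b (x, z, t) - eval_xzt (\<theta> b') (x, z, t), z, t)"
      unfolding P lift_def prod.case e t(3) eval_gens ..
    then show ?thesis by (simp only: P diff_diff_eq 0 diff_zero)
  qed
  obtain b where b: "\<eta> rr = rr + vx ^ d * b" using \<eta>(2)[of rr] by (rule dvd_diffE)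
  obtain b' where b': "\<eta>' rr = rr + vx ^ d * b'" using small'[of rr] by (rule dvd_diffE)
  \<comment> \<open>On z = t = 0 the images of z and t are divisible by x^d, and their k-th and l-th
    powers by x^(2 d) since k, l \<ge> 2. Hence b is still divisible by x^d there and vanishes at
    the origin.\<close>
  have orig: "eval_xzt b (0, 0, 0) = 0" "eval_xzt (\<eta> vz) (0, 0, 0) = 0" "eval_xzt (\<eta> vt) (0, 0, 0) = 0"
  proof -
    obtain a1 where a1: "\<eta> vz = vz + vx ^ d * a1" using \<eta>(2)[of vz] by (rule dvd_diffE)
    obtain a2 where a2: "\<eta> vt = vt + vx ^ d * a2" using \<eta>(2)[of vt] by (rule dvd_diffE)
    note a = a1 a2
    show "eval_xzt (\<eta> vz) (0, 0, 0) = 0" "eval_xzt (\<eta> vt) (0, 0, 0) = 0"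
      using pos by (simp_all add: a eval_simps zero_power)
    define \<epsilon> :: "Cxzt \<Rightarrow> complex poly" where "\<epsilon> = map_poly (\<lambda>q. poly (poly q 0) 0)"
    have re: "ring_map \<epsilon>" unfolding \<epsilon>_def
      by (intro ring_map_map_poly ring_map_comp[OF ring_map_poly ring_map_poly])
    define X :: "complex poly" where "X = [:0, 1:]"
    have g: "\<epsilon> vx = X" "\<epsilon> vz = 0" "\<epsilon> vt = 0"
      by (simp_all add: \<epsilon>_def vx_def vz_def vt_def map_poly_pCons X_def)
    have "\<epsilon> (\<eta> rr) = \<epsilon> (\<eta> vz ^ k + \<eta> vt ^ l + vx)"
      by (simp add: rr_def rm_simps[OF xautD(1)[OF \<eta>(1)]] xautD(3)[OF \<eta>(1)])
    then have "X + X ^ d * \<epsilon> b = (X ^ d * \<epsilon> a1) ^ k + (X ^ d * \<epsilon> a2) ^ l + X"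
      using pos unfolding b a by (simp add: rr_def rm_simps[OF re] g zero_power)
    moreover obtain k' l' where "k = Suc (Suc k')" "l = Suc (Suc l')"
      using k2 kl by (metis Suc_le_D less_trans_Suc numeral_2_eq_2 le_Suc_ex add_Suc less_imp_le order_trans)
    ultimately have "X ^ d * \<epsilon> b = X ^ d * (X ^ d * (\<epsilon> a1 * \<epsilon> a1 * (X ^ d * \<epsilon> a1) ^ k' + \<epsilon> a2 * \<epsilon> a2 * (X ^ d * \<epsilon> a2) ^ l'))"
      by (simp add: algebra_simps)
    then have "\<epsilon> b = X ^ d * (\<epsilon> a1 * \<epsilon> a1 * (X ^ d * \<epsilon> a1) ^ k' + \<epsilon> a2 * \<epsilon> a2 * (X ^ d * \<epsilon> a2) ^ l')"
      by (simp only: mult_cancel_left power_eq_0_iff) (simp add: X_def)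
    then have "poly (\<epsilon> b) 0 = 0" using pos by (simp add: X_def zero_power)
    moreover have "poly (\<epsilon> b) 0 = eval_xzt b (0, 0, 0)"
    proof -
      have "eval_xzt p (0, 0, 0) = coeff (\<epsilon> p) 0" for p
        by (simp add: eval_xzt.simps poly_0_coeff_0 \<epsilon>_def coeff_map_poly)
      then show ?thesis by (simp add: poly_0_coeff_0)
    qed
    ultimately show "eval_xzt b (0, 0, 0) = 0" by simp
  qed
  have "extends (lift \<eta> b)" unfolding extends_def
  proof (intro conjI exI[of _ "lift \<eta>' b'"] allI poly)
    show "lift \<eta> b ` KR \<subseteq> KR" "lift \<eta>' b' ` KR \<subseteq> KR"
      using inK[OF _ \<eta>(1) b] inK[OF _ \<eta>'(1) b'] by blast+
    show "lift \<eta> b (0, 0, 0, 0) = (0, 0, 0, 0)" using orig by (simp add: lift_def)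
    show "lift \<eta> b (lift \<eta>' b' P) = P" "lift \<eta>' b' (lift \<eta> b P) = P" for P
      using inv[OF \<eta>'(1) \<eta>(1) \<eta>'(3) b' b] inv[OF \<eta>(1) \<eta>'(1) \<eta>'(2) b b'] by auto
  qed
  moreover have "restricts_to d k l (restrict (lift \<eta> b) KR) \<eta>"
    unfolding restricts_to_def
  proof (intro allI ballI)
    fix p P assume P: "P \<in> KR"
    obtain x y z t where Pe: "P = (x, y, z, t)" by (cases P)
    show "eval_xzt (\<eta> p) (pr_xzt P) = eval_xzt p (pr_xzt (restrict (lift \<eta> b) KR P))"
      using P eval_hom[OF xautD(1,2,3)[OF \<eta>(1)], of p x z t] by (simp only: Pe restrict_apply' lift_def prod.case pr_xzt.simps)
  qed
  ultimately show ?thesis using b by (rule that) (simp add: lift_def)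
qed

subsection \<open>Families of automorphisms preserving the level sets of \<open>x ^ d * y + z ^ k + t ^ l + x\<close>\<close>

text \<open>The level \<open>c\<close> is the innermost variable; \<open>specialize\<close> sets \<open>c = 0\<close>.\<close>

definition constant_family :: "Cxzt \<Rightarrow> complex poly poly poly poly"
  where "constant_family = map_poly (map_poly (map_poly (\<lambda>c. [:c:])))"
definition specialize :: "complex poly poly poly poly \<Rightarrow> Cxzt"
  where "specialize = map_poly (map_poly (map_poly (\<lambda>q. poly q 0)))"
definition level :: "complex poly poly poly poly" where "level = rr - kc [:0, 1:]"

lemma ring_map_family: "ring_map constant_family" "ring_map specialize"
  unfolding constant_family_def specialize_def by (intro ring_map_map_poly ring_map_const ring_map_poly)+

lemma family_gens: "constant_family (kc c) = kc [:c:]" "constant_family vx = vx" "constant_family vz = vz"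
    "constant_family vt = vt" "specialize (kc q) = kc (poly q 0)" "specialize vx = vx" "specialize vz = vz"
    "specialize vt = vt"
  by (auto simp: constant_family_def specialize_def kc_def vx_def vz_def vt_def map_poly_pCons one_pCons)

lemma specialize_constant: "specialize (constant_family p) = p"
  by (rule ring_map_poly3_eq[OF ring_map_comp[OF ring_map_family(2,1)] ring_map_id]) (auto simp: family_gens)

lemma specialize_level: "specialize level = rr"
  by (simp add: level_def rr_def rm_simps[OF ring_map_family(2)] family_gens)

lemma specialize_br: "specialize (br p q) = br (specialize p) (specialize q)"
proof -
  have "specialize (dz p) = dz (specialize p)" "specialize (dt p) = dt (specialize p)" for p
    by (induction p rule: poly3_induct)
       (simp_all add: rm_simps[OF ring_map_family(2)] family_gens dv_simps[OF derivation_dz] dv_simps[OF derivation_dt])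
  then show ?thesis by (simp add: br_def rm_simps[OF ring_map_family(2)])
qed

lemma level_not_dvd: "\<not> vx dvd level"
proof
  assume "vx dvd level"
  from rm_dvd[OF ring_map_family(2) this] show False by (simp add: specialize_level family_gens not_vx_dvd_rr)
qed

text \<open>The modulus is x^(d+1), not x^d, so that the correction of y carries a factor x.
  Together with the congruence modulo x this makes the lift the identity on x = 0, where y cannot be
  recovered from the level.\<close>

definition family :: "(complex poly poly poly poly \<Rightarrow> complex poly poly poly poly) \<Rightarrow> bool"
  where "family \<psi> \<longleftrightarrow> xaut \<psi> \<and> (\<forall>p. vx dvd \<psi> p - p) \<and> (\<exists>U w. \<psi> level = level * U + vx ^ Suc d * w)"

definition at_zero :: "(complex poly poly poly poly \<Rightarrow> complex poly poly poly poly) \<Rightarrow> Cxzt \<Rightarrow> Cxzt"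
  where "at_zero \<psi> p = specialize (\<psi> (constant_family p))"

lemma family_id: "family (\<lambda>p. p)"
proof -
  have "level = level * 1 + vx ^ Suc d * 0" by simp
  then show ?thesis unfolding family_def using xaut_id by (metis diff_self dvd_0_right)
qed

lemma family_comp: assumes "family \<psi>" "family \<chi>" shows "family (\<lambda>p. \<psi> (\<chi> p))"
proof -
  obtain U w where U: "\<psi> level = level * U + vx ^ Suc d * w" using assms by (auto simp: family_def)
  obtain V v where V: "\<chi> level = level * V + vx ^ Suc d * v" using assms by (auto simp: family_def)
  have x: "xaut \<psi>" "xaut \<chi>" using assms by (auto simp: family_def)
  note r = xautD(1,3)[OF x(1)]
  have "\<psi> (\<chi> level) = level * (U * \<psi> V) + vx ^ Suc d * (w * \<psi> V + \<psi> v)"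
    unfolding V by (simp add: rm_simps[OF r(1)] r(2) U algebra_simps)
  moreover have "vx dvd \<psi> (\<chi> p) - p" for p
  proof -
    have "vx dvd (\<psi> (\<chi> p) - \<chi> p) + (\<chi> p - p)" using assms unfolding family_def by (blast intro: dvd_add)
    then show ?thesis by simp
  qed
  ultimately show ?thesis unfolding family_def using xaut_comp[OF x] by blast
qed

lemma family_inverse: assumes "family \<psi>"
  obtains \<psi>' where "family \<psi>'" "\<And>p. \<psi> (\<psi>' p) = p" "\<And>p. \<psi>' (\<psi> p) = p"
proof -
  have x: "xaut \<psi>" and s: "\<And>p. vx dvd \<psi> p - p" using assms by (auto simp: family_def)
  obtain U w where U: "\<psi> level = level * U + vx ^ Suc d * w" using assms by (auto simp: family_def)
  obtain \<psi>' where \<psi>': "xaut \<psi>'" "\<And>p. \<psi> (\<psi>' p) = p" "\<And>p. \<psi>' (\<psi> p) = p" using xaut_inverse[OF x] by blast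
  have "vx dvd \<psi>' p - p" for p using dvd_diff_swap[OF s[of "\<psi>' p", unfolded \<psi>']] .
  moreover have "\<exists>U' w'. \<psi>' level = level * U' + vx ^ Suc d * w'"
    by (rule xaut_inverse_ideal[OF xautD(1)[OF x] s \<psi>'(1,3) level_not_dvd _ U]) simp
  ultimately show ?thesis using that \<psi>' unfolding family_def by blast
qed

text \<open>The parameter belongs to the base ring and is fixed by \<open>\<psi>\<close>, so setting
  it to 0 commutes with \<open>\<psi>\<close>; hence \<open>at_zero\<close> respects
  composition.\<close>

lemma at_zero_specialize: "xaut \<psi> \<Longrightarrow> at_zero \<psi> (specialize q) = specialize (\<psi> q)"
proof -
  assume x: "xaut \<psi>"
  note r = xautD(1,2,3)[OF x]
  have r0: "ring_map (at_zero \<psi>)"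
    unfolding at_zero_def by (intro ring_map_comp[OF ring_map_family(2)] ring_map_comp[OF r(1) ring_map_family(1)])
  show ?thesis
    by (rule ring_map_poly3_eq[OF ring_map_comp[OF r0 ring_map_family(2)] ring_map_comp[OF ring_map_family(2) r(1)]])
       (simp_all add: at_zero_def family_gens r)
qed

lemma at_zero_xaut: assumes "family \<psi>" shows "xaut (at_zero \<psi>)"
proof -
  obtain \<psi>' where \<psi>': "family \<psi>'" "\<And>p. \<psi> (\<psi>' p) = p" "\<And>p. \<psi>' (\<psi> p) = p" using family_inverse[OF assms] by blast
  have x: "xaut \<psi>" "xaut \<psi>'" using assms \<psi>' by (auto simp: family_def)
  have rm: "ring_map (at_zero \<chi>)" if "xaut \<chi>" for \<chi>
    unfolding at_zero_def by (intro ring_map_comp[OF ring_map_family(2)] ring_map_comp[OF xautD(1)[OF that] ring_map_family(1)])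
  have inv: "at_zero \<psi> (at_zero \<psi>' p) = p" "at_zero \<psi>' (at_zero \<psi> p) = p" for p
    unfolding at_zero_def[of \<psi>' p] at_zero_def[of \<psi> p] at_zero_specialize[OF x(1)] at_zero_specialize[OF x(2)]
    by (simp_all add: \<psi>' specialize_constant)
  have "br (at_zero \<psi> vz) (at_zero \<psi> vt) = 1"
    using xautD(4)[OF x(1), of vz vt] rm_1[OF xautD(1)[OF x(1)]]
    by (simp add: at_zero_def family_gens rm_1[OF ring_map_family(2)] flip: specialize_br)
  then show ?thesis unfolding xaut_def using inv rm[OF x(1)] rm[OF x(2)]
    by (auto simp: at_zero_def family_gens xautD[OF x(1)] intro!: exI[of _ "at_zero \<psi>'"])
qed

lemma level_value: "specialize (vx ^ n * p) = vx ^ n * specialize p"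
  by (simp add: rm_simps[OF ring_map_family(2)] family_gens)

text \<open>Insert c = x^d y + z^k + t^l + x into the family and send y to U y - x w. As
  \<open>level\<close> takes the value -x^d y at such a point, the ideal condition says that the
  value c is preserved. The inverse family then uses the same c: it restores z and t, and y off x =
  0 by cancelling x^d.\<close>

lemma family_extends:
  assumes F: "family \<psi>"
  obtains \<Phi> where "extends \<Phi>" "restricts_to d k l (restrict \<Phi> KR) (at_zero \<psi>)"
proof -
  obtain \<psi>' where \<psi>': "family \<psi>'" "\<And>p. \<psi> (\<psi>' p) = p" "\<And>p. \<psi>' (\<psi> p) = p" using family_inverse[OF F] by blast
  define val4 where "val4 c x z t = subst3 (\<lambda>q. poly q c) x z t" for c x z t :: complex
  have rv: "ring_map (val4 c x z t)" for c x z t unfolding val4_def by (intro ring_map_subst3 ring_map_poly)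
  have vg: "val4 c x z t (kc q) = poly q c" "val4 c x z t vx = x" "val4 c x z t vz = z" "val4 c x z t vt = t" for c x z t q
    by (simp_all add: val4_def subst3_gens[OF ring_map_poly])
  define eqn where "eqn x y z t = x ^ d * y + z ^ k + t ^ l + x" for x y z t :: complex
  define lift where "lift \<chi> U w P = (case P of (x, y, z, t) \<Rightarrow>
      (x, y * val4 (eqn x y z t) x z t U - x * val4 (eqn x y z t) x z t w,
       val4 (eqn x y z t) x z t (\<chi> vz), val4 (eqn x y z t) x z t (\<chi> vt)))"
    for \<chi> :: "complex poly poly poly poly \<Rightarrow> complex poly poly poly poly" and U w and P :: A4
  have poly: "polynomial_map (lift \<chi> U w)" for \<chi> U w
  proof -
    have "polynomial_fun (\<lambda>P. eqn (fst P) (fst (snd P)) (fst (snd (snd P))) (snd (snd (snd P))))"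
      unfolding eqn_def by (intro polynomial_fun.add polynomial_fun.mult polynomial_fun_power coords_fun)
    then have v: "polynomial_fun (\<lambda>P. val4 (eqn (fst P) (fst (snd P)) (fst (snd (snd P))) (snd (snd (snd P))))
        (fst P) (fst (snd (snd P))) (snd (snd (snd P))) p)" for p
      unfolding val4_def
      using polynomial_fun_ev[of "\<lambda>_ c. c", OF polynomial_fun.const _ ring_map_id]
      by (intro polynomial_fun_subst3 coords_fun ring_map_poly) (simp add: ev_def)
    show ?thesis
      unfolding polynomial_map_A4 lift_def case_prod_unfold fst_conv snd_conv
      by (intro conjI polynomial_fun_minus polynomial_fun.mult v coords_fun)
  qed
  have main: "eqn x (y * val4 c x z t U - x * val4 c x z t w) (val4 c x z t (\<chi> vz)) (val4 c x z t (\<chi> vt)) = c"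
    if \<chi>: "xaut \<chi>" and U: "\<chi> level = level * U + vx ^ Suc d * w" and c: "c = eqn x y z t" for \<chi> U w c x y z t
  proof -
    note r = xautD(1,2,3)[OF \<chi>]
    let ?Z = "val4 c x z t (\<chi> vz)" and ?T = "val4 c x z t (\<chi> vt)"
      and ?U = "val4 c x z t U" and ?w = "val4 c x z t w"
    have "?Z ^ k + ?T ^ l + x = c + val4 c x z t (\<chi> level)"
      by (simp add: level_def rr_def rm_simps[OF r(1)] rm_simps[OF rv] r vg)
    also have "val4 c x z t (\<chi> level) = (z ^ k + t ^ l + x - c) * ?U + x ^ Suc d * ?w"
      unfolding U by (simp add: level_def rr_def rm_simps[OF rv] vg)
    also have "z ^ k + t ^ l + x - c = - (x ^ d * y)" by (simp add: c eqn_def)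
    finally have e: "?Z ^ k + ?T ^ l + x = c + (- (x ^ d * y) * ?U + x ^ Suc d * ?w)" .
    have "eqn x (y * ?U - x * ?w) ?Z ?T = x ^ d * (y * ?U - x * ?w) + (?Z ^ k + ?T ^ l + x)"
      by (simp add: eqn_def add.assoc)
    also have "\<dots> = c" unfolding e by (simp add: algebra_simps)
    finally show ?thesis .
  qed
  have hom: "val4 c x (val4 c x z t (\<chi> vz)) (val4 c x z t (\<chi> vt)) p = val4 c x z t (\<chi> p)" if \<chi>: "xaut \<chi>" for \<chi> c x z t p
  proof -
    note r = xautD(1,2,3)[OF \<chi>]
    show ?thesis
      by (induction p rule: poly3_induct) (simp_all add: rm_simps[OF r(1)] rm_simps[OF rv] r vg)
  qed
  have at0: "val4 c 0 z t p = val4 c 0 z t q" if a0: "vx dvd p - q" for c z t p q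
  proof -
    obtain w where "p = q + vx * w" using a0 by (rule dvd_diffE)
    then show ?thesis by (simp add: rm_simps[OF rv] vg)
  qed
  have zero: "lift \<chi> U w (0, y, z, t) = (0, y, z, t)"
    if \<chi>: "xaut \<chi>" "\<And>p. vx dvd \<chi> p - p" "vx dvd U - 1" for \<chi> U w y z t
    using at0[OF \<chi>(2)[of vz]] at0[OF \<chi>(2)[of vt]] at0[OF \<chi>(3)]
    by (simp add: lift_def vg rm_1[OF rv])
  have eqn_lift: "(case lift \<chi> U w (x, y, z, t) of (x, y, z, t) \<Rightarrow> eqn x y z t) = eqn x y z t"
    if "xaut \<chi>" "\<chi> level = level * U + vx ^ Suc d * w" for \<chi> U w x y z t
    using main[OF that refl, of x y z t] by (simp add: lift_def)
  have inv: "lift \<chi>' U' w' (lift \<chi> U w P) = P"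
    if \<chi>: "xaut \<chi>" "\<And>p. vx dvd \<chi> p - p" "vx dvd U - 1" "\<chi> level = level * U + vx ^ Suc d * w"
      and \<chi>': "xaut \<chi>'" "\<And>p. vx dvd \<chi>' p - p" "vx dvd U' - 1" "\<chi>' level = level * U' + vx ^ Suc d * w'"
      and i: "\<And>p. \<chi> (\<chi>' p) = p" for \<chi> U w \<chi>' U' w' P
  proof -
    obtain x y z t where P: "P = (x, y, z, t)" by (cases P)
    show ?thesis
    proof (cases "x = 0")
      case True
      then show ?thesis using zero[OF \<chi>(1-3)] zero[OF \<chi>'(1-3)] by (simp add: P)
    next
      case False
      define c where "c = eqn x y z t"
      obtain y1 where P1: "lift \<chi> U w P = (x, y1, val4 c x z t (\<chi> vz), val4 c x z t (\<chi> vt))"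
        by (simp add: P lift_def c_def)
      have c1: "eqn x y1 (val4 c x z t (\<chi> vz)) (val4 c x z t (\<chi> vt)) = c"
        using eqn_lift[OF \<chi>(1,4), of x y z t] P1 by (simp add: P c_def)
      obtain y2 where P2: "lift \<chi>' U' w' (lift \<chi> U w P) = (x, y2, z, t)"
        unfolding P1 by (simp add: lift_def c1 hom[OF \<chi>(1)] i vg)
      have "eqn x y2 z t = c"
        using eqn_lift[OF \<chi>'(1,4), of x y1 "val4 c x z t (\<chi> vz)" "val4 c x z t (\<chi> vt)"] P2 P1 c1 by simp
      then have "x ^ d * y2 = x ^ d * y" by (simp add: eqn_def c_def)
      then show ?thesis using P2 False by (simp add: P)
    qed
  qed
  have x: "xaut \<psi>" "xaut \<psi>'" and s: "\<And>p. vx dvd \<psi> p - p" "\<And>p. vx dvd \<psi>' p - p"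
    using F \<psi>'(1) by (auto simp: family_def)
  obtain U w where U: "\<psi> level = level * U + vx ^ Suc d * w" using F by (auto simp: family_def)
  obtain U' w' where U': "\<psi>' level = level * U' + vx ^ Suc d * w'" using \<psi>'(1) by (auto simp: family_def)
  have U1: "vx dvd U - 1" by (rule xaut_inverse_ideal(1)[OF xautD(1)[OF x(1)] s(1) x(2) \<psi>'(3) level_not_dvd _ U]) simp
  have U1': "vx dvd U' - 1" by (rule xaut_inverse_ideal(1)[OF xautD(1)[OF x(2)] s(2) x(1) \<psi>'(2) level_not_dvd _ U']) simp
  have inK: "lift \<chi> U w P \<in> KR" if "P \<in> KR" "xaut \<chi>" "\<chi> level = level * U + vx ^ Suc d * w" for \<chi> U w P
    using that(1) eqn_lift[OF that(2,3)] unfolding koras_russell_def eqn_def by (cases P) (auto simp: case_prod_unfold)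
  have "extends (lift \<psi> U w)" unfolding extends_def
  proof (intro conjI exI[of _ "lift \<psi>' U' w'"] allI poly)
    show "lift \<psi> U w ` KR \<subseteq> KR" "lift \<psi>' U' w' ` KR \<subseteq> KR"
      using inK[OF _ x(1) U] inK[OF _ x(2) U'] by blast+
    show "lift \<psi> U w (0, 0, 0, 0) = (0, 0, 0, 0)" by (rule zero[OF x(1) s(1) U1])
    show "lift \<psi> U w (lift \<psi>' U' w' P) = P" for P
      by (rule inv[OF x(2) s(2) U1' U' x(1) s(1) U1 U \<psi>'(3)])
    show "lift \<psi>' U' w' (lift \<psi> U w P) = P" for P
      by (rule inv[OF x(1) s(1) U1 U x(2) s(2) U1' U' \<psi>'(2)])
  qed
  moreover have "restricts_to d k l (restrict (lift \<psi> U w) KR) (at_zero \<psi>)"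
    unfolding restricts_to_def
  proof (intro allI ballI)
    fix p P assume P: "P \<in> KR"
    obtain x y z t where Pe: "P = (x, y, z, t)" by (cases P)
    have c0: "eqn x y z t = 0" using P by (simp add: Pe koras_russell_def eqn_def)
    have sp: "eval_xzt (specialize q) (x, z, t) = val4 0 x z t q" for q x z t
      by (induction q rule: poly3_induct)
         (simp_all add: eval_simps rm_simps[OF rv] vg rm_simps[OF ring_map_family(2)] family_gens)
    have co: "eval_xzt q (x, z, t) = val4 0 x z t (constant_family q)" for q x z t
      using sp[of "constant_family q"] by (simp add: specialize_constant)
    have e: "eval_xzt (at_zero \<psi> p) (x, z, t) = val4 0 x z t (\<psi> (constant_family p))"
      unfolding at_zero_def by (rule sp)
    show "eval_xzt (at_zero \<psi> p) (pr_xzt P) = eval_xzt p (pr_xzt (restrict (lift \<psi> U w) KR P))"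
      using P by (simp add: Pe lift_def c0 e co[of p] hom[OF x(1)])
  qed
  ultimately show ?thesis by (rule that)
qed

subsection \<open>The decomposition\<close>

lemma infl_specialize:
  assumes "infl n H \<psi>" shows "infl n (specialize H) (at_zero \<psi>)"
  unfolding infl_def
proof
  fix p
  obtain w where w: "\<psi> (constant_family p) = constant_family p + vx ^ n * br H (constant_family p) + vx ^ Suc n * w"
    using inflE[OF assms] by blast
  have "at_zero \<psi> p = p + vx ^ n * br (specialize H) p + vx ^ Suc n * specialize w"
    unfolding at_zero_def w rm_add[OF ring_map_family(2)] level_value specialize_br specialize_constant ..
  then show "vx ^ Suc n dvd at_zero \<psi> p - p - vx ^ n * br (specialize H) p" by (rule inflI)
qed

text \<open>The Hamiltonian over the parameter ring is a multiple of \<open>level\<close>, which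
  keeps the ideal of \<open>level\<close> and x^(d+1) invariant; at c = 0 it becomes
  \<open>f * rr\<close>.\<close>

lemma family_realizes:
  assumes n: "n > 0" "n \<le> d"
  obtains \<chi> where "family \<chi>" "infl n (f * rr) (at_zero \<chi>)"
proof -
  obtain \<chi> U w where \<chi>: "xaut \<chi>" "infl n (constant_family f * level) \<chi>" "\<chi> level = level * U + vx ^ Suc d * w"
    using hamiltonian_automorphism[OF n(1), of "Suc d" "constant_family f" level] n(2) by auto
  have "vx dvd \<chi> p - p" for p
  proof -
    obtain w where "\<chi> p = p + vx ^ n * br (constant_family f * level) p + vx ^ Suc n * w" using inflE[OF \<chi>(2)] by blast
    then have "\<chi> p - p = vx ^ n * (br (constant_family f * level) p + vx * w)" by (simp add: algebra_simps)
    then show ?thesis using n(1) by (simp add: dvd_mult2 dvd_power)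
  qed
  then have "family \<chi>" using \<chi> by (auto simp: family_def)
  moreover have "infl n (f * rr) (at_zero \<chi>)"
    using infl_specialize[OF \<chi>(2)] by (simp add: rm_mult[OF ring_map_family(2)] specialize_constant specialize_level)
  ultimately show ?thesis by (rule that)
qed

text \<open>If \<open>\<eta>\<close> is the identity modulo \<open>x ^ n\<close> and preserves the ideal, its leading Hamiltonian
  is constant on the cuspidal curve, hence, up to a constant, a multiple of \<open>z ^ k + t ^ l\<close>.\<close>

lemma leading_hamiltonian:
  assumes \<eta>: "xaut \<eta>" "\<eta> rr = u * rr + vx ^ d * b" and n: "n > 0" "n < d"
    and small: "\<And>p. vx ^ n dvd \<eta> p - (p :: Cxzt)"
  obtains f where "infl n (f * rr) \<eta>" "infl n (f * [:r0:]) \<eta>"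
proof -
  have "br (\<eta> vz) (\<eta> vt) = 1" using xautD(4)[OF \<eta>(1), of vz vt] rm_1[OF xautD(1)[OF \<eta>(1)]] by simp
  then obtain H where H: "infl n [:H:] \<eta>"
    using xaut_congruent_to_id_level[OF xautD(1,2,3)[OF \<eta>(1)] n(1) small] by auto
  obtain w where w: "\<eta> rr = rr + vx ^ n * br [:H:] rr + vx ^ Suc n * w" using inflE[OF H] by blast
  obtain m where m: "d = Suc n + m" using n(2) by (metis Suc_leI le_Suc_ex)
  have e: "(u - 1) * rr = vx ^ n * (br [:H:] rr + vx * w - vx * (vx ^ m * b))"
    using w \<eta>(2) by (simp add: m power_add algebra_simps)
  then have "vx ^ n dvd (u - 1) * rr" by simp
  then have "vx ^ n dvd u - 1" by (rule vx_pow_prime[OF not_vx_dvd_rr])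
  then obtain v where v: "u - 1 = vx ^ n * v" by (auto simp: dvd_def)
  have "vx ^ n * (v * rr) = vx ^ n * (br [:H:] rr + vx * w - vx * (vx ^ m * b))"
    using e by (simp add: v mult.assoc)
  then have "v * rr = br [:H:] rr + vx * w - vx * (vx ^ m * b)" by simp
  then have "coeff (v * rr) 0 = coeff (br [:H:] rr + vx * w - vx * (vx ^ m * b)) 0" by simp
  then have "br2 H r0 = coeff v 0 * r0"
    by (simp add: rm_simps[OF ring_map_red] red_gens coeff_br)
  then obtain c f where Hf: "H = [:[:c:]:] + f * r0" by (rule cusp_hamiltonian)
  have H': "[:H:] = kc c + [:f:] * [:r0:]" by (simp add: Hf kc_def mult.commute)
  have i2: "infl n ([:f:] * [:r0:]) \<eta>" using H unfolding infl_def H' br_left by simp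
  have rr': "rr = [:r0:] + vx" by (simp add: rr_eq vx_def)
  have "infl n ([:f:] * rr) \<eta>" unfolding infl_def
  proof
    fix p
    obtain w where w: "\<eta> p = p + vx ^ n * br ([:f:] * [:r0:]) p + vx ^ Suc n * w" using inflE[OF i2] by blast
    have "\<eta> p = p + vx ^ n * br ([:f:] * rr) p + vx ^ Suc n * (w - br [:f:] p)"
      unfolding w rr' by (simp add: br_left distrib_left algebra_simps del: mult_pCons_left mult_pCons_right)
    then show "vx ^ Suc n dvd \<eta> p - p - vx ^ n * br ([:f:] * rr) p" by (rule inflI)
  qed
  then show ?thesis using i2 by (rule that)
qed

text \<open>The error left by the family found so far again preserves the ideal, so its leading
  Hamiltonian is \<open>f * rr\<close>; composing with a family realizing it improves the congruence
  by one power of x. \<open>leading_hamiltonian\<close> works for exponents below d, so what remains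
  is congruent to the identity modulo x^d.\<close>

theorem decomposition:
  assumes \<phi>: "xaut \<phi>" "\<And>p. vx dvd \<phi> p - p" "\<phi> rr = u * rr + vx ^ d * b"
  obtains \<psi> \<eta> where "family \<psi>" "xaut \<eta>" "\<And>p. vx ^ d dvd \<eta> p - (p :: Cxzt)" "\<And>p. \<phi> p = at_zero \<psi> (\<eta> p)"
proof -
  have ex: "Suc n \<le> d \<Longrightarrow> \<exists>\<psi>. family \<psi> \<and> (\<forall>p. vx ^ Suc n dvd \<phi> p - at_zero \<psi> p)" for n
  proof (induction n)
    case 0
    show ?case using \<phi>(2) family_id
      by (intro exI[of _ "\<lambda>p. p"]) (simp add: at_zero_def specialize_constant)
  next
    case (Suc n)
    let ?n = "Suc n"
    obtain \<psi> where \<psi>: "family \<psi>" "\<And>p. vx ^ ?n dvd \<phi> p - at_zero \<psi> p" using Suc by auto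
    obtain \<psi>' where \<psi>': "family \<psi>'" "\<And>p. \<psi> (\<psi>' p) = p" "\<And>p. \<psi>' (\<psi> p) = p" using family_inverse[OF \<psi>(1)] by blast
    have x: "xaut \<psi>" "xaut \<psi>'" using \<psi>(1) \<psi>'(1) by (auto simp: family_def)
    note r = xautD(1,3)[OF at_zero_xaut[OF \<psi>(1)]] and r' = xautD(1,3)[OF at_zero_xaut[OF \<psi>'(1)]]
    have inv: "at_zero \<psi> (at_zero \<psi>' p) = p" "at_zero \<psi>' (at_zero \<psi> p) = p" for p
      unfolding at_zero_def[of \<psi>' p] at_zero_def[of \<psi> p] at_zero_specialize[OF x(1)] at_zero_specialize[OF x(2)]
      by (simp_all add: \<psi>' specialize_constant)
    define \<eta> where "\<eta> p = at_zero \<psi>' (\<phi> p)" for p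
    have \<eta>: "xaut \<eta>" unfolding \<eta>_def by (rule xaut_comp[OF at_zero_xaut[OF \<psi>'(1)] \<phi>(1)])
    have small: "vx ^ ?n dvd \<eta> p - p" for p
      using rm_dvd[OF r'(1) \<psi>(2)[of p]] by (simp add: rm_diff[OF r'(1)] rm_power[OF r'(1)] rm_mult[OF r'(1)] r'(2) inv \<eta>_def)
    obtain U w where U: "\<psi>' level = level * U + vx ^ Suc d * w" using \<psi>'(1) by (auto simp: family_def)
    have "at_zero \<psi>' rr = specialize (\<psi>' level)" using at_zero_specialize[OF x(2), of level] by (simp add: specialize_level)
    also have "\<dots> = rr * specialize U + vx ^ Suc d * specialize w"
      unfolding U rm_add[OF ring_map_family(2)] level_value by (simp add: rm_mult[OF ring_map_family(2)] specialize_level)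
    finally have e1: "at_zero \<psi>' rr = rr * specialize U + vx ^ Suc d * specialize w" .
    have "\<eta> rr = (at_zero \<psi>' u * specialize U) * rr + vx ^ d * (at_zero \<psi>' u * vx * specialize w + at_zero \<psi>' b)"
      by (simp add: \<eta>_def \<phi>(3) rm_simps[OF r'(1)] r'(2) e1 algebra_simps)
    then obtain f where f: "infl ?n (f * rr) \<eta>"
      using leading_hamiltonian[OF \<eta> _ _ _ small] Suc.prems by (metis Suc_le_lessD zero_less_Suc)
    obtain \<chi> where \<chi>: "family \<chi>" "infl ?n (f * rr) (at_zero \<chi>)" using family_realizes[of ?n f] Suc.prems by auto
    have "vx ^ Suc ?n dvd \<phi> p - at_zero (\<lambda>p. \<psi> (\<chi> p)) p" for p
    proof -
      have "vx ^ Suc ?n dvd (\<eta> p - p - vx ^ ?n * br (f * rr) p) - (at_zero \<chi> p - p - vx ^ ?n * br (f * rr) p)"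
        using f \<chi>(2) unfolding infl_def by (blast intro: dvd_diff)
      then have "vx ^ Suc ?n dvd \<eta> p - at_zero \<chi> p" by simp
      from rm_dvd[OF r(1) this] have "vx ^ Suc ?n dvd \<phi> p - at_zero \<psi> (at_zero \<chi> p)"
        by (simp add: rm_diff[OF r(1)] rm_power[OF r(1)] r(2) rm_mult[OF r(1)] inv \<eta>_def)
      moreover have "at_zero \<psi> (at_zero \<chi> p) = at_zero (\<lambda>p. \<psi> (\<chi> p)) p"
        unfolding at_zero_def[of \<chi>] at_zero_specialize[OF x(1)] by (simp add: at_zero_def)
      ultimately show ?thesis by simp
    qed
    then show ?case using family_comp[OF \<psi>(1) \<chi>(1)] by blast
  qed
  obtain \<psi> where \<psi>: "family \<psi>" "\<And>p. vx ^ d dvd \<phi> p - at_zero \<psi> p"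
    using ex[of "d - 1"] pos by auto
  obtain \<psi>0' where \<psi>0': "xaut \<psi>0'" "\<And>p. at_zero \<psi> (\<psi>0' p) = p" "\<And>p. \<psi>0' (at_zero \<psi> p) = p"
    using xaut_inverse[OF at_zero_xaut[OF \<psi>(1)]] by blast
  have "vx ^ d dvd \<psi>0' (\<phi> p) - p" for p
    using rm_dvd[OF xautD(1)[OF \<psi>0'(1)] \<psi>(2)[of p]]
    by (simp add: rm_diff[OF xautD(1)[OF \<psi>0'(1)]] rm_power[OF xautD(1)[OF \<psi>0'(1)]] xautD(3)[OF \<psi>0'(1)] \<psi>0')
  then show ?thesis using that[OF \<psi>(1) xaut_comp[OF \<psi>0'(1) \<phi>(1)]] \<psi>0' by simp
qed

end

section \<open>The structure of the automorphism group\<close>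

lemma Aut_variety_subgroup: "subgroup (carrier (Aut_variety V)) (BijGroup V)"
proof (rule group.subgroupI[OF group_BijGroup])
  have "polynomial_map (\<lambda>x. x)" by (auto simp: polynomial_map_def comp_def intro: polynomial_fun.coord)
  then have id: "polynomial_map_on V F" if "\<And>P. P \<in> V \<Longrightarrow> F P = P" for F :: "'a \<Rightarrow> 'a"
    using that unfolding polynomial_map_on_def by (intro exI[of _ "\<lambda>x. x"]) auto
  have "inv_into V (restrict (\<lambda>x. x) V) P = P" if "P \<in> V" for P
    by (rule inv_into_f_eq) (use that in \<open>auto simp: inj_on_def\<close>)
  then have "(\<lambda>x\<in>V. x) \<in> carrier (Aut_variety V)" by (simp add: Aut_variety_def id_Bij id)
  then show "carrier (Aut_variety V) \<noteq> {}" by blast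
  show "carrier (Aut_variety V) \<subseteq> carrier (BijGroup V)" by (auto simp: Aut_variety_def BijGroup_def)
next
  fix F assume "F \<in> carrier (Aut_variety V)"
  then have F: "F \<in> Bij V" "polynomial_map_on V F" "polynomial_map_on V (inv_into V F)"
    by (auto simp: Aut_variety_def)
  have b: "bij_betw F V V" using F(1) by (simp add: Bij_def)
  have i: "restrict (inv_into V F) V \<in> Bij V" by (rule restrict_inv_into_Bij[OF F(1)])
  have "inv_into V (restrict (inv_into V F) V) P = F P" if P: "P \<in> V" for P
  proof (rule inv_into_f_eq)
    show "inj_on (restrict (inv_into V F) V) V" using i by (simp add: Bij_def bij_betw_def)
    show "F P \<in> V" using b P by (auto simp: bij_betw_def)
    then show "restrict (inv_into V F) V (F P) = P" using bij_betw_inv_into_left[OF b P] by simp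
  qed
  then have "polynomial_map_on V (inv_into V (restrict (inv_into V F) V))"
    using F(2) unfolding polynomial_map_on_def by auto
  moreover have "polynomial_map_on V (restrict (inv_into V F) V)"
    using F(3) unfolding polynomial_map_on_def by auto
  ultimately show "inv\<^bsub>BijGroup V\<^esub> F \<in> carrier (Aut_variety V)"
    using i by (simp add: inv_BijGroup F(1) Aut_variety_def)
next
  fix F G assume "F \<in> carrier (Aut_variety V)" "G \<in> carrier (Aut_variety V)"
  then have F: "F \<in> Bij V" "polynomial_map_on V F" "polynomial_map_on V (inv_into V F)"
    and G: "G \<in> Bij V" "polynomial_map_on V G" "polynomial_map_on V (inv_into V G)"
    by (auto simp: Aut_variety_def)
  have b: "bij_betw F V V" "bij_betw G V V" using F(1) G(1) by (auto simp: Bij_def)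
  have cm: "polynomial_map_on V H" if p: "polynomial_map_on V A" "polynomial_map_on V B" "B ` V \<subseteq> V" "\<And>P. P \<in> V \<Longrightarrow> H P = A (B P)" for A B H
  proof -
    obtain A' B' where "polynomial_map A'" "\<And>P. P \<in> V \<Longrightarrow> A P = A' P" "polynomial_map B'" "\<And>P. P \<in> V \<Longrightarrow> B P = B' P"
      using p(1,2) unfolding polynomial_map_on_def by metis
    then show ?thesis using p(3,4) polynomial_map_comp[of A' B'] unfolding polynomial_map_on_def
      by (intro exI[of _ "\<lambda>P. A' (B' P)"]) (auto simp: image_subset_iff)
  qed
  have C: "compose V F G \<in> Bij V" by (rule compose_Bij[OF F(1) G(1)])
  have inv: "inv_into V (compose V F G) P = inv_into V G (inv_into V F P)" if P: "P \<in> V" for P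
  proof (rule inv_into_f_eq)
    show "inj_on (compose V F G) V" using C by (simp add: Bij_def bij_betw_def)
    have q: "inv_into V F P \<in> V" by (rule Bij_inv_into_mem[OF F(1) P])
    show r: "inv_into V G (inv_into V F P) \<in> V" by (rule Bij_inv_into_mem[OF G(1) q])
    show "compose V F G (inv_into V G (inv_into V F P)) = P"
      using bij_betw_inv_into_right[OF b(1) P] bij_betw_inv_into_right[OF b(2) q] r by (simp add: compose_def)
  qed
  have "polynomial_map_on V (compose V F G)"
    by (rule cm[OF F(2) G(2)]) (use b in \<open>auto simp: compose_def bij_betw_def\<close>)
  moreover have "polynomial_map_on V (inv_into V (compose V F G))"
    by (rule cm[OF G(3) F(3)]) (use inv Bij_inv_into_mem[OF F(1)] in auto)
  ultimately show "F \<otimes>\<^bsub>BijGroup V\<^esub> G \<in> carrier (Aut_variety V)"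
    using C F(1) G(1) by (simp add: Aut_variety_def BijGroup_def)
qed

lemma group_Aut_variety: "group (Aut_variety V)"
proof -
  have "Aut_variety V = (BijGroup V)\<lparr>carrier := carrier (Aut_variety V)\<rparr>" by (simp add: Aut_variety_def)
  then show ?thesis
    using group.subgroup_imp_group[OF group_BijGroup Aut_variety_subgroup, of V] by simp
qed

lemma Aut_variety_ops:
  assumes "F \<in> carrier (Aut_variety V)"
  shows "G \<in> carrier (Aut_variety V) \<Longrightarrow> F \<otimes>\<^bsub>Aut_variety V\<^esub> G = compose V F G"
    "inv\<^bsub>Aut_variety V\<^esub> F = restrict (inv_into V F) V" "\<one>\<^bsub>Aut_variety V\<^esub> = (\<lambda>x\<in>V. x)"
proof -
  have e: "Aut_variety V = (BijGroup V)\<lparr>carrier := carrier (Aut_variety V)\<rparr>" by (simp add: Aut_variety_def)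
  have F: "F \<in> Bij V" using assms by (simp add: Aut_variety_def)
  show "G \<in> carrier (Aut_variety V) \<Longrightarrow> F \<otimes>\<^bsub>Aut_variety V\<^esub> G = compose V F G"
    using F by (simp add: Aut_variety_def BijGroup_def)
  show "\<one>\<^bsub>Aut_variety V\<^esub> = (\<lambda>x\<in>V. x)" by (simp add: Aut_variety_def BijGroup_def)
  show "inv\<^bsub>Aut_variety V\<^esub> F = restrict (inv_into V F) V"
    using group.m_inv_consistent[OF group_BijGroup Aut_variety_subgroup assms]
    by (simp add: inv_BijGroup[OF F] flip: e)
qed

context koras
begin

lemma torus_hom_gens: "ring_map (torus_hom m)" "torus_hom m (kc c) = kc c" "torus_hom m vx = kc (m ^ (k * l)) * vx"
    "torus_hom m vz = kc (m ^ l) * vz" "torus_hom m vt = kc (m ^ k) * vt"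
  unfolding torus_hom_def by (simp_all add: subst3_gens[OF ring_map_kc] ring_map_subst3[OF ring_map_kc])

lemma torus_hom_comp: "torus_hom a (torus_hom b p) = torus_hom (a * b) p"
  by (rule ring_map_poly3_eq[OF ring_map_comp[OF torus_hom_gens(1) torus_hom_gens(1)] torus_hom_gens(1)])
     (simp_all add: torus_hom_gens rm_mult[OF torus_hom_gens(1)] power_mult_distrib rm_mult[OF ring_map_kc])

lemma torus_hom_1: "torus_hom 1 p = p"
  by (rule ring_map_poly3_eq[OF torus_hom_gens(1) ring_map_id])
     (simp_all add: torus_hom_gens rm_1[OF ring_map_kc])

lemma torus_hom_rr: "torus_hom m rr = kc (m ^ (k * l)) * rr"
  unfolding rr_def
  by (simp add: rm_simps[OF torus_hom_gens(1)] torus_hom_gens power_mult_distrib distrib_left mult.commute[of l k]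
      flip: power_mult rm_power[OF ring_map_kc])

lemma Aut_comp: "F \<in> AX \<Longrightarrow> G \<in> AX \<Longrightarrow> compose KR F G \<in> AX"
  using group.subgroup_self[OF group_Aut_variety] subgroup.m_closed Aut_variety_ops(1) by metis

lemma Aut_inv: "F \<in> AX \<Longrightarrow> restrict (inv_into KR F) KR \<in> AX"
  using group.inv_closed[OF group_Aut_variety] Aut_variety_ops(2) by metis

lemma restricts_restrict: "restricts_to d k l (restrict F KR) \<phi> \<longleftrightarrow> restricts_to d k l F \<phi>"
  by (simp add: restricts_to_def)

lemma congruent_hom:
  assumes \<phi>: "ring_map \<phi>" "\<And>c. \<phi> (kc c) = kc c" and \<tau>: "ring_map \<tau>" "\<And>c. \<tau> (kc c) = kc c"
    and g: "s dvd \<phi> vx - \<tau> vx" "s dvd \<phi> vz - \<tau> vz" "s dvd \<phi> vt - \<tau> vt"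
  shows "s dvd \<phi> p - \<tau> p"
proof (induction p rule: poly3_induct)
  case (add p q)
  have "\<phi> (p + q) - \<tau> (p + q) = (\<phi> p - \<tau> p) + (\<phi> q - \<tau> q)" by (simp add: rm_add[OF \<phi>(1)] rm_add[OF \<tau>(1)])
  then show ?case by (simp only: dvd_add[OF add.IH])
next
  case (mult p q)
  have "\<phi> (p * q) - \<tau> (p * q) = (\<phi> p - \<tau> p) * \<phi> q + \<tau> p * (\<phi> q - \<tau> q)"
    by (simp add: rm_mult[OF \<phi>(1)] rm_mult[OF \<tau>(1)] algebra_simps)
  then show ?case by (simp only: dvd_add[OF dvd_mult2[OF mult.IH(1)] dvd_mult[OF mult.IH(2)]])
qed (use assms in auto)

text \<open>The reduction multiplies z by \<alpha> and t by \<beta> with \<alpha>^k = \<beta>^l.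
  Coprimality turns these into m^l and m^k, so modulo x the automorphism is the torus element of
  m.\<close>

theorem Aut_normal_form:
  assumes F: "F \<in> AX"
  obtains \<phi> \<psi> m u b where "restricts_to d k l F \<phi>" "ring_map \<phi>" "\<And>c. \<phi> (kc c) = kc c" "m \<noteq> 0"
    "\<phi> vx = torus_hom m vx" "\<And>p. vx dvd \<phi> p - torus_hom m p" "\<phi> rr = u * rr + vx ^ d * b"
    "ring_map \<psi>" "\<And>p. \<phi> (\<psi> p) = p" "\<And>p. \<psi> (\<phi> p) = p" "\<And>c. \<psi> (kc c) = kc c"
    "restricts_to d k l (inv_into KR F) \<psi>"
proof -
  obtain \<phi> \<psi> c u b where 1: "restricts_to d k l F \<phi>" "restricts_to d k l (inv_into KR F) \<psi>"
    "ring_map \<phi>" "ring_map \<psi>" "\<And>c. \<phi> (kc c) = kc c" "\<And>c. \<psi> (kc c) = kc c"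
    "\<And>p. \<phi> (\<psi> p) = p" "\<And>p. \<psi> (\<phi> p) = p"
    "c \<noteq> 0" "\<phi> vx = kc c * vx" "\<phi> rr = u * rr + vx ^ d * b" by (rule Aut_restricts[OF F]) (rule that; (assumption | erule meta_spec))
  obtain \<psi>2 u' b' where 2: "restricts_to d k l (restrict (inv_into KR F) KR) \<psi>2" "\<psi>2 rr = u' * rr + vx ^ d * b'"
    using Aut_restricts[OF Aut_inv[OF F]] by metis
  have "\<psi>2 = \<psi>" by (rule restricts_unique[OF 2(1)[unfolded restricts_restrict] 1(2)])
  then have \<psi>r: "\<psi> rr = u' * rr + vx ^ d * b'" using 2(2) by simp
  obtain \<alpha> \<beta> j where ab: "coeff (\<phi> vz) 0 = [:0, [:\<alpha>:]:]" "coeff (\<phi> vt) 0 = [:[:0, \<beta>:]:]" "\<alpha> ^ k = c" "\<beta> ^ l = c"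
    using reduction_form[OF 1(3,5,10,11) 1(4,6) \<psi>r 1(7)] by blast
  have nz: "\<alpha> \<noteq> 0" "\<beta> \<noteq> 0" using ab(3,4) 1(9) pos by (auto simp: zero_power)
  obtain m where m: "m \<noteq> 0" "\<alpha> = m ^ l" "\<beta> = m ^ k" using bezout_roots[OF nz _ cop] ab(3,4) by auto
  have c: "c = m ^ (k * l)" using ab(3) m(2) by (simp add: mult.commute flip: power_mult)
  have x: "\<phi> vx = torus_hom m vx" by (simp add: 1(10) torus_hom_gens c)
  have "coeff (torus_hom m vz) 0 = [:0, [:\<alpha>:]:]" "coeff (torus_hom m vt) 0 = [:[:0, \<beta>:]:]"
    unfolding torus_hom_gens m by (simp_all add: kc_def vz_def vt_def coeff_mult_0)
  then have vd: "vx dvd \<phi> vz - torus_hom m vz" "vx dvd \<phi> vt - torus_hom m vt"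
    by (simp_all add: vx_dvd_iff ab)
  have "vx dvd \<phi> p - torus_hom m p" for p
    by (rule congruent_hom[OF 1(3,5) torus_hom_gens(1,2) _ vd]) (simp add: x)
  from that[OF 1(1,3,5) m(1) x this 1(11,4,7,8,6,2)] show ?thesis .
qed

text \<open>Invertibility makes the Jacobian a nonzero constant, and this constant can be read off
  modulo x, where the map is the identity.\<close>

lemma xaut_congruent_id:
  assumes \<phi>: "ring_map \<phi>" "\<And>c. \<phi> (kc c) = kc c" "\<phi> vx = vx" "\<And>p. vx dvd \<phi> p - (p :: Cxzt)"
    and \<psi>: "ring_map \<psi>" "\<And>p. \<phi> (\<psi> p) = p" "\<And>p. \<psi> (\<phi> p) = p"
  shows "xaut \<phi>"
proof -
  have x': "\<phi> vx = kc 1 * vx" using \<phi>(3) by (simp add: rm_1[OF ring_map_kc])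
  have "\<phi> (br (\<psi> vz) (\<psi> vt)) * br (\<phi> vz) (\<phi> vt) = 1"
    unfolding br_hom[OF \<phi>(1,2) x', symmetric] \<psi> by simp
  then obtain j where j: "br (\<phi> vz) (\<phi> vt) = kc j" by (metis mult.commute unit_poly3)
  have "coeff (\<phi> p) 0 = coeff p 0" for p using \<phi>(4)[of p] by (simp add: vx_dvd_iff)
  then have "coeff (br (\<phi> vz) (\<phi> vt)) 0 = coeff (br vz vt) 0" by (simp only: coeff_br)
  then have "j = 1" by (simp add: j kc_def one_pCons)
  then have "br (\<phi> vz) (\<phi> vt) = 1" by (simp add: j rm_1[OF ring_map_kc])
  then show ?thesis unfolding xaut_def using \<phi>(1-3) \<psi> by blast
qed

theorem Aut_extends:
  assumes F: "F \<in> AX" obtains \<Phi> where "extends \<Phi>" "\<And>P. P \<in> KR \<Longrightarrow> F P = \<Phi> P"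
proof -
  obtain \<phi> \<psi> m u b where *: "restricts_to d k l F \<phi>" "ring_map \<phi>" "\<And>c. \<phi> (kc c) = kc c" "m \<noteq> 0"
    "\<phi> vx = torus_hom m vx" "\<And>p. vx dvd \<phi> p - torus_hom m p" "\<phi> rr = u * rr + vx ^ d * b"
    "ring_map \<psi>" "\<And>p. \<phi> (\<psi> p) = p" "\<And>p. \<psi> (\<phi> p) = p" "\<And>c. \<psi> (kc c) = kc c"
    "restricts_to d k l (inv_into KR F) \<psi>"
    by (rule Aut_normal_form[OF F]) (rule that; (assumption | erule meta_spec))
  note th = torus_hom_gens(1)
  define \<phi>1 where "\<phi>1 p = \<phi> (torus_hom (inverse m) p)" for p
  define \<psi>1 where "\<psi>1 p = torus_hom m (\<psi> p)" for p
  have r: "ring_map \<phi>1" "ring_map \<psi>1"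
    unfolding \<phi>1_def \<psi>1_def by (intro ring_map_comp[OF *(2) th] ring_map_comp[OF th *(8)])+
  have inv: "\<phi>1 (\<psi>1 p) = p" "\<psi>1 (\<phi>1 p) = p" for p
    using *(4) by (simp_all add: \<phi>1_def \<psi>1_def torus_hom_comp torus_hom_1 * )
  have kc1: "\<phi>1 (kc c) = kc c" "\<psi>1 (kc c) = kc c" for c by (simp_all add: \<phi>1_def \<psi>1_def torus_hom_gens * )
  have cong: "vx dvd \<phi>1 p - p" for p
    using *(6)[of "torus_hom (inverse m) p"] *(4) by (simp add: \<phi>1_def torus_hom_comp torus_hom_1)
  have cc: "kc (inverse m ^ (k * l)) * kc (m ^ (k * l)) = 1"
    using *(4) by (simp add: rm_1[OF ring_map_kc] flip: rm_mult[OF ring_map_kc] power_mult_distrib)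
  have x: "\<phi>1 vx = vx"
    using cc by (simp add: \<phi>1_def torus_hom_gens rm_mult[OF *(2)] * mult.assoc[symmetric])
  have xa: "xaut \<phi>1" by (rule xaut_congruent_id[OF r(1) kc1(1) x cong r(2) inv])
  have "\<phi>1 rr = (kc (inverse m ^ (k * l)) * u) * rr + vx ^ d * (kc (inverse m ^ (k * l)) * b)"
    by (simp add: \<phi>1_def torus_hom_rr rm_mult[OF *(2)] * algebra_simps)
  note rr1 = this
  obtain \<chi> \<eta> where d: "family \<chi>" "xaut \<eta>" "\<And>p. vx ^ d dvd \<eta> p - p"
    "\<And>p. \<phi>1 p = at_zero \<chi> (\<eta> p)"
    by (rule decomposition[OF xa cong rr1]) (rule that; (assumption | erule meta_spec))
  obtain A where A: "extends A" "restricts_to d k l (restrict A KR) (at_zero \<chi>)" by (rule family_extends[OF d(1)]) (rule that)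
  obtain B where B: "extends B" "restricts_to d k l (restrict B KR) \<eta>" by (rule level_d_extends[OF d(2,3)]) (rule that)
  \<comment> \<open>Restriction to C[x,z,t] reverses composition, so the torus element is applied
    last to points but innermost to polynomials.\<close>
  define \<Phi> where "\<Phi> P = torus m (B (A P))" for P
  have ext: "extends \<Phi>" unfolding \<Phi>_def by (rule extends_comp[OF torus_extends[OF *(4)] extends_comp[OF B(1) A(1)]])
  have inK: "A P \<in> KR" "B P \<in> KR" if "P \<in> KR" for P using A(1) B(1) that by (auto simp: extends_def)
  have t: "restricts_to d k l (torus m) (torus_hom m)" using torus_restricts[OF *(4)] by (simp add: restricts_restrict)
  have 1: "restricts_to d k l (\<lambda>P. B (A P)) (\<lambda>p. at_zero \<chi> (\<eta> p))"
    by (rule restricts_comp[OF B(2)[unfolded restricts_restrict] A(2)[unfolded restricts_restrict] inK(1) refl])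
  have "restricts_to d k l \<Phi> (\<lambda>p. at_zero \<chi> (\<eta> (torus_hom m p)))"
    by (rule restricts_comp[OF t 1]) (simp_all add: inK \<Phi>_def)
  also have "(\<lambda>p. at_zero \<chi> (\<eta> (torus_hom m p))) = \<phi>"
    using *(4) by (simp add: fun_eq_iff \<phi>1_def torus_hom_comp torus_hom_1 flip: d(4))
  finally have "restricts_to d k l (restrict \<Phi> KR) \<phi>" by (simp add: restricts_restrict)
  then have "F = restrict \<Phi> KR" by (rule Aut_eqI[OF F extends_Aut(2)[OF ext] *(1)])
  then show ?thesis using that[OF ext] by simp
qed

text \<open>The inclusions of ideals hold for \<open>F\<close> and for its inverse, which gives the
  equalities demanded in \<open>KR_A\<close>.\<close>

lemma restriction_in_A: assumes F: "F \<in> AX" "restricts_to d k l F \<phi>" shows "\<phi> \<in> KR_A d k l"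
proof -
  have sub: "\<theta> ` ideal_x \<subseteq> ideal_x \<and> \<theta> ` ideal_xd_r d k l \<subseteq> ideal_xd_r d k l"
    if G: "G \<in> AX" "restricts_to d k l G \<theta>" for G \<theta>
  proof -
    obtain \<theta>' m u b where *: "restricts_to d k l G \<theta>'" "ring_map \<theta>'" "\<theta>' vx = torus_hom m vx" "\<theta>' rr = u * rr + vx ^ d * b"
      using Aut_normal_form[OF G(1)] by metis
    have e: "\<theta> = \<theta>'" by (rule restricts_unique[OF G(2) *(1)])
    note h = rm_simps[OF *(2)]
    have "\<theta>' (a * vx) = (\<theta>' a * kc (m ^ (k * l))) * vx" for a by (simp add: h * torus_hom_gens)
    moreover have "\<theta>' (a * vx ^ d + v * rr) = (\<theta>' a * kc (m ^ (k * l)) ^ d + \<theta>' v * b) * vx ^ d + (\<theta>' v * u) * rr" for a v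
      by (simp add: h * torus_hom_gens power_mult_distrib algebra_simps)
    ultimately show ?thesis unfolding e ideal_x_def ideal_xd_r_def var_eq rr_def[symmetric] by blast
  qed
  obtain \<phi>' \<psi> where *: "restricts_to d k l F \<phi>'" "ring_map \<phi>'" "\<And>c. \<phi>' (kc c) = kc c"
    "\<And>p. \<phi>' (\<psi> p) = p" "\<And>p. \<psi> (\<phi>' p) = p" "restricts_to d k l (inv_into KR F) \<psi>"
    using Aut_normal_form[OF F(1)] by metis
  have e: "\<phi> = \<phi>'" by (rule restricts_unique[OF F(2) *(1)])
  have s: "\<psi> ` ideal_x \<subseteq> ideal_x \<and> \<psi> ` ideal_xd_r d k l \<subseteq> ideal_xd_r d k l"
    by (rule sub[OF Aut_inv[OF F(1)]]) (simp add: restricts_restrict * )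
  have im: "\<phi>' ` I = I" if "\<phi>' ` I \<subseteq> I" "\<psi> ` I \<subseteq> I" for I
  proof
    show "I \<subseteq> \<phi>' ` I" using that(2) *(4) by (metis image_eqI image_subset_iff subsetI)
  qed (rule that(1))
  have "bij \<phi>'" using *(4,5) by (metis bijI')
  then show ?thesis unfolding e KR_A_def algebra_automorphism_def var_eq
    using sub[OF F(1) *(1)] s im by (simp add: rm_add[OF *(2)] rm_mult[OF *(2)] * )
qed

lemma Aut_n_iff: "F \<in> Aut_n d k l n \<longleftrightarrow> F \<in> AX \<and> (\<exists>\<phi>. restricts_to d k l F \<phi> \<and> \<phi> vx = vx \<and> (\<forall>p. vx ^ n dvd \<phi> p - p))"
  unfolding Aut_n_def KR_A_n_def var_eq using restriction_in_A by blast

end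

section \<open>Orbits\<close>

lemma zariski_open_nonzero: assumes "polynomial_fun f" shows "zariski_open {P. f P \<noteq> 0}"
  unfolding zariski_open_def using assms by (intro exI[of _ "{f}"]) auto

lemma regular_on_quotient:
  assumes "polynomial_fun g" "polynomial_fun h" "\<And>P. P \<in> S \<Longrightarrow> h P \<noteq> 0" "\<And>P. P \<in> S \<Longrightarrow> f P = g P / h P"
  shows "regular_on S f"
proof -
  have "zariski_open {P :: 'a. (1 :: complex) \<noteq> 0}" by (rule zariski_open_nonzero[OF polynomial_fun.const])
  then show ?thesis using assms unfolding regular_on_def
    by (intro ballI exI[of _ "{P :: 'a. (1 :: complex) \<noteq> 0}"] exI[of _ g] exI[of _ h]) auto
qed

lemma regular_on_polynomial: "polynomial_fun g \<Longrightarrow> regular_on S g"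
  by (rule regular_on_quotient[OF _ polynomial_fun.const[of 1]]) auto

lemma isomorphic_varietiesI:
  assumes "\<And>Q. Q \<in> T \<Longrightarrow> F (G Q) = Q" "G ` T = S" "regular_map_on S F" "regular_map_on T G"
  shows "isomorphic_varieties S T"
proof -
  have b: "bij_betw F S T" by (rule bij_betw_byWitness[of _ G]) (use assms(1,2) in auto)
  have "inv_into S F Q = G Q" if "Q \<in> T" for Q
    by (rule inv_into_f_eq) (use b assms(1,2) that in \<open>auto simp: bij_betw_def\<close>)
  then have "regular_map_on T (inv_into S F)"
    using assms(4) unfolding regular_map_on_def regular_on_def comp_def by (metis IntD1)
  then show ?thesis using b assms(3) unfolding isomorphic_varieties_def by blast
qed

context koras
begin

text \<open>Modulo x only the torus part is visible. The formulas show that no automorphism can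
  leave the sets cut out by x = 0 and by z = 0 within it.\<close>

lemma Aut_weights:
  assumes F: "F \<in> AX"
  obtains m where "m \<noteq> 0" "\<And>x y z t. (x, y, z, t) \<in> KR \<Longrightarrow> fst (F (x, y, z, t)) = m ^ (k * l) * x"
    "\<And>y z t. (0, y, z, t) \<in> KR \<Longrightarrow> snd (snd (F (0, y, z, t))) = (m ^ l * z, m ^ k * t)"
proof -
  obtain \<phi> m where *: "restricts_to d k l F \<phi>" "m \<noteq> 0" "\<phi> vx = torus_hom m vx" "\<And>p. vx dvd \<phi> p - torus_hom m p"
    using Aut_normal_form[OF F] by metis
  have e: "eval_xzt p (pr_xzt (F (x, y, z, t))) = eval_xzt (\<phi> p) (x, z, t)" if "(x, y, z, t) \<in> KR" for p x y z t
    using *(1) that unfolding restricts_to_def by (metis pr_xzt.simps)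
  have c: "eval_xzt vx (pr_xzt P) = fst P" "eval_xzt vz (pr_xzt P) = fst (snd (snd P))" "eval_xzt vt (pr_xzt P) = snd (snd (snd P))" for P :: A4
    by (cases P; simp add: eval_gens)+
  have 0: "eval_xzt (\<phi> p) (0, z, t) = eval_xzt (torus_hom m p) (0, z, t)" for p z t
  proof -
    obtain w where w: "\<phi> p = torus_hom m p + vx * w" using *(4)[of p] by (rule dvd_diffE)
    show ?thesis unfolding w by (simp add: eval_simps)
  qed
  show ?thesis
  proof (rule that[OF *(2)])
    show "fst (F (x, y, z, t)) = m ^ (k * l) * x" if "(x, y, z, t) \<in> KR" for x y z t
      using e[OF that, of vx] unfolding c *(3) torus_hom_gens by (simp add: eval_simps)
    show "snd (snd (F (0, y, z, t))) = (m ^ l * z, m ^ k * t)" if "(0, y, z, t) \<in> KR" for y z t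
      using e[OF that, of vz] e[OF that, of vt] unfolding c 0 torus_hom_gens by (intro prod_eqI) (simp_all add: eval_simps)
  qed
qed

lemma Aut_origin: assumes "F \<in> AX" shows "F (0, 0, 0, 0) = (0, 0, 0, 0)"
proof -
  have "(0, 0, 0, 0) \<in> KR" using pos by (simp add: koras_russell_def zero_power)
  then show ?thesis using Aut_extends[OF assms] unfolding extends_def by metis
qed

definition conn :: "A4 \<Rightarrow> A4 \<Rightarrow> bool" where "conn P Q \<longleftrightarrow> (\<exists>F\<in>AX. F P = Q)"

lemma conn_sym: assumes "P \<in> KR" "conn P Q" shows "conn Q P"
proof -
  obtain F where F: "F \<in> AX" "F P = Q" using assms(2) by (auto simp: conn_def)
  have "restrict (inv_into KR F) KR Q = P" using Aut_in[OF F(1) assms(1)] Aut_regular(3)[OF F(1) assms(1)] F(2) by auto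
  then show ?thesis using Aut_inv[OF F(1)] unfolding conn_def by blast
qed

lemma conn_trans: assumes "P \<in> KR" "conn P Q" "conn Q S" shows "conn P S"
proof -
  obtain F G where F: "F \<in> AX" "F P = Q" "G \<in> AX" "G Q = S" using assms(2,3) by (auto simp: conn_def)
  have "compose KR G F P = S" using F assms(1) by (simp add: compose_def)
  then show ?thesis using Aut_comp[OF F(3,1)] unfolding conn_def by blast
qed

lemma conn_extends: "extends \<Phi> \<Longrightarrow> P \<in> KR \<Longrightarrow> conn P (\<Phi> P)"
  using extends_Aut(2) unfolding conn_def by (metis restrict_apply')

text \<open>The flow at time \<open>a\<close> of x^d d/dz - k z^(k-1) d/dy. On x = 0 it moves
  nothing but y, which is how points with the same z and t are joined.\<close>

lemma shear_z_extends:
  obtains \<Phi> where "extends \<Phi>" "\<And>x y z t. \<exists>y'. \<Phi> (x, y, z, t) = (x, y', z + a * x ^ d, t)"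
    "\<And>y z t. \<Phi> (0, y, z, t) = (0, y - of_nat k * a * z ^ (k - 1), z, t)"
proof -
  let ?w = "kc a * vx ^ d :: Cxzt" and ?\<eta> = "shear_z (kc a * vx ^ d) :: Cxzt \<Rightarrow> Cxzt"
  have xa: "xaut ?\<eta>"
    by (rule xaut_shear_z) (simp_all add: rm_simps[OF shear_gens(1)] shear_gens dv_simps[OF derivation_dz])
  have "vx ^ d dvd ?\<eta> p - p" for p
    by (rule congruent_hom[OF shear_gens(1,2) ring_map_id]) (simp_all add: shear_gens)
  from level_d_extends[OF xa this] obtain \<Phi> b where \<Phi>: "extends \<Phi>" "?\<eta> rr = rr + vx ^ d * b"
    "\<And>x y z t. \<Phi> (x, y, z, t) = (x, y - eval_xzt b (x, z, t), eval_xzt (?\<eta> vz) (x, z, t), eval_xzt (?\<eta> vt) (x, z, t))"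
    by metis
  define S where "S = (\<Sum>i<k. vz ^ (k - Suc i) * (vz + ?w) ^ i)"
  have "(vz + ?w) ^ k - vz ^ k = ((vz + ?w) - vz) * S" unfolding S_def by (rule power_diff_sumr2)
  then have "?\<eta> rr = rr + vx ^ d * (kc a * S)"
    by (simp add: rr_def rm_simps[OF shear_gens(1)] shear_gens algebra_simps)
  with \<Phi>(2) have b: "b = kc a * S" by simp
  have "eval_xzt b (0, z, t) = of_nat k * a * z ^ (k - 1)" for z t
  proof -
    have "eval_xzt S (0, z, t) = (\<Sum>i<k. z ^ (k - Suc i) * z ^ i)"
      unfolding S_def using pos by (simp add: eval_simps zero_power)
    also have "\<dots> = (\<Sum>i<k. z ^ (k - 1))" by (rule sum.cong) (auto simp flip: power_add)
    finally show ?thesis by (simp add: b eval_simps)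
  qed
  then show ?thesis using pos by (intro that[OF \<Phi>(1)]) (simp_all add: \<Phi>(3) shear_gens eval_simps zero_power)
qed

lemma shear_t_extends:
  obtains \<Phi> where "extends \<Phi>" "\<And>x y z t. \<exists>y'. \<Phi> (x, y, z, t) = (x, y', z, t + a * x ^ d)"
proof -
  let ?\<eta> = "shear_t (kc a * vx ^ d) :: Cxzt \<Rightarrow> Cxzt"
  have xa: "xaut ?\<eta>"
    by (rule xaut_shear_t(1)) (simp_all add: rm_simps[OF shear_gens(6)] shear_gens dv_simps[OF derivation_dt])
  have "vx ^ d dvd ?\<eta> p - p" for p
    by (rule congruent_hom[OF shear_gens(6,7) ring_map_id]) (simp_all add: shear_gens)
  from level_d_extends[OF xa this] obtain \<Phi> b where \<Phi>: "extends \<Phi>"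
    "\<And>x y z t. \<Phi> (x, y, z, t) = (x, y - eval_xzt b (x, z, t), eval_xzt (?\<eta> vz) (x, z, t), eval_xzt (?\<eta> vt) (x, z, t))"
    by metis
  then show ?thesis by (intro that[OF \<Phi>(1)]) (simp add: \<Phi>(2) shear_gens eval_simps)
qed

lemma nth_root_exists: "n > 0 \<Longrightarrow> \<exists>w :: complex. w ^ n = c"
proof (cases "c = 0")
  case False
  assume n: "n > 0"
  define w where "w = complex_of_real (root n (cmod c)) * cis (Arg c / real n)"
  have "(*) w ` {z. z ^ n = 1} = {z. z ^ n = c}"
    using bij_betw_nth_root_unity[OF False n] unfolding w_def by (rule bij_betw_imp_surj_on)
  moreover have "w * 1 \<in> (*) w ` {z. z ^ n = 1}" by (intro imageI) simp
  ultimately show ?thesis by auto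
qed (auto simp: zero_power intro!: exI[of _ 0])

lemma conn_torus: "m \<noteq> 0 \<Longrightarrow> (x, y, z, t) \<in> KR \<Longrightarrow>
    conn (x, y, z, t) (m ^ (k * l) * x, m ^ (k * l) * inverse m ^ (k * l * d) * y, m ^ l * z, m ^ k * t)"
  using conn_extends[OF torus_extends, of m "(x, y, z, t)"] by (simp add: torus_def)

lemma conn_in: "P \<in> KR \<Longrightarrow> conn P Q \<Longrightarrow> Q \<in> KR"
  using Aut_in unfolding conn_def by blast

text \<open>For x nonzero the two shears can be scaled to bring z and t to 0, the torus brings x to
  1, and the equation fixes y.\<close>

lemma conn_x_nonzero: assumes P: "(x, y, z, t) \<in> KR" and x: "x \<noteq> 0" shows "conn (x, y, z, t) (1, - 1, 0, 0)"
proof -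
  obtain A where A: "extends A" "\<And>x' y z' t. \<exists>y'. A (x', y, z', t) = (x', y', z' + (- z / x ^ d) * x' ^ d, t)"
    using shear_z_extends[of "- z / x ^ d"] by metis
  obtain B where B: "extends B" "\<And>x' y z t'. \<exists>y'. B (x', y, z, t') = (x', y', z, t' + (- t / x ^ d) * x' ^ d)"
    using shear_t_extends[of "- t / x ^ d"] by metis
  obtain y1 where y1: "A (x, y, z, t) = (x, y1, 0, t)" using A(2)[of x y z t] x by auto
  obtain y2 where y2: "B (x, y1, 0, t) = (x, y2, 0, 0)" using B(2)[of x y1 0 t] x by auto
  have c1: "conn (x, y, z, t) (x, y1, 0, t)" using conn_extends[OF A(1) P] by (simp add: y1)
  have c2: "conn (x, y1, 0, t) (x, y2, 0, 0)" using conn_extends[OF B(1) conn_in[OF P c1]] by (simp add: y2)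
  have c12: "conn (x, y, z, t) (x, y2, 0, 0)" by (rule conn_trans[OF P c1 c2])
  obtain m where m: "m ^ (k * l) = 1 / x" using nth_root_exists[of "k * l" "1 / x"] pos by auto
  then have "m \<noteq> 0" using x pos by (auto simp: zero_power)
  from conn_torus[OF this conn_in[OF P c12]] obtain y3 where c3: "conn (x, y2, 0, 0) (1, y3, 0, 0)"
    using m x by auto
  have c123: "conn (x, y, z, t) (1, y3, 0, 0)" by (rule conn_trans[OF P c12 c3])
  have "(1, y3, 0, 0) \<in> KR" by (rule conn_in[OF P c123])
  then have "y3 = - 1" using pos by (simp add: koras_russell_def zero_power eq_neg_iff_add_eq_0)
  with c123 show ?thesis by simp
qed

text \<open>The torus is transitive on the punctured cusp, by \<open>bezout_roots\<close>. At z = 1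
  the shear translates y by -k a, hence reaches y = 0.\<close>

lemma conn_z_nonzero:
  assumes P: "(0, y, z, t) \<in> KR" and z: "z \<noteq> 0" and b: "b ^ l = - 1"
  shows "conn (0, y, z, t) (0, 0, 1, b)"
proof -
  have zt: "z ^ k = - (t ^ l)" using P pos by (simp add: koras_russell_def zero_power eq_neg_iff_add_eq_0)
  then have t: "t \<noteq> 0" using z pos by (auto simp: zero_power)
  have b0: "b \<noteq> 0" using b pos by (auto simp: zero_power)
  have "(1 / z) ^ k = (b / t) ^ l" using zt b by (simp add: power_divide)
  then obtain m where m: "m \<noteq> 0" "1 / z = m ^ l" "b / t = m ^ k"
    using bezout_roots[of "1 / z" "b / t"] z t b0 cop by auto
  have "m ^ l * z = 1" "m ^ k * t = b" using z t m(2,3) by (simp_all add: field_simps)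
  with conn_torus[OF m(1) P] obtain y1 where c1: "conn (0, y, z, t) (0, y1, 1, b)" by auto
  obtain A where A: "extends A" "\<And>y z t. A (0, y, z, t) = (0, y - of_nat k * (y1 / of_nat k) * z ^ (k - 1), z, t)"
    using shear_z_extends[of "y1 / of_nat k"] by metis
  have "conn (0, y1, 1, b) (0, 0, 1, b)"
    using conn_extends[OF A(1) conn_in[OF P c1]] pos by (simp add: A(2))
  with c1 show ?thesis by (rule conn_trans[OF P])
qed

text \<open>The torus acts on this line with weight -k l (d - 1), which is nonzero because d \<ge>
  2.\<close>

lemma conn_line: assumes y: "y \<noteq> 0" shows "conn (0, y, 0, 0) (0, 1, 0, 0)"
proof -
  have P: "(0, y, 0, 0) \<in> KR" using pos by (simp add: koras_russell_def zero_power)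
  obtain d' where d': "d = Suc d'" "d' > 0" using d2 by (cases d) auto
  obtain w where w: "w ^ (k * l * d') = 1 / y" using nth_root_exists[of "k * l * d'" "1 / y"] pos d' by auto
  then have w0: "w \<noteq> 0" using y pos d' by (auto simp: zero_power)
  have "inverse w ^ (k * l) * w ^ (k * l * d) = w ^ (k * l * d')"
    using w0 by (simp add: d' power_add power_inverse)
  then have "inverse w ^ (k * l) * w ^ (k * l * d) * y = 1" using w y by simp
  then show ?thesis using conn_torus[of "inverse w", OF _ P] w0 by simp
qed

lemma zero_set_KR: "(0, y, z, t) \<in> KR \<Longrightarrow> z = 0 \<longleftrightarrow> t = 0"
  using pos by (auto simp: koras_russell_def zero_power)

lemma Aut_image:
  assumes F: "F \<in> AX" and P: "(x, y, z, t) \<in> KR" and Q: "F (x, y, z, t) = (x', y', z', t')"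
  shows "x' = 0 \<longleftrightarrow> x = 0" "x = 0 \<Longrightarrow> z' = 0 \<longleftrightarrow> z = 0"
proof -
  obtain m where m: "m \<noteq> 0" "\<And>x y z t. (x, y, z, t) \<in> KR \<Longrightarrow> fst (F (x, y, z, t)) = m ^ (k * l) * x"
    "\<And>y z t. (0, y, z, t) \<in> KR \<Longrightarrow> snd (snd (F (0, y, z, t))) = (m ^ l * z, m ^ k * t)"
    by (rule Aut_weights[OF F]) (rule that; (assumption | simp))
  show "x' = 0 \<longleftrightarrow> x = 0" using m(1) m(2)[OF P] by (simp add: Q)
  show "z' = 0 \<longleftrightarrow> z = 0" if "x = 0" using m(1) m(3)[of y z t] P Q that by auto
qed

lemma orbit_conn: "orbit (Aut_variety KR) (\<lambda>F. F) P = {Q. conn P Q}"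
  unfolding orbit_def conn_def by blast

lemma orbit_eqI:
  assumes "S \<subseteq> KR" "B \<in> S" "\<And>P. P \<in> S \<Longrightarrow> conn P B" "\<And>F P. F \<in> AX \<Longrightarrow> P \<in> S \<Longrightarrow> F P \<in> S" "P \<in> S"
  shows "orbit (Aut_variety KR) (\<lambda>F. F) P = S"
proof -
  have "conn P Q" if "Q \<in> S" for Q
    using conn_trans[OF _ assms(3)[OF assms(5)] conn_sym[OF _ assms(3)[OF that]]] assms(1,5) that by blast
  then show ?thesis using assms(4,5) unfolding orbit_conn conn_def by blast
qed

theorem Aut_orbits:
  defines "O1 \<equiv> {(x, y, z, t). (x, y, z, t) \<in> KR \<and> x \<noteq> 0}"
    and "O2 \<equiv> {(x, y, z, t). (x, y, z, t) \<in> KR \<and> x = 0 \<and> z \<noteq> 0}"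
    and "O3 \<equiv> {(x, y, z, t). x = 0 \<and> z = 0 \<and> t = 0} - {(0, 0, 0, 0)}"
    and "O4 \<equiv> {(0, 0, 0, 0)}"
  shows "orbits (Aut_variety KR) KR (\<lambda>F. F) = {O1, O2, O3, O4}" "card {O1, O2, O3, O4} = 4"
proof -
  obtain b where b: "b ^ l = (- 1 :: complex)" using nth_root_exists[of l "- 1"] pos by auto
  have o: "(0, 0, 0, 0) \<in> KR" using pos by (simp add: koras_russell_def zero_power)
  have sub: "O1 \<subseteq> KR" "O2 \<subseteq> KR" "O3 \<subseteq> KR" "O4 \<subseteq> KR"
    using pos by (auto simp: O1_def O2_def O3_def O4_def koras_russell_def zero_power)
  have un: "P \<in> O1 \<or> P \<in> O2 \<or> P \<in> O3 \<or> P \<in> O4" if "P \<in> KR" for P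
    using that zero_set_KR by (cases P) (auto simp: O1_def O2_def O3_def O4_def)
  have mem: "(1, - 1, 0, 0) \<in> O1" "(0, 0, 1, b) \<in> O2" "(0, 1, 0, 0) \<in> O3" "(0, 0, 0, 0) \<in> O4"
    using pos b by (auto simp: O1_def O2_def O3_def O4_def koras_russell_def zero_power)
  have 1: "orbit (Aut_variety KR) (\<lambda>F. F) P = O1" if "P \<in> O1" for P
  proof (rule orbit_eqI[OF sub(1) mem(1) _ _ that])
    show "conn P (1, - 1, 0, 0)" if "P \<in> O1" for P using that conn_x_nonzero by (auto simp: O1_def)
    fix F P assume F: "F \<in> AX" and P: "P \<in> O1"
    obtain x y z t where Qp: "P = (x, y, z, t)" by (cases P)
    obtain x' y' z' t' where Qf: "F P = (x', y', z', t')" by (cases "F P")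
    have PK: "P \<in> KR" using P sub by blast
    show "F P \<in> O1" using Aut_in[OF F PK, unfolded Qf] Aut_image(1)[OF F PK[unfolded Qp] Qf[unfolded Qp]] P unfolding Qf by (simp add: Qp O1_def)
  qed
  have 2: "orbit (Aut_variety KR) (\<lambda>F. F) P = O2" if "P \<in> O2" for P
  proof (rule orbit_eqI[OF sub(2) mem(2) _ _ that])
    show "conn P (0, 0, 1, b)" if "P \<in> O2" for P using that conn_z_nonzero[OF _ _ b] by (auto simp: O2_def)
    fix F P assume F: "F \<in> AX" and P: "P \<in> O2"
    obtain x y z t where Qp: "P = (x, y, z, t)" by (cases P)
    obtain x' y' z' t' where Qf: "F P = (x', y', z', t')" by (cases "F P")
    have PK: "P \<in> KR" using P sub by blast
    show "F P \<in> O2" using Aut_in[OF F PK, unfolded Qf] Aut_image[OF F PK[unfolded Qp] Qf[unfolded Qp]] P unfolding Qf by (simp add: Qp O2_def)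
  qed
  have 3: "orbit (Aut_variety KR) (\<lambda>F. F) P = O3" if "P \<in> O3" for P
  proof (rule orbit_eqI[OF sub(3) mem(3) _ _ that])
    show "conn P (0, 1, 0, 0)" if "P \<in> O3" for P using that conn_line by (auto simp: O3_def)
    fix F P assume F: "F \<in> AX" and P: "P \<in> O3"
    obtain y where y: "P = (0, y, 0, 0)" "y \<noteq> 0" using P by (auto simp: O3_def)
    have PK: "P \<in> KR" using P sub by blast
    obtain x' y' z' t' where Q: "F P = (x', y', z', t')" by (cases "F P")
    have "x' = 0" "z' = 0" using Aut_image[OF F _ Q[unfolded y(1)]] PK y(1) by auto
    moreover have "t' = 0" using zero_set_KR Aut_in[OF F PK] calculation Q by auto
    moreover have "F P \<noteq> (0, 0, 0, 0)"
      using Aut_regular(3)[OF F PK] Aut_regular(3)[OF F o] Aut_origin[OF F] y by auto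
    ultimately show "F P \<in> O3" by (simp add: O3_def Q)
  qed
  have 4: "orbit (Aut_variety KR) (\<lambda>F. F) P = O4" if "P \<in> O4" for P
  proof (rule orbit_eqI[OF sub(4) mem(4) _ _ that])
    have "conn (0, 0, 0, 0) (0, 0, 0, 0)" using conn_torus[OF _ o, of 1] by simp
    then show "conn P (0, 0, 0, 0)" if "P \<in> O4" for P using that by (simp add: O4_def)
    show "F P \<in> O4" if "F \<in> AX" "P \<in> O4" for F P using that Aut_origin by (simp add: O4_def)
  qed
  have "orbits (Aut_variety KR) KR (\<lambda>F. F) \<subseteq> {O1, O2, O3, O4}"
    unfolding orbits_def using un 1 2 3 4 by blast
  moreover have "O1 \<in> orbits (Aut_variety KR) KR (\<lambda>F. F)" unfolding orbits_def using 1[OF mem(1)] mem(1) sub(1) by blast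
  moreover have "O2 \<in> orbits (Aut_variety KR) KR (\<lambda>F. F)" unfolding orbits_def using 2[OF mem(2)] mem(2) sub(2) by blast
  moreover have "O3 \<in> orbits (Aut_variety KR) KR (\<lambda>F. F)" unfolding orbits_def using 3[OF mem(3)] mem(3) sub(3) by blast
  moreover have "O4 \<in> orbits (Aut_variety KR) KR (\<lambda>F. F)" unfolding orbits_def using 4[OF mem(4)] mem(4) sub(4) by blast
  ultimately show "orbits (Aut_variety KR) KR (\<lambda>F. F) = {O1, O2, O3, O4}" by blast
  have n: "(1, - 1, 0, 0) \<notin> O2" "(1, - 1, 0, 0) \<notin> O3" "(1, - 1, 0, 0) \<notin> O4"
    "(0, 0, 1, b) \<notin> O3" "(0, 0, 1, b) \<notin> O4" "(0, 1, 0, 0) \<notin> O4"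
    by (auto simp: O1_def O2_def O3_def O4_def)
  have "O1 \<noteq> O2" "O1 \<noteq> O3" "O1 \<noteq> O4" "O2 \<noteq> O3" "O2 \<noteq> O4" "O3 \<noteq> O4"
    using n mem(1-3) by blast+
  then show "card {O1, O2, O3, O4} = 4" by simp
qed

lemma open_orbit: "zariski_open_in KR {(x, y, z, t). (x, y, z, t) \<in> KR \<and> x \<noteq> 0}"
  unfolding zariski_open_in_def
  by (rule exI[of _ "{P. fst P \<noteq> 0}"]) (auto intro: zariski_open_nonzero coords_fun)

lemma open_orbit_iso:
  "isomorphic_varieties {(x, y, z, t). (x, y, z, t) \<in> KR \<and> x \<noteq> 0} ((UNIV - {0}) \<times> UNIV :: A3 set)"
proof (rule isomorphic_varietiesI[where F = pr_xzt and G = "\<lambda>(x, z, t). (x, - (z ^ k + t ^ l + x) / x ^ d, z, t)"])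
  let ?T = "(UNIV - {0}) \<times> UNIV :: A3 set" and ?S = "{(x, y, z, t). (x, y, z, t) \<in> KR \<and> x \<noteq> 0}"
  let ?G = "\<lambda>(x, z, t). (x, - (z ^ k + t ^ l + x) / x ^ d, z, t)"
  show "pr_xzt (?G Q) = Q" for Q by (cases Q) simp
  show "?G ` ?T = ?S"
  proof
    show "?G ` ?T \<subseteq> ?S" using KR_point by auto
    show "?S \<subseteq> ?G ` ?T"
    proof
      fix P assume "P \<in> ?S"
      then obtain x y z t where P: "P = (x, y, z, t)" "(x, y, z, t) \<in> KR" "x \<noteq> 0" by auto
      have "x ^ d * y + (z ^ k + t ^ l + x) = 0" using P(2) by (simp add: koras_russell_def add.assoc)
      then have "x ^ d * y = - (z ^ k + t ^ l + x)" by (simp only: eq_neg_iff_add_eq_0)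
      then have "P = ?G (x, z, t)" using P by (simp add: field_simps)
      moreover have "(x, z, t) \<in> ?T" using P(3) by simp
      ultimately show "P \<in> ?G ` ?T" by (rule image_eqI)
    qed
  qed
  have c3: "(coords :: (A3 \<Rightarrow> complex) set) = {\<lambda>P. fst P, \<lambda>P. fst (snd P), \<lambda>P. snd (snd P)}"
    by (auto simp: coords_prod_def coords_complex_def comp_def image_iff)
  have p3: "polynomial_fun (\<lambda>P::A3. fst P)" "polynomial_fun (\<lambda>P::A3. fst (snd P))" "polynomial_fun (\<lambda>P::A3. snd (snd P))"
    by (intro polynomial_fun.coord; simp add: c3)+
  have e: "pr_xzt P = (fst P, fst (snd (snd P)), snd (snd (snd P)))" for P by (cases P) simp
  show "regular_map_on ?S pr_xzt" unfolding regular_map_on_def c3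
    by (simp add: comp_def e regular_on_polynomial coords_fun)
  have "regular_on ?T (\<lambda>P. - (fst (snd P) ^ k + snd (snd P) ^ l + fst P) / fst P ^ d)"
  proof (rule regular_on_quotient)
    show "polynomial_fun (\<lambda>P::A3. - 1 * (fst (snd P) ^ k + snd (snd P) ^ l + fst P))"
      by (intro polynomial_fun.mult polynomial_fun.add polynomial_fun.const polynomial_fun_power p3)
    show "polynomial_fun (\<lambda>P::A3. fst P ^ d)" by (intro polynomial_fun_power p3)
  qed auto
  then show "regular_map_on ?T ?G" unfolding regular_map_on_def coords_A4
    by (simp add: comp_def case_prod_unfold regular_on_polynomial p3)
qed

text \<open>With b^l = -1 the punctured cusp is parametrized by s to (s^l, b s^k). If l i = k j + 1,
  the parameter is recovered as b^j z^i / t^j, which is regular because t is nonzero on it.\<close>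

lemma second_orbit_iso:
  "isomorphic_varieties {(x, y, z, t). (x, y, z, t) \<in> KR \<and> x = 0 \<and> z \<noteq> 0} ((UNIV - {0}) \<times> UNIV :: (complex \<times> complex) set)"
proof -
  obtain b where b: "b ^ l = (- 1 :: complex)" using nth_root_exists[of l "- 1"] pos by auto
  then have b0: "b \<noteq> 0" using pos by (auto simp: zero_power)
  obtain i j where ij: "l * i = k * j + 1"
    using bezout_add_strong_nat[of l k] pos cop by (metis coprime_common_divisor_nat coprime_commute not_less_zero)
  define F where "F P = (b ^ j * fst (snd (snd P)) ^ i / snd (snd (snd P)) ^ j, fst (snd P))" for P :: A4
  define G where "G Q = (0 :: complex, snd Q, fst Q ^ l, b * fst Q ^ k)" for Q :: "complex \<times> complex"
  let ?T = "(UNIV - {0}) \<times> UNIV :: (complex \<times> complex) set"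
    and ?S = "{(x, y, z, t). (x, y, z, t) \<in> KR \<and> x = 0 \<and> z \<noteq> 0}"
  have c2: "(coords :: (complex \<times> complex \<Rightarrow> complex) set) = {\<lambda>P. fst P, \<lambda>P. snd P}"
    by (auto simp: coords_prod_def coords_complex_def comp_def image_iff)
  have p2: "polynomial_fun (\<lambda>P::complex \<times> complex. fst P)" "polynomial_fun (\<lambda>P::complex \<times> complex. snd P)"
    by (intro polynomial_fun.coord; simp add: c2)+
  show ?thesis
  proof (rule isomorphic_varietiesI[where F = F and G = G])
    show "F (G Q) = Q" if T: "Q \<in> ?T" for Q
    proof -
      obtain s y where Q: "Q = (s, y)" "s \<noteq> 0" using T by auto
      have "b ^ j * (s ^ l) ^ i = s * (b * s ^ k) ^ j"
        by (simp add: power_mult_distrib ij flip: power_mult)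
      then show ?thesis using Q(2) b0 by (simp add: Q(1) F_def G_def)
    qed
    show "G ` ?T = ?S"
    proof
      have "(s ^ l) ^ k + (b * s ^ k) ^ l = 0" for s
        by (simp add: power_mult_distrib b mult.commute flip: power_mult)
      then show "G ` ?T \<subseteq> ?S" using pos by (auto simp: G_def koras_russell_def zero_power)
      show "?S \<subseteq> G ` ?T"
      proof
        fix P assume "P \<in> ?S"
        then obtain y z t where P: "P = (0, y, z, t)" "(0, y, z, t) \<in> KR" "z \<noteq> 0" by auto
        have zt: "z ^ k = - (t ^ l)" using P(2) pos by (simp add: koras_russell_def zero_power eq_neg_iff_add_eq_0)
        then have t: "t \<noteq> 0" using P(3) pos by (auto simp: zero_power)
        have "z ^ k = (t / b) ^ l" using zt b by (simp add: power_divide)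
        then obtain s where s: "s \<noteq> 0" "z = s ^ l" "t / b = s ^ k"
          using bezout_roots[of z "t / b"] P(3) t b0 cop by auto
        then have "P = G (s, y)" using b0 by (simp add: P(1) G_def field_simps)
        moreover have "(s, y) \<in> ?T" using s(1) by simp
        ultimately show "P \<in> G ` ?T" by (rule image_eqI)
      qed
    qed
    have "regular_on ?S (\<lambda>P. b ^ j * fst (snd (snd P)) ^ i / snd (snd (snd P)) ^ j)"
    proof (rule regular_on_quotient)
      show "polynomial_fun (\<lambda>P::A4. b ^ j * fst (snd (snd P)) ^ i)"
        by (intro polynomial_fun.mult polynomial_fun.const polynomial_fun_power coords_fun)
      show "polynomial_fun (\<lambda>P::A4. snd (snd (snd P)) ^ j)" by (intro polynomial_fun_power coords_fun)
    qed (use zero_set_KR in auto)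
    then show "regular_map_on ?S F" unfolding regular_map_on_def c2
      by (simp add: comp_def F_def regular_on_polynomial coords_fun)
    show "regular_map_on ?T G" unfolding regular_map_on_def coords_A4
      by (simp add: comp_def G_def regular_on_polynomial polynomial_fun.const polynomial_fun.mult polynomial_fun_power p2)
  qed
qed

end

section \<open>Finite subgroups\<close>

text \<open>The injective character takes values in the N-th roots of unity for N the order of the
  group. By counting it is onto them, and a preimage of the primitive root exp(2 pi i / N)
  generates.\<close>

lemma (in group) cyclic_if_character:
  fixes \<chi> :: "'a \<Rightarrow> complex"
  assumes fin: "finite (carrier G)" and nz: "\<And>x. x \<in> carrier G \<Longrightarrow> \<chi> x \<noteq> 0"
    and mult: "\<And>x y. x \<in> carrier G \<Longrightarrow> y \<in> carrier G \<Longrightarrow> \<chi> (x \<otimes> y) = \<chi> x * \<chi> y"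
    and ker: "\<And>x. x \<in> carrier G \<Longrightarrow> \<chi> x = 1 \<Longrightarrow> x = \<one>"
  shows "cyclic_group G"
proof -
  define N where "N = order G"
  have N: "N > 0" using fin by (simp add: N_def order_gt_0_iff_finite)
  have one: "\<chi> \<one> = 1" using mult[of \<one> \<one>] nz[of \<one>] by simp
  have pow: "\<chi> (x [^] n) = \<chi> x ^ n" if "x \<in> carrier G" for x and n :: nat
    by (induction n) (use that in \<open>auto simp: one mult\<close>)
  have inj: "inj_on \<chi> (carrier G)"
  proof
    fix x y assume xy: "x \<in> carrier G" "y \<in> carrier G" "\<chi> x = \<chi> y"
    have "\<chi> (x \<otimes> inv y) = \<chi> (y \<otimes> inv y)" using xy mult by (metis inv_closed)
    also have "\<dots> = 1" using xy one by simp
    finally have "x \<otimes> inv y = \<one>" using xy ker by simp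
    then show "x = y" using xy by (metis inv_equality inv_inv inv_closed)
  qed
  have "\<chi> x ^ N = 1" if x: "x \<in> carrier G" for x
  proof -
    have b: "bij_betw (\<lambda>y. x \<otimes> y) (carrier G) (carrier G)"
      by (rule bij_betw_byWitness[of _ "\<lambda>y. inv x \<otimes> y"]) (use x in \<open>auto simp: m_assoc[symmetric]\<close>)
    have "(\<Prod>y\<in>carrier G. \<chi> y) = (\<Prod>y\<in>carrier G. \<chi> (x \<otimes> y))" by (rule prod.reindex_bij_betw[OF b, symmetric])
    also have "\<dots> = \<chi> x ^ N * (\<Prod>y\<in>carrier G. \<chi> y)" by (simp add: mult x prod.distrib N_def order_def)
    finally show ?thesis using fin nz by simp
  qed
  then have sub: "\<chi> ` carrier G \<subseteq> {z. z ^ N = 1}" by blast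
  have "card (\<chi> ` carrier G) = card {z :: complex. z ^ N = 1}"
    using card_image[OF inj] card_roots_unity_eq[OF N] by (simp add: N_def order_def)
  then have im: "\<chi> ` carrier G = {z. z ^ N = 1}"
    using N by (intro card_subset_eq sub finite_roots_unity) auto
  note roots = bij_betw_imp_surj_on[OF bij_betw_roots_unity[OF N]]
  have rt: "cis (2 * pi * real j / real N) = cis (2 * pi / real N) ^ j" for j
    by (simp add: DeMoivre mult.commute)
  have "cis (2 * pi / real N) ^ N = 1" using N by (simp add: DeMoivre)
  then have "cis (2 * pi / real N) \<in> \<chi> ` carrier G" unfolding im by simp
  then obtain g where g: "g \<in> carrier G" "\<chi> g = cis (2 * pi / real N)" by auto
  have "\<exists>n::int. h = g [^] n" if h: "h \<in> carrier G" for h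
  proof -
    have "\<chi> h \<in> (\<lambda>j. cis (2 * pi * real j / real N)) ` {..<N}" unfolding roots using im h by blast
    then obtain j :: nat where "\<chi> h = \<chi> (g [^] j)" unfolding pow[OF g(1)] g(2) rt by blast
    then have "h = g [^] j" using inj h g(1) by (simp add: inj_on_def)
    then show ?thesis by (intro exI[of _ "int j"]) (simp add: int_pow_int)
  qed
  then have "carrier G = range (\<lambda>n::int. g [^] n)" using g(1) by auto
  then show ?thesis unfolding cyclic_group using g(1) by blast
qed

text \<open>If \<phi> p is p + x^(n+1) g, the N-th iterate is p + N x^(n+1) g modulo x^(n+2). As N
  is invertible, a trivial iterate pushes the congruence to all powers of x, and a nonzero
  polynomial has bounded x-degree.\<close>

lemma congruent_id_torsion_free:
  fixes \<phi> :: "Cxzt \<Rightarrow> Cxzt"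
  assumes \<phi>: "ring_map \<phi>" "\<phi> vx = vx" "\<And>p. vx dvd \<phi> p - p" and N: "N > 0" "\<And>p. (\<phi> ^^ N) p = p"
  shows "\<phi> p = p"
proof -
  have step: "\<forall>p. vx ^ Suc (Suc n) dvd \<phi> p - p" if n: "\<forall>p. vx ^ Suc n dvd \<phi> p - p" for n
  proof
    fix p
    obtain g where g: "\<phi> p = p + vx ^ Suc n * g" using n[rule_format, of p] by (rule dvd_diffE)
    have "\<exists>w. (\<phi> ^^ j) p = p + of_nat j * (vx ^ Suc n * g) + vx ^ Suc (Suc n) * w" for j
    proof (induction j)
      case 0
      show ?case by (intro exI[of _ 0]) simp
    next
      case (Suc j)
      obtain w where w: "(\<phi> ^^ j) p = p + of_nat j * (vx ^ Suc n * g) + vx ^ Suc (Suc n) * w" using Suc by blast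
      obtain h where h: "\<phi> g = g + vx * h" using \<phi>(3)[of g] by (rule dvd_diffE)
      have "(\<phi> ^^ Suc j) p = \<phi> p + of_nat j * (vx ^ Suc n * \<phi> g) + vx ^ Suc (Suc n) * \<phi> w"
        by (simp add: w rm_add[OF \<phi>(1)] rm_mult[OF \<phi>(1)] rm_of_nat[OF \<phi>(1)] rm_power[OF \<phi>(1)] \<phi>(2))
      also have "\<dots> = p + of_nat (Suc j) * (vx ^ Suc n * g) + vx ^ Suc (Suc n) * (of_nat j * h + \<phi> w)"
        unfolding g h by (simp add: algebra_simps)
      finally show ?case by blast
    qed
    then obtain w where "p = p + of_nat N * (vx ^ Suc n * g) + vx ^ Suc (Suc n) * w" using N(2) by metis
    then have "of_nat N * (vx ^ Suc n * g) + vx ^ Suc (Suc n) * w = 0" by (simp only: add.assoc add_cancel_right_right)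
    then have "of_nat N * (vx ^ Suc n * g) = vx ^ Suc (Suc n) * - w" by (simp only: mult_minus_right eq_neg_iff_add_eq_0)
    then have d: "vx ^ Suc (Suc n) dvd of_nat N * (vx ^ Suc n * g)" by (metis dvd_triv_left)
    obtain q :: Cxzt where q: "of_nat N * q = 1" using of_nat_unit[OF N(1)] by blast
    have "q * of_nat N = 1" using q by (simp only: mult.commute)
    then have e: "vx ^ Suc n * g = q * (of_nat N * (vx ^ Suc n * g))" by (simp only: mult.assoc[symmetric] mult_1)
    have "\<phi> p - p = vx ^ Suc n * g" by (simp add: g)
    then show "vx ^ Suc (Suc n) dvd \<phi> p - p" using dvd_mult[OF d, of q] unfolding e[symmetric] by (simp only:)
  qed
  have all: "\<forall>p. vx ^ Suc n dvd \<phi> p - p" for n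
    by (induction n) (use \<phi>(3) step in auto)
  have "\<phi> p - p = 0"
  proof (rule ccontr)
    assume nz: "\<phi> p - p \<noteq> 0"
    have "degree (vx ^ Suc n :: Cxzt) = Suc n" for n by (simp add: degree_power_eq vx_def)
    then have "Suc n \<le> degree (\<phi> p - p)" for n using dvd_imp_degree_le[OF all[rule_format] nz, of n] by simp
    then show False using not_less_eq_eq by blast
  qed
  then show ?thesis by simp
qed

section \<open>The torus weight as a character\<close>

context koras
begin

definition weight :: "(A4 \<Rightarrow> A4) \<Rightarrow> complex \<Rightarrow> bool"
  where "weight F m \<longleftrightarrow> m \<noteq> 0 \<and> (\<exists>\<phi>. restricts_to d k l F \<phi> \<and> ring_map \<phi> \<and> \<phi> vx = torus_hom m vx \<and>
    (\<forall>p. vx dvd \<phi> p - torus_hom m p))"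

lemma weight_exists: "F \<in> AX \<Longrightarrow> \<exists>m. weight F m"
  unfolding weight_def by (erule Aut_normal_form) blast

text \<open>Modulo x the powers m^l and m^k are visible, and l i = k j + 1 recovers m from
  them.\<close>

lemma weight_unique: assumes "weight F m" "weight F n" shows "m = n"
proof -
  obtain \<phi> \<psi> where *: "restricts_to d k l F \<phi>" "\<And>p. vx dvd \<phi> p - torus_hom m p"
      "restricts_to d k l F \<psi>" "\<And>p. vx dvd \<psi> p - torus_hom n p" and nz: "m \<noteq> 0" "n \<noteq> 0"
    using assms unfolding weight_def by blast
  have e: "\<psi> = \<phi>" by (rule restricts_unique[OF *(3,1)])
  have "vx dvd (\<phi> p - torus_hom n p) - (\<phi> p - torus_hom m p)" for p using *(2,4) unfolding e by (rule dvd_diff[rotated])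
  then have d: "vx dvd torus_hom m p - torus_hom n p" for p by simp
  have "m ^ l = n ^ l" "m ^ k = n ^ k"
    using d[of vz, unfolded torus_hom_gens] d[of vt, unfolded torus_hom_gens]
    by (simp_all add: vx_dvd_iff kc_def vz_def vt_def coeff_mult_0)
  moreover obtain i j where ij: "l * i = k * j + 1"
    using bezout_add_strong_nat[of l k] pos cop by (metis coprime_common_divisor_nat coprime_commute not_less_zero)
  ultimately have "(m ^ l) ^ i = (n ^ l) ^ i" "(m ^ k) ^ j = (n ^ k) ^ j" by simp_all
  then have "m ^ (l * i) = n ^ (l * i)" "m ^ (k * j) = n ^ (k * j)" by (simp_all only: power_mult)
  then show ?thesis using nz by (simp add: ij)
qed

lemma weight_comp:
  assumes "weight F m" "weight G n" "G \<in> AX" shows "weight (compose KR F G) (m * n)"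
proof -
  obtain \<phi> where \<phi>: "restricts_to d k l F \<phi>" "ring_map \<phi>" "\<phi> vx = torus_hom m vx" "\<And>p. vx dvd \<phi> p - torus_hom m p" "m \<noteq> 0"
    using assms(1) unfolding weight_def by blast
  obtain \<psi> where \<psi>: "restricts_to d k l G \<psi>" "ring_map \<psi>" "\<psi> vx = torus_hom n vx" "\<And>p. vx dvd \<psi> p - torus_hom n p" "n \<noteq> 0"
    using assms(2) unfolding weight_def by blast
  obtain \<psi>' where \<psi>': "restricts_to d k l G \<psi>'" "\<And>c. \<psi>' (kc c) = kc c"
    by (rule Aut_normal_form[OF assms(3)]) (rule that; (assumption | erule meta_spec))
  have c: "\<psi> (kc c) = kc c" for c using \<psi>'(2) restricts_unique[OF \<psi>(1) \<psi>'(1)] by simp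
  have "restricts_to d k l (compose KR F G) (\<lambda>p. \<psi> (\<phi> p))"
    by (rule restricts_comp[OF \<phi>(1) \<psi>(1) Aut_in[OF assms(3)]]) (simp_all add: compose_def)
  moreover have "\<psi> (\<phi> vx) = torus_hom (m * n) vx"
    unfolding \<phi>(3) torus_hom_gens by (simp add: rm_mult[OF \<psi>(2)] c \<psi>(3) torus_hom_gens power_mult_distrib rm_mult[OF ring_map_kc])
  moreover have "vx dvd \<psi> (\<phi> p) - torus_hom (m * n) p" for p
  proof -
    obtain w where w: "\<phi> p = torus_hom m p + vx * w" using \<phi>(4)[of p] by (rule dvd_diffE)
    obtain v where v: "\<psi> (torus_hom m p) = torus_hom n (torus_hom m p) + vx * v" using \<psi>(4)[of "torus_hom m p"] by (rule dvd_diffE)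
    have "\<psi> (\<phi> p) - torus_hom (m * n) p = vx * (v + kc (n ^ (k * l)) * \<psi> w)"
      unfolding w rm_add[OF \<psi>(2)] rm_mult[OF \<psi>(2)] v \<psi>(3) torus_hom_gens torus_hom_comp mult.commute[of n m]
      by (simp add: algebra_simps)
    then show ?thesis by (metis dvd_triv_left)
  qed
  ultimately show ?thesis unfolding weight_def using \<phi>(5) \<psi>(5) ring_map_comp[OF \<psi>(2) \<phi>(2)] by auto
qed

lemma weight_1_torsion_free:
  assumes F: "F \<in> AX" and w: "weight F 1" and N: "N > (0 :: nat)" "F [^]\<^bsub>Aut_variety KR\<^esub> N = \<one>\<^bsub>Aut_variety KR\<^esub>"
  shows "F = \<one>\<^bsub>Aut_variety KR\<^esub>"
proof -
  interpret G: group "Aut_variety KR" by (rule group_Aut_variety)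
  note ops = Aut_variety_ops[OF F]
  obtain \<phi> where \<phi>: "restricts_to d k l F \<phi>" "ring_map \<phi>" "\<phi> vx = vx" "\<And>p. vx dvd \<phi> p - p"
    using w unfolding weight_def torus_hom_1 by blast
  have id: "restricts_to d k l \<one>\<^bsub>Aut_variety KR\<^esub> (\<lambda>p. p)" unfolding ops(3) by (rule restricts_id) simp
  have pow: "restricts_to d k l (F [^]\<^bsub>Aut_variety KR\<^esub> n) (\<phi> ^^ n)" for n :: nat
  proof (induction n)
    case 0
    show ?case using id by (simp add: id_def)
  next
    case (Suc n)
    have "F [^]\<^bsub>Aut_variety KR\<^esub> Suc n = compose KR (F [^]\<^bsub>Aut_variety KR\<^esub> n) F"
      by (simp add: Aut_variety_ops(1) F)
    moreover have "restricts_to d k l (compose KR (F [^]\<^bsub>Aut_variety KR\<^esub> n) F) (\<lambda>p. \<phi> ((\<phi> ^^ n) p))"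
      by (rule restricts_comp[OF Suc \<phi>(1) Aut_in[OF F]]) (simp_all add: compose_def)
    ultimately show ?case by (simp add: comp_def)
  qed
  have "(\<phi> ^^ N) p = p" for p using restricts_unique[OF pow[of N, unfolded N(2)] id] by simp
  then have "\<phi> = (\<lambda>p. p)" using congruent_id_torsion_free[OF \<phi>(2-4) N(1)] by blast
  then show ?thesis using Aut_eqI[OF F G.one_closed \<phi>(1)] id by simp
qed

theorem finite_subgroup_cyclic:
  assumes H: "subgroup H (Aut_variety KR)" "finite H"
  shows "cyclic_group ((Aut_variety KR)\<lparr>carrier := H\<rparr>)"
proof -
  interpret G: group "Aut_variety KR" by (rule group_Aut_variety)
  let ?G = "(Aut_variety KR)\<lparr>carrier := H\<rparr>"
  interpret S: group ?G by (rule G.subgroup_imp_group[OF H(1)])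
  have sub: "F \<in> AX" if "F \<in> H" for F using subgroup.subset[OF H(1)] that by blast
  define \<chi> where "\<chi> F = (SOME m. weight F m)" for F
  have \<chi>: "weight F (\<chi> F)" if "F \<in> H" for F unfolding \<chi>_def using weight_exists[OF sub[OF that]] by (rule someI_ex)
  show ?thesis
  proof (rule S.cyclic_if_character[of \<chi>])
    show "finite (carrier ?G)" using H(2) by simp
    show "\<chi> F \<noteq> 0" if "F \<in> carrier ?G" for F using \<chi>[of F] that by (simp add: weight_def)
    show "\<chi> (F \<otimes>\<^bsub>?G\<^esub> K) = \<chi> F * \<chi> K" if "F \<in> carrier ?G" "K \<in> carrier ?G" for F K
    proof -
      have FK: "F \<in> H" "K \<in> H" using that by auto
      have e: "F \<otimes>\<^bsub>?G\<^esub> K = compose KR F K" using Aut_variety_ops(1)[OF sub[OF FK(1)] sub[OF FK(2)]] by simp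
      have "weight (F \<otimes>\<^bsub>?G\<^esub> K) (\<chi> (F \<otimes>\<^bsub>?G\<^esub> K))" using \<chi> S.m_closed[OF that] by simp
      moreover have "weight (F \<otimes>\<^bsub>?G\<^esub> K) (\<chi> F * \<chi> K)" unfolding e by (rule weight_comp[OF \<chi>[OF FK(1)] \<chi>[OF FK(2)] sub[OF FK(2)]])
      ultimately show ?thesis by (rule weight_unique)
    qed
    show "F = \<one>\<^bsub>?G\<^esub>" if "F \<in> carrier ?G" "\<chi> F = 1" for F
    proof -
      have F: "F \<in> H" using that by simp
      have "F [^]\<^bsub>Aut_variety KR\<^esub> n \<in> H" for n :: nat
        using S.nat_pow_closed[OF that(1), of n] by (simp flip: G.nat_pow_consistent)
      then have "\<not> inj (\<lambda>n::nat. F [^]\<^bsub>Aut_variety KR\<^esub> n)"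
        using H(2) finite_imageD[of "\<lambda>n::nat. F [^]\<^bsub>Aut_variety KR\<^esub> n" UNIV] finite_subset[of _ H] by blast
      then obtain i j :: nat where ij: "F [^]\<^bsub>Aut_variety KR\<^esub> j = F [^]\<^bsub>Aut_variety KR\<^esub> i" "i < j"
        unfolding inj_def by (metis linorder_neqE_nat)
      have "F [^]\<^bsub>Aut_variety KR\<^esub> (j - i) = \<one>\<^bsub>Aut_variety KR\<^esub>" by (rule G.pow_eq_div2[OF sub[OF F] ij(1)])
      moreover have "weight F 1" using \<chi>[OF F] that(2) by simp
      ultimately show ?thesis using weight_1_torsion_free[OF sub[OF F], of "j - i"] ij(2) by simp
    qed
  qed
qed

end

section \<open>Actions of the additive group\<close>

lemma poly_eq_0_on_line:
  fixes R :: "'a::idom poly" and g :: "complex \<Rightarrow> 'a"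
  assumes "inj g" "\<And>s. poly R (g s) = 0" shows "R = 0"
proof (rule ccontr)
  assume "R \<noteq> 0"
  then have "finite (range g)" using poly_roots_finite[of R] assms(2) finite_subset[of "range g" "{x. poly R x = 0}"] by blast
  then show False using assms(1) finite_imageD[of g UNIV] infinite_UNIV_char_0 by blast
qed

lemma inj_kc: "inj (kc :: complex \<Rightarrow> Cxzt)"
  by (simp add: inj_def kc_eq_iff)

lemma poly_kc_eqI: "(\<And>s. poly P (kc s) = poly R (kc s)) \<Longrightarrow> P = (R :: Cxzt poly)"
  using poly_eq_0_on_line[OF inj_kc, of "P - R"] by simp

lemma poly_dvd: "(\<And>i. c dvd coeff r i) \<Longrightarrow> c dvd poly r (a :: 'a::idom)"
  using const_poly_dvd_iff[of c r] by (auto simp: dvd_def)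

lemma vx_dvd_coeffs:
  fixes N :: "Cxzt poly"
  assumes "\<And>s. vx dvd poly N (kc s)" shows "vx dvd coeff N i"
proof -
  have r: "ring_map (\<lambda>p :: Cxzt. coeff p 0)" by (intro ring_mapI) (auto simp: coeff_mult_0)
  have e: "coeff (poly N a) 0 = poly (map_poly (\<lambda>p. coeff p 0) N) (coeff a 0)" for a
    by (induction N) (simp_all add: map_poly_pCons coeff_mult_0)
  have "map_poly (\<lambda>p. coeff p 0) N = 0"
  proof (rule poly_eq_0_on_line)
    show "inj (\<lambda>s::complex. [:[:s:]:])" by (simp add: inj_def)
    show "poly (map_poly (\<lambda>p. coeff p 0) N) [:[:s:]:] = 0" for s
      using assms[of s] e[of "kc s"] by (simp add: vx_dvd_iff kc_def)
  qed
  then have "coeff (map_poly (\<lambda>p. coeff p 0) N) i = 0" by simp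
  then show ?thesis by (simp add: coeff_map_poly vx_dvd_iff)
qed

text \<open>Divisibility by x for every complex s passes to the coefficients in s, because a
  polynomial with infinitely many zeros vanishes; so the powers of x can be cancelled one by
  one.\<close>

lemma polynomial_quotient:
  fixes N :: "Cxzt poly"
  assumes "\<And>s. vx ^ M * g s = poly N (kc s)" shows "\<exists>Q. \<forall>s. g s = poly Q (kc s)"
  using assms
proof (induction M arbitrary: N)
  case (Suc M)
  have "vx dvd coeff N i" for i
    by (rule vx_dvd_coeffs) (simp add: Suc.prems[symmetric])
  then obtain N' where N': "N = [:vx:] * N'" using const_poly_dvd_iff[of vx N] by (auto simp: dvd_def)
  have "vx ^ M * g s = poly N' (kc s)" for s
    using Suc.prems[of s] by (simp add: N' mult.assoc)
  then show ?case by (rule Suc.IH)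
qed auto

context koras
begin

text \<open>Off x = 0 the coordinate y is replaced by its expression in x, z, t, at the price of a
  power of x that \<open>polynomial_quotient\<close> removes again.\<close>

lemma polynomial_family:
  assumes "polynomial_fun (f :: complex \<times> A4 \<Rightarrow> complex)"
  shows "\<exists>M (N :: Cxzt poly). \<forall>s x z t. x \<noteq> 0 \<longrightarrow>
    x ^ M * f (s, x, - (z ^ k + t ^ l + x) / x ^ d, z, t) = eval_xzt (poly N (kc s)) (x, z, t)"
  using assms
proof (induction f rule: polynomial_fun.induct)
  case (const c)
  show ?case by (intro exI[of _ 0] exI[of _ "[:kc c:]"]) (simp add: eval_simps)
next
  case (coord c)
  then consider "c = (\<lambda>P. fst P)" | "c = (\<lambda>P. fst (snd P))" | "c = (\<lambda>P. fst (snd (snd P)))"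
    | "c = (\<lambda>P. fst (snd (snd (snd P))))" | "c = (\<lambda>P. snd (snd (snd (snd P))))"
    by (auto simp: coords_prod_def[where 'a = complex and 'b = A4] coords_A4 coords_complex_def comp_def)
  then show ?case
  proof cases
    case 1
    show ?thesis by (intro exI[of _ 0] exI[of _ "[:0, 1:]"]) (simp add: 1 eval_simps)
  next
    case 2
    show ?thesis by (intro exI[of _ 0] exI[of _ "[:vx:]"]) (simp add: 2 eval_simps)
  next
    case 3
    show ?thesis by (intro exI[of _ d] exI[of _ "[:- rr:]"]) (simp add: 3 eval_simps eval_rr)
  next
    case 4
    show ?thesis by (intro exI[of _ 0] exI[of _ "[:vz:]"]) (simp add: 4 eval_simps)
  next
    case 5
    show ?thesis by (intro exI[of _ 0] exI[of _ "[:vt:]"]) (simp add: 5 eval_simps)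
  qed
next
  case (add f g)
  obtain M1 N1 M2 N2 where
    f: "\<And>s x z t. x \<noteq> 0 \<Longrightarrow> x ^ M1 * f (s, x, - (z ^ k + t ^ l + x) / x ^ d, z, t) = eval_xzt (poly N1 (kc s)) (x, z, t)"
    and g: "\<And>s x z t. x \<noteq> 0 \<Longrightarrow> x ^ M2 * g (s, x, - (z ^ k + t ^ l + x) / x ^ d, z, t) = eval_xzt (poly N2 (kc s)) (x, z, t)"
    using add.IH by metis
  show ?case
  proof (intro exI[of _ "M1 + M2"] exI[of _ "[:vx ^ M2:] * N1 + [:vx ^ M1:] * N2"] allI impI)
    fix s x z t :: complex assume x: "x \<noteq> 0"
    let ?P = "(s, x, - (z ^ k + t ^ l + x) / x ^ d, z, t)"
    have "x ^ (M1 + M2) * (f ?P + g ?P) = x ^ M2 * (x ^ M1 * f ?P) + x ^ M1 * (x ^ M2 * g ?P)"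
      by (simp only: power_add distrib_left ac_simps)
    then show "x ^ (M1 + M2) * (f ?P + g ?P) = eval_xzt (poly ([:vx ^ M2:] * N1 + [:vx ^ M1:] * N2) (kc s)) (x, z, t)"
      unfolding f[OF x] g[OF x] by (simp add: eval_simps)
  qed
next
  case (mult f g)
  obtain M1 N1 M2 N2 where
    f: "\<And>s x z t. x \<noteq> 0 \<Longrightarrow> x ^ M1 * f (s, x, - (z ^ k + t ^ l + x) / x ^ d, z, t) = eval_xzt (poly N1 (kc s)) (x, z, t)"
    and g: "\<And>s x z t. x \<noteq> 0 \<Longrightarrow> x ^ M2 * g (s, x, - (z ^ k + t ^ l + x) / x ^ d, z, t) = eval_xzt (poly N2 (kc s)) (x, z, t)"
    using mult.IH by metis
  show ?case
  proof (intro exI[of _ "M1 + M2"] exI[of _ "N1 * N2"] allI impI)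
    fix s x z t :: complex assume x: "x \<noteq> 0"
    let ?P = "(s, x, - (z ^ k + t ^ l + x) / x ^ d, z, t)"
    have "x ^ (M1 + M2) * (f ?P * g ?P) = (x ^ M1 * f ?P) * (x ^ M2 * g ?P)"
      by (simp only: power_add ac_simps)
    then show "x ^ (M1 + M2) * (f ?P * g ?P) = eval_xzt (poly (N1 * N2) (kc s)) (x, z, t)"
      unfolding f[OF x] g[OF x] by (simp add: eval_simps)
  qed
qed

text \<open>A locally nilpotent \<open>\<delta>\<close> with \<open>r0\<close> dividing \<open>\<delta> r0\<close> kills \<open>r0\<close>, and
  then it vanishes by Mason's theorem.\<close>

lemma cuspidal_lnd_0:
  fixes f :: "complex poly poly"
  defines "\<delta> \<equiv> br2 (f * r0)"
  assumes nil: "\<And>g. \<exists>n. (\<delta> ^^ n) g = 0"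
  shows "\<delta> g = 0"
proof -
  have add: "\<delta> (p + q) = \<delta> p + \<delta> q" and mult: "\<delta> (p * q) = p * \<delta> q + q * \<delta> p" for p q
    unfolding \<delta>_def br2_def by (simp_all add: d2_simps algebra_simps)
  \<comment> \<open>With the zero degree function and e = 0, leading forms are the elements
    themselves and \<open>nu\<close> is the ordinary nilpotency order of \<delta>.\<close>
  interpret lnd_degree "UNIV :: complex poly poly set" "\<lambda>_. 0 :: int" \<delta> 0
    by unfold_locales (use nil in \<open>auto simp: add mult\<close>)
  have nu0: "nu p = 0 \<longleftrightarrow> \<delta> p = 0" if "p \<noteq> 0" for p
    using nu_0_iff[of p] that by (simp add: lt_def)
  have rnz: "r0 \<noteq> (0 :: complex poly poly)" by (simp add: zt_nz)
  have "br2 (f * r0) r0 = r0 * br2 f r0" unfolding br2_def by (simp add: d2_simps algebra_simps)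
  then have dr: "\<delta> r0 = r0 * br2 f r0" by (simp add: \<delta>_def)
  have r: "\<delta> r0 = 0"
  proof (rule ccontr)
    assume nz: "\<delta> r0 \<noteq> 0"
    then obtain n where n: "nu r0 = Suc n" using nu0[OF rnz] by (cases "nu r0") auto
    have "nu (\<delta> r0) = n" using nu_D[of r0 n] rnz n by simp
    moreover have "br2 f r0 \<noteq> 0" using nz dr by auto
    then have "nu (\<delta> r0) = nu r0 + nu (br2 f r0)" unfolding dr using rnz by (intro nu_mult) auto
    ultimately show False using n by simp
  qed
  have "nu pz = 0 \<and> nu pt = 0"
  proof (rule mason[of 1 1 pz pt r0 k l])
    show "r0 = 1 * pz ^ k + 1 * pt ^ l" by (simp add: r0_def)
    show "nu r0 = 0" using nu0[OF rnz] r by simp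
  qed (use k2 kl nu_1 in \<open>simp_all add: zt_nz\<close>)
  then have "\<delta> pz = 0" "\<delta> pt = 0" using nu0[of pz] nu0[of pt] by (simp_all add: zt_nz)
  then have "map_poly pderiv (f * r0) = 0" "pderiv (f * r0) = 0"
    by (simp_all add: \<delta>_def br2_def pz_def pt_def pderiv_pCons map_poly_pCons one_pCons)
  then show ?thesis by (simp add: \<delta>_def br2_def)
qed

section \<open>The locally nilpotent derivation of an action of the additive group\<close>

context
  fixes a :: "complex \<Rightarrow> A4 \<Rightarrow> A4"
  assumes a: "Ga_action KR a"
begin

lemma action: "P \<in> KR \<Longrightarrow> a (s + t) P = a s (a t P)" "P \<in> KR \<Longrightarrow> a 0 P = P" "a s \<in> AX"
proof -
  have ga: "group_action Ga KR a" using a by (simp add: Ga_action_def)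
  then interpret h: group_hom Ga "BijGroup KR" a by (simp add: group_action_def)
  have B: "a s \<in> Bij KR" for s using h.hom_closed[of s] by (simp add: Ga_def BijGroup_def)
  have "a (s + t) = compose KR (a s) (a t)" for s t
    using h.hom_mult[of s t] B by (simp add: Ga_def BijGroup_def)
  then show add: "P \<in> KR \<Longrightarrow> a (s + t) P = a s (a t P)" for s t P by (simp add: compose_def)
  have "a 0 = (\<lambda>x\<in>KR. x)" using h.hom_one by (simp add: Ga_def BijGroup_def)
  then show zero: "P \<in> KR \<Longrightarrow> a 0 P = P" for P by simp
  obtain G where G: "polynomial_map G" "\<And>s P. P \<in> KR \<Longrightarrow> a s P = G (s, P)"
    using a unfolding Ga_action_def polynomial_map_on_def by auto
  have "polynomial_map (\<lambda>P :: A4. (s, P))" for s :: complex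
    by (auto simp: polynomial_map_def coords_prod_def[where 'a = complex and 'b = A4] coords_complex_def comp_def
        intro: polynomial_fun.intros)
  then have Gs: "polynomial_map (\<lambda>P. G (s, P))" for s by (rule polynomial_map_comp[OF G(1)])
  then have p: "polynomial_map_on KR (a s)" for s
    unfolding polynomial_map_on_def using G(2) by blast
  have b: "bij_betw (a s) KR KR" using B by (simp add: Bij_def)
  have "inv_into KR (a s) P = a (- s) P" if "P \<in> KR" for P
  proof (rule inv_into_f_eq)
    show "inj_on (a s) KR" using b by (simp add: bij_betw_def)
    show "a (- s) P \<in> KR" using B[of "- s"] that by (auto simp: Bij_def bij_betw_def)
    show "a s (a (- s) P) = P" using add[OF that, of s "- s"] zero[OF that] by simp
  qed
  then have "polynomial_map_on KR (inv_into KR (a s))"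
    using p[of "- s"] unfolding polynomial_map_on_def by auto
  then show "a s \<in> AX" using B p by (simp add: Aut_variety_def)
qed

definition co :: "complex \<Rightarrow> Cxzt \<Rightarrow> Cxzt" where "co s = (SOME \<phi>. restricts_to d k l (a s) \<phi>)"

lemma co: "restricts_to d k l (a s) (co s)"
proof -
  have "\<exists>\<phi>. restricts_to d k l (a s) \<phi>" by (rule Aut_normal_form[OF action(3)[of s]]) (rule exI)
  then show ?thesis unfolding co_def by (rule someI_ex)
qed

lemma co_eq: "restricts_to d k l (a s) \<phi> \<Longrightarrow> co s = \<phi>"
  by (rule restricts_unique[OF co])

lemma co_hom: "ring_map (co s)" "co s (kc c) = kc c"
  by (rule Aut_normal_form[OF action(3)[of s]]; simp add: co_eq)+

lemma co_add: "co t (co s p) = co (s + t) p"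
proof -
  have "restricts_to d k l (a (s + t)) (\<lambda>p. co t (co s p))"
    by (rule restricts_comp[OF co co Aut_in[OF action(3)] action(1)])
  then show ?thesis by (simp add: co_eq)
qed

lemma co_0: "co 0 p = p"
  using co_eq[OF restricts_id[of "a 0"]] action(2) by simp

lemma co_polynomial: "\<exists>Q. \<forall>s. co s p = poly Q (kc s)"
proof -
  obtain G where G: "polynomial_map G" "\<And>s P. P \<in> KR \<Longrightarrow> a s P = G (s, P)"
    using a unfolding Ga_action_def polynomial_map_on_def by auto
  define f where "f P = eval_xzt p (pr_xzt (G P))" for P
  have pr: "pr_xzt P = (fst P, fst (snd (snd P)), snd (snd (snd P)))" for P by (cases P) simp
  have "polynomial_fun f" unfolding f_def pr by (rule polynomial_fun_comp[OF polynomial_fun_eval G(1)])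
  from polynomial_family[OF this] obtain M N where N: "\<And>s x z t. x \<noteq> 0 \<Longrightarrow>
    x ^ M * f (s, x, - (z ^ k + t ^ l + x) / x ^ d, z, t) = eval_xzt (poly N (kc s)) (x, z, t)" by metis
  have "vx ^ M * co s p = poly N (kc s)" for s
  proof -
    have "eval_xzt (vx ^ M * co s p - poly N (kc s)) (x, z, t) = 0" if x: "x \<noteq> 0" for x z t
    proof -
      note P = KR_point[OF x, of z t]
      have "eval_xzt (co s p) (x, z, t) = f (s, x, - (z ^ k + t ^ l + x) / x ^ d, z, t)"
        using co[of s, unfolded restricts_to_def, rule_format, OF P, of p] unfolding f_def G(2)[OF P] by simp
      then show ?thesis using N[OF x, of s z t] by (simp add: eval_simps)
    qed
    then have "vx ^ M * co s p - poly N (kc s) = 0" by (rule eval_eq_0)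
    then show ?thesis by simp
  qed
  then show ?thesis by (rule polynomial_quotient)
qed

definition Q :: "Cxzt \<Rightarrow> Cxzt poly" where "Q p = (SOME q. \<forall>s. co s p = poly q (kc s))"

lemma Q: "co s p = poly (Q p) (kc s)"
  using someI_ex[OF co_polynomial[of p]] unfolding Q_def by blast

lemma Q_eqI: "(\<And>s. co s p = poly q (kc s)) \<Longrightarrow> Q p = q"
  by (rule poly_kc_eqI) (simp add: Q[symmetric])

lemma Q_hom: "Q (p + q) = Q p + Q q" "Q (p * q) = Q p * Q q" "Q (kc c) = [:kc c:]"
  by (rule Q_eqI; simp add: rm_add[OF co_hom(1)] rm_mult[OF co_hom(1)] co_hom(2) Q[symmetric])+

text \<open>The derivative of the action at time 0.\<close>

definition D :: "Cxzt \<Rightarrow> Cxzt" where "D p = coeff (Q p) 1"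

lemma Q_0: "coeff (Q p) 0 = p"
  using Q[of 0 p] by (simp add: co_0 rm_0[OF ring_map_kc] poly_0_coeff_0)

lemma derivation_D: "derivation D"
  unfolding derivation_def D_def Q_hom
proof (intro conjI allI)
  show "coeff (Q p * Q q) 1 = p * coeff (Q q) 1 + q * coeff (Q p) 1" for p q
    by (simp add: coeff_mult Q_0 mult.commute)
qed simp

lemma D_kc: "D (kc c) = 0"
  by (simp add: D_def Q_hom)

lemma D_poly: "D (poly q (kc s)) = poly (map_poly D q) (kc s)"
proof (induction q)
  case (pCons c q)
  then show ?case
    by (simp add: map_poly_pCons dv_add[OF derivation_D] dv_mult[OF derivation_D] D_kc dv_0[OF derivation_D])
qed (simp add: dv_0[OF derivation_D])

text \<open>Differentiating the group law turns it into the differential equation Q' = D Q in the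
  time variable. Hence the i-th coefficient is D^i p / i!, and D is locally nilpotent because Q p is
  a polynomial.\<close>

lemma D_coeff: "D (coeff (Q p) i) = of_nat (Suc i) * coeff (Q p) (Suc i)"
proof -
  have "poly (pderiv (Q p)) (kc s) = poly (map_poly D (Q p)) (kc s)" for s
  proof -
    have "Q (co s p) = pcompose (Q p) [:kc s, 1:]"
      by (rule Q_eqI, subst co_add) (simp add: Q poly_pcompose rm_add[OF ring_map_kc])
    then have "D (co s p) = coeff (pcompose (Q p) [:kc s, 1:]) 1" by (simp add: D_def)
    also have "\<dots> = coeff (pderiv (pcompose (Q p) [:kc s, 1:])) 0" by (simp add: coeff_pderiv)
    also have "\<dots> = poly (pderiv (Q p)) (kc s)"
      by (simp add: pderiv_pcompose pderiv_pCons poly_pcompose flip: poly_0_coeff_0)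
    finally show ?thesis by (simp add: Q D_poly)
  qed
  then have "pderiv (Q p) = map_poly D (Q p)" by (rule poly_kc_eqI)
  then have "coeff (pderiv (Q p)) i = coeff (map_poly D (Q p)) i" by simp
  then show ?thesis by (simp add: coeff_pderiv coeff_map_poly dv_0[OF derivation_D])
qed

lemma D_of_nat_mult: "D (of_nat n * p) = of_nat n * D p"
proof -
  have "D (of_nat n) = 0" by (induction n) (simp_all add: dv_simps[OF derivation_D])
  then show ?thesis by (simp add: dv_mult[OF derivation_D])
qed

lemma D_nilpotent: "\<exists>n. (D ^^ n) p = 0"
proof -
  have "(D ^^ n) p = of_nat (fact n) * coeff (Q p) n" for n
  proof (induction n)
    case (Suc n)
    then show ?case by (simp add: D_of_nat_mult[of "fact n", simplified] D_coeff algebra_simps)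
  qed (simp add: Q_0)
  then show ?thesis using coeff_eq_0[of "Q p" "Suc (degree (Q p))"] by (metis lessI mult_zero_right)
qed

text \<open>As a function of s this value is a complex polynomial, and one without zeros is
  constant, hence equal to its value at s = 0.\<close>

lemma nonvanishing_constant:
  assumes "\<And>s. eval_xzt (co s p) P \<noteq> 0" shows "eval_xzt (co s p) P = eval_xzt p P"
proof -
  define q where "q = map_poly (\<lambda>p. eval_xzt p P) (Q p)"
  have c: "eval_xzt (kc s) P = s" for s by (cases P) (simp add: eval_gens)
  have "eval_xzt (poly r b) P = poly (map_poly (\<lambda>p. eval_xzt p P) r) (eval_xzt b P)" for r b
    by (induction r) (simp_all add: map_poly_pCons rm_simps[OF ring_map_eval])
  then have e: "eval_xzt (co s p) P = poly q s" for s by (simp add: Q q_def c)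
  then have "constant (poly q)" using fundamental_theorem_of_algebra assms by metis
  then have "poly q s = poly q 0" by (simp add: constant_def)
  then show ?thesis using e[of 0] by (simp add: e co_0)
qed

text \<open>Evaluating the images of z and t at (0,1,0) and (0,0,1) gives m(s)^l and m(s)^k. Both
  are nonvanishing polynomials in s with value 1 at s = 0, so they are 1, and coprimality of k and l
  gives m(s) = 1.\<close>

lemma co_unipotent: "xaut (co s)" "vx dvd co s p - p" "\<exists>u b. co s rr = u * rr + vx ^ d * b"
proof -
  have nf: "\<exists>m \<psi> u b. m \<noteq> 0 \<and> co s vx = torus_hom m vx \<and> (\<forall>p. vx dvd co s p - torus_hom m p) \<and> co s rr = u * rr + vx ^ d * b
     \<and> ring_map \<psi> \<and> (\<forall>p. co s (\<psi> p) = p) \<and> (\<forall>p. \<psi> (co s p) = p)" for s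
  proof (rule Aut_normal_form[OF action(3)[of s]])
    fix \<phi> \<psi> m u b
    assume *: "restricts_to d k l (a s) \<phi>" "m \<noteq> 0" "\<phi> vx = torus_hom m vx" "\<And>p. vx dvd \<phi> p - torus_hom m p" "\<phi> rr = u * rr + vx ^ d * b"
      "ring_map \<psi>" "\<And>p. \<phi> (\<psi> p) = p" "\<And>p. \<psi> (\<phi> p) = p"
    have "co s = \<phi>" by (rule co_eq[OF *(1)])
    then show ?thesis using *(2-8) by blast
  qed
  then obtain m where m: "\<And>s. m s \<noteq> 0" "\<And>s p. vx dvd co s p - torus_hom (m s) p" "\<And>s. co s vx = torus_hom (m s) vx" by metis
  have ev: "eval_xzt (co s p) (0, z, t) = eval_xzt (torus_hom (m s) p) (0, z, t)" for s p z t
  proof -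
    obtain w where w: "co s p = torus_hom (m s) p + vx * w" using m(2)[of s p] by (rule dvd_diffE)
    show ?thesis unfolding w by (simp add: eval_simps)
  qed
  have z: "eval_xzt (co s vz) (0, 1, 0) = m s ^ l" "eval_xzt (co s vt) (0, 0, 1) = m s ^ k" for s
    by (simp_all add: ev torus_hom_gens eval_simps)
  have 1: "m s ^ l = 1" "m s ^ k = 1"
    using nonvanishing_constant[of vz "(0, 1, 0)" s] nonvanishing_constant[of vt "(0, 0, 1)" s] m(1)
    by (simp_all add: z eval_gens)
  obtain i j where ij: "l * i = k * j + 1"
    using bezout_add_strong_nat[of l k] pos cop by (metis coprime_common_divisor_nat coprime_commute not_less_zero)
  have "m s ^ (l * i) = 1" "m s ^ (k * j) = 1" by (simp_all add: power_mult 1)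
  then have m1: "m s = 1" by (simp add: ij)
  then have c: "vx dvd co s p - p" for p using m(2)[of s p] by (simp add: torus_hom_1)
  then show "vx dvd co s p - p" .
  have x: "co s vx = vx" using m(3)[of s] m1 by (simp add: torus_hom_1)
  obtain \<psi> where \<psi>: "ring_map \<psi>" "\<And>p. co s (\<psi> p) = p" "\<And>p. \<psi> (co s p) = p" using nf[of s] by metis
  show "xaut (co s)" by (rule xaut_congruent_id[OF co_hom x c \<psi>])
  show "\<exists>u b. co s rr = u * rr + vx ^ d * b" using nf[of s] by metis
qed

lemma Q_split: "\<exists>q. Q p = pCons p q"
  by (cases "Q p") (use Q_0[of p] in auto)

lemma D_vx: "D vx = 0" and D_dvd_vx: "vx dvd D p"
proof -
  have "Q vx = [:vx:]" by (rule Q_eqI) (simp add: xautD(3)[OF co_unipotent(1)])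
  then show "D vx = 0" by (simp add: D_def)
  obtain q where q: "Q p = pCons p q" using Q_split by blast
  have "vx dvd poly [:0, 1:] (kc s) * poly q (kc s)" for s
    using co_unipotent(2)[of s p] by (simp add: Q q)
  then have "vx dvd poly ([:0, 1:] * q) (kc s)" for s by (simp only: poly_mult)
  then have "vx dvd coeff ([:0, 1:] * q) 1" by (rule vx_dvd_coeffs)
  then show "vx dvd D p" by (simp add: D_def q)
qed

lemma D_vx_pow: "D (vx ^ n * p) = vx ^ n * D p"
  by (simp add: dv_mult[OF derivation_D] dv_power[OF derivation_D] D_vx)

lemma dvd_coeff_Suc:
  assumes "s dvd D (coeff (Q p) i)" shows "s dvd coeff (Q p) (Suc i)"
proof -
  obtain q :: Cxzt where q: "of_nat (Suc i) * q = 1" using of_nat_unit[of "Suc i"] by blast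
  have "q * D (coeff (Q p) i) = (of_nat (Suc i) * q) * coeff (Q p) (Suc i)" unfolding D_coeff by (simp only: ac_simps)
  then have "coeff (Q p) (Suc i) = q * D (coeff (Q p) i)" unfolding q by simp
  then show ?thesis using assms by simp
qed

lemma level_dvd:
  assumes "\<And>p. vx ^ n dvd D p" shows "vx ^ n dvd co s p - p"
proof -
  obtain q where q: "Q p = pCons p q" using Q_split by blast
  have "vx ^ n dvd coeff (Q p) (Suc i)" for i by (rule dvd_coeff_Suc) (rule assms)
  then have "vx ^ n dvd poly q (kc s)" by (intro poly_dvd) (simp add: q)
  then show ?thesis by (simp add: Q q)
qed

text \<open>Write D = x^n E. Modulo x the operator E is the bracket with a multiple of
  \<open>r0\<close>, by \<open>leading_hamiltonian\<close>, and D^i = x^(n i) E^i makes it locally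
  nilpotent. So \<open>cuspidal_lnd_0\<close> gives that E vanishes modulo x.\<close>

lemma level_step:
  assumes n: "0 < n" "n < d" and lev: "\<And>p. vx ^ n dvd D p" shows "vx ^ Suc n dvd D p"
proof -
  obtain u b where rr: "co 1 rr = u * rr + vx ^ d * b" using co_unipotent(3) by blast
  obtain f where f: "infl n (f * [:r0:]) (co 1)"
    by (rule leading_hamiltonian[OF co_unipotent(1) rr n level_dvd[OF lev]]) (rule that)
  define h where "h = coeff f 0 * r0"
  have "\<forall>p. \<exists>w. D p = vx ^ n * w" using lev by (simp add: dvd_def)
  then obtain E where "\<forall>p. D p = vx ^ n * E p" by (rule choice[THEN exE])
  then have E: "\<And>p. D p = vx ^ n * E p" by simp
  \<comment> \<open>Taylor terms of order at least 2 contain D twice and are divisible by x^(2 n),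
    where 2 n \<ge> n + 1.\<close>
  have lin: "vx ^ Suc n dvd co 1 p - p - D p" for p
  proof -
    obtain q where q: "Q p = pCons p q" using Q_split by blast
    obtain q1 r where r: "q = pCons q1 r" by (cases q)
    have Qp: "Q p = pCons p (pCons (D p) r)" using q r by (simp add: D_def)
    have "vx ^ Suc n dvd coeff r i" for i
    proof -
      have "vx ^ n dvd coeff (Q p) (Suc i)" by (rule dvd_coeff_Suc) (rule lev)
      then obtain w where w: "coeff (Q p) (Suc i) = vx ^ n * w" by (auto simp: dvd_def)
      have "D (coeff (Q p) (Suc i)) = vx ^ n * D w" unfolding w by (rule D_vx_pow)
      then have "D (coeff (Q p) (Suc i)) = vx ^ (n + n) * E w" unfolding E[of w] by (simp only: power_add mult.assoc)
      moreover have "vx ^ Suc n dvd (vx ^ (n + n) :: Cxzt)" using n by (intro le_imp_power_dvd) simp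
      ultimately have "vx ^ Suc n dvd D (coeff (Q p) (Suc i))" by (metis dvd_mult2)
      from dvd_coeff_Suc[OF this] show ?thesis by (simp add: Qp)
    qed
    then have "vx ^ Suc n dvd poly r 1" by (rule poly_dvd)
    moreover have "co 1 p - p - D p = poly r 1" by (simp add: Q Qp rm_1[OF ring_map_kc])
    ultimately show ?thesis by simp
  qed
  have red: "coeff (E p) 0 = br2 h (coeff p 0)" for p
  proof -
    have "vx ^ Suc n dvd (co 1 p - p - vx ^ n * br (f * [:r0:]) p) - (co 1 p - p - D p)"
      using f lin[of p] unfolding infl_def by (blast intro: dvd_diff)
    also have "(co 1 p - p - vx ^ n * br (f * [:r0:]) p) - (co 1 p - p - D p) = vx ^ n * (E p - br (f * [:r0:]) p)"
      by (simp add: E right_diff_distrib)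
    finally have "vx ^ n * vx dvd vx ^ n * (E p - br (f * [:r0:]) p)" by (simp add: mult.commute)
    then have "vx dvd E p - br (f * [:r0:]) p" by (simp only: dvd_mult_cancel_left) simp
    then show ?thesis by (simp add: vx_dvd_iff coeff_br coeff_mult_0 h_def mult.commute[of r0])
  qed
  have iter: "(D ^^ i) p = vx ^ (n * i) * (E ^^ i) p" for i p
  proof (induction i)
    case (Suc i)
    have "(D ^^ Suc i) p = vx ^ (n * i) * D ((E ^^ i) p)" by (simp add: Suc D_vx_pow)
    then show ?case unfolding E[of "(E ^^ i) p"] by (simp add: power_add mult.assoc mult.left_commute)
  qed simp
  have redi: "coeff ((E ^^ i) p) 0 = (br2 h ^^ i) (coeff p 0)" for i p
    by (induction i) (simp_all add: red)
  have "\<exists>i. (br2 h ^^ i) g = 0" for g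
  proof -
    obtain i where "(D ^^ i) [:g:] = 0" using D_nilpotent by blast
    then have "(E ^^ i) [:g:] = 0" unfolding iter by simp
    then show ?thesis using redi[of i "[:g:]"] by auto
  qed
  then have "br2 h (coeff p 0) = 0" unfolding h_def by (rule cuspidal_lnd_0)
  then have "vx dvd E p" using red[of p] by (simp add: vx_dvd_iff)
  then show ?thesis unfolding E by (simp add: mult.commute mult_dvd_mono)
qed

theorem Ga_action_level: "a s \<in> Aut_n d k l d"
proof -
  have "Suc n \<le> d \<Longrightarrow> vx ^ Suc n dvd D p" for n p
  proof (induction n arbitrary: p)
    case 0
    then show ?case using D_dvd_vx by simp
  next
    case (Suc n)
    have "vx ^ Suc n dvd D p" for p by (rule Suc.IH) (use Suc.prems in simp)
    then show ?case by (rule level_step[rotated 2]) (use Suc.prems in simp_all)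
  qed
  from this[of "d - 1"] have "vx ^ d dvd D p" for p using pos by simp
  then have "vx ^ d dvd co s p - p" for p by (rule level_dvd)
  then show ?thesis unfolding Aut_n_iff using action(3) co xautD(3)[OF co_unipotent(1)] by blast
qed

end

section \<open>Subgroups generated by actions of the additive group\<close>

lemma Aut_n_subgroup: "subgroup (Aut_n d k l n) (Aut_variety KR)"
proof (rule group.subgroupI[OF group_Aut_variety])
  interpret G: group "Aut_variety KR" by (rule group_Aut_variety)
  show "Aut_n d k l n \<subseteq> AX" by (auto simp: Aut_n_iff)
  have "restricts_to d k l \<one>\<^bsub>Aut_variety KR\<^esub> (\<lambda>p. p)"
    unfolding Aut_variety_ops(3)[OF G.one_closed] by (rule restricts_id) simp
  then have "\<one>\<^bsub>Aut_variety KR\<^esub> \<in> Aut_n d k l n" unfolding Aut_n_iff by (intro conjI G.one_closed exI[of _ "\<lambda>p. p"]) auto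
  then show "Aut_n d k l n \<noteq> {}" by blast
next
  fix F assume "F \<in> Aut_n d k l n"
  then obtain \<phi> where F: "F \<in> AX" and \<phi>: "restricts_to d k l F \<phi>" "\<phi> vx = vx" "\<And>p. vx ^ n dvd \<phi> p - p"
    unfolding Aut_n_iff by blast
  obtain \<phi>' \<psi> where *: "restricts_to d k l F \<phi>'" "\<And>p. \<phi>' (\<psi> p) = p" "\<And>p. \<psi> (\<phi>' p) = p" "restricts_to d k l (inv_into KR F) \<psi>"
    by (rule Aut_normal_form[OF F]) (rule that; (assumption | erule meta_spec))
  have e: "\<phi>' = \<phi>" by (rule restricts_unique[OF *(1) \<phi>(1)])
  have "vx ^ n dvd \<psi> p - p" for p
    using \<phi>(3)[of "\<psi> p"] *(2)[of p] unfolding e by (simp add: dvd_diff_swap)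
  moreover have "\<psi> vx = vx" using *(3)[of vx] unfolding e \<phi>(2) .
  ultimately show "inv\<^bsub>Aut_variety KR\<^esub> F \<in> Aut_n d k l n"
    unfolding Aut_n_iff Aut_variety_ops(2)[OF F] using Aut_inv[OF F] *(4) restricts_restrict by blast
next
  fix F G assume "F \<in> Aut_n d k l n" "G \<in> Aut_n d k l n"
  then obtain \<phi> \<psi> where F: "F \<in> AX" and \<phi>: "restricts_to d k l F \<phi>" "\<phi> vx = vx" "\<And>p. vx ^ n dvd \<phi> p - p"
    and G: "G \<in> AX" and \<psi>: "restricts_to d k l G \<psi>" "\<psi> vx = vx" "\<And>p. vx ^ n dvd \<psi> p - p"
    unfolding Aut_n_iff by blast
  have "restricts_to d k l (compose KR F G) (\<lambda>p. \<psi> (\<phi> p))"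
    by (rule restricts_comp[OF \<phi>(1) \<psi>(1) Aut_in[OF G]]) (simp_all add: compose_def)
  moreover have "vx ^ n dvd \<psi> (\<phi> p) - p" for p
    using dvd_add[OF \<psi>(3)[of "\<phi> p"] \<phi>(3)[of p]] by simp
  ultimately show "F \<otimes>\<^bsub>Aut_variety KR\<^esub> G \<in> Aut_n d k l n"
    unfolding Aut_n_iff Aut_variety_ops(1)[OF F G] using Aut_comp[OF F G] \<phi>(2) \<psi>(2)
    by (intro conjI exI[of _ "\<lambda>p. \<psi> (\<phi> p)"]) simp_all
qed

text \<open>Strictness is witnessed by the automorphism with leading Hamiltonian \<open>rr\<close>
  at level d - 1, which is positive since d \<ge> 2. It is the identity modulo x, but moves z by
  x^(d-1) times -l t^(l-1) modulo x^d and so lies outside the subgroup of level d.\<close>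

theorem generate_Ga_strict:
  "generate (Aut_variety KR) (\<Union>{range a | a. Ga_action KR a}) \<subset> Aut_n d k l 1"
proof -
  have "\<Union>{range a | a. Ga_action KR a} \<subseteq> Aut_n d k l d" using Ga_action_level by blast
  then have gen: "generate (Aut_variety KR) (\<Union>{range a | a. Ga_action KR a}) \<subseteq> Aut_n d k l d"
    by (rule group.generate_subgroup_incl[OF group_Aut_variety _ Aut_n_subgroup])
  have "vx dvd (vx ^ d :: Cxzt)" using pos by (simp add: dvd_power)
  then have "vx ^ 1 dvd p" if "vx ^ d dvd p" for p :: Cxzt using dvd_trans[OF _ that] by simp
  then have mono: "Aut_n d k l d \<subseteq> Aut_n d k l 1" unfolding subset_iff Aut_n_iff by blast
  obtain n where n: "d = Suc n" "n > 0" using d2 by (cases d) auto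
  obtain \<chi> where \<chi>: "family \<chi>" "infl n (1 * rr) (at_zero \<chi>)" using family_realizes[of n 1] n by auto
  obtain \<Phi> where \<Phi>: "extends \<Phi>" "restricts_to d k l (restrict \<Phi> KR) (at_zero \<chi>)"
    by (rule family_extends[OF \<chi>(1)]) (rule that)
  let ?F = "restrict \<Phi> KR"
  have FA: "?F \<in> AX" by (rule extends_Aut(2)[OF \<Phi>(1)])
  have "vx ^ 1 dvd at_zero \<chi> p - p" for p
  proof -
    obtain w where w: "at_zero \<chi> p = p + vx ^ n * br (1 * rr) p + vx ^ Suc n * w" using inflE[OF \<chi>(2)] by blast
    have "at_zero \<chi> p - p = vx ^ n * (br rr p + vx * w)" unfolding w by (simp add: algebra_simps)
    then show ?thesis using n(2) by (simp add: dvd_mult2 dvd_power)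
  qed
  then have in1: "?F \<in> Aut_n d k l 1"
    unfolding Aut_n_iff using FA \<Phi>(2) xautD(3)[OF at_zero_xaut[OF \<chi>(1)]] by blast
  have "?F \<notin> Aut_n d k l d"
  proof
    assume "?F \<in> Aut_n d k l d"
    then obtain \<phi> where "restricts_to d k l ?F \<phi>" "\<And>p. vx ^ d dvd \<phi> p - p" unfolding Aut_n_iff by blast
    then have "vx ^ Suc n dvd at_zero \<chi> vz - vz" using restricts_unique[OF \<Phi>(2)] n(1) by metis
    from dvd_diff[OF this \<chi>(2)[unfolded infl_def, rule_format, of vz]]
    have "vx ^ n * vx dvd vx ^ n * br rr (vz :: Cxzt)" by (simp add: mult.commute)
    then have "vx dvd br rr (vz :: Cxzt)" by (simp only: dvd_mult_cancel_left) simp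
    then have "br2 r0 pz = (0 :: complex poly poly)" by (simp add: vx_dvd_iff coeff_br red_gens del: br_gens)
    moreover have "br2 r0 pz = - (of_nat l * pt ^ (l - 1) :: complex poly poly)"
      unfolding r0_def br2_def by (simp add: d2_simps) (simp add: pz_def pt_def pderiv_pCons map_poly_pCons one_pCons)
    ultimately show False using pos zt_nz(2) by (simp add: zt_nz)
  qed
  then show ?thesis using gen mono in1 by blast
qed

end

theorem proposition3p1:
  fixes d k l :: nat
  assumes "d \<ge> 2" and "2 \<le> k" and "k < l" and "coprime k l"
  defines "X \<equiv> koras_russell d k l"
  defines "AutX \<equiv> Aut_variety X"
  defines "O1 \<equiv> {(x, y, z, t). (x, y, z, t) \<in> X \<and> x \<noteq> 0}"
  defines "O2 \<equiv> {(x, y, z, t). (x, y, z, t) \<in> X \<and> x = 0 \<and> z \<noteq> 0}"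
  defines "O3 \<equiv> {(x, y, z, t). x = 0 \<and> z = 0 \<and> t = 0} - {(0, 0, 0, 0)}"
  defines "O4 \<equiv> {(0, 0, 0, 0)}"
  shows
    \<comment> \<open>(1)\<close>
    "(\<forall>F\<in>carrier AutX. \<exists>\<Phi>\<in>carrier (Aut_variety (UNIV :: A4 set)). \<forall>P\<in>X. \<Phi> P = F P)
     \<and>
     \<comment> \<open>(2)\<close>
     (orbits AutX X (\<lambda>F. F) = {O1, O2, O3, O4} \<and> card {O1, O2, O3, O4} = 4
      \<and> zariski_open_in X O1
      \<and> isomorphic_varieties O1
           ((UNIV - {0}) \<times> UNIV :: (complex \<times> complex \<times> complex) set)
      \<and> isomorphic_varieties O2 ((UNIV - {0}) \<times> UNIV :: (complex \<times> complex) set)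
      \<and> (\<forall>F\<in>carrier AutX. F (0, 0, 0, 0) = (0, 0, 0, 0)))
     \<and>
     \<comment> \<open>(3)\<close>
     (\<forall>H. subgroup H AutX \<and> finite H \<longrightarrow> cyclic_group (AutX\<lparr>carrier := H\<rparr>))
     \<and>
     \<comment> \<open>(4)\<close>
     (\<forall>a. Ga_action X a \<longrightarrow> range a \<subseteq> Aut_n d k l d)
     \<and>
     generate AutX (\<Union>{range a | a. Ga_action X a}) \<subset> Aut_n d k l 1"
proof -
  interpret koras d k l by unfold_locales (fact assms(1-4))+
  show ?thesis unfolding X_def AutX_def O1_def O2_def O3_def O4_def
  proof (intro conjI ballI allI impI)
    show "\<exists>\<Phi>\<in>carrier (Aut_variety (UNIV :: A4 set)). \<forall>P\<in>KR. \<Phi> P = F P" if "F \<in> AX" for F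
      using Aut_extends[OF that] extends_Aut(1) by metis
    show "cyclic_group ((Aut_variety KR)\<lparr>carrier := H\<rparr>)" if "subgroup H (Aut_variety KR) \<and> finite H" for H
      using finite_subgroup_cyclic that by blast
    show "range a \<subseteq> Aut_n d k l d" if "Ga_action KR a" for a
      using Ga_action_level[OF that] by blast
  qed (fact Aut_orbits open_orbit open_orbit_iso second_orbit_iso Aut_origin generate_Ga_strict)+
qed

end
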